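(* Let $\kappa\le 0$, $\tau\in\mathbb{R}$ with $(\kappa,\tau)\neq(0,0)$, $c=\sqrt{-\kappa}/2$, and let $\mathbb{E}=\mathbb{E}^3(\kappa,\tau)$. Let $\Sigma$ be a Riemann surface and let $X=(x_1,x_2,x_3):\Sigma\to\mathbb{E}$ be a (conformal) constant mean curvature immersion with critical mean curvature $H=c$. Assume that $X$ is nowhere vertical and has upwards pointing unit normal vector. Let $g:\Sigma\to\mathbb{D}=\{|w|<1\}$ be its Gauss map. Then $g$ is nowhere antiholomorphic, i.e. $g_z\neq0$ at every point for any local conformal parameter $z$ on $\Sigma$, and $g$ satisfies the second order elliptic equation $$(1-|g|^2)\,g_{z\bar z}+2\,\bar g\,g_z\,g_{\bar z}=0. \qquad (1)$$ In other words, $g$ is harmonic into $\mathbb{D}$ endowed with the hyperbolic metric $4|\mathrm{d}w|^2/(1-|w|^2)^2$ (of curvature $-1$). Moreover, the immersion $X$ can be recovered from $g$ by means of the representation formula $$\begin{cases}\displaystyle \zeta_z=\frac{2}{c+i\tau}\,\frac{(1-c\zeta\bar g)^2}{(1-|g|^2)^2}\,g_z,\\[3mm] \displaystyle \zeta_{\bar z}=-\frac{2}{c-i\tau}\,\frac{(g-c\zeta)^2}{(1-|g|^2)^2}\,\bar g_{\bar z},\\[3mm] \displaystyle (x_3)_z=-\frac{2}{c+i\tau}\,\frac{(\bar g-c\bar\zeta)(1-c\zeta\bar g)}{(1-c^2|\zeta|^2)(1-|g|^2)^2}\,g_z+\frac{i\tau}{2}\,\frac{\zeta\bar\zeta_z-\bar\zeta\zeta_z}{1-c^2|\zeta|^2},\end{cases}\qquad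 (2)$$ where $\zeta=x_1+ix_2$. Conversely, assume that $\Sigma$ is a simply connected Riemann surface and that a map $g:\Sigma\to\mathbb{D}$ satisfies (1) and is nowhere antiholomorphic. Then the map $X=(x_1,x_2,x_3):\Sigma\to\mathbb{E}$ given by the representation formula (2) (that is, obtained by solving (2) with an initial condition $X(z_0)=p$, where $z_0\in\Sigma$, $p\in\mathbb{E}$) is a conformal constant mean curvature immersion with critical mean curvature $c$ whose Gauss map is $g$.
   Context: Model. For $\kappa\le0$, $\tau\in\mathbb{R}$ and $c=\sqrt{-\kappa}/2$, $\mathbb{E}^3(\kappa,\tau)$ is $\{|x_1+ix_2|<1/c\}\times\mathbb{R}$ (all of $\mathbb{R}^3$ if $\kappa=0$) with metric $\Lambda^2(\mathrm{d}x_1^2+\mathrm{d}x_2^2)+(\tau\Lambda(x_2\mathrm{d}x_1-x_1\mathrm{d}x_2)+\mathrm{d}x_3)^2$, where $\Lambda=\frac1{1-c^2|\zeta|^2}$, $\zeta=x_1+ix_2$. An orthonormal frame, taken to be positively oriented, is $$V_1=\tfrac1\Lambda\tfrac{\partial}{\partial x_1}-\tau x_2\tfrac{\partial}{\partial x_3},\quad V_2=\tfrac1\Lambda\tfrac{\partial}{\partial x_2}+\tau x_1\tfrac{\partial}{\partial x_3},\quad V_3=\tfrac{\partial}{\partial x_3}=:\xi.$$ Conventions for immersions. All immersions $X:\Sigma\to\mathbb{E}$ from a Riemann surface are conformal. For a conformal coordinate $z=u+iv$, $\langle X_z,X_z\rangle=0$ and $\langle X_z,X_{\bar z}\rangle=\lambda/2>0$.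 The unit normal $N=N_1V_1+N_2V_2+N_3V_3$ is the one compatible with the orientation of $\Sigma$: $X_u\times X_v=\lambda N$. The mean curvature function $H$ is taken with respect to $N$: $\hat\nabla_{X_{\bar z}}X_z=\frac{\lambda H}{2}N$, where $\hat\nabla$ is the Levi-Civita connection of $\mathbb{E}$. Critical mean curvature means that $H$ is constant and $H=c$ (so when $\kappa<0$ the surface is oriented by its mean curvature vector). $X$ is nowhere vertical if $\xi$ is nowhere tangent to it, i.e. $N_3=\langle N,\xi\rangle$ never vanishes; the normal is upwards pointing if $N_3>0$. Gauss map. The Gauss map of $X$ is $$g=\frac{N_1+iN_2+c\zeta(1+N_3)}{c\bar\zeta(N_1+iN_2)+1+N_3},$$ with values in $\mathbb{C}\cup\{\infty\}$; it takes values in $\mathbb{D}$ exactly when the surface is nowhere vertical with upwards pointing normal. Notation: subscripts $z,\bar z$ denote derivatives $\partial_z,\partial_{\bar z}$; $\bar g_{\bar z}=\partial_{\bar z}(\bar g)=\overline{g_z}$, and $\bar\zeta_z=\partial_z(\bar\zeta)$. *)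

theory Defs
  imports "HOL-Complex_Analysis.Complex_Analysis"
begin

section \<open>Smooth maps\<close>

primrec Ck_on :: "nat \<Rightarrow> ('a::real_normed_vector \<Rightarrow> 'b::real_normed_vector) \<Rightarrow> 'a set \<Rightarrow> bool" where
  "Ck_on 0 f D \<longleftrightarrow> continuous_on D f"
| "Ck_on (Suc k) f D \<longleftrightarrow>
     (\<forall>x\<in>D. f differentiable (at x)) \<and> (\<forall>v. Ck_on k (\<lambda>x. frechet_derivative f (at x) v) D)"

definition smooth_on :: "('a::real_normed_vector \<Rightarrow> 'b::real_normed_vector) \<Rightarrow> 'a set \<Rightarrow> bool" where
  "smooth_on f D \<longleftrightarrow> (\<forall>k. Ck_on k f D)"


section \<open>Riemann surfaces\<close>

type_synonym 'a chart = "'a set \<times> ('a \<Rightarrow> complex)"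

abbreviation chart_inv :: "'a chart \<Rightarrow> complex \<Rightarrow> 'a" where
  "chart_inv \<phi> \<equiv> inv_into (fst \<phi>) (snd \<phi>)"

definition complex_chart_on :: "'a::topological_space set \<Rightarrow> 'a chart \<Rightarrow> bool" where
  "complex_chart_on S \<phi> \<longleftrightarrow>
     openin (top_of_set S) (fst \<phi>) \<and> open (snd \<phi> ` fst \<phi>) \<and>
     homeomorphism (fst \<phi>) (snd \<phi> ` fst \<phi>) (snd \<phi>) (chart_inv \<phi>)"

definition holomorphically_compatible :: "'a chart \<Rightarrow> 'a chart \<Rightarrow> bool" where
  "holomorphically_compatible \<phi> \<psi> \<longleftrightarrow>
     (snd \<psi> \<circ> chart_inv \<phi>) holomorphic_on (snd \<phi> ` (fst \<phi> \<inter> fst \<psi>)) \<and>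
     (snd \<phi> \<circ> chart_inv \<psi>) holomorphic_on (snd \<psi> ` (fst \<phi> \<inter> fst \<psi>))"

text \<open>Second countability is not required: by Rado's theorem it is automatic.\<close>

definition riemann_surface :: "'a::t2_space set \<Rightarrow> 'a chart set \<Rightarrow> bool" where
  "riemann_surface S A \<longleftrightarrow>
     S \<noteq> {} \<and> connected S \<and> (\<Union>\<phi>\<in>A. fst \<phi>) = S \<and>
     (\<forall>\<phi>\<in>A. complex_chart_on S \<phi>) \<and>
     (\<forall>\<phi>\<in>A. \<forall>\<psi>\<in>A. holomorphically_compatible \<phi> \<psi>)"

text \<open>The local conformal parameters are the charts of the maximal atlas generated by \<open>A\<close>.\<close>

definition conformal_params :: "'a::t2_space set \<Rightarrow> 'a chart set \<Rightarrow> 'a chart set" where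
  "conformal_params S A =
     {\<phi>. complex_chart_on S \<phi> \<and> (\<forall>\<psi>\<in>A. holomorphically_compatible \<phi> \<psi>)}"

definition smooth_map ::
  "'a::t2_space set \<Rightarrow> 'a chart set \<Rightarrow> ('a \<Rightarrow> 'b::real_normed_vector) \<Rightarrow> bool" where
  "smooth_map S A f \<longleftrightarrow>
     (\<forall>\<phi>\<in>conformal_params S A. smooth_on (f \<circ> chart_inv \<phi>) (snd \<phi> ` fst \<phi>))"

definition differentiable_map ::
  "'a::t2_space set \<Rightarrow> 'a chart set \<Rightarrow> ('a \<Rightarrow> 'b::real_normed_vector) \<Rightarrow> bool" where
  "differentiable_map S A f \<longleftrightarrow>
     (\<forall>\<phi>\<in>conformal_params S A. \<forall>q\<in>fst \<phi>. (f \<circ> chart_inv \<phi>) differentiable (at (snd \<phi> q)))"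

text \<open>Derivatives of maps on the surface with respect to the parameter \<open>z = u + i v\<close> given
  by a chart \<open>\<phi>\<close>.\<close>

definition du :: "'a chart \<Rightarrow> ('a \<Rightarrow> 'b::real_normed_vector) \<Rightarrow> 'a \<Rightarrow> 'b" where
  "du \<phi> f q = frechet_derivative (f \<circ> chart_inv \<phi>) (at (snd \<phi> q)) 1"

definition dv :: "'a chart \<Rightarrow> ('a \<Rightarrow> 'b::real_normed_vector) \<Rightarrow> 'a \<Rightarrow> 'b" where
  "dv \<phi> f q = frechet_derivative (f \<circ> chart_inv \<phi>) (at (snd \<phi> q)) \<i>"

definition dz :: "'a chart \<Rightarrow> ('a \<Rightarrow> complex) \<Rightarrow> 'a \<Rightarrow> complex" where
  "dz \<phi> f q = (du \<phi> f q - \<i> * dv \<phi> f q) / 2"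

definition dzbar :: "'a chart \<Rightarrow> ('a \<Rightarrow> complex) \<Rightarrow> 'a \<Rightarrow> complex" where
  "dzbar \<phi> f q = (du \<phi> f q + \<i> * dv \<phi> f q) / 2"

text \<open>\<open>X\<^sub>z\<close> and its conjugate, as vectors of the complexified tangent space.\<close>

definition vec_dz :: "'a chart \<Rightarrow> ('a \<Rightarrow> real ^ 'n) \<Rightarrow> 'a \<Rightarrow> complex ^ 'n" where
  "vec_dz \<phi> X q = (\<chi> k. dz \<phi> (\<lambda>r. complex_of_real (X r $ k)) q)"

definition vec_dzbar :: "'a chart \<Rightarrow> ('a \<Rightarrow> real ^ 'n) \<Rightarrow> 'a \<Rightarrow> complex ^ 'n" where
  "vec_dzbar \<phi> X q = (\<chi> k. dzbar \<phi> (\<lambda>r. complex_of_real (X r $ k)) q)"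


section \<open>Riemannian metrics in global coordinates\<close>

text \<open>A metric on an open subset of \<open>\<real>\<^sup>n\<close> is given by its matrix of components.
  The inner product is used for real tangent vectors and, extended bilinearly (not sesquilinearly),
  for complexified ones.\<close>

definition metric_inner :: "real ^ 'n ^ 'n \<Rightarrow> 'f::real_field ^ 'n \<Rightarrow> 'f ^ 'n \<Rightarrow> 'f" where
  "metric_inner G v w = (\<Sum>i\<in>UNIV. \<Sum>j\<in>UNIV. of_real (G $ i $ j) * v $ i * w $ j)"

definition partial :: "'n \<Rightarrow> (real ^ 'n \<Rightarrow> real) \<Rightarrow> real ^ 'n \<Rightarrow> real" where
  "partial i f p = frechet_derivative f (at p) (axis i 1)"

definition christoffel ::
  "(real ^ 'n \<Rightarrow> real ^ 'n ^ 'n) \<Rightarrow> real ^ 'n \<Rightarrow> 'n \<Rightarrow> 'n \<Rightarrow> 'n \<Rightarrow> real" where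
  "christoffel m p k i j =
     (\<Sum>l\<in>UNIV. matrix_inv (m p) $ k $ l *
        (partial i (\<lambda>y. m y $ j $ l) p + partial j (\<lambda>y. m y $ i $ l) p
         - partial l (\<lambda>y. m y $ i $ j) p)) / 2"

text \<open>The Levi-Civita covariant derivative of \<open>X\<^sub>z\<close> in the direction of the conjugate of \<open>X\<^sub>z\<close>.\<close>

definition cov_dzbar_dz ::
  "(real ^ 'n \<Rightarrow> real ^ 'n ^ 'n) \<Rightarrow> 'a chart \<Rightarrow> ('a \<Rightarrow> real ^ 'n) \<Rightarrow> 'a \<Rightarrow> complex ^ 'n" where
  "cov_dzbar_dz m \<phi> X q = (\<chi> k.
     dzbar \<phi> (dz \<phi> (\<lambda>r. complex_of_real (X r $ k))) q +
     (\<Sum>i\<in>UNIV. \<Sum>j\<in>UNIV. complex_of_real (christoffel m (X q) k i j)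
        * vec_dzbar \<phi> X q $ i * vec_dz \<phi> X q $ j))"

text \<open>For any conformal metric \<open>\<mu> |dz|\<^sup>2\<close> on the source, the tension field of \<open>f\<close> is
  \<open>4 / \<mu>\<close> times \<open>cov_dzbar_dz\<close>.\<close>

definition harmonic_map ::
  "'a::t2_space set \<Rightarrow> 'a chart set \<Rightarrow> (real ^ 'n \<Rightarrow> real ^ 'n ^ 'n) \<Rightarrow> ('a \<Rightarrow> real ^ 'n) \<Rightarrow> bool" where
  "harmonic_map S A m f \<longleftrightarrow> smooth_map S A f \<and>
     (\<forall>\<phi>\<in>conformal_params S A. \<forall>q\<in>fst \<phi>. cov_dzbar_dz m \<phi> f q = 0)"

definition hyperbolic_disc_metric :: "real ^ 2 \<Rightarrow> real ^ 2 ^ 2" where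
  "hyperbolic_disc_metric w = mat (4 / (1 - (norm w)\<^sup>2)\<^sup>2)"

definition complex_vec :: "complex \<Rightarrow> real ^ 2" where
  "complex_vec w = vector [Re w, Im w]"


section \<open>The homogeneous spaces\<close>

definition crit :: "real \<Rightarrow> real" where
  "crit \<kappa> = sqrt (- \<kappa>) / 2"

definition zeta :: "real ^ 3 \<Rightarrow> complex" where
  "zeta p = Complex (p $ 1) (p $ 2)"

definition E_carrier :: "real \<Rightarrow> (real ^ 3) set" where
  "E_carrier \<kappa> = {p. \<kappa> = 0 \<or> norm (zeta p) < 1 / crit \<kappa>}"

definition Lam :: "real \<Rightarrow> real ^ 3 \<Rightarrow> real" where
  "Lam \<kappa> p = 1 / (1 - (crit \<kappa>)\<^sup>2 * (norm (zeta p))\<^sup>2)"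

text \<open>The coefficients of the form \<open>\<tau>\<Lambda>(x\<^sub>2 dx\<^sub>1 - x\<^sub>1 dx\<^sub>2) + dx\<^sub>3\<close>.\<close>

definition E_form :: "real \<Rightarrow> real \<Rightarrow> real ^ 3 \<Rightarrow> real ^ 3" where
  "E_form \<kappa> \<tau> p = vector [\<tau> * Lam \<kappa> p * p $ 2, - \<tau> * Lam \<kappa> p * p $ 1, 1]"

definition E_metric :: "real \<Rightarrow> real \<Rightarrow> real ^ 3 \<Rightarrow> real ^ 3 ^ 3" where
  "E_metric \<kappa> \<tau> p = (\<chi> i j.
     (if i = j \<and> i \<noteq> 3 then (Lam \<kappa> p)\<^sup>2 else 0) + E_form \<kappa> \<tau> p $ i * E_form \<kappa> \<tau> p $ j)"

definition E_frame :: "real \<Rightarrow> real \<Rightarrow> real ^ 3 \<Rightarrow> real ^ 3 ^ 3" where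
  "E_frame \<kappa> \<tau> p = vector
     [vector [1 / Lam \<kappa> p, 0, - \<tau> * p $ 2],
      vector [0, 1 / Lam \<kappa> p, \<tau> * p $ 1],
      vector [0, 0, 1]]"

definition frame_coords :: "real \<Rightarrow> real \<Rightarrow> real ^ 3 \<Rightarrow> real ^ 3 \<Rightarrow> real ^ 3" where
  "frame_coords \<kappa> \<tau> p v = (\<chi> i. metric_inner (E_metric \<kappa> \<tau> p) v (E_frame \<kappa> \<tau> p $ i))"

text \<open>The cross product of the oriented tangent space at \<open>p\<close>, for which the frame is a positively
  oriented orthonormal basis.\<close>

definition E_cross :: "real \<Rightarrow> real \<Rightarrow> real ^ 3 \<Rightarrow> real ^ 3 \<Rightarrow> real ^ 3 \<Rightarrow> real ^ 3" where
  "E_cross \<kappa> \<tau> p v w =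
     (\<Sum>i\<in>UNIV. cross3 (frame_coords \<kappa> \<tau> p v) (frame_coords \<kappa> \<tau> p w) $ i *\<^sub>R (E_frame \<kappa> \<tau> p $ i))"


section \<open>Conformal immersions\<close>

definition conf_factor :: "real \<Rightarrow> real \<Rightarrow> 'a chart \<Rightarrow> ('a \<Rightarrow> real ^ 3) \<Rightarrow> 'a \<Rightarrow> real" where
  "conf_factor \<kappa> \<tau> \<phi> X q =
     2 * Re (metric_inner (E_metric \<kappa> \<tau> (X q)) (vec_dz \<phi> X q) (vec_dzbar \<phi> X q))"

definition conformal_immersion ::
  "'a::t2_space set \<Rightarrow> 'a chart set \<Rightarrow> real \<Rightarrow> real \<Rightarrow> ('a \<Rightarrow> real ^ 3) \<Rightarrow> bool" where
  "conformal_immersion S A \<kappa> \<tau> X \<longleftrightarrow>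
     X \<in> S \<rightarrow> E_carrier \<kappa> \<and> smooth_map S A X \<and>
     (\<forall>\<phi>\<in>conformal_params S A. \<forall>q\<in>fst \<phi>.
        metric_inner (E_metric \<kappa> \<tau> (X q)) (vec_dz \<phi> X q) (vec_dz \<phi> X q) = 0 \<and>
        metric_inner (E_metric \<kappa> \<tau> (X q)) (vec_dz \<phi> X q) (vec_dzbar \<phi> X q)
          = complex_of_real (conf_factor \<kappa> \<tau> \<phi> X q / 2) \<and>
        conf_factor \<kappa> \<tau> \<phi> X q > 0)"

text \<open>For a conformal immersion the condition below does not depend on the parameter.\<close>

definition unit_normal ::
  "'a::t2_space set \<Rightarrow> 'a chart set \<Rightarrow> real \<Rightarrow> real \<Rightarrow> ('a \<Rightarrow> real ^ 3) \<Rightarrow> 'a \<Rightarrow> real ^ 3" where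
  "unit_normal S A \<kappa> \<tau> X q = (THE n. \<forall>\<phi>\<in>conformal_params S A. q \<in> fst \<phi> \<longrightarrow>
     E_cross \<kappa> \<tau> (X q) (du \<phi> X q) (dv \<phi> X q) = conf_factor \<kappa> \<tau> \<phi> X q *\<^sub>R n)"

definition normal_coords ::
  "'a::t2_space set \<Rightarrow> 'a chart set \<Rightarrow> real \<Rightarrow> real \<Rightarrow> ('a \<Rightarrow> real ^ 3) \<Rightarrow> 'a \<Rightarrow> real ^ 3" where
  "normal_coords S A \<kappa> \<tau> X q = frame_coords \<kappa> \<tau> (X q) (unit_normal S A \<kappa> \<tau> X q)"

definition nowhere_vertical ::
  "'a::t2_space set \<Rightarrow> 'a chart set \<Rightarrow> real \<Rightarrow> real \<Rightarrow> ('a \<Rightarrow> real ^ 3) \<Rightarrow> bool" where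
  "nowhere_vertical S A \<kappa> \<tau> X \<longleftrightarrow> (\<forall>q\<in>S. normal_coords S A \<kappa> \<tau> X q $ 3 \<noteq> 0)"

definition upwards_pointing ::
  "'a::t2_space set \<Rightarrow> 'a chart set \<Rightarrow> real \<Rightarrow> real \<Rightarrow> ('a \<Rightarrow> real ^ 3) \<Rightarrow> bool" where
  "upwards_pointing S A \<kappa> \<tau> X \<longleftrightarrow> (\<forall>q\<in>S. normal_coords S A \<kappa> \<tau> X q $ 3 > 0)"

definition has_mean_curvature ::
  "'a::t2_space set \<Rightarrow> 'a chart set \<Rightarrow> real \<Rightarrow> real \<Rightarrow> ('a \<Rightarrow> real ^ 3) \<Rightarrow> ('a \<Rightarrow> real) \<Rightarrow> bool" where
  "has_mean_curvature S A \<kappa> \<tau> X H \<longleftrightarrow>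
     (\<forall>\<phi>\<in>conformal_params S A. \<forall>q\<in>fst \<phi>.
        cov_dzbar_dz (E_metric \<kappa> \<tau>) \<phi> X q =
          (\<chi> k. complex_of_real (conf_factor \<kappa> \<tau> \<phi> X q * H q / 2 * unit_normal S A \<kappa> \<tau> X q $ k)))"

definition critical_cmc_immersion ::
  "'a::t2_space set \<Rightarrow> 'a chart set \<Rightarrow> real \<Rightarrow> real \<Rightarrow> ('a \<Rightarrow> real ^ 3) \<Rightarrow> bool" where
  "critical_cmc_immersion S A \<kappa> \<tau> X \<longleftrightarrow>
     conformal_immersion S A \<kappa> \<tau> X \<and> has_mean_curvature S A \<kappa> \<tau> X (\<lambda>_. crit \<kappa>)"

text \<open>The value \<open>None\<close> stands for the point at infinity. With \<open>w = (N\<^sub>1 + i N\<^sub>2) / (1 + N\<^sub>3)\<close>, the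
  stereographic projection of the normal, the Gauss map is \<open>(w + c \<zeta>) / (c \<zeta>\<^sup>* w + 1)\<close>
  (\<open>\<zeta>\<^sup>*\<close> being the conjugate of \<open>\<zeta>\<close>); when \<open>N\<^sub>3 = -1\<close> the defining quotient is \<open>0/0\<close> and has to be
  read as the value \<open>1 / (c \<zeta>\<^sup>*)\<close> of this Moebius transformation at \<open>w = \<infinity>\<close>.\<close>

definition gauss_map ::
  "'a::t2_space set \<Rightarrow> 'a chart set \<Rightarrow> real \<Rightarrow> real \<Rightarrow> ('a \<Rightarrow> real ^ 3) \<Rightarrow> 'a \<Rightarrow> complex option" where
  "gauss_map S A \<kappa> \<tau> X q =
     (let N = normal_coords S A \<kappa> \<tau> X q;
          c\<zeta> = complex_of_real (crit \<kappa>) * zeta (X q);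
          numer = Complex (N $ 1) (N $ 2) + c\<zeta> * complex_of_real (1 + N $ 3);
          denom = cnj c\<zeta> * Complex (N $ 1) (N $ 2) + 1 + complex_of_real (N $ 3)
      in if N $ 3 = -1 then (if c\<zeta> = 0 then None else Some (1 / cnj c\<zeta>))
         else if denom = 0 then None else Some (numer / denom))"


section \<open>The Gauss map equation and the representation formula\<close>

definition nowhere_antiholomorphic ::
  "'a::t2_space set \<Rightarrow> 'a chart set \<Rightarrow> ('a \<Rightarrow> complex) \<Rightarrow> bool" where
  "nowhere_antiholomorphic S A g \<longleftrightarrow>
     (\<forall>\<phi>\<in>conformal_params S A. \<forall>q\<in>fst \<phi>. dz \<phi> g q \<noteq> 0)"

definition gauss_equation :: "'a::t2_space set \<Rightarrow> 'a chart set \<Rightarrow> ('a \<Rightarrow> complex) \<Rightarrow> bool" where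
  "gauss_equation S A g \<longleftrightarrow>
     (\<forall>\<phi>\<in>conformal_params S A. \<forall>q\<in>fst \<phi>.
        (1 - complex_of_real ((norm (g q))\<^sup>2)) * dzbar \<phi> (dz \<phi> g) q
          + 2 * cnj (g q) * dz \<phi> g q * dzbar \<phi> g q = 0)"

definition representation_formula ::
  "'a::t2_space set \<Rightarrow> 'a chart set \<Rightarrow> real \<Rightarrow> real \<Rightarrow> ('a \<Rightarrow> complex) \<Rightarrow> ('a \<Rightarrow> real ^ 3) \<Rightarrow> bool" where
  "representation_formula S A \<kappa> \<tau> g X \<longleftrightarrow>
     (\<forall>\<phi>\<in>conformal_params S A. \<forall>q\<in>fst \<phi>.
       let c = complex_of_real (crit \<kappa>); t = complex_of_real \<tau>;
           Z = (\<lambda>r. zeta (X r)); \<zeta> = zeta (X q); \<gamma> = g q;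
           D = 1 - complex_of_real ((norm \<gamma>)\<^sup>2);
           L = 1 - c\<^sup>2 * complex_of_real ((norm \<zeta>)\<^sup>2)
       in dz \<phi> Z q = 2 / (c + \<i> * t) * ((1 - c * \<zeta> * cnj \<gamma>)\<^sup>2 / D\<^sup>2) * dz \<phi> g q \<and>
          dzbar \<phi> Z q =
            - (2 / (c - \<i> * t)) * ((\<gamma> - c * \<zeta>)\<^sup>2 / D\<^sup>2) * dzbar \<phi> (\<lambda>r. cnj (g r)) q \<and>
          dz \<phi> (\<lambda>r. complex_of_real (X r $ 3)) q =
            - (2 / (c + \<i> * t)) * ((cnj \<gamma> - c * cnj \<zeta>) * (1 - c * \<zeta> * cnj \<gamma>) / (L * D\<^sup>2)) * dz \<phi> g q
            + \<i> * t / 2 * ((\<zeta> * dz \<phi> (\<lambda>r. cnj (Z r)) q - cnj \<zeta> * dz \<phi> Z q) / L))"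

text \<open>Only differentiability is required of them.\<close>

definition representation_solution ::
  "'a::t2_space set \<Rightarrow> 'a chart set \<Rightarrow> real \<Rightarrow> real \<Rightarrow> ('a \<Rightarrow> complex) \<Rightarrow> ('a \<Rightarrow> real ^ 3) \<Rightarrow> bool" where
  "representation_solution S A \<kappa> \<tau> g X \<longleftrightarrow>
     X \<in> S \<rightarrow> E_carrier \<kappa> \<and> differentiable_map S A X \<and> representation_formula S A \<kappa> \<tau> g X"

end

theory Submission
  imports Defs
begin

no_notation fps_nth (infixl "$" 75)

text \<open>Write \<open>R = h\<^sub>z - (i \<tau> / 2) \<Lambda> (\<zeta> \<zeta>\<^sup>*\<^sub>z - \<zeta>\<^sup>* \<zeta>\<^sub>z)\<close> for the vertical and \<open>P = \<Lambda> \<zeta>\<^sub>z\<close> for the horizontal part of \<open>X\<^sub>z\<close>.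
  Conformality with upward normal means that \<open>X\<^sub>z\<close> is an isotropic vector, determined by \<open>P\<close> and the
  stereographic projection \<open>w\<close> of the normal, in particular \<open>R = - w\<^sup>* P\<close>. The mean curvature equation
  for \<open>H = c\<close> then gives the derivatives of \<open>P\<close> and \<open>w\<close>, and \<open>g\<close> is the image of \<open>w\<close> under a hyperbolic
  translation depending on \<open>\<zeta>\<close>; substituting yields the equation for \<open>g\<close> and the representation formula,
  and the computation can be reversed.

  To integrate the formula, note that for given \<open>g\<close> the first two equations form a Riccati system for \<open>\<zeta>\<close>.
  It is the projectivization \<open>\<zeta> = p / q\<close> of a linear system that is flat by the equation for \<open>g\<close> and
  preserves \<open>|q|\<^sup>2 - c\<^sup>2 |p|\<^sup>2\<close>, so solutions exist on discs whose size does not depend on the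
  initial value and stay in the disc of radius \<open>1 / c\<close>. The third equation is then a closed form. Local
  solutions with this uniformity and uniqueness extend along paths, without monodromy on a simply
  connected surface.\<close>

section \<open>Calculus of smooth maps\<close>

text \<open>The equation for \<open>g\<close> does not come from differentiating the expression of
  \<open>g\<close> a second time. Equality of the mixed derivatives of \<open>\<zeta>\<close> is a
  single linear relation between the left side of the equation and its conjugate. The moduli of the
  two coefficients are in the ratio of \<open>|1 - c \<zeta> cnj g|^2\<close> to
  \<open>|g - c \<zeta>|^2\<close>, unequal because the normal points upwards, and this forces the
  left side to vanish. In the converse direction a solution is only assumed differentiable, so its
  smoothness is bootstrapped from the formula before mixed derivatives are exchanged. The linear
  system behind the Riccati system has a special shape: both right sides are multiples of squares of
  affine functions of \<open>\<zeta>\<close>, hence both coefficient matrices are nilpotent; they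
  are negative adjoints of each other for the hermitian form, which is why the form is constant. The
  monodromy argument is carried out for abstract local sections with values in a Hausdorff space,
  since continuation uses only existence through every admissible value over one neighbourhood and
  agreement of germs.\<close>

lemma Ck_on_cong:
  assumes "open D" "\<And>x. x \<in> D \<Longrightarrow> f x = g x" "Ck_on k f D"
  shows "Ck_on k g D"
  using assms(2,3)
proof (induction k arbitrary: f g)
  case 0
  then show ?case by (auto cong: continuous_on_cong)
next
  case (Suc k)
  have fd: "f differentiable (at x)" if "x \<in> D" for x using Suc.prems that by auto
  have eq: "frechet_derivative g (at x) = frechet_derivative f (at x)" if "x \<in> D" for x
    using frechet_derivative_transform_within_open[OF fd[OF that] assms(1) that] Suc.prems(1) by auto
  have "g differentiable (at x)" if "x \<in> D" for x
    using fd[OF that] Suc.prems(1) assms(1) that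
    by (metis differentiable_def has_derivative_transform_within_open)
  moreover have "Ck_on k (\<lambda>x. frechet_derivative g (at x) v) D" for v
    by (rule Suc.IH[of "\<lambda>x. frechet_derivative f (at x) v"]) (use Suc.prems eq in auto)
  ultimately show ?case by auto
qed

lemma Ck_on_SucI:
  assumes "open D" "\<And>x. x \<in> D \<Longrightarrow> (f has_derivative f' x) (at x)"
    and "\<And>v. Ck_on k (\<lambda>x. f' x v) D"
  shows "Ck_on (Suc k) f D"
proof -
  have "Ck_on k (\<lambda>x. frechet_derivative f (at x) v) D" for v
    by (rule Ck_on_cong[OF assms(1) _ assms(3)[of v]]) (use frechet_derivative_at[OF assms(2)] in auto)
  then show ?thesis using assms(2) by (auto simp: differentiable_def)
qed

lemma Ck_on_SucD: "Ck_on (Suc k) f D \<Longrightarrow> Ck_on k f D"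
proof (induction k arbitrary: f)
  case 0
  then show ?case
    by (auto intro!: continuous_at_imp_continuous_on differentiable_imp_continuous_within)
qed auto

lemma Ck_on_has_derivative:
  "Ck_on (Suc k) f D \<Longrightarrow> x \<in> D \<Longrightarrow> (f has_derivative frechet_derivative f (at x)) (at x)"
  by (auto simp: frechet_derivative_works)

lemma Ck_on_subset: "Ck_on k f D \<Longrightarrow> D' \<subseteq> D \<Longrightarrow> Ck_on k f D'"
  by (induction k arbitrary: f) (auto intro: continuous_on_subset)

lemma Ck_on_const: "open D \<Longrightarrow> Ck_on k (\<lambda>x. a) D"
proof (induction k arbitrary: a)
  case (Suc k)
  then show ?case by (intro Ck_on_SucI[where f'="\<lambda>_ _. 0"]) auto
qed auto

lemma Ck_on_linear_comp:
  assumes "open D" "bounded_linear h" "Ck_on k f D"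
  shows "Ck_on k (\<lambda>x. h (f x)) D"
  using assms(3)
proof (induction k arbitrary: f)
  case 0
  then show ?case using assms(2) by (auto intro: bounded_linear.continuous_on)
next
  case (Suc k)
  show ?case
    by (rule Ck_on_SucI[OF assms(1) bounded_linear.has_derivative[OF assms(2)
          Ck_on_has_derivative[OF Suc.prems]] Suc.IH]) (use Suc.prems in auto)
qed

lemma Ck_on_ident: "open D \<Longrightarrow> Ck_on k (\<lambda>x. x) D"
proof (cases k)
  case (Suc m)
  then show "open D \<Longrightarrow> ?thesis"
    by (auto intro!: Ck_on_SucI[where f'="\<lambda>_ v. v"] Ck_on_const)
qed auto

lemma Ck_on_add:
  assumes "open D" "Ck_on k f D" "Ck_on k g D"
  shows "Ck_on k (\<lambda>x. f x + g x) D"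
  using assms(2,3)
proof (induction k arbitrary: f g)
  case 0
  then show ?case by (auto intro: continuous_intros)
next
  case (Suc k)
  show ?case
    by (rule Ck_on_SucI[OF assms(1) has_derivative_add[OF Ck_on_has_derivative[OF Suc.prems(1)]
          Ck_on_has_derivative[OF Suc.prems(2)]] Suc.IH]) (use Suc.prems in auto)
qed

lemma Ck_on_bilinear:
  assumes "open D" "bounded_bilinear h" "Ck_on k f D" "Ck_on k g D"
  shows "Ck_on k (\<lambda>x. h (f x) (g x)) D"
  using assms(3,4)
proof (induction k arbitrary: f g)
  case 0
  then show ?case using assms(2) by (auto intro: bounded_bilinear.continuous_on)
next
  case (Suc k)
  note fk = Ck_on_SucD[OF Suc.prems(1)] and gk = Ck_on_SucD[OF Suc.prems(2)]
  show ?case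
    by (rule Ck_on_SucI[OF assms(1) bounded_bilinear.FDERIV[OF assms(2)
            Ck_on_has_derivative[OF Suc.prems(1)] Ck_on_has_derivative[OF Suc.prems(2)]]
          Ck_on_add[OF assms(1) Suc.IH Suc.IH]]) (use Suc.prems fk gk in auto)
qed

lemma Ck_on_mult:
  fixes f g :: "'a::real_normed_vector \<Rightarrow> 'b::real_normed_algebra"
  shows "open D \<Longrightarrow> Ck_on k f D \<Longrightarrow> Ck_on k g D \<Longrightarrow> Ck_on k (\<lambda>x. f x * g x) D"
  by (rule Ck_on_bilinear[OF _ bounded_bilinear_mult])

lemma Ck_on_minus: "open D \<Longrightarrow> Ck_on k f D \<Longrightarrow> Ck_on k (\<lambda>x. - f x) D"
  by (rule Ck_on_linear_comp[OF _ bounded_linear_minus[OF bounded_linear_ident]])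

text \<open>The derivative of the inverse is built from the inverse itself and the derivative of
  \<open>f\<close>. The induction therefore runs on \<open>k\<close> with \<open>f\<close> fixed,
  unlike the product rule, which passes to derivatives of its factors.\<close>

lemma Ck_on_inverse:
  fixes f :: "'a::real_normed_vector \<Rightarrow> 'b::real_normed_field"
  assumes "open D" "Ck_on k f D" "\<And>x. x \<in> D \<Longrightarrow> f x \<noteq> 0"
  shows "Ck_on k (\<lambda>x. inverse (f x)) D"
  using assms(2,3)
proof (induction k)
  case 0
  then show ?case by (auto intro: continuous_on_inverse)
next
  case (Suc k)
  have I: "Ck_on k (\<lambda>x. inverse (f x)) D"
    using Suc.IH Ck_on_SucD[OF Suc.prems(1)] Suc.prems(2) by auto
  show ?case
    by (rule Ck_on_SucI[OF assms(1) Deriv.has_derivative_inverse[OF _ Ck_on_has_derivative[OF Suc.prems(1)]]])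
       (use Suc.prems I assms(1) in \<open>auto intro!: Ck_on_minus Ck_on_mult\<close>)
qed

named_theorems smooth_intros

lemma smooth_on_cong: "open D \<Longrightarrow> smooth_on f D \<Longrightarrow> (\<And>x. x \<in> D \<Longrightarrow> f x = g x) \<Longrightarrow> smooth_on g D"
  unfolding smooth_on_def using Ck_on_cong by blast

lemma smooth_on_subset: "smooth_on f D \<Longrightarrow> D' \<subseteq> D \<Longrightarrow> smooth_on f D'"
  unfolding smooth_on_def using Ck_on_subset by blast

lemma smooth_on_const [smooth_intros]: "open D \<Longrightarrow> smooth_on (\<lambda>x. a) D"
  and smooth_on_ident [smooth_intros]: "open D \<Longrightarrow> smooth_on (\<lambda>x. x) D"
  by (simp_all add: smooth_on_def Ck_on_const Ck_on_ident)

lemma smooth_on_linear_comp: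
  "open D \<Longrightarrow> bounded_linear h \<Longrightarrow> smooth_on f D \<Longrightarrow> smooth_on (\<lambda>x. h (f x)) D"
  by (simp add: smooth_on_def Ck_on_linear_comp)

lemma smooth_on_add [smooth_intros]:
  "open D \<Longrightarrow> smooth_on f D \<Longrightarrow> smooth_on g D \<Longrightarrow> smooth_on (\<lambda>x. f x + g x) D"
  by (simp add: smooth_on_def Ck_on_add)

lemma smooth_on_minus [smooth_intros]: "open D \<Longrightarrow> smooth_on f D \<Longrightarrow> smooth_on (\<lambda>x. - f x) D"
  by (simp add: smooth_on_def Ck_on_minus)

lemma smooth_on_diff [smooth_intros]:
  "open D \<Longrightarrow> smooth_on f D \<Longrightarrow> smooth_on g D \<Longrightarrow> smooth_on (\<lambda>x. f x - g x) D"
  using smooth_on_add[of D f "\<lambda>x. - g x"] smooth_on_minus[of D g] by simp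

lemma smooth_on_scaleR [smooth_intros]:
  "open D \<Longrightarrow> smooth_on f D \<Longrightarrow> smooth_on g D \<Longrightarrow> smooth_on (\<lambda>x. f x *\<^sub>R g x) D"
  by (simp add: smooth_on_def Ck_on_bilinear[OF _ bounded_bilinear_scaleR])

lemma smooth_on_mult [smooth_intros]:
  fixes f g :: "'a::real_normed_vector \<Rightarrow> 'b::real_normed_algebra"
  shows "open D \<Longrightarrow> smooth_on f D \<Longrightarrow> smooth_on g D \<Longrightarrow> smooth_on (\<lambda>x. f x * g x) D"
  by (simp add: smooth_on_def Ck_on_mult)

lemma smooth_on_power [smooth_intros]:
  fixes f :: "'a::real_normed_vector \<Rightarrow> 'b::real_normed_algebra_1"
  shows "open D \<Longrightarrow> smooth_on f D \<Longrightarrow> smooth_on (\<lambda>x. f x ^ n) D"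
  by (induction n) (auto intro!: smooth_intros)

lemma smooth_on_divide [smooth_intros]:
  fixes f g :: "'a::real_normed_vector \<Rightarrow> 'b::real_normed_field"
  shows "open D \<Longrightarrow> smooth_on f D \<Longrightarrow> smooth_on g D \<Longrightarrow> (\<And>x. x \<in> D \<Longrightarrow> g x \<noteq> 0) \<Longrightarrow>
    smooth_on (\<lambda>x. f x / g x) D"
  by (auto simp: smooth_on_def divide_inverse intro!: Ck_on_mult Ck_on_inverse)

lemmas smooth_on_cnj [smooth_intros] = smooth_on_linear_comp[OF _ bounded_linear_cnj]
  and smooth_on_Re [smooth_intros] = smooth_on_linear_comp[OF _ bounded_linear_Re]
  and smooth_on_Im [smooth_intros] = smooth_on_linear_comp[OF _ bounded_linear_Im]
  and smooth_on_of_real [smooth_intros] = smooth_on_linear_comp[OF _ bounded_linear_of_real]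
  and smooth_on_nth = smooth_on_linear_comp[OF _ bounded_linear_vec_nth]

lemma smooth_on_frechet: "smooth_on f D \<Longrightarrow> smooth_on (\<lambda>x. frechet_derivative f (at x) v) D"
  unfolding smooth_on_def by (metis Ck_on.simps(2))

lemma smooth_on_differentiable: "smooth_on f D \<Longrightarrow> x \<in> D \<Longrightarrow> f differentiable (at x)"
  unfolding smooth_on_def by (metis Ck_on.simps(2))

lemma smooth_on_continuous_on: "smooth_on f D \<Longrightarrow> continuous_on D f"
  unfolding smooth_on_def by (metis Ck_on.simps(1))

text \<open>Two applications of the mean value inequality, one for each side of the parallelogram
  spanned by \<open>h u\<close> and \<open>h v\<close>, compare its second difference with
  \<open>h^2\<close> times the mixed derivative at \<open>x\<close>.\<close>

lemma mixed_difference_estimate: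
  fixes f :: "'a::real_normed_vector \<Rightarrow> 'b::real_normed_vector"
  assumes "open D" "x \<in> D" "Ck_on 2 f D" "e > 0"
  shows "\<exists>d>0. \<forall>h. 0 < h \<and> h < d \<longrightarrow>
    norm (f (x + h *\<^sub>R u + h *\<^sub>R v) - f (x + h *\<^sub>R u) - f (x + h *\<^sub>R v) + f x
      - (h * h) *\<^sub>R frechet_derivative (\<lambda>y. frechet_derivative f (at y) u) (at x) v) \<le> e * h * h"
proof -
  define fu where "fu = (\<lambda>y. frechet_derivative f (at y) u)"
  define fuv where "fuv = (\<lambda>y. frechet_derivative fu (at y) v)"
  have C: "Ck_on (Suc (Suc 0)) f D" using assms(3) by (simp add: numeral_2_eq_2)
  have f': "(f has_derivative frechet_derivative f (at y)) (at y)" if "y \<in> D" for y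
    using Ck_on_has_derivative[OF C that] .
  have C1: "Ck_on (Suc 0) fu D" using C unfolding fu_def by simp
  have fu': "(fu has_derivative frechet_derivative fu (at y)) (at y)" if "y \<in> D" for y
    using Ck_on_has_derivative[OF C1 that] .
  have "continuous_on D fuv" using C1 unfolding fuv_def by simp
  then have "continuous (at x) fuv" using assms(1,2) continuous_on_eq_continuous_at by blast
  then obtain d1 where d1: "d1 > 0" "\<And>y. dist y x < d1 \<Longrightarrow> dist (fuv y) (fuv x) < e"
    using \<open>e > 0\<close> unfolding continuous_at_eps_delta by metis
  obtain d2 where d2: "d2 > 0" "ball x d2 \<subseteq> D" using assms(1,2) openE by blast
  \<comment> \<open>With this scale the whole parallelogram lies in the ball of radius
    \<open>min d1 d2\<close>; the summand 1 keeps the denominator positive when \<open>u\<close> and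
    \<open>v\<close> vanish.\<close>
  define d where "d = min d1 d2 / (norm u + norm v + 1)"
  have "d > 0" using d1 d2 unfolding d_def by (auto intro!: divide_pos_pos add_nonneg_pos)
  have small: "dist (x + s *\<^sub>R u + t *\<^sub>R v) x < min d1 d2"
    if "0 \<le> s" "s \<le> h" "0 \<le> t" "t \<le> h" "h < d" for s t h
  proof -
    have "dist (x + s *\<^sub>R u + t *\<^sub>R v) x \<le> s * norm u + t * norm v"
      using norm_triangle_ineq[of "s *\<^sub>R u" "t *\<^sub>R v"] that by (simp add: dist_norm add.assoc)
    also have "\<dots> \<le> h * norm u + h * norm v" using that by (intro add_mono mult_right_mono) auto
    also have "\<dots> \<le> h * (norm u + norm v + 1)" using that by (simp add: algebra_simps)
    also have "\<dots> < d * (norm u + norm v + 1)" using that by (intro mult_strict_right_mono) (auto intro: add_nonneg_pos)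
    also have "\<dots> = min d1 d2" unfolding d_def
      by (metis add_nonneg_pos add_nonneg_nonneg less_irrefl nonzero_divide_eq_eq norm_ge_zero zero_less_one)
    finally show ?thesis .
  qed
  show ?thesis
  proof (intro exI[of _ d] conjI \<open>d > 0\<close> allI impI)
    fix h assume h: "0 < h \<and> h < d"
    have inD: "x + s *\<^sub>R u + t *\<^sub>R v \<in> D" if "0 \<le> s" "s \<le> h" "0 \<le> t" "t \<le> h" for s t
      using small[OF that] h d2(2) by (auto simp: dist_commute)
    have bnd: "norm (fuv (x + s *\<^sub>R u + t *\<^sub>R v) - fuv x) \<le> e" if "0 \<le> s" "s \<le> h" "0 \<le> t" "t \<le> h" for s t
      using d1(2)[of "x + s *\<^sub>R u + t *\<^sub>R v"] small[OF that] h by (simp add: dist_norm less_imp_le)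
    \<comment> \<open>Subtracting the linear term leaves \<open>fuv - fuv x\<close> as derivative in
      \<open>t\<close>, which is at most \<open>e\<close> in norm.\<close>
    define \<psi> where "\<psi> s = (\<lambda>t. fu (x + s *\<^sub>R u + t *\<^sub>R v) - t *\<^sub>R fuv x)" for s
    have \<psi>: "norm (\<psi> s h - \<psi> s 0) \<le> e * norm (h - 0)" if s: "0 \<le> s" "s \<le> h" for s
    proof (rule differentiable_bound[of "{0..h}"])
      show "(\<psi> s has_derivative (\<lambda>r. r *\<^sub>R (fuv (x + s *\<^sub>R u + t *\<^sub>R v) - fuv x))) (at t within {0..h})"
        if "t \<in> {0..h}" for t
      proof -
        have D: "(fu has_derivative frechet_derivative fu (at (x + s *\<^sub>R u + t *\<^sub>R v)))
           (at (x + s *\<^sub>R u + t *\<^sub>R v))"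
          using fu' inD s that by auto
        have "linear (frechet_derivative fu (at (x + s *\<^sub>R u + t *\<^sub>R v)))"
          using has_derivative_linear[OF D] .
        then have L: "frechet_derivative fu (at (x + s *\<^sub>R u + t *\<^sub>R v)) (r *\<^sub>R v)
           = r *\<^sub>R fuv (x + s *\<^sub>R u + t *\<^sub>R v)" for r
          unfolding fuv_def by (rule linear_cmul)
        have i: "((\<lambda>t. x + s *\<^sub>R u + t *\<^sub>R v) has_derivative (\<lambda>r. r *\<^sub>R v)) (at t within {0..h})"
          by (auto intro!: derivative_eq_intros)
        have "((\<lambda>t. fu (x + s *\<^sub>R u + t *\<^sub>R v)) has_derivative
            (\<lambda>r. frechet_derivative fu (at (x + s *\<^sub>R u + t *\<^sub>R v)) (r *\<^sub>R v))) (at t within {0..h})"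
          using has_derivative_compose[OF i D] .
        then show ?thesis unfolding \<psi>_def L
          by (auto intro!: derivative_eq_intros simp: algebra_simps)
      qed
      show "onorm (\<lambda>r. r *\<^sub>R (fuv (x + s *\<^sub>R u + t *\<^sub>R v) - fuv x)) \<le> e" if "t \<in> {0..h}" for t
        using bnd[of s t] s that
        by (intro onorm_le) (auto simp: mult.commute[of e] intro: mult_left_mono)
    qed (use h in auto)
    \<comment> \<open>Its derivative in \<open>s\<close> is exactly the increment
      \<open>\<psi> s h - \<psi> s 0\<close> that has just been estimated, so the second mean value
      inequality applies.\<close>
    define \<phi> where "\<phi> = (\<lambda>s. f (x + s *\<^sub>R u + h *\<^sub>R v) - f (x + s *\<^sub>R u) - s *\<^sub>R h *\<^sub>R fuv x)"
    have "norm (\<phi> h - \<phi> 0) \<le> (e * h) * norm (h - 0)"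
    proof (rule differentiable_bound[of "{0..h}"])
      have Df: "((\<lambda>s. f (x + s *\<^sub>R u + t *\<^sub>R v)) has_derivative (\<lambda>r. r *\<^sub>R fu (x + s *\<^sub>R u + t *\<^sub>R v))) (at s within {0..h})"
        if "s \<in> {0..h}" "t \<in> {0..h}" for s t
      proof -
        have D: "(f has_derivative frechet_derivative f (at (x + s *\<^sub>R u + t *\<^sub>R v)))
           (at (x + s *\<^sub>R u + t *\<^sub>R v))"
          using f' inD that by auto
        have "linear (frechet_derivative f (at (x + s *\<^sub>R u + t *\<^sub>R v)))"
          using has_derivative_linear[OF D] .
        then have L: "frechet_derivative f (at (x + s *\<^sub>R u + t *\<^sub>R v)) (r *\<^sub>R u)
           = r *\<^sub>R fu (x + s *\<^sub>R u + t *\<^sub>R v)" for r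
          unfolding fu_def by (rule linear_cmul)
        have i: "((\<lambda>s. x + s *\<^sub>R u + t *\<^sub>R v) has_derivative (\<lambda>r. r *\<^sub>R u)) (at s within {0..h})"
          by (auto intro!: derivative_eq_intros)
        show ?thesis using has_derivative_compose[OF i D] unfolding L .
      qed
      show "(\<phi> has_derivative (\<lambda>r. r *\<^sub>R (\<psi> s h - \<psi> s 0))) (at s within {0..h})" if "s \<in> {0..h}" for s
        using Df[OF that, of h] Df[OF that, of 0] h unfolding \<phi>_def \<psi>_def
        by (auto intro!: derivative_eq_intros simp: algebra_simps)
      show "onorm (\<lambda>r. r *\<^sub>R (\<psi> s h - \<psi> s 0)) \<le> e * h" if "s \<in> {0..h}" for s
        using \<psi>[of s] that h
        by (intro onorm_le) (auto simp: mult.commute[of "e * h"] intro: mult_left_mono)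
    qed (use h in auto)
    then show "norm (f (x + h *\<^sub>R u + h *\<^sub>R v) - f (x + h *\<^sub>R u) - f (x + h *\<^sub>R v) + f x
      - (h * h) *\<^sub>R frechet_derivative (\<lambda>y. frechet_derivative f (at y) u) (at x) v) \<le> e * h * h"
      using h unfolding \<phi>_def fuv_def fu_def by (simp add: algebra_simps)
  qed
qed

text \<open>The second difference is symmetric in \<open>u\<close> and \<open>v\<close>, so both
  iterated derivatives approximate one and the same quantity.\<close>

lemma frechet_derivative_commute:
  fixes f :: "'a::real_normed_vector \<Rightarrow> 'b::real_normed_vector"
  assumes "open D" "x \<in> D" "Ck_on 2 f D"
  shows "frechet_derivative (\<lambda>y. frechet_derivative f (at y) u) (at x) v
       = frechet_derivative (\<lambda>y. frechet_derivative f (at y) v) (at x) u" (is "?fa = ?fb")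
proof (rule ccontr)
  assume ne0: "?fa \<noteq> ?fb"
  define a b where ab: "a = ?fa" "b = ?fb"
  have ne: "a \<noteq> b" using ne0 ab by simp
  \<comment> \<open>With a third of the gap, the two errors add up to \<open>2 e h^2\<close>, while
    \<open>a\<close> and \<open>b\<close> scaled by \<open>h^2\<close> are \<open>3 e h^2\<close>
    apart.\<close>
  define e where "e = norm (a - b) / 3"
  have "e > 0" using ne unfolding e_def by simp
  obtain d1 where d1: "d1 > 0" "\<And>h. 0 < h \<and> h < d1 \<Longrightarrow>
    norm (f (x + h *\<^sub>R u + h *\<^sub>R v) - f (x + h *\<^sub>R u) - f (x + h *\<^sub>R v) + f x - (h * h) *\<^sub>R a) \<le> e * h * h"
    using mixed_difference_estimate[OF assms \<open>e > 0\<close>, of u v] unfolding ab by blast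
  obtain d2 where d2: "d2 > 0" "\<And>h. 0 < h \<and> h < d2 \<Longrightarrow>
    norm (f (x + h *\<^sub>R v + h *\<^sub>R u) - f (x + h *\<^sub>R v) - f (x + h *\<^sub>R u) + f x - (h * h) *\<^sub>R b) \<le> e * h * h"
    using mixed_difference_estimate[OF assms \<open>e > 0\<close>, of v u] unfolding ab by blast
  define h where "h = min d1 d2 / 2"
  define K where "K = f (x + h *\<^sub>R u + h *\<^sub>R v) - f (x + h *\<^sub>R u) - f (x + h *\<^sub>R v) + f x"
  have h: "0 < h" "h < d1" "h < d2" using d1 d2 by (auto simp: h_def)
  have 1: "norm (K - (h * h) *\<^sub>R a) \<le> e * h * h" using d1(2)[of h] h unfolding K_def by auto
  have "K = f (x + h *\<^sub>R v + h *\<^sub>R u) - f (x + h *\<^sub>R v) - f (x + h *\<^sub>R u) + f x"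
    unfolding K_def by (simp add: algebra_simps)
  then have 2: "norm (K - (h * h) *\<^sub>R b) \<le> e * h * h" using d2(2)[of h] h by auto
  have "(h * h) *\<^sub>R (a - b) = (K - (h * h) *\<^sub>R b) - (K - (h * h) *\<^sub>R a)"
    by (simp add: algebra_simps)
  then have "norm ((h * h) *\<^sub>R (a - b)) \<le> norm (K - (h * h) *\<^sub>R b) + norm (K - (h * h) *\<^sub>R a)"
    using norm_triangle_ineq4 by metis
  then have "norm ((h * h) *\<^sub>R (a - b)) \<le> 2 * (e * h * h)" using 1 2 by linarith
  moreover have "norm ((h * h) *\<^sub>R (a - b)) = 3 * (e * h * h)" using h by (simp add: e_def)
  moreover have "e * h * h > 0" using h \<open>e > 0\<close> by simp
  ultimately show False by linarith
qed

section \<open>Wirtinger derivatives\<close>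

lemma has_derivative_divide_num:
  fixes f :: "'a::real_normed_vector \<Rightarrow> 'b::real_normed_field"
  shows "(f has_derivative f') F \<Longrightarrow> ((\<lambda>x. f x / k) has_derivative (\<lambda>x. f' x / k)) F"
  unfolding divide_inverse by (rule has_derivative_mult_left)

text \<open>Every real linear map of the plane is \<open>a v + b cnj v\<close> for unique
  \<open>a\<close> and \<open>b\<close>, which are then the derivatives with respect to
  \<open>z\<close> and its conjugate. Carrying both at once is needed since conjugating the function
  exchanges them.\<close>

definition has_wirtinger :: "(complex \<Rightarrow> complex) \<Rightarrow> complex \<Rightarrow> complex \<Rightarrow> complex \<Rightarrow> bool" where
  "has_wirtinger f a b z \<longleftrightarrow> (f has_derivative (\<lambda>v. a * v + b * cnj v)) (at z)"

definition wz :: "(complex \<Rightarrow> complex) \<Rightarrow> complex \<Rightarrow> complex" where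
  "wz f z = (frechet_derivative f (at z) 1 - \<i> * frechet_derivative f (at z) \<i>) / 2"

definition wzb :: "(complex \<Rightarrow> complex) \<Rightarrow> complex \<Rightarrow> complex" where
  "wzb f z = (frechet_derivative f (at z) 1 + \<i> * frechet_derivative f (at z) \<i>) / 2"

lemma has_wirtinger_frechet:
  assumes "has_wirtinger f a b z"
  shows "frechet_derivative f (at z) v = a * v + b * cnj v"
  using frechet_derivative_at[OF assms[unfolded has_wirtinger_def]] by metis

lemma has_wirtinger_unique:
  assumes "has_wirtinger f a b z"
  shows "wz f z = a" "wzb f z = b"
  unfolding wz_def wzb_def has_wirtinger_frechet[OF assms] by (auto simp: field_simps)

lemma has_wirtinger_works:
  assumes "f differentiable (at z)"
  shows "has_wirtinger f (wz f z) (wzb f z) z"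
proof -
  let ?F = "frechet_derivative f (at z)"
  have D: "(f has_derivative ?F) (at z)" using assms frechet_derivative_works by blast
  then have l: "linear ?F" by (rule has_derivative_linear)
  have "?F v = wz f z * v + wzb f z * cnj v" for v
  proof -
    have "?F v = ?F (Re v *\<^sub>R 1 + Im v *\<^sub>R \<i>)" 
      by (rule arg_cong[of _ _ ?F]) (simp add: complex_eq_iff)
    also have "\<dots> = Re v *\<^sub>R ?F 1 + Im v *\<^sub>R ?F \<i>" by (simp only: linear_add[OF l] linear_cmul[OF l])
    also have "\<dots> = wz f z * v + wzb f z * cnj v"
      unfolding wz_def wzb_def by (simp add: complex_eq_iff field_simps)
    finally show ?thesis .
  qed
  then have "?F = (\<lambda>v. wz f z * v + wzb f z * cnj v)" by auto
  then show ?thesis unfolding has_wirtinger_def using D by simp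
qed

lemma has_wirtinger_differentiable: "has_wirtinger f a b z \<Longrightarrow> f differentiable (at z)"
  unfolding has_wirtinger_def differentiable_def by auto

lemma has_wirtinger_transform:
  "has_wirtinger f a b z \<Longrightarrow> open D \<Longrightarrow> z \<in> D \<Longrightarrow> (\<And>x. x \<in> D \<Longrightarrow> f x = g x) \<Longrightarrow> has_wirtinger g a b z"
  unfolding has_wirtinger_def by (rule has_derivative_transform_within_open)

lemma has_wirtinger_eq: "has_wirtinger f a b z \<Longrightarrow> a = a' \<Longrightarrow> b = b' \<Longrightarrow> has_wirtinger f a' b' z"
  by simp

named_theorems wirtinger_intros

lemma has_wirtinger_const [wirtinger_intros]: "has_wirtinger (\<lambda>z. k) 0 0 z"
  by (simp add: has_wirtinger_def)

lemma has_wirtinger_add [wirtinger_intros]: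
  "has_wirtinger f a b z \<Longrightarrow> has_wirtinger g a' b' z \<Longrightarrow> has_wirtinger (\<lambda>z. f z + g z) (a + a') (b + b') z"
  using has_derivative_add[of f "\<lambda>v. a * v + b * cnj v" "at z" g "\<lambda>v. a' * v + b' * cnj v"]
  unfolding has_wirtinger_def by (simp add: algebra_simps)

lemma has_wirtinger_diff [wirtinger_intros]:
  "has_wirtinger f a b z \<Longrightarrow> has_wirtinger g a' b' z \<Longrightarrow> has_wirtinger (\<lambda>z. f z - g z) (a - a') (b - b') z"
  using has_derivative_diff[of f "\<lambda>v. a * v + b * cnj v" "at z" g "\<lambda>v. a' * v + b' * cnj v"]
  unfolding has_wirtinger_def by (simp add: algebra_simps)

lemma has_wirtinger_minus [wirtinger_intros]:
  "has_wirtinger f a b z \<Longrightarrow> has_wirtinger (\<lambda>z. - f z) (- a) (- b) z"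
  using has_derivative_minus[of f "\<lambda>v. a * v + b * cnj v" "at z"]
  unfolding has_wirtinger_def by (simp add: algebra_simps)

lemma has_wirtinger_mult [wirtinger_intros]:
  "has_wirtinger f a b z \<Longrightarrow> has_wirtinger g a' b' z \<Longrightarrow>
    has_wirtinger (\<lambda>z. f z * g z) (f z * a' + a * g z) (f z * b' + b * g z) z"
  using has_derivative_mult[of f "\<lambda>v. a * v + b * cnj v" z UNIV g "\<lambda>v. a' * v + b' * cnj v"]
  unfolding has_wirtinger_def by (simp add: algebra_simps)

lemma has_wirtinger_power2 [wirtinger_intros]:
  "has_wirtinger f a b z \<Longrightarrow> has_wirtinger (\<lambda>z. (f z)\<^sup>2) (2 * f z * a) (2 * f z * b) z"
  using has_wirtinger_mult[of f a b z f a b] by (simp add: power2_eq_square mult_ac)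

lemma has_wirtinger_inverse [wirtinger_intros]:
  assumes "has_wirtinger f a b z" "f z \<noteq> 0"
  shows "has_wirtinger (\<lambda>z. inverse (f z)) (- a / (f z)\<^sup>2) (- b / (f z)\<^sup>2) z"
proof -
  have "(\<lambda>v. - (inverse (f z) * (a * v + b * cnj v) * inverse (f z)))
    = (\<lambda>v. - a / (f z)\<^sup>2 * v + - b / (f z)\<^sup>2 * cnj v)"
    using assms(2) by (auto simp: fun_eq_iff field_simps power2_eq_square)
  then show ?thesis
    using Deriv.has_derivative_inverse[OF assms(2) assms(1)[unfolded has_wirtinger_def]]
    unfolding has_wirtinger_def by metis
qed

lemma has_wirtinger_divide [wirtinger_intros]:
  assumes "has_wirtinger f a b z" "has_wirtinger g a' b' z" "g z \<noteq> 0"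
  shows "has_wirtinger (\<lambda>z. f z / g z) ((a * g z - f z * a') / (g z)\<^sup>2) ((b * g z - f z * b') / (g z)\<^sup>2) z"
proof -
  have "has_wirtinger (\<lambda>z. f z * inverse (g z))
     (f z * (- a' / (g z)\<^sup>2) + a * inverse (g z)) (f z * (- b' / (g z)\<^sup>2) + b * inverse (g z)) z"
    by (intro wirtinger_intros assms)
  then show ?thesis unfolding divide_inverse[symmetric]
    by (rule has_wirtinger_eq) (use assms(3) in \<open>auto simp: field_simps power2_eq_square\<close>)
qed

lemma has_wirtinger_cnj [wirtinger_intros]:
  assumes "has_wirtinger f a b z"
  shows "has_wirtinger (\<lambda>z. cnj (f z)) (cnj b) (cnj a) z"
  using bounded_linear.has_derivative[OF bounded_linear_cnj assms[unfolded has_wirtinger_def]]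
  unfolding has_wirtinger_def by (simp add: add.commute)

text \<open>A real function equals its own conjugate, and conjugation swaps and conjugates the two
  coefficients.\<close>

lemma has_wirtinger_real:
  assumes "has_wirtinger (\<lambda>z. complex_of_real (f z)) a b z"
  shows "b = cnj a"
  using has_wirtinger_unique[OF has_wirtinger_cnj[OF assms]] has_wirtinger_unique[OF assms] by simp

lemma has_wirtinger_comp_holomorphic:
  assumes "has_wirtinger f a b (T z)" "(T has_field_derivative t) (at z)"
  shows "has_wirtinger (\<lambda>z. f (T z)) (a * t) (b * cnj t) z"
  using has_derivative_compose[OF assms(2)[unfolded has_field_derivative_def] assms(1)[unfolded has_wirtinger_def]]
  unfolding has_wirtinger_def by (simp add: mult_ac)

lemma smooth_on_has_wirtinger:
  "smooth_on f D \<Longrightarrow> z \<in> D \<Longrightarrow> has_wirtinger f (wz f z) (wzb f z) z"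
  by (rule has_wirtinger_works[OF smooth_on_differentiable])

lemma smooth_on_wz [smooth_intros]: "open D \<Longrightarrow> smooth_on f D \<Longrightarrow> smooth_on (wz f) D"
  and smooth_on_wzb [smooth_intros]: "open D \<Longrightarrow> smooth_on f D \<Longrightarrow> smooth_on (wzb f) D"
  unfolding wz_def[abs_def] wzb_def[abs_def] by (intro smooth_intros smooth_on_frechet; simp)+

text \<open>Both sides are a quarter of the Laplacian plus a multiple of the difference of the two
  mixed second derivatives, with opposite signs; that difference vanishes.\<close>

lemma wzb_wz:
  assumes "open D" "smooth_on f D" "z \<in> D"
  shows "wzb (wz f) z = wz (wzb f) z"
proof -
  have D: "\<And>v. (\<lambda>x. frechet_derivative f (at x) v) differentiable (at z)"
    using smooth_on_differentiable[OF smooth_on_frechet[OF assms(2)] assms(3)] .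
  have C: "Ck_on 2 f D" using assms(2) by (auto simp: smooth_on_def)
  let ?F = "\<lambda>u. frechet_derivative (\<lambda>x. frechet_derivative f (at x) u) (at z)"
  have F: "((\<lambda>x. frechet_derivative f (at x) u) has_derivative ?F u) (at z)" for u
    using D frechet_derivative_works by blast
  have 1: "frechet_derivative (wz f) (at z) v = (?F 1 v - \<i> * ?F \<i> v) / 2" for v
  proof -
    have "(wz f has_derivative (\<lambda>v. (?F 1 v - \<i> * ?F \<i> v) / 2)) (at z)"
      unfolding wz_def[abs_def] by (intro has_derivative_divide_num has_derivative_mult_right has_derivative_diff F)
    from fun_cong[OF frechet_derivative_at[OF this], of v] show ?thesis by simp
  qed
  have 2: "frechet_derivative (wzb f) (at z) v = (?F 1 v + \<i> * ?F \<i> v) / 2" for v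
  proof -
    have "(wzb f has_derivative (\<lambda>v. (?F 1 v + \<i> * ?F \<i> v) / 2)) (at z)"
      unfolding wzb_def[abs_def] by (intro has_derivative_divide_num has_derivative_mult_right has_derivative_add F)
    from fun_cong[OF frechet_derivative_at[OF this], of v] show ?thesis by simp
  qed
  have "?F 1 \<i> = ?F \<i> 1" by (rule frechet_derivative_commute[OF assms(1,3) C])
  then show ?thesis unfolding wz_def[of "wzb f"] wzb_def[of "wz f"] 1 2
    by (simp add: field_simps)
qed

text \<open>The coefficients \<open>F\<close> and \<open>G\<close> may depend on \<open>f\<close> itself: this is the bootstrap for
  solutions of first order systems.\<close>

lemma smooth_on_bootstrap:
  assumes "open D" "\<And>z. z \<in> D \<Longrightarrow> has_wirtinger f (F z) (G z) z"
    and "\<And>k. Ck_on k f D \<Longrightarrow> Ck_on k F D \<and> Ck_on k G D"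
  shows "smooth_on f D"
proof -
  have "Ck_on k f D" for k
  proof (induction k)
    case 0
    have "isCont f z" if "z \<in> D" for z
      using has_wirtinger_differentiable[OF assms(2)[OF that]] differentiable_imp_continuous_within by blast
    then show ?case by (simp add: continuous_at_imp_continuous_on)
  next
    case (Suc k)
    then show ?case
      by (intro Ck_on_SucI[OF assms(1) assms(2)[unfolded has_wirtinger_def]] Ck_on_add Ck_on_mult Ck_on_const)
        (use assms(1,3) in auto)
  qed
  then show ?thesis by (simp add: smooth_on_def)
qed

section \<open>Flat linear systems\<close>

text \<open>The function \<open>\<phi>\<close> is nonincreasing: Cauchy-Schwarz and
  \<open>2 |f| e \<le> |f|^2 + e^2\<close> bound the growth of the squared norm. Squaring avoids
  differentiating the norm at zeros of \<open>f\<close>.\<close>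

lemma gronwall:
  fixes f :: "real \<Rightarrow> 'v::real_inner"
  assumes f': "\<And>t. t \<in> {0..1} \<Longrightarrow> (f has_vector_derivative f' t) (at t within {0..1})"
    and bnd: "\<And>t. t \<in> {0..1} \<Longrightarrow> norm (f' t) \<le> K * norm (f t) + e"
    and "f 0 = 0" "0 \<le> K" "0 \<le> e" and t: "t \<in> {0..1}"
  shows "norm (f t) \<le> e * exp (2 * K + 1)"
proof -
  \<comment> \<open>The part \<open>2 * K\<close> absorbs the linear growth of the squared norm, and
    the 1 absorbs the \<open>|f|^2\<close> that comes from splitting the cross term
    \<open>2 |f| e\<close>.\<close>
  define L where "L = 2 * K + 1"
  define \<phi> where "\<phi> t = exp (- L * t) * (f t \<bullet> f t) - e\<^sup>2 * t" for t
  have \<phi>': "(\<phi> has_real_derivative exp (- L * t) * (2 * (f t \<bullet> f' t) - L * (f t \<bullet> f t)) - e\<^sup>2) (at t within {0..1})"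
    if "t \<in> {0..1}" for t
  proof -
    have "((\<lambda>t. f t \<bullet> f t) has_derivative (\<lambda>h. f t \<bullet> (h *\<^sub>R f' t) + (h *\<^sub>R f' t) \<bullet> f t)) (at t within {0..1})"
      using f'[OF that] unfolding has_vector_derivative_def by (intro has_derivative_inner)
    then have "((\<lambda>t. f t \<bullet> f t) has_real_derivative 2 * (f t \<bullet> f' t)) (at t within {0..1})"
      unfolding has_field_derivative_def
      by (rule has_derivative_eq_rhs) (auto simp: fun_eq_iff inner_commute)
    then show ?thesis unfolding \<phi>_def
      by (auto intro!: derivative_eq_intros simp: algebra_simps)
  qed
  have "\<phi> t \<le> \<phi> 0"
  proof (rule DERIV_nonpos_imp_decreasing_open[where f=\<phi> and a=0 and b=t])
    fix s assume s: "0 < s" "s < t"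
    then have s1: "s \<in> {0..1}" using t by auto
    have "f s \<bullet> f' s \<le> norm (f s) * (K * norm (f s) + e)"
      using norm_cauchy_schwarz[of "f s" "f' s"] mult_left_mono[OF bnd[OF s1] norm_ge_zero[of "f s"]] by linarith
    moreover have "2 * (norm (f s) * e) \<le> norm (f s)^2 + e^2"
      using sum_squares_bound[of "norm (f s)" e] by (simp add: power2_eq_square algebra_simps)
    ultimately have "2 * (f s \<bullet> f' s) - L * (f s \<bullet> f s) \<le> e\<^sup>2"
      unfolding L_def power2_norm_eq_inner[symmetric] by (simp add: power2_eq_square algebra_simps)
    moreover have "exp (- L * s) \<le> 1" using s \<open>0 \<le> K\<close> unfolding L_def by (auto intro!: mult_nonpos_nonneg)
    ultimately have "exp (- L * s) * (2 * (f s \<bullet> f' s) - L * (f s \<bullet> f s)) \<le> 1 * e\<^sup>2"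
      by (meson mult_mono mult_left_mono exp_ge_zero order_trans mult_right_mono zero_le_power2)
    moreover have "(\<phi> has_real_derivative exp (- L * s) * (2 * (f s \<bullet> f' s) - L * (f s \<bullet> f s)) - e\<^sup>2) (at s)"
      using \<phi>'[OF s1] at_within_Icc_at[of 0 s 1] s t by simp
    ultimately show "\<exists>y. (\<phi> has_real_derivative y) (at s) \<and> y \<le> 0"
      by (intro exI[of _ "exp (- L * s) * (2 * (f s \<bullet> f' s) - L * (f s \<bullet> f s)) - e\<^sup>2"]) auto
  next
    have "continuous_on {0..1} \<phi>" using \<phi>' by (rule DERIV_continuous_on)
    then show "continuous_on {0..t} \<phi>" using t by (auto intro: continuous_on_subset)
  qed (use t in auto)
  then have "exp (- L * t) * (norm (f t))\<^sup>2 \<le> e\<^sup>2 * t"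
    using \<open>f 0 = 0\<close> by (simp add: \<phi>_def power2_norm_eq_inner)
  also have "\<dots> \<le> e\<^sup>2 * 1" using t by (intro mult_left_mono) auto
  finally have "exp (L * t) * (exp (- L * t) * (norm (f t))\<^sup>2) \<le> exp (L * t) * e\<^sup>2"
    by (intro mult_left_mono) auto
  then have "(norm (f t))\<^sup>2 \<le> exp (L * t) * e\<^sup>2"
    by (simp add: mult.assoc[symmetric] exp_add[symmetric])
  \<comment> \<open>A wasteful bound, chosen so that the right side is a perfect square and the root
    can be taken.\<close>
  also have "\<dots> \<le> (exp L)\<^sup>2 * e\<^sup>2"
  proof (rule mult_right_mono)
    have "L * t \<le> L * 1" using t \<open>0 \<le> K\<close> by (intro mult_left_mono) (auto simp: L_def)
    moreover have "0 \<le> L" using \<open>0 \<le> K\<close> by (simp add: L_def)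
    ultimately have "L * t \<le> L + L" by linarith
    then have "exp (L * t) \<le> exp (L + L)" by (simp only: exp_le_cancel_iff)
    then show "exp (L * t) \<le> (exp L)\<^sup>2" by (simp only: exp_add power2_eq_square)
  qed simp
  finally have "(norm (f t))\<^sup>2 \<le> (e * exp L)\<^sup>2" by (simp add: power_mult_distrib mult.commute)
  then show ?thesis unfolding L_def[symmetric] using \<open>0 \<le> e\<close> by (simp add: power2_le_iff_abs_le)
qed

lemma gronwall_zero:
  fixes f :: "real \<Rightarrow> 'v::real_inner"
  assumes "\<And>t. t \<in> {0..1} \<Longrightarrow> (f has_vector_derivative f' t) (at t within {0..1})"
    and "\<And>t. t \<in> {0..1} \<Longrightarrow> norm (f' t) \<le> K * norm (f t)"
    and "f 0 = 0" "0 \<le> K" "t \<in> {0..1}"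
  shows "f t = 0"
  using gronwall[of f f' K 0 t] assms by auto

text \<open>On an interval of length 1 the condition \<open>K < 1\<close> already makes the Picard
  operator a contraction for the supremum norm, so no subdivision of the interval is required. Later
  uses arrange this by taking short rays.\<close>

lemma linear_ode_exists:
  fixes prod :: "'m::real_normed_vector \<Rightarrow> 'v::banach \<Rightarrow> 'v" and y0 :: 'v
  assumes bl: "bounded_bilinear prod" and M: "continuous_on {0..1} M"
    and bnd: "\<And>t y. t \<in> {0..1} \<Longrightarrow> norm (prod (M t) y) \<le> K * norm y" and K: "0 \<le> K" "K < 1"
  shows "\<exists>y. y 0 = y0 \<and> (\<forall>t\<in>{0..1}. (y has_vector_derivative prod (M t) (y t)) (at t within {0..1::real}))"
proof -
  \<comment> \<open>The fixed point theorem is applied in the complete space of bounded continuous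
    functions on the whole line. Clamping the time to the unit interval turns the integral operator
    into a self-map of that space.\<close>
  define cl :: "real \<Rightarrow> real" where "cl t = max 0 (min 1 t)" for t
  have cl: "cl t \<in> {0..1}" for t by (auto simp: cl_def)
  have cl_id: "cl t = t" if "t \<in> {0..1}" for t using that by (auto simp: cl_def)
  define h where "h \<phi> s = prod (M s) (apply_bcontfun \<phi> s)" for \<phi> s
  have hc: "continuous_on {0..1} (h \<phi>)" for \<phi>
    unfolding h_def by (intro bounded_bilinear.continuous_on[OF bl M] continuous_on_apply_bcontfun)
  have hsub: "continuous_on {0..s} (h \<phi>)" if "s \<in> {0..1}" for \<phi> s
    using that by (intro continuous_on_subset[OF hc]) auto
  define I where "I \<phi> t = y0 + integral {0..t} (h \<phi>)" for \<phi> t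
  have I': "(I \<phi> has_vector_derivative h \<phi> t) (at t within {0..1})" if "t \<in> {0..1}" for \<phi> t
    unfolding I_def using integral_has_vector_derivative[OF hc that] by (auto intro!: derivative_eq_intros)
  have Ic: "continuous_on {0..1} (I \<phi>)" for \<phi>
    by (rule continuous_on_vector_derivative) (rule I')
  have mem: "(\<lambda>t. I \<phi> (cl t)) \<in> bcontfun" for \<phi>
  proof -
    have "continuous_on UNIV (\<lambda>t. I \<phi> (cl t))"
      by (rule continuous_on_compose2[OF Ic]) (use cl in \<open>auto simp: cl_def intro!: continuous_intros\<close>)
    moreover have "bounded (I \<phi> ` {0..1})"
      by (intro compact_imp_bounded compact_continuous_image Ic) auto
    then have "bounded (range (\<lambda>t. I \<phi> (cl t)))"
      by (rule bounded_subset) (use cl in auto)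
    ultimately show ?thesis by (simp add: bcontfun_def)
  qed
  define T where "T \<phi> = Bcontfun (\<lambda>t. I \<phi> (cl t))" for \<phi>
  have T: "apply_bcontfun (T \<phi>) t = I \<phi> (cl t)" for \<phi> t
    unfolding T_def by (simp add: Bcontfun_inverse mem)
  have "dist (T \<phi>) (T \<psi>) \<le> K * dist \<phi> \<psi>" for \<phi> \<psi>
  proof (rule dist_bound)
    fix t
    let ?s = "cl t"
    have s: "0 \<le> ?s" "?s \<le> 1" using cl[of t] by auto
    have "I \<phi> ?s - I \<psi> ?s = integral {0..?s} (\<lambda>u. h \<phi> u - h \<psi> u)"
      unfolding I_def using hsub[OF cl]
      by (simp add: Henstock_Kurzweil_Integration.integral_diff integrable_continuous_interval)
    also have "norm \<dots> \<le> (K * dist \<phi> \<psi>) * (?s - 0)"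
    proof (rule integral_bound)
      fix u assume "u \<in> {0..?s}"
      then have "u \<in> {0..1}" using s by auto
      then have "norm (prod (M u) (apply_bcontfun \<phi> u - apply_bcontfun \<psi> u)) \<le> K * norm (apply_bcontfun \<phi> u - apply_bcontfun \<psi> u)"
        by (rule bnd)
      also have "\<dots> \<le> K * dist \<phi> \<psi>"
        using K dist_bounded[of \<phi> u \<psi>] by (intro mult_left_mono) (auto simp: dist_norm)
      finally show "norm (h \<phi> u - h \<psi> u) \<le> K * dist \<phi> \<psi>"
        unfolding h_def by (simp add: bounded_bilinear.diff_right[OF bl])
    qed (use s in \<open>auto intro!: continuous_intros hsub cl\<close>)
    also have "\<dots> \<le> (K * dist \<phi> \<psi>) * 1" using s K by (intro mult_left_mono) auto
    finally show "dist (apply_bcontfun (T \<phi>) t) (apply_bcontfun (T \<psi>) t) \<le> K * dist \<phi> \<psi>"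
      by (simp add: T dist_norm)
  qed
  then obtain \<phi> where fp: "T \<phi> = \<phi>" using banach_fix_type[OF K, of T] by auto
  have eq: "apply_bcontfun \<phi> t = I \<phi> t" if "t \<in> {0..1}" for t
    using T[of \<phi> t] fp cl_id[OF that] by simp
  show ?thesis
  proof (intro exI[of _ "I \<phi>"] conjI ballI)
    show "I \<phi> 0 = y0" by (simp add: I_def)
    show "(I \<phi> has_vector_derivative prod (M t) (I \<phi> t)) (at t within {0..1})" if "t \<in> {0..1}" for t
      using I'[OF that, of \<phi>] eq[OF that] by (simp add: h_def)
  qed
qed

section \<open>Integrability of flat systems on discs\<close>

lemma complex_linear_expand:
  assumes "linear F"
  shows "F v = Re v *\<^sub>R F 1 + Im v *\<^sub>R F \<i>"
proof -
  have "F v = F (Re v *\<^sub>R 1 + Im v *\<^sub>R \<i>)" by (rule arg_cong[of _ _ F]) (simp add: complex_eq_iff)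
  also have "\<dots> = Re v *\<^sub>R F 1 + Im v *\<^sub>R F \<i>" by (simp only: linear_add[OF assms] linear_cmul[OF assms])
  finally show ?thesis .
qed

text \<open>Uniform continuity on the compact set is needed only for the differential evaluated at 1
  and at \<open>\<i>\<close>, which determine it; convexity keeps the segment from \<open>p\<close>
  to \<open>q\<close> inside \<open>S\<close>.\<close>

lemma uniform_linearization:
  fixes f :: "complex \<Rightarrow> 'm::real_normed_vector"
  assumes "Ck_on 1 f U" "compact S" "convex S" "S \<subseteq> U" "e > 0"
  shows "\<exists>d>0. \<forall>p\<in>S. \<forall>q\<in>S. norm (q - p) < d \<longrightarrow>
    norm (f q - f p - frechet_derivative f (at p) (q - p)) \<le> e * norm (q - p)"
proof -
  define D where "D x = frechet_derivative f (at x)" for x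
  have C: "Ck_on (Suc 0) f U" using assms(1) by simp
  have f': "(f has_derivative D x) (at x)" if "x \<in> S" for x
    using Ck_on_has_derivative[OF C] that assms(4) unfolding D_def by auto
  have uc: "uniformly_continuous_on S (\<lambda>x. D x v)" for v
    using C assms(2,4) unfolding D_def
    by (intro compact_uniformly_continuous) (auto intro: continuous_on_subset)
  obtain d1 where d1: "d1 > 0" "\<And>x y. x \<in> S \<Longrightarrow> y \<in> S \<Longrightarrow> dist y x < d1 \<Longrightarrow> dist (D y 1) (D x 1) < e / 2"
    using uc[of 1] \<open>e > 0\<close> unfolding uniformly_continuous_on_def by (meson half_gt_zero)
  obtain d2 where d2: "d2 > 0" "\<And>x y. x \<in> S \<Longrightarrow> y \<in> S \<Longrightarrow> dist y x < d2 \<Longrightarrow> dist (D y \<i>) (D x \<i>) < e / 2"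
    using uc[of \<i>] \<open>e > 0\<close> unfolding uniformly_continuous_on_def by (meson half_gt_zero)
  show ?thesis
  proof (intro exI[of _ "min d1 d2"] conjI ballI impI)
    fix p q assume pq: "p \<in> S" "q \<in> S" "norm (q - p) < min d1 d2"
    have seg: "closed_segment p q \<subseteq> S" using pq assms(3) by (simp add: closed_segment_subset)
    have "norm (f q - f p - D p (q - p)) \<le> norm (q - p) * e"
    proof (rule differentiable_bound_linearization[where S="closed_segment p q" and f'=D])
      show "p + t *\<^sub>R (q - p) \<in> closed_segment p q" if "t \<in> {0..1}" for t
        using that by (auto simp: closed_segment_def algebra_simps intro!: exI[of _ t])
      show "(f has_derivative D x) (at x within closed_segment p q)" if "x \<in> closed_segment p q" for x
        using f' seg that has_derivative_at_withinI by blast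
      show "onorm (D x - D p) \<le> e" if x: "x \<in> closed_segment p q" for x
      proof (rule onorm_le)
        fix v
        have xS: "x \<in> S" using x seg by auto
        have "dist x p \<le> dist q p" using dist_in_closed_segment[OF x] by (metis dist_commute)
        then have dx: "dist x p < d1" "dist x p < d2" using pq(3) by (auto simp: dist_norm)
        have "(D x - D p) v = Re v *\<^sub>R (D x 1 - D p 1) + Im v *\<^sub>R (D x \<i> - D p \<i>)"
          using complex_linear_expand[OF has_derivative_linear[OF f'[OF xS]], of v]
            complex_linear_expand[OF has_derivative_linear[OF f'[OF pq(1)]], of v]
          by (simp add: algebra_simps)
        also have "norm \<dots> \<le> \<bar>Re v\<bar> * norm (D x 1 - D p 1) + \<bar>Im v\<bar> * norm (D x \<i> - D p \<i>)"
          by (rule order_trans[OF norm_triangle_ineq]) simp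
        also have "\<dots> \<le> norm v * (e / 2) + norm v * (e / 2)"
          using d1(2)[OF pq(1) xS dx(1)] d2(2)[OF pq(1) xS dx(2)] abs_Re_le_cmod[of v] abs_Im_le_cmod[of v]
          by (intro add_mono mult_mono) (auto simp: dist_norm)
        finally show "norm ((D x - D p) v) \<le> e * norm v" by (simp add: mult.commute)
      qed
    qed auto
    then show "norm (f q - f p - frechet_derivative f (at p) (q - p)) \<le> e * norm (q - p)"
      by (simp add: D_def mult.commute)
  qed (use d1 d2 in auto)
qed


lemma compact_norm_bound:
  assumes "compact S" "continuous_on S f"
  obtains N where "N > 0" "\<And>x. x \<in> S \<Longrightarrow> norm (f x) \<le> N"
proof -
  have "bounded (f ` S)" using assms compact_continuous_image compact_imp_bounded by blast
  then show ?thesis using that by (auto simp: bounded_pos)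
qed

text \<open>The system is integrated along the rays from \<open>z0\<close>. The difference of the solutions along two
  neighbouring rays is compared with the expected differential, and by flatness the error term
  satisfies a linear differential inequality with right hand side of second order.\<close>

lemma flat_system_ball:
  fixes prod :: "'m::real_normed_vector \<Rightarrow> 'v::euclidean_space \<Rightarrow> 'v"
  assumes bl: "bounded_bilinear prod" and A: "Ck_on 1 A U" and B: "Ck_on 1 B U"
    and r: "r > 0" "cball z0 r \<subseteq> U"
    and flat: "\<And>z y. z \<in> U \<Longrightarrow>
      prod (frechet_derivative A (at z) \<i>) y + prod (A z) (prod (B z) y) =
      prod (frechet_derivative B (at z) 1) y + prod (B z) (prod (A z) y)"
    and K: "\<And>z v y. z \<in> cball z0 r \<Longrightarrow> norm (prod (Re v *\<^sub>R A z + Im v *\<^sub>R B z) y) \<le> K * norm v * norm y"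
      "0 \<le> K" "K * r < 1"
  shows "\<exists>Y. Y z0 = y0 \<and>
    (\<forall>z\<in>ball z0 r. (Y has_derivative (\<lambda>v. prod (Re v *\<^sub>R A z + Im v *\<^sub>R B z) (Y z))) (at z))"
proof -
  interpret bounded_bilinear prod by fact
  define S where "S = cball z0 r"
  have S: "compact S" "convex S" "S \<subseteq> U" using r unfolding S_def by auto
  have z0v: "z0 + t *\<^sub>R v \<in> S" if "t \<in> {0..1}" "norm v \<le> r" for t v
  proof -
    have "\<bar>t\<bar> * norm v \<le> 1 * r" using that by (intro mult_mono) auto
    then show ?thesis by (simp add: S_def dist_norm)
  qed
  define A' where "A' z = frechet_derivative A (at z)" for z
  define B' where "B' z = frechet_derivative B (at z)" for z
  have CA: "Ck_on (Suc 0) A U" and CB: "Ck_on (Suc 0) B U" using A B by auto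
  have A': "(A has_derivative A' z) (at z)" and B': "(B has_derivative B' z) (at z)" if "z \<in> S" for z
    using Ck_on_has_derivative[OF CA] Ck_on_has_derivative[OF CB] that S unfolding A'_def B'_def by auto
  note A'lin = has_derivative_linear[OF A'] and B'lin = has_derivative_linear[OF B']
  \<comment> \<open>\<open>Om\<close> is the operator valued one-form of the system. In
    \<open>DOm z w v\<close> the form is differentiated at \<open>z\<close> along \<open>w\<close>,
    and \<open>v\<close> is its argument.\<close>
  define Om where "Om z v = Re v *\<^sub>R A z + Im v *\<^sub>R B z" for z v
  define DOm where "DOm z w v = Re v *\<^sub>R A' z w + Im v *\<^sub>R B' z w" for z w v
  have Om_add: "Om z (v + w) = Om z v + Om z w" for z v w by (simp add: Om_def algebra_simps)
  have DOm_scale: "DOm z (t *\<^sub>R w) v = t *\<^sub>R DOm z w v" if "z \<in> S" for z t w v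
    using linear_cmul[OF A'lin[OF that]] linear_cmul[OF B'lin[OF that]] by (simp add: DOm_def algebra_simps)
  \<comment> \<open>The difference of the two sides is bilinear and alternating in \<open>v\<close>
    and \<open>w\<close>, so the hypothesis for the pair consisting of 1 and \<open>\<i>\<close>
    yields all pairs.\<close>
  have flat2: "prod (DOm z v w) y + prod (Om z w) (prod (Om z v) y)
     = prod (DOm z w v) y + prod (Om z v) (prod (Om z w) y)" if "z \<in> S" for z v w y
  proof -
    have f: "prod (A' z \<i>) y = prod (B' z 1) y + prod (B z) (prod (A z) y) - prod (A z) (prod (B z) y)"
      using flat[of z y] that S(3) unfolding A'_def B'_def by (auto simp: algebra_simps)
    show ?thesis
      unfolding DOm_def Om_def complex_linear_expand[OF A'lin[OF that], of v] complex_linear_expand[OF A'lin[OF that], of w]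
        complex_linear_expand[OF B'lin[OF that], of v] complex_linear_expand[OF B'lin[OF that], of w]
      by (simp add: add_left add_right scaleR_left scaleR_right f algebra_simps)
  qed
  obtain Cp where Cp: "Cp > 0" "\<And>a b. norm (prod a b) \<le> norm a * norm b * Cp" using pos_bounded by blast
  have cA: "continuous_on S A" and cB: "continuous_on S B"
    and cA1: "continuous_on S (\<lambda>z. A' z v)" and cB1: "continuous_on S (\<lambda>z. B' z v)" for v
    using Ck_on_SucD[OF CA] Ck_on_SucD[OF CB] CA CB S(3) unfolding A'_def B'_def
    by (auto intro: continuous_on_subset)
  obtain N where N: "N > 0" "\<And>z. z \<in> S \<Longrightarrow> norm (A z, B z) \<le> N"
    using compact_norm_bound[OF S(1) continuous_on_Pair[OF cA cB]] by blast
  have Om_bnd: "norm (Om z v) \<le> 2 * N * norm v" if "z \<in> S" for z v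
  proof -
    have "norm (Om z v) \<le> \<bar>Re v\<bar> * norm (A z) + \<bar>Im v\<bar> * norm (B z)"
      unfolding Om_def by (rule order_trans[OF norm_triangle_ineq]) simp
    also have "\<dots> \<le> norm v * N + norm v * N"
      using N(2)[OF that] norm_fst_le[of "A z" "B z"] norm_snd_le[of "B z" "A z"] abs_Re_le_cmod[of v] abs_Im_le_cmod[of v]
      by (intro add_mono mult_mono) auto
    finally show ?thesis by simp
  qed
  obtain N1 where N1: "N1 > 0" "\<And>z. z \<in> S \<Longrightarrow> norm ((A' z 1, A' z \<i>), (B' z 1, B' z \<i>)) \<le> N1"
    using compact_norm_bound[OF S(1) continuous_on_Pair[OF continuous_on_Pair[OF cA1 cA1] continuous_on_Pair[OF cB1 cB1]]]
    by blast
  have A'_bnd: "norm (A' z w) \<le> 2 * N1 * norm w" and B'_bnd: "norm (B' z w) \<le> 2 * N1 * norm w" if "z \<in> S" for z w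
  proof -
    have n: "norm (A' z 1) \<le> N1" "norm (A' z \<i>) \<le> N1" "norm (B' z 1) \<le> N1" "norm (B' z \<i>) \<le> N1"
      using N1(2)[OF that] norm_fst_le norm_snd_le order_trans by metis+
    have "norm (Re w *\<^sub>R a + Im w *\<^sub>R b) \<le> 2 * N1 * norm w" if "norm a \<le> N1" "norm b \<le> N1" for a b :: 'm
    proof -
      have "norm (Re w *\<^sub>R a + Im w *\<^sub>R b) \<le> \<bar>Re w\<bar> * norm a + \<bar>Im w\<bar> * norm b"
        by (rule order_trans[OF norm_triangle_ineq]) simp
      also have "\<dots> \<le> norm w * N1 + norm w * N1"
        using that abs_Re_le_cmod[of w] abs_Im_le_cmod[of w] by (intro add_mono mult_mono) auto
      finally show ?thesis by simp
    qed
    then show "norm (A' z w) \<le> 2 * N1 * norm w" "norm (B' z w) \<le> 2 * N1 * norm w"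
      using n complex_linear_expand[OF A'lin[OF that], of w] complex_linear_expand[OF B'lin[OF that], of w] by auto
  qed
  have lin: "\<exists>d>0. \<forall>p\<in>S. \<forall>q\<in>S. \<forall>v. norm (q - p) < d \<longrightarrow>
     norm (Om q v - Om p v - DOm p (q - p) v) \<le> 2 * e * norm (q - p) * norm v" if e: "e > 0" for e
  proof -
    obtain dA where dA: "dA > 0" "\<And>p q. p \<in> S \<Longrightarrow> q \<in> S \<Longrightarrow> norm (q - p) < dA \<Longrightarrow>
       norm (A q - A p - A' p (q - p)) \<le> e * norm (q - p)"
      using uniform_linearization[OF A S e] unfolding A'_def by blast
    obtain dB where dB: "dB > 0" "\<And>p q. p \<in> S \<Longrightarrow> q \<in> S \<Longrightarrow> norm (q - p) < dB \<Longrightarrow>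
       norm (B q - B p - B' p (q - p)) \<le> e * norm (q - p)"
      using uniform_linearization[OF B S e] unfolding B'_def by blast
    show ?thesis
    proof (intro exI[of _ "min dA dB"] conjI ballI allI impI)
      fix p q v assume pq: "p \<in> S" "q \<in> S" "norm (q - p) < min dA dB"
      have "Om q v - Om p v - DOm p (q - p) v =
         Re v *\<^sub>R (A q - A p - A' p (q - p)) + Im v *\<^sub>R (B q - B p - B' p (q - p))"
        by (simp add: Om_def DOm_def algebra_simps)
      also have "norm \<dots> \<le> \<bar>Re v\<bar> * norm (A q - A p - A' p (q - p)) + \<bar>Im v\<bar> * norm (B q - B p - B' p (q - p))"
        by (rule order_trans[OF norm_triangle_ineq]) simp
      also have "\<dots> \<le> norm v * (e * norm (q - p)) + norm v * (e * norm (q - p))"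
        using dA(2)[OF pq(1,2)] dB(2)[OF pq(1,2)] pq(3) abs_Re_le_cmod[of v] abs_Im_le_cmod[of v]
        by (intro add_mono mult_mono) auto
      finally show "norm (Om q v - Om p v - DOm p (q - p) v) \<le> 2 * e * norm (q - p) * norm v"
        by (simp add: algebra_simps)
    qed (use dA dB in auto)
  qed
  \<comment> \<open>A Lipschitz constant for \<open>Om\<close>: \<open>4 * N1\<close> bounds
    \<open>DOm\<close>, and 2 is the linearization error \<open>2 * e\<close> at
    \<open>e = 1\<close>.\<close>
  define L where "L = 4 * N1 + 2"
  obtain d1 where d1: "d1 > 0" "\<And>p q v. p \<in> S \<Longrightarrow> q \<in> S \<Longrightarrow> norm (q - p) < d1 \<Longrightarrow>
       norm (Om q v - Om p v) \<le> L * norm (q - p) * norm v"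
  proof -
    obtain d where d: "d > 0" "\<And>p q v. p \<in> S \<Longrightarrow> q \<in> S \<Longrightarrow> norm (q - p) < d \<Longrightarrow>
       norm (Om q v - Om p v - DOm p (q - p) v) \<le> 2 * 1 * norm (q - p) * norm v"
      using lin[of 1] by auto
    have "norm (Om q v - Om p v) \<le> L * norm (q - p) * norm v" if pq: "p \<in> S" "q \<in> S" "norm (q - p) < d" for p q v
    proof -
      have "norm (DOm p (q - p) v) \<le> \<bar>Re v\<bar> * norm (A' p (q - p)) + \<bar>Im v\<bar> * norm (B' p (q - p))"
        unfolding DOm_def by (rule order_trans[OF norm_triangle_ineq]) simp
      also have "\<dots> \<le> norm v * (2 * N1 * norm (q - p)) + norm v * (2 * N1 * norm (q - p))"
        using A'_bnd[OF pq(1)] B'_bnd[OF pq(1)] abs_Re_le_cmod[of v] abs_Im_le_cmod[of v]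
        by (intro add_mono mult_mono) auto
      finally have "norm (DOm p (q - p) v) \<le> 4 * N1 * norm (q - p) * norm v" by (simp add: algebra_simps)
      moreover have "norm (Om q v - Om p v) \<le> norm (Om q v - Om p v - DOm p (q - p) v) + norm (DOm p (q - p) v)"
        by (metis norm_triangle_sub add.commute)
      ultimately show ?thesis using d(2)[OF pq, of v] unfolding L_def by (simp add: algebra_simps)
    qed
    then show ?thesis using that d(1) by blast
  qed
  have L: "L > 0" using N1 by (simp add: L_def)
  \<comment> \<open>Along the ray to \<open>z0 + v\<close> the system is an ordinary one on the unit
    interval. Its contraction constant is \<open>K * r\<close>, which is below 1 by hypothesis,
    whatever the initial value.\<close>
  have "\<exists>y. y 0 = y0 \<and> (\<forall>t\<in>{0..1}. (y has_vector_derivative prod (Om (z0 + t *\<^sub>R v) v) (y t)) (at t within {0..1::real}))"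
    if v: "norm v \<le> r" for v
  proof (rule linear_ode_exists[OF bl, where K="K * r"])
    show "continuous_on {0..1} (\<lambda>t. Om (z0 + t *\<^sub>R v) v)" unfolding Om_def
      by (intro continuous_intros continuous_on_compose2[OF cA] continuous_on_compose2[OF cB]) (use z0v v in auto)
    show "norm (prod (Om (z0 + t *\<^sub>R v) v) y) \<le> K * r * norm y" if "t \<in> {0..1}" for t y
    proof -
      have "norm (prod (Om (z0 + t *\<^sub>R v) v) y) \<le> K * norm v * norm y"
        using K(1)[of "z0 + t *\<^sub>R v"] z0v[OF that v] unfolding Om_def S_def by blast
      also have "\<dots> \<le> K * r * norm y" using v K(2) by (intro mult_right_mono mult_left_mono) auto
      finally show ?thesis .
    qed
  qed (use K r in auto)
  then obtain y where y0: "\<And>v. norm v \<le> r \<Longrightarrow> y v 0 = y0" and y: "\<And>v t. norm v \<le> r \<Longrightarrow> t \<in> {0..1} \<Longrightarrow>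
     (y v has_vector_derivative prod (Om (z0 + t *\<^sub>R v) v) (y v t)) (at t within {0..1})"
    by metis
  define Y where "Y z = y (z - z0) 1" for z
  have prodK: "norm (prod (Om p v) u) \<le> 1 * norm u" if "p \<in> S" "norm v \<le> r" for p v u
  proof -
    have "norm (prod (Om p v) u) \<le> K * norm v * norm u" using K(1) that unfolding Om_def S_def by blast
    also have "\<dots> \<le> K * r * norm u" using that K(2) by (intro mult_right_mono mult_left_mono) auto
    also have "\<dots> \<le> 1 * norm u" using K(3) by (intro mult_right_mono) auto
    finally show ?thesis .
  qed
  have pb: "norm (prod a b) \<le> \<alpha> * \<beta> * Cp" if "norm a \<le> \<alpha>" "norm b \<le> \<beta>" for a b \<alpha> \<beta>
  proof -
    have "0 \<le> \<alpha>" using that(1) norm_ge_zero order_trans by blast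
    then have "norm a * norm b * Cp \<le> \<alpha> * \<beta> * Cp" using that Cp(1) by (intro mult_right_mono mult_mono) auto
    then show ?thesis using Cp(2)[of a b] by linarith
  qed
  have "(Y has_derivative (\<lambda>w. prod (Om (z0 + v) w) (Y (z0 + v)))) (at (z0 + v))" if v: "norm v < r" for v
  proof -
    have vr: "norm v \<le> r" using v by simp
    define P where "P = y v"
    have "continuous_on {0..1} P" unfolding P_def
      by (rule continuous_on_vector_derivative) (use y vr in auto)
    then obtain NP where NP: "NP > 0" "\<And>t. t \<in> {0..1} \<Longrightarrow> norm (P t) \<le> NP"
      using compact_norm_bound[OF compact_Icc] by blast
    \<comment> \<open>\<open>C1\<close> measures the change of the right side between two rays,
      \<open>C2\<close> the resulting distance of the solutions (the factor \<open>exp 3\<close> is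
      the one from \<open>gronwall\<close> with \<open>K = 1\<close>). \<open>C3\<close> and
      \<open>C4\<close> collect the second order terms and the linearization error.\<close>
    define C1 where "C1 = (L * r + 2 * N) * NP * Cp"
    define C2 where "C2 = C1 * exp 3"
    define C3 where "C3 = (L * r * C2 + 2 * N * C2 + L * NP) * Cp"
    define C4 where "C4 = 2 * r * NP * Cp"
    have Cpos: "C1 > 0" "C2 > 0" "C3 > 0" "C4 > 0"
      using L N NP Cp r by (auto simp: C1_def C2_def C3_def C4_def intro!: mult_pos_pos add_pos_pos)
    have main: "norm (Y (z0 + v + w) - Y (z0 + v) - prod (Om (z0 + v) w) (Y (z0 + v)))
        \<le> norm w * (C3 * norm w + C4 * e) * exp 3"
      if w: "norm w < d1" "norm (v + w) < r" and e: "e > 0" and dw: "norm w < d"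
        and d: "\<And>p q v. p \<in> S \<Longrightarrow> q \<in> S \<Longrightarrow> norm (q - p) < d \<Longrightarrow>
           norm (Om q v - Om p v - DOm p (q - p) v) \<le> 2 * e * norm (q - p) * norm v" for w e d
    proof -
      have vwr: "norm (v + w) \<le> r" using w by simp
      define Q where "Q = y (v + w)"
      define p where "p t = z0 + t *\<^sub>R v" for t
      define q where "q t = z0 + t *\<^sub>R (v + w)" for t
      have pS: "p t \<in> S" and qS: "q t \<in> S" if "t \<in> {0..1}" for t
        using z0v[OF that vr] z0v[OF that vwr] by (auto simp: p_def q_def)
      have qp: "q t - p t = t *\<^sub>R w" for t by (simp add: p_def q_def algebra_simps)
      have tw: "norm (q t - p t) \<le> norm w" if "t \<in> {0..1}" for t
        using that by (simp add: qp mult_left_le_one_le)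
      have Pd: "(P has_vector_derivative prod (Om (p t) v) (P t)) (at t within {0..1})"
       and Qd: "(Q has_vector_derivative prod (Om (q t) (v + w)) (Q t)) (at t within {0..1})"
        if "t \<in> {0..1}" for t
        using y[OF vr that] y[OF vwr that] by (auto simp: P_def Q_def p_def q_def)
      have Ld: "norm (Om (q t) u - Om (p t) u) \<le> L * norm w * norm u" if "t \<in> {0..1}" for t u
      proof -
        have "norm (Om (q t) u - Om (p t) u) \<le> L * norm (q t - p t) * norm u"
          using d1(2)[OF pS[OF that] qS[OF that]] tw[OF that] w by auto
        also have "\<dots> \<le> L * norm w * norm u" using tw[OF that] L by (intro mult_right_mono mult_left_mono) auto
        finally show ?thesis .
      qed
      have E: "norm (Q t - P t) \<le> C2 * norm w" if t: "t \<in> {0..1}" for t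
      proof -
        have "norm (Q t - P t) \<le> (C1 * norm w) * exp (2 * 1 + 1)"
        proof (rule gronwall[where f'="\<lambda>t. prod (Om (q t) (v + w)) (Q t) - prod (Om (p t) v) (P t)"])
          show "norm (prod (Om (q s) (v + w)) (Q s) - prod (Om (p s) v) (P s)) \<le> 1 * norm (Q s - P s) + C1 * norm w"
            if s: "s \<in> {0..1}" for s
          proof -
            have "prod (Om (q s) (v + w)) (Q s) - prod (Om (p s) v) (P s) =
               prod (Om (q s) (v + w)) (Q s - P s) + prod ((Om (q s) v - Om (p s) v) + Om (q s) w) (P s)"
              by (simp add: Om_add add_left diff_left diff_right)
            also have "norm \<dots> \<le> 1 * norm (Q s - P s) + ((L * norm w * r + 2 * N * norm w) * NP * Cp)"
            proof (intro vwr vr order_trans[OF norm_triangle_ineq] add_mono prodK qS s vwr pb NP(2)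
                order_trans[OF norm_triangle_ineq] Om_bnd)
              show "norm (Om (q s) v - Om (p s) v) \<le> L * norm w * r"
                using Ld[OF s, of v] mult_left_mono[OF vr, of "L * norm w"] L by (meson mult_nonneg_nonneg norm_ge_zero less_imp_le order_trans)
            qed
            also have "\<dots> = 1 * norm (Q s - P s) + C1 * norm w" by (simp add: C1_def algebra_simps)
            finally show ?thesis .
          qed
          show "Q 0 - P 0 = 0" using y0 vr vwr by (simp add: Q_def P_def)
        qed (use Pd Qd t Cpos in \<open>auto intro!: derivative_eq_intros\<close>)
        then show ?thesis by (simp add: C2_def mult_ac)
      qed
      \<comment> \<open>The expected differential of the solution along the ray, in the direction
        \<open>t w\<close> of the neighbouring ray. At \<open>t = 1\<close> it is the derivative
        claimed for \<open>Y\<close>.\<close>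
      define C where "C t = t *\<^sub>R prod (Om (p t) w) (P t)" for t
      define C' where "C' t = prod (Om (p t) w) (P t) + t *\<^sub>R prod (DOm (p t) w v) (P t) + prod (Om (p t) v) (C t)" for t
      have Cd: "(C has_vector_derivative C' t) (at t within {0..1})" if t: "t \<in> {0..1}" for t
      proof -
        have pd: "(p has_derivative (\<lambda>h. h *\<^sub>R v)) (at t within {0..1})"
          unfolding p_def by (auto intro!: derivative_eq_intros)
        have Ad: "((\<lambda>t. A (p t)) has_vector_derivative A' (p t) v) (at t within {0..1})"
          using has_derivative_compose[OF pd A'[OF pS[OF t]]] linear_cmul[OF A'lin[OF pS[OF t]]]
          by (simp add: has_vector_derivative_def)
        have Bd: "((\<lambda>t. B (p t)) has_vector_derivative B' (p t) v) (at t within {0..1})"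
          using has_derivative_compose[OF pd B'[OF pS[OF t]]] linear_cmul[OF B'lin[OF pS[OF t]]]
          by (simp add: has_vector_derivative_def)
        have Od: "((\<lambda>t. Om (p t) w) has_vector_derivative DOm (p t) v w) (at t within {0..1})"
          unfolding Om_def DOm_def
          by (intro has_vector_derivative_add bounded_linear.has_vector_derivative[OF bounded_linear_scaleR_right] Ad Bd)
        have "((\<lambda>t. prod (Om (p t) w) (P t)) has_vector_derivative
            (prod (Om (p t) w) (prod (Om (p t) v) (P t)) + prod (DOm (p t) v w) (P t))) (at t within {0..1})"
          by (rule has_vector_derivative[OF Od Pd[OF t]])
        then have "(C has_vector_derivative (t *\<^sub>R (prod (Om (p t) w) (prod (Om (p t) v) (P t)) + prod (DOm (p t) v w) (P t))
            + 1 *\<^sub>R prod (Om (p t) w) (P t))) (at t within {0..1})"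
          unfolding C_def
          by (intro has_vector_derivative_scaleR) (auto intro!: derivative_eq_intros)
        \<comment> \<open>Flatness is used here: the derivative of the form along the ray is
          exchanged for its derivative across the ray, and the latter is what comparison with the
          neighbouring ray produces.\<close>
        moreover have "t *\<^sub>R (prod (Om (p t) w) (prod (Om (p t) v) (P t)) + prod (DOm (p t) v w) (P t))
            + 1 *\<^sub>R prod (Om (p t) w) (P t) = C' t"
          using flat2[OF pS[OF t], of v w "P t"] unfolding C'_def C_def
          by (simp add: scaleR_right add.commute scaleR_add_right[symmetric])
        ultimately show ?thesis by simp
      qed
      have "norm (Q 1 - P 1 - C 1) \<le> (norm w * (C3 * norm w + C4 * e)) * exp (2 * 1 + 1)"
      proof (rule gronwall[where f'="\<lambda>t. prod (Om (q t) (v + w)) (Q t) - prod (Om (p t) v) (P t) - C' t"])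
        show "norm (prod (Om (q s) (v + w)) (Q s) - prod (Om (p s) v) (P s) - C' s)
            \<le> 1 * norm (Q s - P s - C s) + norm w * (C3 * norm w + C4 * e)" if s: "s \<in> {0..1}" for s
        proof -
          \<comment> \<open>The first term is the Gronwall term. The next three are products of two
            increments, hence quadratic in \<open>norm w\<close>; the last is the linearization
            error, of size \<open>e\<close> times \<open>norm w\<close>.\<close>
          have split: "prod (Om (q s) (v + w)) (Q s) - prod (Om (p s) v) (P s) - C' s =
             prod (Om (p s) v) (Q s - P s - C s)
             + (prod (Om (q s) (v + w) - Om (p s) (v + w)) (Q s - P s) + prod (Om (p s) w) (Q s - P s)
             + prod (Om (q s) w - Om (p s) w) (P s)
             + prod (Om (q s) v - Om (p s) v - DOm (p s) (q s - p s) v) (P s))"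
            unfolding C'_def qp DOm_scale[OF pS[OF s]]
            by (simp add: Om_add add_left add_right diff_left diff_right scaleR_left algebra_simps)
          have bound: "norm (prod (Om (p s) v) (Q s - P s - C s)
             + (prod (Om (q s) (v + w) - Om (p s) (v + w)) (Q s - P s) + prod (Om (p s) w) (Q s - P s)
             + prod (Om (q s) w - Om (p s) w) (P s)
             + prod (Om (q s) v - Om (p s) v - DOm (p s) (q s - p s) v) (P s))) \<le> 1 * norm (Q s - P s - C s) + ((L * norm w * r) * (C2 * norm w) * Cp
              + (2 * N * norm w) * (C2 * norm w) * Cp + (L * norm w * norm w) * NP * Cp
              + (2 * e * norm w * r) * NP * Cp)"
          proof (intro vwr vr order_trans[OF norm_triangle_ineq] add_mono prodK pS s vr pb E NP(2) Om_bnd Ld)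
            show "norm (Om (q s) (v + w) - Om (p s) (v + w)) \<le> L * norm w * r"
              using Ld[OF s, of "v + w"] mult_left_mono[OF vwr, of "L * norm w"] L by (meson mult_nonneg_nonneg norm_ge_zero less_imp_le order_trans)
            have "norm (Om (q s) v - Om (p s) v - DOm (p s) (q s - p s) v) \<le> 2 * e * norm (q s - p s) * norm v"
              using d[OF pS[OF s] qS[OF s]] tw[OF s] dw by auto
            also have "\<dots> \<le> 2 * e * norm w * r" using tw[OF s] vr e by (intro mult_mono) auto
            finally show "norm (Om (q s) v - Om (p s) v - DOm (p s) (q s - p s) v) \<le> 2 * e * norm w * r" .
          qed
          have expand: "(L * x * r) * (C2 * x) * Cp + (2 * N * x) * (C2 * x) * Cp + (L * x * x) * NP * Cp
              + (2 * e * x * r) * NP * Cp = x * (C3 * x + C4 * e)" for x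
            unfolding C3_def C4_def by algebra
          show ?thesis using bound unfolding split expand .
        qed
        show "Q 0 - P 0 - C 0 = 0" using y0 vr vwr by (simp add: Q_def P_def C_def)
      qed (use Pd Qd Cd Cpos e in \<open>auto intro!: derivative_eq_intros\<close>)
      then show ?thesis by (simp add: Y_def P_def Q_def C_def p_def add_diff_eq)
    qed
    show ?thesis unfolding has_derivative_at_alt
    proof (intro conjI allI impI)
      show "bounded_linear (\<lambda>w. prod (Om (z0 + v) w) (Y (z0 + v)))"
        unfolding Om_def by (intro bounded_linear_compose[OF bounded_linear_left] bounded_linear_add
          bounded_linear_compose[OF bounded_linear_scaleR_left] bounded_linear_Re bounded_linear_Im)
      fix e :: real assume e: "e > 0"
      \<comment> \<open>The error is divided in halves: this choice makes the \<open>C4\<close> term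
        at most \<open>e / 2\<close>, and the last entry of \<open>d'\<close> does the same for the
        \<open>C3\<close> term.\<close>
      define e' where "e' = e / (2 * exp 3 * C4)"
      have e': "e' > 0" using e Cpos by (simp add: e'_def)
      obtain d where d: "d > 0" "\<And>p q v. p \<in> S \<Longrightarrow> q \<in> S \<Longrightarrow> norm (q - p) < d \<Longrightarrow>
           norm (Om q v - Om p v - DOm p (q - p) v) \<le> 2 * e' * norm (q - p) * norm v"
        using lin[OF e'] by blast
      define d' where "d' = Min {d, d1, r - norm v, e / (2 * exp 3 * C3)}"
      show "\<exists>d>0. \<forall>z. norm (z - (z0 + v)) < d \<longrightarrow>
         norm (Y z - Y (z0 + v) - prod (Om (z0 + v) (z - (z0 + v))) (Y (z0 + v))) \<le> e * norm (z - (z0 + v))"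
      proof (intro exI[of _ d'] conjI allI impI)
        show "d' > 0" using d d1 v e Cpos by (simp add: d'_def)
        fix z assume "norm (z - (z0 + v)) < d'"
        define w where "w = z - (z0 + v)"
        have w: "norm w < d" "norm w < d1" "norm w < r - norm v" "norm w < e / (2 * exp 3 * C3)"
          using \<open>norm (z - (z0 + v)) < d'\<close> by (auto simp: d'_def w_def)
        have "norm (v + w) < r" using norm_triangle_ineq[of v w] w by linarith
        then have "norm (Y (z0 + v + w) - Y (z0 + v) - prod (Om (z0 + v) w) (Y (z0 + v)))
          \<le> norm w * (C3 * norm w + C4 * e') * exp 3"
          using main[OF w(2) _ e' w(1) d(2)] by blast
        also have "\<dots> = norm w * ((C3 * norm w) * exp 3 + C4 * e' * exp 3)" by (simp add: algebra_simps)
        also have "\<dots> \<le> norm w * (e / 2 + e / 2)"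
        proof (intro mult_left_mono add_mono)
          show "C3 * norm w * exp 3 \<le> e / 2" using w(4) Cpos by (simp add: field_simps)
          show "C4 * e' * exp 3 \<le> e / 2" using Cpos by (simp add: e'_def)
        qed auto
        finally show "norm (Y z - Y (z0 + v) - prod (Om (z0 + v) (z - (z0 + v))) (Y (z0 + v))) \<le> e * norm (z - (z0 + v))"
          by (simp add: w_def mult.commute)
      qed
    qed
  qed
  note Y' = this
  have "(Y has_derivative (\<lambda>v. prod (Re v *\<^sub>R A z + Im v *\<^sub>R B z) (Y z))) (at z)" if "z \<in> ball z0 r" for z
    using Y'[of "z - z0"] that by (simp add: Om_def dist_norm norm_minus_commute)
  moreover have "Y z0 = y0"
  proof -
    have "y 0 1 - y0 = 0"
    proof (rule gronwall_zero[where f="\<lambda>t. y 0 t - y0" and f'="\<lambda>t. 0" and K=0 and t=1])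
      fix t :: real assume "t \<in> {0..1}"
      then show "((\<lambda>t. y 0 t - y0) has_vector_derivative 0) (at t within {0..1})"
        using y[of 0 t] r by (auto simp: Om_def zero_left intro!: derivative_eq_intros)
    qed (use y0[of 0] r in auto)
    then show ?thesis by (simp add: Y_def)
  qed
  ultimately show ?thesis by blast
qed


text \<open>The operator bound \<open>K\<close> is taken over a fixed disc about \<open>z0\<close>
  and does not involve initial data, so one radius serves every starting point \<open>z1\<close> and
  every value: the disc of radius \<open>2 * \<rho>\<close> about \<open>z1\<close> contains the one
  of radius \<open>\<rho>\<close> about \<open>z0\<close>.\<close>

lemma flat_system_local:
  fixes prod :: "'m::real_normed_vector \<Rightarrow> 'v::euclidean_space \<Rightarrow> 'v"
  assumes bl: "bounded_bilinear prod" and A: "Ck_on 1 A U" and B: "Ck_on 1 B U"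
    and U: "open U" "z0 \<in> U"
    and flat: "\<And>z y. z \<in> U \<Longrightarrow>
      prod (frechet_derivative A (at z) \<i>) y + prod (A z) (prod (B z) y) =
      prod (frechet_derivative B (at z) 1) y + prod (B z) (prod (A z) y)"
  shows "\<exists>\<rho>>0. ball z0 \<rho> \<subseteq> U \<and> (\<forall>z1\<in>ball z0 \<rho>. \<forall>y1. \<exists>Y. Y z1 = y1 \<and>
    (\<forall>z\<in>ball z0 \<rho>. (Y has_derivative (\<lambda>v. prod (Re v *\<^sub>R A z + Im v *\<^sub>R B z) (Y z))) (at z)))"
proof -
  interpret bounded_bilinear prod by fact
  obtain R where R: "R > 0" "cball z0 R \<subseteq> U" using U open_contains_cball by blast
  obtain Cp where Cp: "Cp > 0" "\<And>a b. norm (prod a b) \<le> norm a * norm b * Cp" using pos_bounded by blast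
  have "continuous_on (cball z0 R) A" "continuous_on (cball z0 R) B"
    using Ck_on_SucD[of 0 A U] Ck_on_SucD[of 0 B U] A B R(2) by (auto intro: continuous_on_subset)
  then obtain N where N: "N > 0" "\<And>z. z \<in> cball z0 R \<Longrightarrow> norm (A z, B z) \<le> N"
    using compact_norm_bound[OF compact_cball continuous_on_Pair] by metis
  define K where "K = 2 * N * Cp"
  have K: "K > 0" using N Cp by (simp add: K_def)
  have bnd: "norm (prod (Re v *\<^sub>R A z + Im v *\<^sub>R B z) y) \<le> K * norm v * norm y" if z: "z \<in> cball z0 R" for z v y
  proof -
    have "norm (Re v *\<^sub>R A z + Im v *\<^sub>R B z) \<le> \<bar>Re v\<bar> * norm (A z) + \<bar>Im v\<bar> * norm (B z)"
      by (rule order_trans[OF norm_triangle_ineq]) simp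
    also have "\<dots> \<le> norm v * N + norm v * N"
      using N(2)[OF z] norm_fst_le[of "A z" "B z"] norm_snd_le[of "B z" "A z"] abs_Re_le_cmod[of v] abs_Im_le_cmod[of v]
      by (intro add_mono mult_mono) auto
    finally have "norm (Re v *\<^sub>R A z + Im v *\<^sub>R B z) * norm y * Cp \<le> (2 * N * norm v) * norm y * Cp"
      using Cp(1) by (intro mult_right_mono) auto
    then show ?thesis using Cp(2)[of "Re v *\<^sub>R A z + Im v *\<^sub>R B z" y] by (simp add: K_def mult_ac)
  qed
  \<comment> \<open>The bound \<open>R / 3\<close> keeps the discs of radius
    \<open>2 * \<rho>\<close> about points \<open>z1\<close> inside \<open>cball z0 R\<close>; the
    bound \<open>1 / (4 * K)\<close> gives \<open>K * (2 * \<rho>) \<le> 1 / 2\<close>.\<close>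
  define \<rho> where "\<rho> = min (R / 3) (1 / (4 * K))"
  have \<rho>: "\<rho> > 0" "3 * \<rho> \<le> R" "K * (2 * \<rho>) < 1"
  proof -
    have "K * \<rho> \<le> K * (1 / (4 * K))" using K unfolding \<rho>_def by (intro mult_left_mono) auto
    then show "K * (2 * \<rho>) < 1" using K by simp
  qed (use R K in \<open>auto simp: \<rho>_def\<close>)
  show ?thesis
  proof (intro exI[of _ \<rho>] conjI ballI allI)
    show "ball z0 \<rho> \<subseteq> U" using R(2) \<rho> by (intro order_trans[OF _ R(2)] ball_subset_cball order_trans[OF ball_subset_cball subset_cball]) auto
    fix z1 y1 assume z1: "z1 \<in> ball z0 \<rho>"
    have sub: "cball z1 (2 * \<rho>) \<subseteq> cball z0 R"
    proof
      fix x assume "x \<in> cball z1 (2 * \<rho>)"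
      then show "x \<in> cball z0 R" using z1 \<rho> dist_triangle[of z0 x z1] by auto
    qed
    have sub2: "ball z0 \<rho> \<subseteq> ball z1 (2 * \<rho>)"
    proof
      fix x assume "x \<in> ball z0 \<rho>"
      then show "x \<in> ball z1 (2 * \<rho>)" using z1 \<rho> dist_triangle[of z1 x z0] by (auto simp: dist_commute)
    qed
    have "\<exists>Y. Y z1 = y1 \<and> (\<forall>z\<in>ball z1 (2 * \<rho>). (Y has_derivative (\<lambda>v. prod (Re v *\<^sub>R A z + Im v *\<^sub>R B z) (Y z))) (at z))"
      by (rule flat_system_ball[OF bl A B _ _ flat bnd]) (use sub R \<rho> K in auto)
    then show "\<exists>Y. Y z1 = y1 \<and>
      (\<forall>z\<in>ball z0 \<rho>. (Y has_derivative (\<lambda>v. prod (Re v *\<^sub>R A z + Im v *\<^sub>R B z) (Y z))) (at z))"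
      using sub2 by blast
  qed (use \<rho> in auto)
qed

text \<open>A closed form is a nilpotent linear system, and rescaling it makes it small enough for
  the previous lemma on the whole disc.\<close>

lemma closed_form_primitive:
  fixes a b :: "complex \<Rightarrow> real"
  assumes a: "Ck_on 1 a U" and b: "Ck_on 1 b U" and U: "open U" and r: "r > 0" "cball z0 r \<subseteq> U"
    and closed: "\<And>z. z \<in> U \<Longrightarrow> frechet_derivative a (at z) \<i> = frechet_derivative b (at z) 1"
  shows "\<exists>F. F z0 = y0 \<and> (\<forall>z\<in>ball z0 r. (F has_derivative (\<lambda>v. Re v * a z + Im v * b z)) (at z))"
proof -
  \<comment> \<open>The second component is constant and serves as a factor 1, while the first
    integrates the form. Products of two coefficients vanish, so flatness reduces to
    closedness.\<close>
  define prod :: "real \<Rightarrow> real \<times> real \<Rightarrow> real \<times> real" where "prod m y = (m * snd y, 0)" for m y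
  have bl: "bounded_bilinear prod"
  proof
    have "norm (prod m y) \<le> norm m * norm y * 1" for m y
      using norm_snd_le[of "snd y" "fst y"] by (auto simp: prod_def abs_mult intro!: mult_left_mono)
    then show "\<exists>K. \<forall>m y. norm (prod m y) \<le> norm m * norm y * K" by blast
  qed (auto simp: prod_def algebra_simps)
  have "continuous_on (cball z0 r) a" "continuous_on (cball z0 r) b"
    using Ck_on_SucD[of 0 a U] Ck_on_SucD[of 0 b U] a b r(2) by (auto intro: continuous_on_subset)
  then obtain N where N: "N > 0" "\<And>z. z \<in> cball z0 r \<Longrightarrow> norm (a z, b z) \<le> N"
    using compact_norm_bound[OF compact_cball continuous_on_Pair] by metis
  \<comment> \<open>The rescaled operator bound is \<open>2 * N * d\<close>, and its product with
    \<open>r\<close> is one half. Dividing the solution by \<open>d\<close> undoes the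
    rescaling.\<close>
  define d where "d = 1 / (4 * N * r)"
  have d: "d > 0" using N r by (simp add: d_def)
  have fr: "frechet_derivative (\<lambda>z. d * f z) (at z) v = d * frechet_derivative f (at z) v"
    if "Ck_on 1 f U" "z \<in> U" for f :: "complex \<Rightarrow> real" and z v
  proof -
    have "(f has_derivative frechet_derivative f (at z)) (at z)"
      using Ck_on_has_derivative[of 0 f U z] that by simp
    from fun_cong[OF frechet_derivative_at[OF has_derivative_mult_right[OF this]], of d v]
    show ?thesis by simp
  qed
  have "\<exists>Y. Y z0 = (0, 1) \<and> (\<forall>z\<in>ball z0 r. (Y has_derivative (\<lambda>v. prod (Re v *\<^sub>R (d * a z) + Im v *\<^sub>R (d * b z)) (Y z))) (at z))"
  proof (rule flat_system_ball[OF bl _ _ r, where K="2 * N * d"])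
    show "Ck_on 1 (\<lambda>z. d * a z) U" "Ck_on 1 (\<lambda>z. d * b z) U"
      using a b U by (auto simp del: Ck_on.simps One_nat_def intro!: Ck_on_mult Ck_on_const)
    show "prod (frechet_derivative (\<lambda>z. d * a z) (at z) \<i>) y + prod (d * a z) (prod (d * b z) y) =
         prod (frechet_derivative (\<lambda>z. d * b z) (at z) 1) y + prod (d * b z) (prod (d * a z) y)" if "z \<in> U" for z y
      using fr[OF a that] fr[OF b that] closed[OF that] by (simp add: prod_def)
    show "norm (prod (Re v *\<^sub>R (d * a z) + Im v *\<^sub>R (d * b z)) y) \<le> 2 * N * d * norm v * norm y" if "z \<in> cball z0 r" for z v y
    proof -
      have "\<bar>Re v * a z + Im v * b z\<bar> \<le> \<bar>Re v\<bar> * \<bar>a z\<bar> + \<bar>Im v\<bar> * \<bar>b z\<bar>"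
        by (metis abs_triangle_ineq abs_mult)
      also have "\<dots> \<le> norm v * N + norm v * N"
        using N(2)[OF that] norm_fst_le[of "a z" "b z"] norm_snd_le[of "b z" "a z"] abs_Re_le_cmod[of v] abs_Im_le_cmod[of v]
        by (intro add_mono mult_mono) auto
      finally have "d * \<bar>Re v * a z + Im v * b z\<bar> \<le> d * (2 * N * norm v)" using d by (intro mult_left_mono) auto
      moreover have "Re v *\<^sub>R (d * a z) + Im v *\<^sub>R (d * b z) = d * (Re v * a z + Im v * b z)"
        by (simp add: algebra_simps)
      ultimately have "\<bar>Re v *\<^sub>R (d * a z) + Im v *\<^sub>R (d * b z)\<bar> \<le> 2 * N * d * norm v"
        using d by (simp add: abs_mult mult_ac)
      then have "\<bar>Re v *\<^sub>R (d * a z) + Im v *\<^sub>R (d * b z)\<bar> * \<bar>snd y\<bar> \<le> 2 * N * d * norm v * norm y"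
        using N d norm_snd_le[of "snd y" "fst y"] by (intro mult_mono) auto
      then show ?thesis by (simp add: prod_def abs_mult)
    qed
    show "2 * N * d * r < 1" using N r by (simp add: d_def)
  qed (use N d in auto)
  then obtain Y where Y: "Y z0 = (0, 1)" "\<And>z. z \<in> ball z0 r \<Longrightarrow>
    (Y has_derivative (\<lambda>v. prod (Re v *\<^sub>R (d * a z) + Im v *\<^sub>R (d * b z)) (Y z))) (at z)"
    by blast
  have "((\<lambda>z. snd (Y z)) has_derivative (\<lambda>v. 0)) (at z)" if "z \<in> ball z0 r" for z
    using has_derivative_snd[OF Y(2)[OF that]] by (simp add: prod_def)
  then have "((\<lambda>z. snd (Y z)) has_derivative (\<lambda>v. 0)) (at z within ball z0 r)" if "z \<in> ball z0 r" for z
    using has_derivative_at_withinI that by blast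
  from has_derivative_zero_constant[OF convex_ball this]
  have "\<exists>k. \<forall>z\<in>ball z0 r. snd (Y z) = k" .
  then obtain k where k: "\<And>z. z \<in> ball z0 r \<Longrightarrow> snd (Y z) = k" by blast
  have k1: "k = 1" using k[of z0] Y(1) r by auto
  show ?thesis
  proof (intro exI[of _ "\<lambda>z. y0 + fst (Y z) / d"] conjI ballI)
    show "y0 + fst (Y z0) / d = y0" using Y by simp
    fix z assume z: "z \<in> ball z0 r"
    have "((\<lambda>z. y0 + fst (Y z) / d) has_derivative (\<lambda>v. 0 + (Re v *\<^sub>R (d * a z) + Im v *\<^sub>R (d * b z)) / d)) (at z)"
      using has_derivative_fst[OF Y(2)[OF z]] k[OF z] k1
      by (intro has_derivative_add has_derivative_const has_derivative_divide_num) (simp add: prod_def)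
    moreover have "(\<lambda>v. 0 + (Re v *\<^sub>R (d * a z) + Im v *\<^sub>R (d * b z)) / d) = (\<lambda>v. Re v * a z + Im v * b z)"
      using d by (auto simp: fun_eq_iff field_simps)
    ultimately show "((\<lambda>z. y0 + fst (Y z) / d) has_derivative (\<lambda>v. Re v * a z + Im v * b z)) (at z)" by simp
  qed
qed

section \<open>Monodromy\<close>

text \<open>The members of \<open>L\<close> act as sheets of a covering of \<open>S\<close> with
  fibre \<open>E\<close>: over one neighbourhood there is a sheet through every point and every
  value, and sheets with a common value agree nearby. Analytic continuation is carried out directly
  with the sheets, without constructing a covering space.\<close>

locale flat_sections =
  fixes S :: "'a::topological_space set" and L :: "('a set \<times> ('a \<Rightarrow> 'b::t2_space)) set" and E :: "'b set"
  assumes L_open: "(U, f) \<in> L \<Longrightarrow> openin (top_of_set S) U"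
    and L_cont: "(U, f) \<in> L \<Longrightarrow> continuous_on U f"
    and L_range: "(U, f) \<in> L \<Longrightarrow> r \<in> U \<Longrightarrow> f r \<in> E"
    and L_ex: "q \<in> S \<Longrightarrow> \<exists>U. q \<in> U \<and> openin (top_of_set S) U \<and> path_connected U \<and>
      (\<forall>r\<in>U. \<forall>y\<in>E. \<exists>f. (U, f) \<in> L \<and> f r = y)"
    and L_unique: "(U, f) \<in> L \<Longrightarrow> (V, h) \<in> L \<Longrightarrow> r \<in> U \<Longrightarrow> r \<in> V \<Longrightarrow> f r = h r \<Longrightarrow>
      \<exists>W. openin (top_of_set S) W \<and> r \<in> W \<and> W \<subseteq> U \<inter> V \<and> (\<forall>x\<in>W. f x = h x)"
begin

text \<open>A lift of \<open>h\<close> to the sheets: near each parameter the values are those of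
  one sheet composed with \<open>h\<close>. The domain is any topological space, so that intervals
  and squares are treated alike.\<close>

definition flat :: "('c::topological_space \<Rightarrow> 'a) \<Rightarrow> 'c set \<Rightarrow> ('c \<Rightarrow> 'b) \<Rightarrow> bool" where
  "flat h T Y \<longleftrightarrow> (\<forall>t\<in>T. \<exists>U f W. (U, f) \<in> L \<and> openin (top_of_set T) W \<and> t \<in> W \<and> h ` W \<subseteq> U \<and>
     (\<forall>s\<in>W. Y s = f (h s)))"

lemma flatE:
  assumes "flat h T Y" "t \<in> T"
  obtains U f W where "(U, f) \<in> L" "openin (top_of_set T) W" "t \<in> W" "h ` W \<subseteq> U" "\<And>s. s \<in> W \<Longrightarrow> Y s = f (h s)"
  using assms unfolding flat_def by meson

lemma flat_range: "flat h T Y \<Longrightarrow> t \<in> T \<Longrightarrow> Y t \<in> E"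
  by (metis flatE L_range image_subset_iff)

lemma flat_compose:
  assumes "flat h T Y" "continuous_on T' k" "k ` T' \<subseteq> T" "\<And>t. t \<in> T' \<Longrightarrow> h' t = h (k t)"
  shows "flat h' T' (\<lambda>t. Y (k t))"
  unfolding flat_def
proof
  fix t assume t: "t \<in> T'"
  then have "k t \<in> T" using assms(3) by auto
  then obtain U f W where *: "(U, f) \<in> L" "openin (top_of_set T) W" "k t \<in> W" "h ` W \<subseteq> U"
    "\<And>s. s \<in> W \<Longrightarrow> Y s = f (h s)" using flatE[OF assms(1)] by metis
  have "openin (top_of_set T') (T' \<inter> k -` W)"
    using continuous_openin_preimage[OF assms(2) _ *(2)] assms(3) by auto
  then show "\<exists>U f W. (U, f) \<in> L \<and> openin (top_of_set T') W \<and> t \<in> W \<and> h' ` W \<subseteq> U \<and> (\<forall>s\<in>W. Y (k s) = f (h' s))"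
    using * t assms(4) by (intro exI[of _ U] exI[of _ f] exI[of _ "T' \<inter> k -` W"]) auto
qed

lemma flat_continuous:
  assumes "flat h T Y" "continuous_on T h"
  shows "continuous_on T Y"
  unfolding continuous_openin_preimage_eq
proof (intro allI impI)
  fix G :: "'b set" assume G: "open G"
  show "openin (top_of_set T) (T \<inter> Y -` G)"
    unfolding openin_subopen[of _ "T \<inter> Y -` G"]
  proof
    fix t assume t: "t \<in> T \<inter> Y -` G"
    then obtain U f W where *: "(U, f) \<in> L" "openin (top_of_set T) W" "t \<in> W" "h ` W \<subseteq> U"
      "\<And>s. s \<in> W \<Longrightarrow> Y s = f (h s)" using flatE[OF assms(1), of t] by (metis IntD1)
    have WT: "W \<subseteq> T" using *(2) openin_imp_subset by blast
    have "continuous_on W (\<lambda>s. f (h s))"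
      by (rule continuous_on_compose2[OF L_cont[OF *(1)] continuous_on_subset[OF assms(2) WT] *(4)])
    then have "openin (top_of_set W) (W \<inter> (\<lambda>s. f (h s)) -` G)"
      using G by (rule continuous_openin_preimage_gen)
    then have "openin (top_of_set T) (W \<inter> (\<lambda>s. f (h s)) -` G)"
      using *(2) openin_trans by blast
    then show "\<exists>V. openin (top_of_set T) V \<and> t \<in> V \<and> V \<subseteq> T \<inter> Y -` G"
      using *(3,5) WT t by (intro exI[of _ "W \<inter> (\<lambda>s. f (h s)) -` G"]) auto
  qed
qed

text \<open>The coincidence set is open because sheets that meet agree nearby, and closed because
  the value space is Hausdorff.\<close>

lemma flat_unique:
  assumes Y1: "flat h T Y1" and Y2: "flat h T Y2" and h: "continuous_on T h" "h ` T \<subseteq> S"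
    and T: "connected T" "t0 \<in> T" "Y1 t0 = Y2 t0" and t: "t \<in> T"
  shows "Y1 t = Y2 t"
proof -
  define A where "A = {t \<in> T. Y1 t = Y2 t}"
  have "openin (top_of_set T) A"
    unfolding openin_subopen[of _ A]
  proof
    fix t assume "t \<in> A"
    then have t: "t \<in> T" "Y1 t = Y2 t" by (auto simp: A_def)
    obtain U1 f1 W1 where 1: "(U1, f1) \<in> L" "openin (top_of_set T) W1" "t \<in> W1" "h ` W1 \<subseteq> U1"
      "\<And>s. s \<in> W1 \<Longrightarrow> Y1 s = f1 (h s)" using flatE[OF Y1 t(1)] by metis
    obtain U2 f2 W2 where 2: "(U2, f2) \<in> L" "openin (top_of_set T) W2" "t \<in> W2" "h ` W2 \<subseteq> U2"
      "\<And>s. s \<in> W2 \<Longrightarrow> Y2 s = f2 (h s)" using flatE[OF Y2 t(1)] by metis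
    obtain W where W: "openin (top_of_set S) W" "h t \<in> W" "\<And>x. x \<in> W \<Longrightarrow> f1 x = f2 x"
      using L_unique[OF 1(1) 2(1), of "h t"] 1(3,4,5) 2(3,4,5) t by (metis image_subset_iff)
    have "openin (top_of_set T) (T \<inter> h -` W)"
      using continuous_openin_preimage[OF h(1) _ W(1)] h(2) by auto
    then have "openin (top_of_set T) (W1 \<inter> W2 \<inter> (T \<inter> h -` W))" using 1(2) 2(2) by auto
    moreover have "W1 \<inter> W2 \<inter> (T \<inter> h -` W) \<subseteq> A" using 1(5) 2(5) W(3) by (auto simp: A_def)
    ultimately show "\<exists>V. openin (top_of_set T) V \<and> t \<in> V \<and> V \<subseteq> A" using 1(3) 2(3) W(2) t by blast
  qed
  moreover have "closedin (top_of_set T) A"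
  proof -
    have "openin (top_of_set T) (T - A)"
      unfolding openin_subopen[of _ "T - A"]
    proof
      fix t assume "t \<in> T - A"
      then have t: "t \<in> T" "Y1 t \<noteq> Y2 t" by (auto simp: A_def)
      obtain G1 G2 where G: "open G1" "open G2" "Y1 t \<in> G1" "Y2 t \<in> G2" "G1 \<inter> G2 = {}"
        using hausdorff[OF t(2)] by blast
      have "openin (top_of_set T) ((T \<inter> Y1 -` G1) \<inter> (T \<inter> Y2 -` G2))"
        using continuous_openin_preimage_gen[OF flat_continuous[OF Y1 h(1)] G(1)]
          continuous_openin_preimage_gen[OF flat_continuous[OF Y2 h(1)] G(2)] by auto
      moreover have "(T \<inter> Y1 -` G1) \<inter> (T \<inter> Y2 -` G2) \<subseteq> T - A" using G(5) by (auto simp: A_def)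
      ultimately show "\<exists>V. openin (top_of_set T) V \<and> t \<in> V \<and> V \<subseteq> T - A" using G t by blast
    qed
    then show ?thesis by (auto simp: closedin_def A_def)
  qed
  ultimately have "A = {} \<or> A = T" using T(1) connected_clopen by blast
  then show ?thesis using T t by (auto simp: A_def)
qed

text \<open>The value may be prescribed at an arbitrary parameter. This freedom is what lets lifts
  be continued across a common part of two domains in either direction.\<close>

definition liftable :: "('c::topological_space \<Rightarrow> 'a) \<Rightarrow> 'c set \<Rightarrow> bool" where
  "liftable h T \<longleftrightarrow> (\<forall>t\<in>T. \<forall>y\<in>E. \<exists>Y. flat h T Y \<and> Y t = y)"

text \<open>Connectedness of the overlap spreads the agreement at \<open>e\<close> over all of it. A
  point of only one closed piece has a neighbourhood missing the other piece; at a common point the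
  two sheets involved coincide near the image point.\<close>

lemma glue_flat:
  assumes Y1: "flat h T1 Y1" and Y2: "flat h T2 Y2"
    and cl: "closed T1" "closed T2" and con: "connected (T1 \<inter> T2)"
    and e: "e \<in> T1 \<inter> T2" "Y1 e = Y2 e"
    and h: "continuous_on (T1 \<union> T2) h" "h ` (T1 \<union> T2) \<subseteq> S"
  shows "flat h (T1 \<union> T2) (\<lambda>t. if t \<in> T1 then Y1 t else Y2 t)"
proof -
  have agree: "Y1 t = Y2 t" if "t \<in> T1 \<inter> T2" for t
  proof (rule flat_unique[where T="T1 \<inter> T2" and h=h and ?t0.0=e])
    show "flat h (T1 \<inter> T2) Y1" "flat h (T1 \<inter> T2) Y2"
      using flat_compose[OF Y1, of "T1 \<inter> T2" "\<lambda>t. t"] flat_compose[OF Y2, of "T1 \<inter> T2" "\<lambda>t. t"] by auto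
    show "continuous_on (T1 \<inter> T2) h" using h(1) by (rule continuous_on_subset) auto
  qed (use h(2) con e that in auto)
  let ?T = "T1 \<union> T2" let ?Y = "\<lambda>t. if t \<in> T1 then Y1 t else Y2 t"
  have Y: "?Y t = Y1 t" if "t \<in> T1" for t using that by simp
  have Y': "?Y t = Y2 t" if "t \<in> T2" for t using that agree by auto
  show ?thesis unfolding flat_def
  proof
    fix t assume t: "t \<in> ?T"
    have oneside: "\<exists>U f W. (U, f) \<in> L \<and> openin (top_of_set (A \<union> B)) W \<and> t \<in> W \<and> h ` W \<subseteq> U \<and> (\<forall>s\<in>W. ?Y s = f (h s))"
      if AB: "flat h A Z" "closed B" "\<And>s. s \<in> A \<Longrightarrow> ?Y s = Z s" "t \<in> A" "t \<notin> B" for A B Z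
    proof -
      obtain U f W where *: "(U, f) \<in> L" "openin (top_of_set A) W" "t \<in> W" "h ` W \<subseteq> U"
        "\<And>s. s \<in> W \<Longrightarrow> Z s = f (h s)" using flatE[OF AB(1,4)] by metis
      obtain O1 where O: "open O1" "W = A \<inter> O1" using *(2) openin_open by metis
      have "openin (top_of_set (A \<union> B)) ((A \<union> B) \<inter> (O1 - B))" using O(1) AB(2) by (simp add: openin_open_Int open_Diff)
      moreover have "(A \<union> B) \<inter> (O1 - B) \<subseteq> W" using O by auto
      moreover have "t \<in> (A \<union> B) \<inter> (O1 - B)" using O AB *(3) by auto
      moreover have "?Y s = f (h s)" if "s \<in> W" for s using *(5)[OF that] that AB(3)[of s] O(2) by simp
      ultimately show ?thesis using *(1,4) by (intro exI[of _ U] exI[of _ f] exI[of _ "(A \<union> B) \<inter> (O1 - B)"]) blast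
    qed
    consider "t \<in> T1" "t \<notin> T2" | "t \<in> T2" "t \<notin> T1" | "t \<in> T1" "t \<in> T2" using t by blast
    then show "\<exists>U f W. (U, f) \<in> L \<and> openin (top_of_set ?T) W \<and> t \<in> W \<and> h ` W \<subseteq> U \<and> (\<forall>s\<in>W. ?Y s = f (h s))"
    proof cases
      case 1 then show ?thesis using oneside[OF Y1 cl(2) Y] by blast
    next
      case 2 then show ?thesis using oneside[OF Y2 cl(1) Y'] by (simp add: Un_commute)
    next
      case 3
      obtain U1 f1 W1 where 1: "(U1, f1) \<in> L" "openin (top_of_set T1) W1" "t \<in> W1" "h ` W1 \<subseteq> U1"
        "\<And>s. s \<in> W1 \<Longrightarrow> Y1 s = f1 (h s)" using flatE[OF Y1 3(1)] by metis
      obtain U2 f2 W2 where 2: "(U2, f2) \<in> L" "openin (top_of_set T2) W2" "t \<in> W2" "h ` W2 \<subseteq> U2"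
        "\<And>s. s \<in> W2 \<Longrightarrow> Y2 s = f2 (h s)" using flatE[OF Y2 3(2)] by metis
      have "f1 (h t) = f2 (h t)" using agree[of t] 3 1(3,5) 2(3,5) by auto
      then obtain W where W: "openin (top_of_set S) W" "h t \<in> W" "W \<subseteq> U1 \<inter> U2" "\<And>x. x \<in> W \<Longrightarrow> f1 x = f2 x"
        using L_unique[OF 1(1) 2(1), of "h t"] 1(3,4) 2(3,4) by (metis image_subset_iff)
      have "openin (top_of_set ?T) (?T \<inter> h -` W)"
        using continuous_openin_preimage[OF h(1) _ W(1)] h(2) by auto
      then obtain O3 where O3: "open O3" "?T \<inter> h -` W = ?T \<inter> O3" using openin_open by metis
      obtain O1 where O1: "open O1" "W1 = T1 \<inter> O1" using 1(2) openin_open by metis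
      obtain O2 where O2: "open O2" "W2 = T2 \<inter> O2" using 2(2) openin_open by metis
      let ?W = "?T \<inter> (O1 \<inter> O2 \<inter> O3)"
      have hW: "h s \<in> W" if "s \<in> ?W" for s using O3(2) that by blast
      have "?Y s = f1 (h s)" if s: "s \<in> ?W" for s
      proof (cases "s \<in> T1")
        case True then show ?thesis using 1(5) O1 s by auto
      next
        case False then show ?thesis using 2(5)[of s] O2 s W(4)[OF hW[OF s]] by auto
      qed
      moreover have "openin (top_of_set ?T) ?W" using O1 O2 O3 by (intro openin_open_Int open_Int)
      moreover have "t \<in> ?W" using O1 O2 O3 1(3) 2(3) t W(2) by auto
      moreover have "h ` ?W \<subseteq> U1" using hW W(3) by blast
      ultimately show ?thesis using 1(1) by (intro exI[of _ U1] exI[of _ f1] exI[of _ ?W]) blast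
    qed
  qed
qed

text \<open>Lift over the piece that contains the given parameter, read off the value at a point of
  the overlap, and lift over the other piece from there.\<close>

lemma liftable_Un:
  assumes "liftable h T1" "liftable h T2"
    and cl: "closed T1" "closed T2" and con: "connected (T1 \<inter> T2)" "T1 \<inter> T2 \<noteq> {}"
    and h: "continuous_on (T1 \<union> T2) h" "h ` (T1 \<union> T2) \<subseteq> S"
  shows "liftable h (T1 \<union> T2)"
proof -
  have *: "\<exists>Y. flat h (A \<union> B) Y \<and> Y t = y"
    if AB: "liftable h A" "liftable h B" "closed A" "closed B" "connected (A \<inter> B)" "A \<inter> B \<noteq> {}"
      "continuous_on (A \<union> B) h" "h ` (A \<union> B) \<subseteq> S" and t: "t \<in> A" "y \<in> E" for A B t y
  proof -
    obtain Y1 where Y1: "flat h A Y1" "Y1 t = y" using AB(1) t unfolding liftable_def by blast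
    obtain e where e: "e \<in> A \<inter> B" using AB(6) by blast
    then obtain Y2 where Y2: "flat h B Y2" "Y2 e = Y1 e"
      using AB(2) flat_range[OF Y1(1), of e] unfolding liftable_def by blast
    show ?thesis
      by (rule exI, rule conjI, rule glue_flat[OF Y1(1) Y2(1) AB(3,4,5) e Y2(2)[symmetric] AB(7,8)])
        (use Y1(2) t(1) in simp)
  qed
  show ?thesis unfolding liftable_def
  proof (intro ballI)
    fix t y assume t: "t \<in> T1 \<union> T2" and y: "y \<in> E"
    show "\<exists>Y. flat h (T1 \<union> T2) Y \<and> Y t = y"
    proof (cases "t \<in> T1")
      case True then show ?thesis using *[OF assms(1,2) cl con h _ y] by blast
    next
      case False then show ?thesis
        using *[of T2 T1 t y] assms t y by (simp add: Un_commute Int_commute)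
    qed
  qed
qed

lemma liftable_local:
  assumes "h ` T \<subseteq> U" "\<And>r y. r \<in> U \<Longrightarrow> y \<in> E \<Longrightarrow> \<exists>f. (U, f) \<in> L \<and> f r = y"
  shows "liftable h T"
  unfolding liftable_def
proof (intro ballI)
  fix t y assume t: "t \<in> T" and "y \<in> E"
  then obtain f where f: "(U, f) \<in> L" "f (h t) = y" using assms by blast
  have "flat h T (\<lambda>t. f (h t))" unfolding flat_def
    using f assms(1) by (intro ballI exI[of _ U] exI[of _ f] exI[of _ T]) auto
  then show "\<exists>Y. flat h T Y \<and> Y t = y" using f by blast
qed

text \<open>Bisection, in the form of the rule \<open>Bolzano\<close>, replaces a Lebesgue number
  argument and is applied once in each variable. Taking \<open>h\<close> on the whole plane lets
  small rectangles be placed around every point.\<close>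

lemma liftable_rectangle:
  fixes h :: "real \<times> real \<Rightarrow> 'a"
  assumes h: "continuous_on UNIV h" "range h \<subseteq> S" and "a \<le> b" "c \<le> d"
  shows "liftable h ({a..b} \<times> {c..d})"
proof -
  have hc: "continuous_on T h" "h ` T \<subseteq> S" for T
    using h by (auto intro: continuous_on_subset)
  have loc: "\<exists>e>0. \<forall>a b c d. a \<le> x \<and> x \<le> b \<and> b - a < e \<and> c \<le> t \<and> t \<le> d \<and> d - c < e \<longrightarrow> liftable h ({a..b} \<times> {c..d})" for x t
  proof -
    have "h (x, t) \<in> S" using h by auto
    then obtain U where U: "h (x, t) \<in> U" "openin (top_of_set S) U"
      "\<And>r y. r \<in> U \<Longrightarrow> y \<in> E \<Longrightarrow> \<exists>f. (U, f) \<in> L \<and> f r = y" using L_ex by meson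
    have "openin (top_of_set UNIV) (UNIV \<inter> h -` U)"
      using continuous_openin_preimage[OF h(1) _ U(2)] h(2) by auto
    then have "open (h -` U)" by simp
    moreover have "(x, t) \<in> h -` U" using U(1) by simp
    ultimately obtain A B where AB: "open A" "open B" "x \<in> A" "t \<in> B" "A \<times> B \<subseteq> h -` U"
      by (metis open_prod_elim mem_Sigma_iff)
    obtain e1 where e1: "e1 > 0" "ball x e1 \<subseteq> A" using AB openE by metis
    obtain e2 where e2: "e2 > 0" "ball t e2 \<subseteq> B" using AB openE by metis
    show ?thesis
    proof (intro exI[of _ "min e1 e2"] conjI allI impI)
      fix a b c d assume *: "a \<le> x \<and> x \<le> b \<and> b - a < min e1 e2 \<and> c \<le> t \<and> t \<le> d \<and> d - c < min e1 e2"
      have "{a..b} \<subseteq> ball x e1" "{c..d} \<subseteq> ball t e2" using * by (auto simp: dist_real_def)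
      then have "h ` ({a..b} \<times> {c..d}) \<subseteq> U" using AB(5) e1 e2 by blast
      then show "liftable h ({a..b} \<times> {c..d})" using U(3) by (rule liftable_local)
    qed (use e1 e2 in auto)
  qed
  \<comment> \<open>Bisection in the second variable with \<open>x\<close> fixed. The width
    \<open>e\<close> of the strip may shrink at each union, so the smaller of the two widths is
    kept.\<close>
  have strip: "c \<le> d \<longrightarrow> (\<exists>e>0. \<forall>a b. a \<le> x \<and> x \<le> b \<and> b - a < e \<longrightarrow> liftable h ({a..b} \<times> {c..d}))" for x
    using \<open>c \<le> d\<close>
  proof (induction rule: Bolzano)
    case (trans c d e)
    then obtain e1 e2 where e: "e1 > 0" "e2 > 0"
      "\<And>a b. a \<le> x \<and> x \<le> b \<and> b - a < e1 \<Longrightarrow> liftable h ({a..b} \<times> {c..d})"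
      "\<And>a b. a \<le> x \<and> x \<le> b \<and> b - a < e2 \<Longrightarrow> liftable h ({a..b} \<times> {d..e})" by meson
    have "liftable h ({a..b} \<times> {c..e})" if "a \<le> x \<and> x \<le> b \<and> b - a < min e1 e2" for a b
    proof -
      have I: "({a..b} \<times> {c..d}) \<inter> ({a..b} \<times> {d..e}) = {a..b} \<times> {d}" using trans by auto
      have "liftable h (({a..b} \<times> {c..d}) \<union> ({a..b} \<times> {d..e}))"
      proof (rule liftable_Un)
        show "connected (({a..b} \<times> {c..d}) \<inter> ({a..b} \<times> {d..e}))"
          unfolding I by (intro connected_Times) auto
        show "({a..b} \<times> {c..d}) \<inter> ({a..b} \<times> {d..e}) \<noteq> {}" unfolding I using that by auto
      qed (use e that in \<open>auto intro!: hc closed_Times\<close>)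
      moreover have "({a..b} \<times> {c..d}) \<union> ({a..b} \<times> {d..e}) = {a..b} \<times> {c..e}" using trans by auto
      ultimately show ?thesis by simp
    qed
    then show ?case using e(1,2) by (intro impI exI[of _ "min e1 e2"]) auto
  next
    case (local t)
    obtain e where e: "e > 0" "\<And>a b c d. a \<le> x \<and> x \<le> b \<and> b - a < e \<and> c \<le> t \<and> t \<le> d \<and> d - c < e \<Longrightarrow>
      liftable h ({a..b} \<times> {c..d})" using loc by meson
    then show ?case by (intro exI[of _ e] conjI allI impI) auto
  qed
  have "a \<le> b \<longrightarrow> liftable h ({a..b} \<times> {c..d})"
    using \<open>a \<le> b\<close>
  proof (induction rule: Bolzano)
    case (trans a x b)
    have I: "({a..x} \<times> {c..d}) \<inter> ({x..b} \<times> {c..d}) = {x} \<times> {c..d}" using trans by auto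
    have "liftable h (({a..x} \<times> {c..d}) \<union> ({x..b} \<times> {c..d}))"
    proof (rule liftable_Un)
      show "connected (({a..x} \<times> {c..d}) \<inter> ({x..b} \<times> {c..d}))" unfolding I by (intro connected_Times) auto
      show "({a..x} \<times> {c..d}) \<inter> ({x..b} \<times> {c..d}) \<noteq> {}" unfolding I using \<open>c \<le> d\<close> by auto
    qed (use trans in \<open>auto intro!: hc closed_Times\<close>)
    moreover have "({a..x} \<times> {c..d}) \<union> ({x..b} \<times> {c..d}) = {a..b} \<times> {c..d}" using trans by auto
    ultimately show ?case by simp
  next
    case (local x)
    obtain e where "e > 0" "\<And>a b. a \<le> x \<and> x \<le> b \<and> b - a < e \<Longrightarrow> liftable h ({a..b} \<times> {c..d})"
      using strip[of x] \<open>c \<le> d\<close> by meson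
    then show ?case by (intro exI[of _ e] conjI allI impI) auto
  qed
  then show ?thesis using \<open>a \<le> b\<close> by blast
qed

text \<open>Clamping both coordinates extends \<open>h\<close> to the plane without leaving its
  image.\<close>

lemma liftable_square:
  fixes h :: "real \<times> real \<Rightarrow> 'a"
  assumes h: "continuous_on ({0..1} \<times> {0..1}) h" "h ` ({0..1} \<times> {0..1}) \<subseteq> S"
  shows "liftable h ({0..1} \<times> {0..1})"
proof -
  define cl :: "real \<Rightarrow> real" where "cl t = max 0 (min 1 t)" for t
  have cl: "cl t \<in> {0..1}" "t \<in> {0..1} \<Longrightarrow> cl t = t" for t by (auto simp: cl_def)
  define h' where "h' p = h (cl (fst p), cl (snd p))" for p
  have "continuous_on UNIV h'" unfolding h'_def
    by (rule continuous_on_compose2[OF h(1)]) (use cl in \<open>auto simp: cl_def intro!: continuous_intros\<close>)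
  moreover have "range h' \<subseteq> S" using h(2) cl by (auto simp: h'_def)
  ultimately have lift: "liftable h' ({0..1} \<times> {0..1})" by (rule liftable_rectangle) auto
  show ?thesis unfolding liftable_def
  proof (intro ballI)
    fix t y assume "t \<in> {0..1::real} \<times> {0..1::real}" "y \<in> E"
    then obtain Y where Y: "flat h' ({0..1} \<times> {0..1}) Y" "Y t = y" using lift unfolding liftable_def by blast
    have "flat h ({0..1} \<times> {0..1}) (\<lambda>t. Y t)"
      by (rule flat_compose[OF Y(1)]) (auto simp: h'_def cl)
    then show "\<exists>Y. flat h ({0..1} \<times> {0..1}) Y \<and> Y t = y" using Y(2) by blast
  qed
qed

text \<open>A path is viewed as a map on the square that is constant in the first
  coordinate.\<close>

lemma path_lift_exists:
  assumes "path p" "path_image p \<subseteq> S" "y \<in> E"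
  obtains Y where "flat p {0..1} Y" "Y 0 = y"
proof -
  have "continuous_on ({0..1::real} \<times> {0..1::real}) (\<lambda>x. p (snd x))"
    by (rule continuous_on_compose2[of "{0..1}" p]) (use assms(1) in \<open>auto simp: path_def intro!: continuous_intros\<close>)
  then have "liftable (\<lambda>x. p (snd x)) ({0..1::real} \<times> {0..1::real})"
    by (rule liftable_square) (use assms(2) in \<open>auto simp: path_image_def\<close>)
  then obtain Y where Y: "flat (\<lambda>x. p (snd x)) ({0..1::real} \<times> {0..1::real}) Y" "Y (0, 0) = y"
    using assms(3) unfolding liftable_def by fastforce
  have "flat p {0..1} (\<lambda>t. Y (0, t))"
    by (rule flat_compose[OF Y(1)]) (auto intro!: continuous_intros)
  then show ?thesis using that Y(2) by blast
qed

lemma path_lift_unique: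
  assumes "flat p {0..1::real} Y1" "flat p {0..1} Y2" "path p" "path_image p \<subseteq> S"
    "t0 \<in> {0..1}" "Y1 t0 = Y2 t0" "t \<in> {0..1}"
  shows "Y1 t = Y2 t"
  by (rule flat_unique[OF assms(1,2) _ _ _ assms(5,6,7)]) (use assms(3,4) in \<open>auto simp: path_def path_image_def\<close>)

text \<open>A null homotopy is lifted over the square. On the edge of the constant loop the lift is
  constant. The two edges traced by the base point carry the same path, and their lifts agree at
  that constant end, hence also at the end belonging to \<open>p\<close>.\<close>

lemma loop_lift_closed:
  assumes "simply_connected S" "path p" "path_image p \<subseteq> S" "p 1 = p 0" "flat p {0..1} Y"
  shows "Y 1 = Y 0"
proof -
  have p0: "p 0 \<in> S" using assms(3) by (auto simp: path_image_def)
  have "homotopic_loops S p (\<lambda>t. p 0)"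
  proof -
    have "path (\<lambda>t. p 0)" "path_image (\<lambda>t. p 0) \<subseteq> S" using p0 by (auto simp: path_def path_image_def)
    then show ?thesis
      using assms(1)[unfolded simply_connected_def, rule_format, of p "\<lambda>t. p 0"] assms(2-4)
      by (simp add: pathfinish_def pathstart_def)
  qed
  then obtain h :: "real \<times> real \<Rightarrow> 'a" where h: "continuous_on ({0..1} \<times> {0..1}) h" "h ` ({0..1} \<times> {0..1}) \<subseteq> S"
    "\<And>x. x \<in> {0..1} \<Longrightarrow> h (0, x) = p x" "\<And>x. x \<in> {0..1} \<Longrightarrow> h (1, x) = p 0"
    "\<And>t. t \<in> {0..1} \<Longrightarrow> h (t, 1) = h (t, 0)"
    unfolding homotopic_loops pathfinish_def pathstart_def o_def image_subset_iff_funcset by blast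
  have Y0: "Y 0 \<in> E" using flat_range[OF assms(5)] by auto
  obtain Z where Z: "flat h ({0..1} \<times> {0..1}) Z" "Z (0, 0) = Y 0"
    using liftable_square[OF h(1,2)] Y0 unfolding liftable_def by fastforce
  have left: "flat p {0..1} (\<lambda>t. Z (0, t))"
    by (rule flat_compose[OF Z(1)]) (use h(3) in \<open>auto intro!: continuous_intros\<close>)
  have 1: "Z (0, 1) = Y 1"
    by (rule path_lift_unique[OF left assms(5,2,3), of 0]) (use Z(2) in auto)
  have right: "flat (\<lambda>t. p 0) {0..1::real} (\<lambda>t. Z (1, t))"
    by (rule flat_compose[OF Z(1)]) (use h(4) in \<open>auto intro!: continuous_intros\<close>)
  have Z1: "Z (1, 0) \<in> E" using flat_range[OF Z(1)] by auto
  \<comment> \<open>A single sheet through the value gives a constant lift of the constant loop,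
    with which the lift of that edge is compared.\<close>
  obtain U f where Uf: "(U, f) \<in> L" "p 0 \<in> U" "f (p 0) = Z (1, 0)"
    using L_ex[OF p0] Z1 by meson
  have const: "flat (\<lambda>t. p 0) {0..1::real} (\<lambda>t. Z (1, 0))"
    unfolding flat_def using Uf by (intro ballI exI[of _ U] exI[of _ f] exI[of _ "{0..1}"]) auto
  have 2: "Z (1, 1) = Z (1, 0)"
    by (rule flat_unique[OF right const, of 0]) (use p0 in \<open>auto intro!: continuous_intros\<close>)
  have bot: "flat (\<lambda>s. h (s, 0)) {0..1} (\<lambda>s. Z (s, 0))"
    by (rule flat_compose[OF Z(1)]) (auto intro!: continuous_intros)
  have top: "flat (\<lambda>s. h (s, 0)) {0..1} (\<lambda>s. Z (s, 1))"
    by (rule flat_compose[OF Z(1)]) (use h(5) in \<open>auto intro!: continuous_intros\<close>)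
  have "Z (0, 0) = Z (0, 1)"
  proof (rule flat_unique[OF bot top, of 1 0])
    show "continuous_on {0..1} (\<lambda>s. h (s, 0))"
      by (rule continuous_on_compose2[OF h(1)]) (auto intro!: continuous_intros)
    show "(\<lambda>s. h (s, 0)) ` {0..1} \<subseteq> S" using h(2) by auto
  qed (use 2 in auto)
  then show ?thesis using 1 Z(2) by simp
qed

text \<open>Apply the closing of lifts to the loop that follows \<open>p\<close> and returns along
  \<open>q\<close>, and read its lift on the two halves, the second one backwards.\<close>

lemma lift_endpoint_unique:
  assumes "simply_connected S"
    and p: "path p" "path_image p \<subseteq> S" and q: "path q" "path_image q \<subseteq> S"
    and ends: "p 0 = q 0" "p 1 = q 1"
    and Y: "flat p {0..1} Y" and Z: "flat q {0..1} Z" and "Y 0 = Z 0"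
  shows "Y 1 = Z 1"
proof -
  define l where "l = p +++ reversepath q"
  have l: "path l" "path_image l \<subseteq> S"
  proof -
    have "pathfinish p = pathstart (reversepath q)" using ends by (simp add: pathfinish_def)
    then show "path l" unfolding l_def using p q by (intro path_join_imp) auto
    show "path_image l \<subseteq> S" unfolding l_def using p q by (intro subset_path_image_join) auto
  qed
  have l01: "l 1 = l 0" using ends by (simp add: l_def joinpaths_def reversepath_def)
  have "Y 0 \<in> E" using flat_range[OF Y] by auto
  then obtain X where X: "flat l {0..1} X" "X 0 = Y 0" using path_lift_exists[OF l(1,2)] by blast
  have X1: "X 1 = X 0" by (rule loop_lift_closed[OF assms(1) l l01 X(1)])
  have "flat p {0..1} (\<lambda>t. X (t / 2))"
    by (rule flat_compose[OF X(1)]) (auto simp: l_def joinpaths_def intro!: continuous_intros)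
  from path_lift_unique[OF this Y p, of 0 1] have 1: "X (1 / 2) = Y 1" using X(2) by auto
  have "flat q {0..1} (\<lambda>t. X (1 - t / 2))"
    by (rule flat_compose[OF X(1)])
      (auto simp: l_def joinpaths_def reversepath_def ends(2) not_le intro!: continuous_intros arg_cong[of _ _ q])
  from path_lift_unique[OF this Z q, of 0 1] have "X (1 / 2) = Z 1" using X(2) X1 assms(10) by auto
  then show ?thesis using 1 by simp
qed

theorem global_section:
  assumes sc: "simply_connected S" and z0: "z0 \<in> S" "y0 \<in> E"
  shows "\<exists>X. X z0 = y0 \<and> (\<forall>q\<in>S. \<exists>U f. (U, f) \<in> L \<and> q \<in> U \<and> (\<forall>r\<in>U. X r = f r))"
proof -
  \<comment> \<open>The endpoint relation of continuation from the base point; \<open>uniq\<close>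
    and \<open>ex\<close> show that it is the graph of a function on \<open>S\<close>.\<close>
  define R where "R r y \<longleftrightarrow> (\<exists>p Y. path p \<and> path_image p \<subseteq> S \<and> p 0 = z0 \<and> p 1 = r \<and> flat p {0..1} Y \<and> Y 0 = y0 \<and> Y 1 = y)" for r y
  have uniq: "y = y'" if "R r y" "R r y'" for r y y'
    using that lift_endpoint_unique[OF sc] unfolding R_def by metis
  have ex: "\<exists>y. R r y" if rS: "r \<in> S" for r
  proof -
    have "path (\<lambda>t. x)" "path_image (\<lambda>t. x) \<subseteq> S" if "x \<in> S" for x using that by (auto simp: path_def path_image_def)
    \<comment> \<open>Simple connectivity is a statement about free homotopies of loops. Applied to
      two constant loops it yields a path joining their base points, namely the trace of the base
      point.\<close>
    then have "homotopic_loops S (\<lambda>t. z0) (\<lambda>t. r)"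
      using sc[unfolded simply_connected_def, rule_format, of "\<lambda>t. z0" "\<lambda>t. r"] z0(1) rS
      by (simp add: pathfinish_def pathstart_def)
    then obtain h :: "real \<times> real \<Rightarrow> 'a" where h: "continuous_on ({0..1::real} \<times> {0..1::real}) h" "h ` ({0..1} \<times> {0..1}) \<subseteq> S"
      "h (0, 0) = z0" "h (1, 0) = r"
      unfolding homotopic_loops by (auto simp: image_subset_iff_funcset)
    define p where "p t = h (t, 0)" for t
    have "continuous_on {0..1} p" unfolding p_def
      by (rule continuous_on_compose2[OF h(1)]) (auto intro!: continuous_intros)
    then have p: "path p" "path_image p \<subseteq> S" "p 0 = z0" "p 1 = r"
      using h by (auto simp: path_def path_image_def p_def)
    obtain Y where "flat p {0..1} Y" "Y 0 = y0" using path_lift_exists[OF p(1,2) z0(2)] by blast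
    then have "R r (Y 1)" unfolding R_def using p by blast
    then show ?thesis by blast
  qed
  define X where "X r = (SOME y. R r y)" for r
  have X: "R r (X r)" if "r \<in> S" for r unfolding X_def by (rule someI_ex[OF ex[OF that]])
  show ?thesis
  proof (intro exI[of _ X] conjI ballI)
    have const: "path (\<lambda>t. z0)" "path_image (\<lambda>t. z0) \<subseteq> S" using z0 by (auto simp: path_def path_image_def)
     obtain Y where Y: "flat (\<lambda>t. z0) {0..1::real} Y" "Y 0 = y0" using path_lift_exists[OF const z0(2)] by blast
    then have "R z0 (Y 1)" unfolding R_def using const by blast
    moreover have "Y 1 = Y 0" by (rule loop_lift_closed[OF sc _ _ _ Y(1)]) (use z0 in \<open>auto simp: path_def path_image_def\<close>)
    ultimately show "X z0 = y0" using uniq X[OF z0(1)] Y(2) by metis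
  next
    fix q assume q: "q \<in> S"
    obtain U where U: "q \<in> U" "openin (top_of_set S) U" "path_connected U"
      "\<And>r y. r \<in> U \<Longrightarrow> y \<in> E \<Longrightarrow> \<exists>f. (U, f) \<in> L \<and> f r = y" using L_ex[OF q] by meson
    have US: "U \<subseteq> S" using U(2) openin_imp_subset by blast
    obtain p Y where p: "path p" "path_image p \<subseteq> S" "p 0 = z0" "p 1 = q" "flat p {0..1} Y" "Y 0 = y0" "Y 1 = X q"
      using X[OF q] unfolding R_def by blast
    have "X q \<in> E" using flat_range[OF p(5), of 1] p(7) by auto
    then obtain f where f: "(U, f) \<in> L" "f q = X q" using U by blast
    \<comment> \<open>The path to \<open>q\<close> is prolonged inside the path connected
      \<open>U\<close>. On the second part the lift must be the sheet \<open>f\<close>, so the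
      continued value at \<open>r\<close> is \<open>f r\<close>.\<close>
    have "X r = f r" if r: "r \<in> U" for r
    proof -
      obtain k where k: "path k" "path_image k \<subseteq> U" "k 0 = q" "k 1 = r"
        using U(1,3) r unfolding path_connected_def pathstart_def pathfinish_def by metis
      have kS: "path_image k \<subseteq> S" using k(2) US by blast
      define l where "l = p +++ k"
      have "pathfinish p = pathstart k" using p k by (simp add: pathfinish_def pathstart_def)
      then have l: "path l" "path_image l \<subseteq> S" "l 0 = z0" "l 1 = r"
        unfolding l_def using p k subset_path_image_join[OF p(2) kS] by (auto intro!: path_join_imp) (auto simp: joinpaths_def)
      obtain Z where Z: "flat l {0..1} Z" "Z 0 = y0" using path_lift_exists[OF l(1,2) z0(2)] by blast
      have "flat p {0..1} (\<lambda>t. Z (t / 2))"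
        by (rule flat_compose[OF Z(1)]) (auto simp: l_def joinpaths_def intro!: continuous_intros)
      from path_lift_unique[OF this p(5,1,2), of 0 1] have 1: "Z (1 / 2) = X q" using Z(2) p(6,7) by auto
      have "flat k {0..1} (\<lambda>t. Z ((1 + t) / 2))"
        by (rule flat_compose[OF Z(1)])
          (use p(4) k(3) in \<open>auto simp: l_def joinpaths_def field_simps not_le intro!: continuous_intros\<close>)
      moreover have "flat k {0..1} (\<lambda>t. f (k t))" unfolding flat_def
        using f(1) k(2) by (intro ballI exI[of _ U] exI[of _ f] exI[of _ "{0..1}"]) (auto simp: path_image_def)
      ultimately have "Z 1 = f (k 1)"
        using path_lift_unique[of k "\<lambda>t. Z ((1 + t) / 2)" "\<lambda>t. f (k t)" 0 1] k(1,3) kS 1 f(2) by auto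
      then have "Z 1 = f r" using k(4) by simp
      then have "R r (f r)" unfolding R_def using l Z by blast
      then show ?thesis using uniq X r US by blast
    qed
    then show "\<exists>U f. (U, f) \<in> L \<and> q \<in> U \<and> (\<forall>r\<in>U. X r = f r)" using f(1) U(1) by blast
  qed
qed

end

section \<open>The geometry of the homogeneous spaces\<close>

lemma norm_zeta_sq: "(norm (zeta p))\<^sup>2 = (p $ 1)\<^sup>2 + (p $ 2)\<^sup>2"
  by (simp add: zeta_def cmod_power2)

text \<open>The polynomial condition treats the flat and the hyperbolic base together: for
  \<open>\<kappa> = 0\<close> it holds trivially because \<open>crit 0 = 0\<close>, and for
  \<open>\<kappa> < 0\<close> it is the disc of radius \<open>1 / crit \<kappa>\<close>.\<close>

lemma E_carrier_iff:
  assumes "\<kappa> \<le> 0"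
  shows "p \<in> E_carrier \<kappa> \<longleftrightarrow> (crit \<kappa>)\<^sup>2 * (norm (zeta p))\<^sup>2 < 1"
proof (cases "\<kappa> = 0")
  case False
  then have c: "crit \<kappa> > 0" using assms by (simp add: crit_def)
  have "norm (zeta p) < 1 / crit \<kappa> \<longleftrightarrow> crit \<kappa> * norm (zeta p) < 1"
    using c by (simp add: field_simps)
  also have "\<dots> \<longleftrightarrow> (crit \<kappa> * norm (zeta p))\<^sup>2 < 1\<^sup>2"
    using c power_strict_mono[of "crit \<kappa> * norm (zeta p)" 1 2] power2_less_imp_less[of "crit \<kappa> * norm (zeta p)" 1] by auto
  finally show ?thesis using False by (simp add: E_carrier_def power_mult_distrib)
qed (simp add: E_carrier_def crit_def)

lemma Lam_relations:
  assumes "\<kappa> \<le> 0" "p \<in> E_carrier \<kappa>"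
  shows "Lam \<kappa> p > 0" "Lam \<kappa> p * (1 - (crit \<kappa>)\<^sup>2 * ((p $ 1)\<^sup>2 + (p $ 2)\<^sup>2)) = 1"
    "1 / Lam \<kappa> p = 1 - (crit \<kappa>)\<^sup>2 * ((p $ 1)\<^sup>2 + (p $ 2)\<^sup>2)"
  using assms(2) unfolding E_carrier_iff[OF assms(1)] Lam_def norm_zeta_sq by (auto simp: field_simps)

text \<open>Pairing with the one-form dual to the vertical field \<open>V3\<close>. It is stated
  over any real field because it is evaluated on real tangent vectors and on complexified
  ones.\<close>

definition E_coform :: "real \<Rightarrow> real \<Rightarrow> real ^ 3 \<Rightarrow> 'f::real_field ^ 3 \<Rightarrow> 'f" where
  "E_coform \<kappa> \<tau> p v = of_real (\<tau> * Lam \<kappa> p) * (of_real (p $ 2) * v $ 1 - of_real (p $ 1) * v $ 2) + v $ 3"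

lemma metric_inner_E:
  "metric_inner (E_metric \<kappa> \<tau> p) v w =
     (of_real (Lam \<kappa> p))\<^sup>2 * (v $ 1 * w $ 1 + v $ 2 * w $ 2) + E_coform \<kappa> \<tau> p v * E_coform \<kappa> \<tau> p w"
  unfolding metric_inner_def E_metric_def E_form_def E_coform_def sum_3
  by (simp add: power2_eq_square algebra_simps)

lemma frame_coords_E:
  assumes "\<kappa> \<le> 0" "p \<in> E_carrier \<kappa>"
  shows "frame_coords \<kappa> \<tau> p v $ 1 = Lam \<kappa> p * v $ 1" "frame_coords \<kappa> \<tau> p v $ 2 = Lam \<kappa> p * v $ 2"
    "frame_coords \<kappa> \<tau> p v $ 3 = E_coform \<kappa> \<tau> p v"
  using Lam_relations(1)[OF assms] unfolding frame_coords_def metric_inner_E E_frame_def E_coform_def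
  by (simp_all add: power2_eq_square)

lemma frame_coords_combination:
  assumes "\<kappa> \<le> 0" "p \<in> E_carrier \<kappa>"
  shows "frame_coords \<kappa> \<tau> p (\<Sum>i\<in>UNIV. n $ i *\<^sub>R (E_frame \<kappa> \<tau> p $ i)) = n"
  unfolding vec_eq_iff forall_3 frame_coords_E[OF assms] E_coform_def sum_3
  using Lam_relations(1)[OF assms] by (simp add: E_frame_def algebra_simps)

lemma frame_coords_cross:
  assumes "\<kappa> \<le> 0" "p \<in> E_carrier \<kappa>"
  shows "frame_coords \<kappa> \<tau> p (E_cross \<kappa> \<tau> p v w) = cross3 (frame_coords \<kappa> \<tau> p v) (frame_coords \<kappa> \<tau> p w)"
  unfolding E_cross_def by (rule frame_coords_combination[OF assms])

lemma frame_coords_scaleR: "frame_coords \<kappa> \<tau> p (k *\<^sub>R v) = k *\<^sub>R frame_coords \<kappa> \<tau> p v"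
  unfolding frame_coords_def metric_inner_E vec_eq_iff by (simp add: E_coform_def algebra_simps)

lemma Lam_has_derivative:
  assumes "\<kappa> \<le> 0" "p \<in> E_carrier \<kappa>"
  shows "(Lam \<kappa> has_derivative (\<lambda>v. 2 * (crit \<kappa>)\<^sup>2 * (Lam \<kappa> p)\<^sup>2 * (p $ 1 * v $ 1 + p $ 2 * v $ 2))) (at p)"
proof -
  have ne: "1 - (crit \<kappa>)\<^sup>2 * ((p $ 1)\<^sup>2 + (p $ 2)\<^sup>2) \<noteq> 0" using Lam_relations(2)[OF assms] by auto
  have "((\<lambda>y. 1 / (1 - (crit \<kappa>)\<^sup>2 * ((y $ 1)\<^sup>2 + (y $ 2)\<^sup>2))) has_derivative
      (\<lambda>v. 2 * (crit \<kappa>)\<^sup>2 * (1 / (1 - (crit \<kappa>)\<^sup>2 * ((p $ 1)\<^sup>2 + (p $ 2)\<^sup>2)))\<^sup>2 * (p $ 1 * v $ 1 + p $ 2 * v $ 2))) (at p)"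
    using ne by (auto intro!: derivative_eq_intros bounded_linear_imp_has_derivative bounded_linear_vec_nth
        simp: fun_eq_iff field_simps power2_eq_square)
  then show ?thesis unfolding Lam_def[abs_def] norm_zeta_sq .
qed

lemma partial_E_metric:
  fixes \<kappa> \<tau> :: real and p :: "real ^ 3" and dL :: "real ^ 3 \<Rightarrow> real" and dF :: "real ^ 3 \<Rightarrow> real ^ 3"
  assumes "\<kappa> \<le> 0" "p \<in> E_carrier \<kappa>"
  defines "\<And>v. dL v \<equiv> 2 * (crit \<kappa>)\<^sup>2 * (Lam \<kappa> p)\<^sup>2 * (p $ 1 * v $ 1 + p $ 2 * v $ 2)"
  defines "\<And>v. dF v \<equiv> vector [\<tau> * (dL v * p $ 2 + Lam \<kappa> p * v $ 2), - \<tau> * (dL v * p $ 1 + Lam \<kappa> p * v $ 1), 0] :: real ^ 3"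
  shows "partial k (\<lambda>y. E_metric \<kappa> \<tau> y $ i $ j) p =
    (if i = j \<and> i \<noteq> 3 then 2 * Lam \<kappa> p * dL (axis k 1) else 0)
    + dF (axis k 1) $ i * E_form \<kappa> \<tau> p $ j + E_form \<kappa> \<tau> p $ i * dF (axis k 1) $ j"
proof -
  note L = Lam_has_derivative[OF assms(1,2), folded dL_def]
  have nth: "((\<lambda>y. y $ i) has_derivative (\<lambda>v. v $ i)) (at p)" for i :: 3 and p :: "real ^ 3"
    by (rule bounded_linear_imp_has_derivative[OF bounded_linear_vec_nth])
  have F: "((\<lambda>y. E_form \<kappa> \<tau> y $ i) has_derivative (\<lambda>v. dF v $ i)) (at p)" for i
  proof -
    have "((\<lambda>y. \<tau> * Lam \<kappa> y * y $ 2) has_derivative (\<lambda>v. \<tau> * (dL v * p $ 2 + Lam \<kappa> p * v $ 2))) (at p)"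
      "((\<lambda>y. - \<tau> * Lam \<kappa> y * y $ 1) has_derivative (\<lambda>v. - \<tau> * (dL v * p $ 1 + Lam \<kappa> p * v $ 1))) (at p)"
      by (rule has_derivative_eq_rhs, (rule derivative_intros L nth)+, simp add: fun_eq_iff algebra_simps)+
    then show ?thesis using exhaust_3[of i] by (auto simp: E_form_def dF_def)
  qed
  have L2: "((\<lambda>y. if b then (Lam \<kappa> y)\<^sup>2 else 0) has_derivative (\<lambda>v. if b then 2 * Lam \<kappa> p * dL v else 0)) (at p)" for b
    using has_derivative_power[OF L, of 2] by (cases b) (auto simp: mult_ac)
  have "((\<lambda>y. E_metric \<kappa> \<tau> y $ i $ j) has_derivative (\<lambda>v. (if i = j \<and> i \<noteq> 3 then 2 * Lam \<kappa> p * dL v else 0)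
    + (E_form \<kappa> \<tau> p $ i * dF v $ j + dF v $ i * E_form \<kappa> \<tau> p $ j))) (at p)"
    unfolding E_metric_def vec_lambda_beta
    by (intro has_derivative_add L2 has_derivative_mult F)
  from fun_cong[OF frechet_derivative_at[OF this], of "axis k 1"]
  show ?thesis unfolding partial_def by simp
qed

text \<open>The inverse metric is the sum of the tensor squares of the vectors of an orthonormal
  frame. \<open>matrix_inv\<close> is a choice, so its identification passes through a two-sided
  inverse.\<close>

lemma matrix_inv_E_metric:
  assumes "\<kappa> \<le> 0" "p \<in> E_carrier \<kappa>"
  shows "matrix_inv (E_metric \<kappa> \<tau> p) = (\<chi> i j. \<Sum>a\<in>UNIV. E_frame \<kappa> \<tau> p $ a $ i * E_frame \<kappa> \<tau> p $ a $ j)"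
proof -
  let ?I = "(\<chi> i j. \<Sum>a\<in>UNIV. E_frame \<kappa> \<tau> p $ a $ i * E_frame \<kappa> \<tau> p $ a $ j)"
  have L: "Lam \<kappa> p \<noteq> 0" using Lam_relations(1)[OF assms] by simp
  have 1: "E_metric \<kappa> \<tau> p ** ?I = mat 1"
    using L unfolding vec_eq_iff forall_3 matrix_matrix_mult_def sum_3 E_metric_def E_form_def E_frame_def mat_def
    by (simp add: field_simps power2_eq_square)
  have 2: "?I ** E_metric \<kappa> \<tau> p = mat 1"
    using L unfolding vec_eq_iff forall_3 matrix_matrix_mult_def sum_3 E_metric_def E_form_def E_frame_def mat_def
    by (simp add: field_simps power2_eq_square)
  have "\<exists>B. E_metric \<kappa> \<tau> p ** B = mat 1 \<and> B ** E_metric \<kappa> \<tau> p = mat 1" using 1 2 by blast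
  then have "matrix_inv (E_metric \<kappa> \<tau> p) ** E_metric \<kappa> \<tau> p = mat 1"
    unfolding matrix_inv_def by (rule someI2_ex) blast
  then have "(matrix_inv (E_metric \<kappa> \<tau> p) ** E_metric \<kappa> \<tau> p) ** ?I = ?I" by simp
  then show ?thesis unfolding matrix_mul_assoc[symmetric] 1 by simp
qed

text \<open>The quadratic part of the Levi-Civita derivative, bilinear in the two velocities.\<close>

definition E_chris :: "real \<Rightarrow> real \<Rightarrow> real ^ 3 \<Rightarrow> 'f::real_field ^ 3 \<Rightarrow> 'f ^ 3 \<Rightarrow> 'f ^ 3" where
  "E_chris \<kappa> \<tau> p a b =
    (let k = of_real (2 * (crit \<kappa>)\<^sup>2 * Lam \<kappa> p); t = of_real \<tau>; L = of_real (Lam \<kappa> p);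
         x = of_real (p $ 1); y = of_real (p $ 2);
         A = E_coform \<kappa> \<tau> p a; B = E_coform \<kappa> \<tau> p b;
         G1 = k * (x * (a $ 1 * b $ 1 - a $ 2 * b $ 2) + y * (a $ 1 * b $ 2 + a $ 2 * b $ 1)) + t * (b $ 2 * A + B * a $ 2);
         G2 = k * (x * (a $ 1 * b $ 2 + a $ 2 * b $ 1) - y * (a $ 1 * b $ 1 - a $ 2 * b $ 2)) - t * (b $ 1 * A + B * a $ 1)
     in vector [G1, G2,
       t * k * L / 2 * ((x * b $ 1 + y * b $ 2) * (y * a $ 1 - x * a $ 2) + (x * a $ 1 + y * a $ 2) * (y * b $ 1 - x * b $ 2))
       - t * L * (y * G1 - x * G2)])"

text \<open>All 27 components are compared on basis vectors. After substitution of the metric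
  derivatives each is a polynomial identity modulo the relations between \<open>L\<close>,
  \<open>1 / L\<close>, \<open>x\<close> and \<open>y\<close>.\<close>

lemma christoffel_E:
  assumes "\<kappa> \<le> 0" "p \<in> E_carrier \<kappa>"
  shows "christoffel (E_metric \<kappa> \<tau>) p k i j = E_chris \<kappa> \<tau> p (axis j 1) (axis i 1) $ k"
proof -
  define L K c x y where LK: "L = Lam \<kappa> p" "K = 1 / Lam \<kappa> p" "c = crit \<kappa>" "x = p $ 1" "y = p $ 2"
  have K: "K = 1 - c^2 * (x^2 + y^2)" and "L * K = 1" using Lam_relations[OF assms] by (simp_all add: LK)
  then have r: "L = 1 + c^2 * L * (x^2 + y^2)" by algebra
  \<comment> \<open>\<open>u\<close> and \<open>v\<close> are the partial derivatives of
    \<open>Lam\<close>. The form has the components \<open>a\<close>, \<open>- b\<close> and 1, and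
    \<open>a1\<close>, \<open>a2\<close>, \<open>b1\<close>, \<open>b2\<close> are the partial
    derivatives of \<open>a\<close> and \<open>b\<close>.\<close>
  define u v where uv: "u = 2 * c\<^sup>2 * L\<^sup>2 * x" "v = 2 * c\<^sup>2 * L\<^sup>2 * y"
  define D where "D k i j = partial k (\<lambda>y. E_metric \<kappa> \<tau> y $ i $ j) p" for k i j
  define a where "a = \<tau> * L * y" define b where "b = \<tau> * L * x"
  define a1 a2 b1 b2 where ab: "a1 = \<tau> * u * y" "a2 = \<tau> * (v * y + L)" "b1 = \<tau> * (u * x + L)" "b2 = \<tau> * v * x"
  have F: "E_form \<kappa> \<tau> p $ 1 = a" "E_form \<kappa> \<tau> p $ 2 = - b" "E_form \<kappa> \<tau> p $ 3 = 1"
    by (simp_all add: E_form_def a_def b_def LK)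
  have D: "D 1 1 1 = 2 * L * u + 2 * a * a1" "D 2 1 1 = 2 * L * v + 2 * a * a2" "D 3 1 1 = 0"
     "D 1 2 2 = 2 * L * u + 2 * b * b1" "D 2 2 2 = 2 * L * v + 2 * b * b2" "D 3 2 2 = 0"
     "D 1 1 2 = - a1 * b - a * b1" "D 2 1 2 = - a2 * b - a * b2" "D 3 1 2 = 0"
     "D 1 2 1 = - a1 * b - a * b1" "D 2 2 1 = - a2 * b - a * b2" "D 3 2 1 = 0"
     "D 1 1 3 = a1" "D 2 1 3 = a2" "D 3 1 3 = 0" "D 1 3 1 = a1" "D 2 3 1 = a2" "D 3 3 1 = 0"
     "D 1 2 3 = - b1" "D 2 2 3 = - b2" "D 3 2 3 = 0" "D 1 3 2 = - b1" "D 2 3 2 = - b2" "D 3 3 2 = 0"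
     "D 1 3 3 = 0" "D 2 3 3 = 0" "D 3 3 3 = 0"
    unfolding D_def partial_E_metric[OF assms] F ab LK[symmetric]
    by (simp_all add: axis_def uv)
  have I: "matrix_inv (E_metric \<kappa> \<tau> p) = (\<chi> i j. \<Sum>a\<in>UNIV. E_frame \<kappa> \<tau> p $ a $ i * E_frame \<kappa> \<tau> p $ a $ j)"
    by (rule matrix_inv_E_metric[OF assms])
  have I': "matrix_inv (E_metric \<kappa> \<tau> p) $ 1 $ 1 = K\<^sup>2" "matrix_inv (E_metric \<kappa> \<tau> p) $ 1 $ 2 = 0"
    "matrix_inv (E_metric \<kappa> \<tau> p) $ 2 $ 1 = 0" "matrix_inv (E_metric \<kappa> \<tau> p) $ 2 $ 2 = K\<^sup>2"
    "matrix_inv (E_metric \<kappa> \<tau> p) $ 1 $ 3 = - K * \<tau> * y" "matrix_inv (E_metric \<kappa> \<tau> p) $ 3 $ 1 = - K * \<tau> * y"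
    "matrix_inv (E_metric \<kappa> \<tau> p) $ 2 $ 3 = K * \<tau> * x" "matrix_inv (E_metric \<kappa> \<tau> p) $ 3 $ 2 = K * \<tau> * x"
    "matrix_inv (E_metric \<kappa> \<tau> p) $ 3 $ 3 = \<tau>\<^sup>2 * (x\<^sup>2 + y\<^sup>2) + 1"
    unfolding I vec_lambda_beta sum_3 E_frame_def LK by (simp_all add: power2_eq_square algebra_simps)
  have KL: "K * L = 1" "L * K = 1" using \<open>L * K = 1\<close> by (simp_all add: mult.commute)
  have chr: "christoffel (E_metric \<kappa> \<tau>) p k i j =
     (\<Sum>l\<in>UNIV. matrix_inv (E_metric \<kappa> \<tau> p) $ k $ l * (D i j l + D j i l - D l i j)) / 2" for k i j
    unfolding christoffel_def D_def ..
  have "\<forall>k i j. christoffel (E_metric \<kappa> \<tau>) p k i j = E_chris \<kappa> \<tau> p (axis j 1) (axis i 1) $ k"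
    unfolding forall_3 chr sum_3 I' D E_chris_def Let_def E_coform_def LK[symmetric]
    by (simp add: axis_def a_def b_def ab uv) (intro conjI; use KL r in \<open>algebra\<close>)
  then show ?thesis by blast
qed

lemma E_chris_sum:
  fixes a b :: "complex ^ 3"
  assumes "\<kappa> \<le> 0" "p \<in> E_carrier \<kappa>"
  shows "(\<Sum>i\<in>UNIV. \<Sum>j\<in>UNIV. complex_of_real (christoffel (E_metric \<kappa> \<tau>) p k i j) * b $ i * a $ j)
    = E_chris \<kappa> \<tau> p a b $ k"
proof -
  have "\<forall>k. (\<Sum>i\<in>UNIV. \<Sum>j\<in>UNIV. complex_of_real (christoffel (E_metric \<kappa> \<tau>) p k i j) * b $ i * a $ j)
    = E_chris \<kappa> \<tau> p a b $ k"
    unfolding christoffel_E[OF assms] forall_3 sum_3 E_chris_def Let_def E_coform_def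
    by (simp add: axis_def) (intro conjI; algebra)
  then show ?thesis by blast
qed

lemma cov_dzbar_dz_E:
  assumes "\<kappa> \<le> 0" "X q \<in> E_carrier \<kappa>"
  shows "cov_dzbar_dz (E_metric \<kappa> \<tau>) \<phi> X q $ k =
    dzbar \<phi> (dz \<phi> (\<lambda>r. complex_of_real (X r $ k))) q
      + E_chris \<kappa> \<tau> (X q) (vec_dz \<phi> X q) (vec_dzbar \<phi> X q) $ k"
  unfolding cov_dzbar_dz_def vec_lambda_beta E_chris_sum[OF assms] ..

text \<open>In the complex coordinate of the base the first term is the connection of the conformal
  metric \<open>\<Lambda>^2 |d\<zeta>|^2\<close>, multiplicative in the two velocities. The term
  with \<open>\<tau>\<close> is the twist caused by the nonintegrable horizontal planes.\<close>

lemma E_chris_horizontal: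
  fixes a b :: "complex ^ 3"
  shows "E_chris \<kappa> \<tau> p a b $ 1 + \<i> * E_chris \<kappa> \<tau> p a b $ 2 =
    2 * of_real ((crit \<kappa>)\<^sup>2 * Lam \<kappa> p) * cnj (zeta p) * (a $ 1 + \<i> * a $ 2) * (b $ 1 + \<i> * b $ 2)
    - \<i> * of_real \<tau> * ((b $ 1 + \<i> * b $ 2) * E_coform \<kappa> \<tau> p a + E_coform \<kappa> \<tau> p b * (a $ 1 + \<i> * a $ 2))"
proof -
  have z: "cnj (zeta p) = of_real (p $ 1) - \<i> * of_real (p $ 2)" by (simp add: zeta_def complex_eq_iff)
  have i: "\<i> * \<i> = -1" by simp
  show ?thesis unfolding E_chris_def Let_def z of_real_mult of_real_power of_real_numeral vector_3 using i by algebra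
qed

text \<open>The one-form cancels the summand with \<open>G1\<close> and \<open>G2\<close> in the
  third component of \<open>E_chris\<close>; only the part containing derivatives of
  \<open>\<Lambda>\<close> survives.\<close>

lemma E_chris_vertical:
  fixes a b :: "complex ^ 3"
  shows "E_coform \<kappa> \<tau> p (E_chris \<kappa> \<tau> p a b) =
    - \<i> * of_real (\<tau> * (crit \<kappa>)\<^sup>2 * (Lam \<kappa> p)\<^sup>2) / 4 *
    ((zeta p * (b $ 1 - \<i> * b $ 2) + cnj (zeta p) * (b $ 1 + \<i> * b $ 2)) * (zeta p * (a $ 1 - \<i> * a $ 2) - cnj (zeta p) * (a $ 1 + \<i> * a $ 2))
     + (zeta p * (a $ 1 - \<i> * a $ 2) + cnj (zeta p) * (a $ 1 + \<i> * a $ 2)) * (zeta p * (b $ 1 - \<i> * b $ 2) - cnj (zeta p) * (b $ 1 + \<i> * b $ 2)))"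
proof -
  let ?x = "complex_of_real (p $ 1)" and ?y = "complex_of_real (p $ 2)"
  have i: "\<i> * \<i> = -1" by simp
  have z: "zeta p = ?x + \<i> * ?y" and zc: "cnj (zeta p) = ?x - \<i> * ?y"
    by (simp_all add: zeta_def complex_eq_iff)
  have s: "zeta p * (v $ 1 - \<i> * v $ 2) + cnj (zeta p) * (v $ 1 + \<i> * v $ 2) = 2 * (?x * v $ 1 + ?y * v $ 2)"
    "zeta p * (v $ 1 - \<i> * v $ 2) - cnj (zeta p) * (v $ 1 + \<i> * v $ 2) = 2 * \<i> * (?y * v $ 1 - ?x * v $ 2)" for v :: "complex ^ 3"
    unfolding zc unfolding z by (simp_all add: algebra_simps)
  have "E_coform \<kappa> \<tau> p (E_chris \<kappa> \<tau> p a b) = of_real (\<tau> * (crit \<kappa>)\<^sup>2 * (Lam \<kappa> p)\<^sup>2) *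
      ((?x * b $ 1 + ?y * b $ 2) * (?y * a $ 1 - ?x * a $ 2) + (?x * a $ 1 + ?y * a $ 2) * (?y * b $ 1 - ?x * b $ 2))"
    by (simp add: E_coform_def E_chris_def Let_def power2_eq_square mult_ac)
  also have "\<dots> = - \<i> * of_real (\<tau> * (crit \<kappa>)\<^sup>2 * (Lam \<kappa> p)\<^sup>2) / 4 *
      (2 * (?x * b $ 1 + ?y * b $ 2) * (2 * \<i> * (?y * a $ 1 - ?x * a $ 2))
       + 2 * (?x * a $ 1 + ?y * a $ 2) * (2 * \<i> * (?y * b $ 1 - ?x * b $ 2)))"
    by (simp add: algebra_simps)
  finally show ?thesis unfolding s .
qed

text \<open>Isotropic vectors \<open>A\<close> are parametrized by \<open>P = A\<^sub>1 + i A\<^sub>2\<close> and the stereographic projection \<open>w\<close>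
  of the normal: \<open>A\<^sub>1 - i A\<^sub>2 = - (w\<^sup>*)\<^sup>2 P\<close> and \<open>A\<^sub>3 = - w\<^sup>* P\<close>.\<close>

lemma cross_isotropic:
  assumes P: "A1 + \<i> * A2 = P" and Q: "A1 - \<i> * A2 = - (cnj w)\<^sup>2 * P" and R: "A3 = - cnj w * P"
  shows "cross3 (vector [2 * Re A1, 2 * Re A2, 2 * Re A3]) (vector [- 2 * Im A1, - 2 * Im A2, - 2 * Im A3])
    = ((norm P)\<^sup>2 * (1 + (norm w)\<^sup>2)) *\<^sub>R vector [2 * Re w, 2 * Im w, 1 - (norm w)\<^sup>2]"
    and "2 * ((norm A1)\<^sup>2 + (norm A2)\<^sup>2 + (norm A3)\<^sup>2) = (norm P)\<^sup>2 * (1 + (norm w)\<^sup>2)\<^sup>2"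
    and "A1\<^sup>2 + A2\<^sup>2 + A3\<^sup>2 = 0"
proof -
  have A: "A1 = (P - (cnj w)\<^sup>2 * P) / 2" "A2 = - \<i> * (P + (cnj w)\<^sup>2 * P) / 2"
    proof -
    have 1: "P - (cnj w)\<^sup>2 * P = (A1 + \<i> * A2) + (A1 - \<i> * A2)" unfolding P Q by simp
    have 2: "P + (cnj w)\<^sup>2 * P = (A1 + \<i> * A2) - (A1 - \<i> * A2)" unfolding P Q by simp
    show "A1 = (P - (cnj w)\<^sup>2 * P) / 2" "A2 = - \<i> * (P + (cnj w)\<^sup>2 * P) / 2"
      unfolding 1 2 by (simp_all add: complex_eq_iff)
  qed
  obtain p q where Pe: "P = Complex p q" by (cases P)
  obtain x y where we: "w = Complex x y" by (cases w)
  have re: "2 * Re A1 = p - ((x * x - y * y) * p + 2 * x * y * q)" "2 * Re A2 = q + ((x * x - y * y) * q - 2 * x * y * p)"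
    "2 * Re A3 = - 2 * (x * p + y * q)"
    and im: "- 2 * Im A1 = - (q - ((x * x - y * y) * q - 2 * x * y * p))" "- 2 * Im A2 = p + (x * x - y * y) * p + 2 * x * y * q"
    "- 2 * Im A3 = 2 * (x * q - y * p)"
    unfolding A R Pe we by (simp_all add: power2_eq_square field_simps)
  have n: "(norm P)\<^sup>2 = p * p + q * q" "(norm w)\<^sup>2 = x * x + y * y" "Re w = x" "Im w = y"
    unfolding Pe we cmod_power2 by (simp_all add: power2_eq_square)
  show "cross3 (vector [2 * Re A1, 2 * Re A2, 2 * Re A3]) (vector [- 2 * Im A1, - 2 * Im A2, - 2 * Im A3])
    = ((norm P)\<^sup>2 * (1 + (norm w)\<^sup>2)) *\<^sub>R vector [2 * Re w, 2 * Im w, 1 - (norm w)\<^sup>2]"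
    unfolding re im n cross3_def vec_eq_iff forall_3 vector_scaleR_component vector_3 real_scaleR_def by (intro conjI; algebra)
  have "4 * ((norm A1)\<^sup>2 + (norm A2)\<^sup>2 + (norm A3)\<^sup>2) = (2 * Re A1)\<^sup>2 + (2 * Re A2)\<^sup>2 + (2 * Re A3)\<^sup>2
     + (- 2 * Im A1)\<^sup>2 + (- 2 * Im A2)\<^sup>2 + (- 2 * Im A3)\<^sup>2"
    unfolding cmod_power2 by (simp add: power2_eq_square algebra_simps)
  also have "\<dots> = 2 * ((norm P)\<^sup>2 * (1 + (norm w)\<^sup>2)\<^sup>2)"
    unfolding re im n by algebra
  finally show "2 * ((norm A1)\<^sup>2 + (norm A2)\<^sup>2 + (norm A3)\<^sup>2) = (norm P)\<^sup>2 * (1 + (norm w)\<^sup>2)\<^sup>2"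
    by simp
  have "A1\<^sup>2 + A2\<^sup>2 = (A1 + \<i> * A2) * (A1 - \<i> * A2)" by (simp add: power2_eq_square algebra_simps)
  then show "A1\<^sup>2 + A2\<^sup>2 + A3\<^sup>2 = 0" unfolding P Q R by (simp add: power2_eq_square algebra_simps)
qed

text \<open>With \<open>Q = A1 - \<i> A2\<close>, isotropy reads \<open>P Q = - A3^2\<close>, and
  the third component of the cross product is \<open>|P|^2 - |Q|^2\<close>. Positivity gives
  \<open>P \<noteq> 0\<close>, and then \<open>|Q| = |w|^2 |P|\<close> turns it into
  \<open>|w| < 1\<close>.\<close>

lemma isotropic_upwards:
  assumes iso: "A1\<^sup>2 + A2\<^sup>2 + A3\<^sup>2 = 0"
    and up: "cross3 (vector [2 * Re A1, 2 * Re A2, 2 * Re A3]) (vector [- 2 * Im A1, - 2 * Im A2, - 2 * Im A3]) $ 3 > 0"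
  defines "P \<equiv> A1 + \<i> * A2" and "w \<equiv> - cnj (A3 / (A1 + \<i> * A2))"
  shows "P \<noteq> 0" "A1 - \<i> * A2 = - (cnj w)\<^sup>2 * P" "A3 = - cnj w * P" "norm w < 1"
proof -
  define Q where "Q = A1 - \<i> * A2"
  have "(norm P)\<^sup>2 - (norm Q)\<^sup>2 > 0"
    using up unfolding P_def Q_def cmod_power2 cross3_def by (simp add: power2_eq_square algebra_simps)
  then have PQ: "norm Q < norm P" by (simp add: power2_less_imp_less)
  then show P: "P \<noteq> 0" by auto
  have w: "cnj w = - A3 / P" by (simp add: w_def P_def)
  then show R: "A3 = - cnj w * P" using P by simp
  have "P * Q = - A3\<^sup>2" 
  proof -
    have "\<i> * \<i> = -1" by simp
    then show ?thesis using iso unfolding P_def Q_def by algebra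
  qed
  then have "Q = - A3\<^sup>2 / P" using P by (simp add: field_simps)
  then show Q: "A1 - \<i> * A2 = - (cnj w)\<^sup>2 * P" using P unfolding w Q_def by (simp add: field_simps power2_eq_square)
  have "norm Q = (norm w)\<^sup>2 * norm P" using Q unfolding Q_def[symmetric] by (simp add: norm_mult norm_power)
  then have "(norm w)\<^sup>2 < 1" using PQ P by (simp add: field_simps)
  then show "norm w < 1" by (simp add: power2_less_1_iff abs_less_iff) 
qed

section \<open>Pointwise identities\<close>

text \<open>In this section conjugates are treated as independent variables, marked by \<open>b\<close>; the letter
  \<open>s\<close> stands for \<open>i \<tau>\<close>, and \<open>K\<close> for \<open>1 / \<Lambda>\<close>.\<close>

lemma eq_of_scale: "k * x = k * y \<Longrightarrow> k \<noteq> 0 \<Longrightarrow> x = (y :: complex)"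
  by simp

lemma eq_iff_of_diff: "l' - r' = l - r \<Longrightarrow> l = r \<longleftrightarrow> l' = (r' :: complex)"
  by auto

text \<open>The first equation is the horizontal part of the mean curvature equation, with
  \<open>m\<close> for the mixed derivative of \<open>\<zeta>\<close>; the second prescribes the
  conjugate derivative of \<open>P\<close>. Their defects differ by the nonzero factor
  \<open>L\<close>.\<close>

lemma horizontal_iff:
  fixes L K P Pb w wb Z Zb c s m :: complex
  assumes LK: "L * K = 1"
  shows "m + 2 * c\<^sup>2 * L * Zb * (K * P) * (- K * w\<^sup>2 * Pb) - s * ((- K * w\<^sup>2 * Pb) * (- wb * P) + (- w * Pb) * (K * P))
      = c * P * Pb * (1 + w * wb) * w * K \<longleftrightarrow>
    c\<^sup>2 * L\<^sup>2 * (Zb * (- K * w\<^sup>2 * Pb) + Z * (K * Pb)) * (K * P) + L * m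
      = P * Pb * (c\<^sup>2 * (Z + Zb * w\<^sup>2) - s * w * (1 - w * wb) + c * w * (1 + w * wb))" (is "?l = ?r \<longleftrightarrow> ?l' = ?r'")
proof -
  have "?l' - ?r' = L * (?l - ?r)" using LK by algebra
  moreover have "L \<noteq> 0" using LK by auto
  ultimately show ?thesis by auto
qed

text \<open>Here the defects of the two equations are equal. The identity \<open>key\<close> says
  that rewriting the quadratic terms as a derivative of the vertical part produces exactly the
  change from \<open>c\<close> to \<open>c + s\<close> on the right.\<close>

lemma vertical_iff:
  fixes L K P Pb w wb Z Zb c s m mb n :: complex
  assumes LK: "L * K = 1" and K: "K = 1 - c\<^sup>2 * Z * Zb"
  defines "p \<equiv> K * P" and "pb \<equiv> K * Pb" and "q \<equiv> - K * w\<^sup>2 * Pb" and "qb \<equiv> - K * wb\<^sup>2 * P"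
  shows "(n - s / 2 * L * (Z * mb - Zb * m))
      - s * c\<^sup>2 * L\<^sup>2 / 4 * ((Z * pb + Zb * q) * (Z * qb - Zb * p) + (Z * qb + Zb * p) * (Z * pb - Zb * q))
      = c / 2 * P * Pb * (1 - w\<^sup>2 * wb\<^sup>2) \<longleftrightarrow>
    n - s / 2 * (c\<^sup>2 * L\<^sup>2 * (Zb * q + Z * pb) * (Z * qb - Zb * p) + L * (q * qb - pb * p + Z * mb - Zb * m))
      = (c + s) / 2 * P * Pb * (1 - w\<^sup>2 * wb\<^sup>2)" (is "?l = ?r \<longleftrightarrow> ?l' = ?r'")
proof -
  define B V M h where BV: "B = c\<^sup>2 * L\<^sup>2 * (Zb * q + Z * pb) * (Z * qb - Zb * p) + L * (q * qb - pb * p + Z * mb - Zb * m)"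
    "V = (Z * pb + Zb * q) * (Z * qb - Zb * p) + (Z * qb + Zb * p) * (Z * pb - Zb * q)"
    "M = Z * mb - Zb * m" "h = 1 - w\<^sup>2 * wb\<^sup>2"
  have key: "2 * s * B + 2 * s * P * Pb * h = 2 * s * L * M + s * c\<^sup>2 * L\<^sup>2 * V"
    unfolding BV p_def q_def pb_def qb_def using LK K by algebra
  have "4 * ((n - s / 2 * B) - (c + s) / 2 * P * Pb * h) = 4 * n - 2 * c * P * Pb * h - (2 * s * B + 2 * s * P * Pb * h)"
    by (simp add: field_simps)
  also have "\<dots> = 4 * ((n - s / 2 * L * M) - s * c\<^sup>2 * L\<^sup>2 / 4 * V - c / 2 * P * Pb * h)"
    unfolding key by (simp add: field_simps)
  finally have "(n - s / 2 * B) - (c + s) / 2 * P * Pb * h = (n - s / 2 * L * M) - s * c\<^sup>2 * L\<^sup>2 / 4 * V - c / 2 * P * Pb * h"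
    by (rule eq_of_scale) simp
  then show ?thesis unfolding BV by (rule eq_iff_of_diff)
qed

text \<open>The right side is the formal conjugate of the left: \<open>s\<close> changes sign and
  barred and unbarred letters are exchanged. It serves as the integrability condition for the
  height.\<close>

lemma vertical_closed:
  fixes L K P Pb w wb Z Zb c s m mb :: complex
  assumes LK: "L * K = 1" and K: "K = 1 - c\<^sup>2 * Z * Zb"
  defines "p \<equiv> K * P" and "pb \<equiv> K * Pb" and "q \<equiv> - K * w\<^sup>2 * Pb" and "qb \<equiv> - K * wb\<^sup>2 * P"
  shows "(c + s) / 2 * P * Pb * (1 - w\<^sup>2 * wb\<^sup>2)
    + s / 2 * (c\<^sup>2 * L\<^sup>2 * (Zb * q + Z * pb) * (Z * qb - Zb * p) + L * (q * qb - pb * p + Z * mb - Zb * m))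
   = (c - s) / 2 * P * Pb * (1 - w\<^sup>2 * wb\<^sup>2)
    - s / 2 * (c\<^sup>2 * L\<^sup>2 * (Z * qb + Zb * p) * (Zb * q - Z * pb) + L * (q * qb - pb * p + Zb * m - Z * mb))"
    (is "?l = ?r")
proof -
  have "2 * ?l = (c + s) * P * Pb * (1 - w\<^sup>2 * wb\<^sup>2)
    + s * (c\<^sup>2 * L\<^sup>2 * (Zb * q + Z * pb) * (Z * qb - Zb * p) + L * (q * qb - pb * p + Z * mb - Zb * m))"
    by (simp add: field_simps)
  also have "\<dots> = (c - s) * P * Pb * (1 - w\<^sup>2 * wb\<^sup>2)
    - s * (c\<^sup>2 * L\<^sup>2 * (Z * qb + Zb * p) * (Zb * q - Z * pb) + L * (q * qb - pb * p + Zb * m - Z * mb))"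
    unfolding p_def q_def pb_def qb_def using LK K by algebra
  also have "\<dots> = 2 * ?r" by (simp add: field_simps)
  finally show ?thesis by (rule eq_of_scale) simp
qed

text \<open>The numerator that the quotient rule produces for \<open>w\<close>, the negative
  conjugate of the vertical part divided by \<open>P\<close>, once the derivatives of both parts are
  known. The halves are cleared first so that the identity becomes polynomial.\<close>

lemma stereo_derivative:
  fixes P Pb w wb Z Zb c s :: complex
  shows "(c - s) / 2 * P * Pb * (1 - w\<^sup>2 * wb\<^sup>2)
      + w * (P * Pb * (c\<^sup>2 * (Zb + Z * wb\<^sup>2) + s * wb * (1 - w * wb) + c * wb * (1 + w * wb)))
    = P * Pb * (c / 2 * (1 + w * wb)\<^sup>2 - s / 2 * (1 - w * wb)\<^sup>2 + c\<^sup>2 * w * (Zb + Z * wb\<^sup>2))" (is "?l = ?r")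
proof -
  have "2 * ?l = (c - s) * P * Pb * (1 - w\<^sup>2 * wb\<^sup>2)
      + 2 * w * (P * Pb * (c\<^sup>2 * (Zb + Z * wb\<^sup>2) + s * wb * (1 - w * wb) + c * wb * (1 + w * wb)))"
    by (simp add: field_simps)
  also have "\<dots> = P * Pb * (c * (1 + w * wb)\<^sup>2 - s * (1 - w * wb)\<^sup>2 + 2 * c\<^sup>2 * w * (Zb + Z * wb\<^sup>2))"
    by algebra
  also have "\<dots> = 2 * ?r" by (simp add: field_simps)
  finally show ?thesis by (rule eq_of_scale) simp
qed

text \<open>The quotient rule for \<open>g\<close> with \<open>dw\<close> in place of
  \<open>w\<^sub>z\<close>. All terms cancel up to a multiple of \<open>P (1 - w wb)^2\<close>, and
  this product form is what shows that \<open>g\<^sub>z\<close> has no zeros.\<close>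

lemma gauss_derivative:
  fixes P w wb Z Zb c s K :: complex
  assumes K: "K = 1 - c\<^sup>2 * Z * Zb" and E: "1 + c * Zb * w \<noteq> 0"
  defines "dw \<equiv> - P * (c / 2 * (1 + w * wb)\<^sup>2 - s / 2 * (1 - w * wb)\<^sup>2 + c\<^sup>2 * w * (Zb + Z * wb\<^sup>2))"
  shows "((dw + c * (K * P)) * (1 + c * Zb * w) - (w + c * Z) * (c * ((- K * wb\<^sup>2 * P) * w + Zb * dw))) / (1 + c * Zb * w)\<^sup>2
    = K * P * ((c + s) / 2) * (1 - w * wb)\<^sup>2 / (1 + c * Zb * w)\<^sup>2"
proof -
  define v where "v = - P * (c * (1 + w * wb)\<^sup>2 - s * (1 - w * wb)\<^sup>2 + 2 * c\<^sup>2 * w * (Zb + Z * wb\<^sup>2))"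
  have v: "dw = v / 2" by (simp add: dw_def v_def algebra_simps)
  have "(v + 2 * c * (K * P)) * (1 + c * Zb * w) - (w + c * Z) * (c * (2 * (- K * wb\<^sup>2 * P) * w + Zb * v))
    = K * P * (c + s) * (1 - w * wb)\<^sup>2" unfolding v_def using K by algebra
  moreover have "2 * ((dw + c * (K * P)) * (1 + c * Zb * w) - (w + c * Z) * (c * ((- K * wb\<^sup>2 * P) * w + Zb * dw)))
    = (v + 2 * c * (K * P)) * (1 + c * Zb * w) - (w + c * Z) * (c * (2 * (- K * wb\<^sup>2 * P) * w + Zb * v))"
    unfolding v by (simp add: field_simps)
  ultimately have "(dw + c * (K * P)) * (1 + c * Zb * w) - (w + c * Z) * (c * ((- K * wb\<^sup>2 * P) * w + Zb * dw))
    = K * P * ((c + s) / 2) * (1 - w * wb)\<^sup>2" by (simp add: field_simps)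
  then show ?thesis by (rule arg_cong[where f="\<lambda>x. x / (1 + c * Zb * w)\<^sup>2"])
qed

text \<open>The hypothesis \<open>eq\<close> is the equality of mixed derivatives of
  \<open>\<zeta>\<close> with denominators cleared; \<open>gzb\<close> stands for the conjugate of
  \<open>gz\<close>. One more factor \<open>D\<close> permits eliminating \<open>a\<close> and
  \<open>ab\<close>, and \<open>u - v * gb = D\<close> then removes every term without
  \<open>E\<close> or \<open>Eb\<close>.\<close>

lemma gauss_equation_identity:
  fixes c s Z g gb D a ab gz gzb u v E Eb :: complex
  assumes D: "D = 1 - g * gb" and u: "u = 1 - c * Z * gb" and v: "v = g - c * Z"
    and a: "a * ((c + s) * D\<^sup>2) = 2 * gz" and ab: "ab * ((c - s) * D\<^sup>2) = 2 * gzb"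
    and eq: "2 * (E + 2 * g * gz * gzb) * (c - s) * u\<^sup>2 + 2 * (Eb + 2 * gb * gz * gzb) * (c + s) * v\<^sup>2
       = (c + s) * (c - s) * D ^ 3 * (2 * a * u * c * (- ab * v\<^sup>2 * gb + Z * gzb) - 2 * ab * v * (gz - c * (a * u\<^sup>2)))"
    and D0: "D \<noteq> 0"
  shows "E * (c - s) * u\<^sup>2 + Eb * (c + s) * v\<^sup>2 = 0"
proof -
  have "(c + s) * (c - s) * D ^ 4 * (a * ab) = 4 * gz * gzb" using a ab by algebra
  moreover have "(c + s) * (c - s) * D ^ 3 * (2 * a * u * c * (- ab * v\<^sup>2 * gb + Z * gzb) - 2 * ab * v * (gz - c * (a * u\<^sup>2))) * D
      = 2 * c * u * v * (u - v * gb) * ((c + s) * (c - s) * D ^ 4 * (a * ab))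
        + 2 * u * c * Z * gzb * (c - s) * D\<^sup>2 * (a * ((c + s) * D\<^sup>2)) - 2 * v * gz * (c + s) * D\<^sup>2 * (ab * ((c - s) * D\<^sup>2))"
    by algebra
  moreover have "u - v * gb = D" using D u v by algebra
  ultimately have "(2 * (E + 2 * g * gz * gzb) * (c - s) * u\<^sup>2 + 2 * (Eb + 2 * gb * gz * gzb) * (c + s) * v\<^sup>2) * D
     = 2 * c * u * v * D * (4 * gz * gzb) + 2 * u * c * Z * gzb * (c - s) * D\<^sup>2 * (2 * gz) - 2 * v * gz * (c + s) * D\<^sup>2 * (2 * gzb)"
    unfolding eq a ab by simp
  then have "2 * (E * (c - s) * u\<^sup>2 + Eb * (c + s) * v\<^sup>2) * D = 0" using D u v by algebra
  then have "2 * (E * (c - s) * u\<^sup>2 + Eb * (c + s) * v\<^sup>2) = 0" using D0 by (metis mult_eq_0_iff)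
  then show ?thesis by (metis mult_eq_0_iff zero_neq_numeral)
qed

text \<open>Translates the mixed derivative of \<open>\<zeta>\<close>, computed from the formula in
  terms of \<open>g\<close>, into \<open>w\<close> and \<open>P\<close>. The remaining denominator
  \<open>Eb\<close> disappears when the contributions \<open>1\<close> and \<open>3\<close> are
  combined.\<close>

lemma second_derivative_identity:
  fixes c s Z Zb w wb K P Pb E Eb D u m g gb q gzb gz p :: complex
  assumes K: "K = 1 - c\<^sup>2 * Z * Zb" and E: "E = 1 + c * Zb * w" "Eb = 1 + c * Z * wb" "E \<noteq> 0" "Eb \<noteq> 0"
    and g: "g = (w + c * Z) / E" "gb = (wb + c * Zb) / Eb" and K0: "K \<noteq> 0" and w1: "1 - w * wb \<noteq> 0"
    and D: "D = (1 - w * wb) * K / (E * Eb)" and u: "u = K / Eb" and q: "q = - K * w\<^sup>2 * Pb"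
    and gzb: "gzb = K * Pb * ((c - s) / 2) * (1 - w * wb)\<^sup>2 / Eb\<^sup>2"
  shows "(K * P) * (2 * g * gzb / D - 2 * c * (q * gb + Z * gzb) / u)
    = K * (P * Pb * ((c - s) * w * (1 - w * wb) + 2 * c * w\<^sup>2 * (wb + c * Zb)))"
proof -
  have 1: "2 * g * gzb / D = (w + c * Z) * (c - s) * Pb * (1 - w * wb) / Eb"
  proof -
    have "2 * (n / E) * (K * Pb * (d / 2) * h\<^sup>2 / Eb\<^sup>2) / (h * K / (E * Eb)) = n * d * Pb * h / Eb"
      if "h \<noteq> 0" for n d h :: complex
      using that E(3,4) K0 by (simp add: field_simps power2_eq_square)
    then show ?thesis unfolding g gzb D using w1 by blast
  qed
  have 2: "2 * c * (q * gb) / u = - 2 * c * w\<^sup>2 * Pb * (wb + c * Zb)"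
    unfolding g q u using E(4) K0 by (simp add: field_simps)
  have 3: "2 * c * (Z * gzb) / u = c * Z * (c - s) * Pb * (1 - w * wb)\<^sup>2 / Eb"
    unfolding gzb u using E(4) K0 by (simp add: field_simps power2_eq_square)
  have 4: "(w + c * Z) * (c - s) * Pb * (1 - w * wb) / Eb - c * Z * (c - s) * Pb * (1 - w * wb)\<^sup>2 / Eb
     = (c - s) * Pb * w * (1 - w * wb)"
  proof -
    have "(w + c * Z) * (c - s) * Pb * (1 - w * wb) - c * Z * (c - s) * Pb * (1 - w * wb)\<^sup>2
       = (c - s) * Pb * w * (1 - w * wb) * Eb" unfolding E(2) by algebra
    then show ?thesis using E(4) by (simp add: diff_divide_distrib[symmetric])
  qed
  have "2 * g * gzb / D - 2 * c * (q * gb + Z * gzb) / u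
    = 2 * g * gzb / D - 2 * c * (q * gb) / u - 2 * c * (Z * gzb) / u"
    by (simp add: distrib_left add_divide_distrib)
  also have "\<dots> = (c - s) * Pb * w * (1 - w * wb) + 2 * c * w\<^sup>2 * Pb * (wb + c * Zb)"
    unfolding 1 2 3 using 4 by (simp add: algebra_simps)
  finally have eq: "2 * g * gzb / D - 2 * c * (q * gb + Z * gzb) / u
    = (c - s) * Pb * w * (1 - w * wb) + 2 * c * w\<^sup>2 * Pb * (wb + c * Zb)" .
  show ?thesis unfolding eq by (simp add: algebra_simps)
qed

section \<open>Hyperbolic translations of the disc\<close>

lemma cnj_mult_self: "z * cnj z = complex_of_real ((norm z)\<^sup>2)"
  by (simp only: complex_norm_square)

lemma norm_less_one_iff: "norm (z::complex) < 1 \<longleftrightarrow> (norm z)\<^sup>2 < 1"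
  by (simp add: abs_square_less_1)

lemma has_wirtinger_wz: "has_wirtinger f a b z \<Longrightarrow> has_wirtinger f (wz f z) b z"
  using has_wirtinger_unique(1) by simp

lemma moebius_denominator_nonzero:
  fixes Z w :: complex and c :: real
  assumes "c\<^sup>2 * (norm Z)\<^sup>2 < 1" "norm w < 1"
  shows "1 + c * cnj Z * w \<noteq> 0" "1 - c * cnj Z * w \<noteq> 0"
proof -
  have "(norm (c * cnj Z * w))\<^sup>2 = (c\<^sup>2 * (norm Z)\<^sup>2) * (norm w)\<^sup>2"
    by (simp add: norm_mult power_mult_distrib)
  also have "\<dots> \<le> (c\<^sup>2 * (norm Z)\<^sup>2) * 1"
    using assms(2) by (intro mult_left_mono) (auto simp: abs_square_le_1)
  finally have "norm (c * cnj Z * w) < 1" using assms(1) by (simp add: norm_less_one_iff)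
  then have "c * cnj Z * w \<noteq> -1" "c * cnj Z * w \<noteq> 1" by auto
  then show "1 + c * cnj Z * w \<noteq> 0" "1 - c * cnj Z * w \<noteq> 0"
    by (auto simp: add_eq_0_iff)
qed

text \<open>The map from \<open>w\<close> to \<open>g\<close> is the hyperbolic translation of the
  disc that moves 0 to \<open>c Z\<close>. The formula for \<open>1 - g * cnj g\<close> is the usual
  one for disc automorphisms and shows that the disc is preserved.\<close>

lemma moebius_identities:
  fixes Z w :: complex and c :: real
  assumes Z: "c\<^sup>2 * (norm Z)\<^sup>2 < 1" and w: "norm w < 1"
  defines "E \<equiv> 1 + c * cnj Z * w" and "K \<equiv> 1 - (complex_of_real c)\<^sup>2 * Z * cnj Z"
  defines "g \<equiv> (w + c * Z) / E"
  shows "1 - c * Z * cnj g = K / cnj E" "1 - g * cnj g = (1 - w * cnj w) * K / (E * cnj E)"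
    "g - c * Z = K * w / E" "norm g < 1" "E \<noteq> 0" "K \<noteq> 0"
    "(g - c * Z) / (1 - c * cnj Z * g) = w"
proof -
  show E: "E \<noteq> 0" using moebius_denominator_nonzero[OF Z w] unfolding E_def by simp
  have Kr: "K = complex_of_real (1 - c\<^sup>2 * (norm Z)\<^sup>2)"
    unfolding K_def by (simp add: cnj_mult_self mult.assoc)
  then show K: "K \<noteq> 0" using Z by (metis of_real_eq_0_iff diff_gt_0_iff_gt less_irrefl)
  have Ec: "cnj E = 1 + c * Z * cnj w" by (simp add: E_def)
  have gc: "cnj g = (cnj w + c * cnj Z) / cnj E" by (simp add: g_def)
  have E': "cnj E \<noteq> 0" using E by simp
  show u: "1 - c * Z * cnj g = K / cnj E"
  proof -
    have "cnj E - c * Z * (cnj w + c * cnj Z) = K" unfolding Ec K_def by (simp add: power2_eq_square algebra_simps)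
    then show ?thesis unfolding gc using E' by (simp add: field_simps)
  qed
  show D: "1 - g * cnj g = (1 - w * cnj w) * K / (E * cnj E)"
  proof -
    have "E * cnj E - (w + c * Z) * (cnj w + c * cnj Z) = (1 - w * cnj w) * K"
      unfolding Ec unfolding E_def K_def by (simp add: power2_eq_square algebra_simps)
    then show ?thesis unfolding gc unfolding g_def using E E' by (simp add: field_simps)
  qed
  show v: "g - c * Z = K * w / E"
  proof -
    have "(w + c * Z) - c * Z * E = K * w" unfolding E_def K_def by (simp add: power2_eq_square algebra_simps)
    then show ?thesis unfolding g_def using E by (simp add: field_simps)
  qed
  have "complex_of_real (1 - (norm g)\<^sup>2) = complex_of_real ((1 - (norm w)\<^sup>2) * (1 - c\<^sup>2 * (norm Z)\<^sup>2) / (norm E)\<^sup>2)"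
    using D unfolding cnj_mult_self Kr by simp
  then have "1 - (norm g)\<^sup>2 = (1 - (norm w)\<^sup>2) * (1 - c\<^sup>2 * (norm Z)\<^sup>2) / (norm E)\<^sup>2"
    by (simp only: of_real_eq_iff)
  moreover have "\<dots> > 0" using Z w E by (intro divide_pos_pos mult_pos_pos) (auto simp: norm_less_one_iff)
  ultimately show "norm g < 1" by (simp add: norm_less_one_iff)
  have cK: "cnj K = K" by (simp add: K_def mult_ac)
  have "1 - c * cnj Z * g = cnj (1 - c * Z * cnj g)" by simp
  also have "\<dots> = K / E" unfolding u by (simp add: cK)
  finally have "1 - c * cnj Z * g = K / E" .
  then show "(g - c * Z) / (1 - c * cnj Z * g) = w" unfolding v using E K by simp
qed

text \<open>The inverse translation has parameter \<open>- c Z\<close>, so the identities for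
  \<open>- c\<close> apply with the roles of \<open>g\<close> and \<open>w\<close>
  exchanged.\<close>

lemma moebius_inverse:
  fixes Z g :: complex and c :: real
  assumes Z: "c\<^sup>2 * (norm Z)\<^sup>2 < 1" and g: "norm g < 1"
  defines "w \<equiv> (g - c * Z) / (1 - c * cnj Z * g)"
  shows "norm w < 1" "(w + c * Z) / (1 + c * cnj Z * w) = g"
proof -
  have Z': "(- c)\<^sup>2 * (norm Z)\<^sup>2 < 1" using Z by simp
  note * = moebius_identities[OF Z' g]
  show "norm w < 1" using *(4) by (simp add: w_def)
  show "(w + c * Z) / (1 + c * cnj Z * w) = g" using *(7) by (simp add: w_def)
qed

text \<open>The factor \<open>\<Lambda>\<close> as a function of \<open>\<zeta>\<close>, complex
  valued and with the conjugate written out, so that Wirtinger derivatives can be taken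
  directly.\<close>

definition lam :: "real \<Rightarrow> complex \<Rightarrow> complex" where
  "lam c Z = 1 / (1 - (complex_of_real c)\<^sup>2 * Z * cnj Z)"

lemma lam_facts:
  assumes "c\<^sup>2 * (norm Z)\<^sup>2 < 1"
  shows "1 - (complex_of_real c)\<^sup>2 * Z * cnj Z \<noteq> 0" "lam c Z * (1 - (complex_of_real c)\<^sup>2 * Z * cnj Z) = 1"
    "lam c Z \<noteq> 0" "cnj (lam c Z) = lam c Z"
    "lam c Z = complex_of_real (1 / (1 - c\<^sup>2 * (norm Z)\<^sup>2))"
proof -
  have Kr: "1 - (complex_of_real c)\<^sup>2 * Z * cnj Z = complex_of_real (1 - c\<^sup>2 * (norm Z)\<^sup>2)"
    by (simp add: cnj_mult_self mult.assoc)
  show K: "1 - (complex_of_real c)\<^sup>2 * Z * cnj Z \<noteq> 0"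
    unfolding Kr using assms by (metis of_real_eq_0_iff diff_gt_0_iff_gt less_irrefl)
  then show "lam c Z * (1 - (complex_of_real c)\<^sup>2 * Z * cnj Z) = 1" "lam c Z \<noteq> 0" by (auto simp: lam_def)
  show "cnj (lam c Z) = lam c Z" by (simp add: lam_def mult_ac)
  show "lam c Z = complex_of_real (1 / (1 - c\<^sup>2 * (norm Z)\<^sup>2))" unfolding lam_def Kr by simp
qed

lemma has_wirtinger_lam:
  assumes "c\<^sup>2 * (norm (f z))\<^sup>2 < 1" "has_wirtinger f p q z"
  shows "has_wirtinger (\<lambda>z. lam c (f z))
    ((complex_of_real c)\<^sup>2 * (lam c (f z))\<^sup>2 * (cnj (f z) * p + f z * cnj q))
    ((complex_of_real c)\<^sup>2 * (lam c (f z))\<^sup>2 * (cnj (f z) * q + f z * cnj p)) z"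
  unfolding lam_def
  by (rule has_wirtinger_eq, (rule wirtinger_intros assms lam_facts(1)[OF assms(1)])+)
     (simp_all add: field_simps lam_facts(1)[OF assms(1)])

lemma smooth_on_lam:
  assumes "open W" "smooth_on f W" "\<And>z. z \<in> W \<Longrightarrow> c\<^sup>2 * (norm (f z))\<^sup>2 < 1"
  shows "smooth_on (\<lambda>z. lam c (f z)) W"
  unfolding lam_def using assms lam_facts(1) by (intro smooth_intros) auto

text \<open>Only the conjugate derivative matters later, because the mean curvature equation
  prescribes just that one; the other coefficient stays unevaluated.\<close>

lemma has_wirtinger_horizontal:
  assumes W: "open W" "z \<in> W" and Z: "smooth_on Z W" and cZ: "\<And>z. z \<in> W \<Longrightarrow> c\<^sup>2 * (norm (Z z))\<^sup>2 < 1"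
  shows "has_wirtinger (\<lambda>z. lam c (Z z) * wz Z z) (wz (\<lambda>z. lam c (Z z) * wz Z z) z)
    ((complex_of_real c)\<^sup>2 * (lam c (Z z))\<^sup>2 * (cnj (Z z) * wzb Z z + Z z * cnj (wz Z z)) * wz Z z
      + lam c (Z z) * wzb (wz Z) z) z"
proof -
  have "has_wirtinger (\<lambda>z. lam c (Z z) * wz Z z)
    (lam c (Z z) * wz (wz Z) z + (complex_of_real c)\<^sup>2 * (lam c (Z z))\<^sup>2 * (cnj (Z z) * wz Z z + Z z * cnj (wzb Z z)) * wz Z z)
    (lam c (Z z) * wzb (wz Z) z + (complex_of_real c)\<^sup>2 * (lam c (Z z))\<^sup>2 * (cnj (Z z) * wzb Z z + Z z * cnj (wz Z z)) * wz Z z) z"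
    by (intro has_wirtinger_mult has_wirtinger_lam cZ W smooth_on_has_wirtinger[of _ W] Z smooth_on_wz)
  from has_wirtinger_wz[OF this] show ?thesis by (simp only: add.commute)
qed

text \<open>The part of the height derivative due to horizontal motion: subtracting it from the
  derivative of the height leaves the vertical frame component of \<open>X\<^sub>z\<close>.\<close>

definition vert :: "real \<Rightarrow> real \<Rightarrow> (complex \<Rightarrow> complex) \<Rightarrow> complex \<Rightarrow> complex" where
  "vert c \<tau> Z z = \<i> * \<tau> / 2 * lam c (Z z) * (Z z * cnj (wzb Z z) - cnj (Z z) * wz Z z)"

lemma has_wirtinger_vert:
  assumes W: "open W" "z \<in> W" and Z: "smooth_on Z W" and cZ: "\<And>z. z \<in> W \<Longrightarrow> c\<^sup>2 * (norm (Z z))\<^sup>2 < 1"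
  shows "has_wirtinger (vert c \<tau> Z) (wz (vert c \<tau> Z) z)
    (\<i> * \<tau> / 2 * ((complex_of_real c)\<^sup>2 * (lam c (Z z))\<^sup>2 * (cnj (Z z) * wzb Z z + Z z * cnj (wz Z z))
        * (Z z * cnj (wzb Z z) - cnj (Z z) * wz Z z)
      + lam c (Z z) * (wzb Z z * cnj (wzb Z z) - cnj (wz Z z) * wz Z z
          + Z z * cnj (wzb (wz Z) z) - cnj (Z z) * wzb (wz Z) z))) z"
proof -
  let ?L = "lam c (Z z)"
  let ?Lb = "(complex_of_real c)\<^sup>2 * ?L\<^sup>2 * (cnj (Z z) * wzb Z z + Z z * cnj (wz Z z))"
  have m: "wz (wzb Z) z = wzb (wz Z) z" using wzb_wz[OF W(1) Z W(2)] by simp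
  have Zd: "has_wirtinger Z (wz Z z) (wzb Z z) z" by (rule smooth_on_has_wirtinger[OF Z W(2)])
  have wzd: "has_wirtinger (wz Z) (wz (wz Z) z) (wzb (wz Z) z) z"
    by (rule smooth_on_has_wirtinger[OF smooth_on_wz[OF W(1) Z] W(2)])
  have wzbd: "has_wirtinger (wzb Z) (wzb (wz Z) z) (wzb (wzb Z) z) z"
    using smooth_on_has_wirtinger[OF smooth_on_wzb[OF W(1) Z] W(2)] unfolding m .
  define M where "M = (\<lambda>z. Z z * cnj (wzb Z z) - cnj (Z z) * wz Z z)"
  have M: "has_wirtinger M (wz M z) (Z z * cnj (wzb (wz Z) z) + wzb Z z * cnj (wzb Z z)
      - (cnj (Z z) * wzb (wz Z) z + cnj (wz Z z) * wz Z z)) z"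
  proof -
    have "has_wirtinger M ((Z z * cnj (wzb (wzb Z) z) + wz Z z * cnj (wzb Z z))
      - (cnj (Z z) * wz (wz Z) z + cnj (wzb Z z) * wz Z z)) (Z z * cnj (wzb (wz Z) z) + wzb Z z * cnj (wzb Z z)
      - (cnj (Z z) * wzb (wz Z) z + cnj (wz Z z) * wz Z z)) z" unfolding M_def
      by (intro has_wirtinger_diff has_wirtinger_mult has_wirtinger_cnj Zd wzd wzbd)
    then show ?thesis by (rule has_wirtinger_wz)
  qed
  have "has_wirtinger (\<lambda>z. \<i> * \<tau> / 2 * (lam c (Z z) * M z))
     (\<i> * \<tau> / 2 * (?L * wz M z + (complex_of_real c)\<^sup>2 * ?L\<^sup>2 * (cnj (Z z) * wz Z z + Z z * cnj (wzb Z z)) * M z)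
       + 0 * (lam c (Z z) * M z))
     (\<i> * \<tau> / 2 * (?L * (Z z * cnj (wzb (wz Z) z) + wzb Z z * cnj (wzb Z z)
      - (cnj (Z z) * wzb (wz Z) z + cnj (wz Z z) * wz Z z)) + ?Lb * M z) + 0 * (lam c (Z z) * M z)) z"
    by (intro has_wirtinger_mult has_wirtinger_const has_wirtinger_lam cZ W Zd M)
  moreover have "(\<lambda>z. \<i> * \<tau> / 2 * (lam c (Z z) * M z)) = vert c \<tau> Z"
    by (auto simp: vert_def M_def fun_eq_iff)
  ultimately have *: "has_wirtinger (vert c \<tau> Z)
     (\<i> * \<tau> / 2 * (?L * wz M z + (complex_of_real c)\<^sup>2 * ?L\<^sup>2 * (cnj (Z z) * wz Z z + Z z * cnj (wzb Z z)) * M z)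
       + 0 * (lam c (Z z) * M z))
     (\<i> * \<tau> / 2 * (?L * (Z z * cnj (wzb (wz Z) z) + wzb Z z * cnj (wzb Z z)
      - (cnj (Z z) * wzb (wz Z) z + cnj (wz Z z) * wz Z z)) + ?Lb * M z) + 0 * (lam c (Z z) * M z)) z" by simp
  show ?thesis
    by (rule has_wirtinger_eq[OF has_wirtinger_wz[OF *] refl]) (simp add: M_def algebra_simps)
qed

section \<open>The equations in a conformal parameter\<close>

text \<open>The quantity \<open>P\<close> for \<open>X\<^sub>z\<close>: the \<open>V1\<close>
  component plus \<open>\<i>\<close> times the \<open>V2\<close> component.\<close>

definition horiz :: "real \<Rightarrow> (complex \<Rightarrow> complex) \<Rightarrow> complex \<Rightarrow> complex" where
  "horiz c Z z = lam c (Z z) * wz Z z"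

text \<open>The parametrized surface with horizontal part \<open>Z\<close> and height \<open>h\<close> is conformal at \<open>z\<close> and its
  upward unit normal has stereographic projection \<open>w\<close>.\<close>

definition isotropic_at :: "real \<Rightarrow> real \<Rightarrow> (complex \<Rightarrow> complex) \<Rightarrow> (complex \<Rightarrow> real) \<Rightarrow> complex \<Rightarrow> complex \<Rightarrow> bool" where
  "isotropic_at c \<tau> Z h z w \<longleftrightarrow> wz Z z \<noteq> 0 \<and> norm w < 1 \<and> cnj (wzb Z z) = - (cnj w)\<^sup>2 * wz Z z \<and>
     wz (\<lambda>z. complex_of_real (h z)) z - vert c \<tau> Z z = - cnj w * horiz c Z z"

text \<open>The horizontal and the vertical component of the mean curvature equation for \<open>H = c\<close>.\<close>

definition cmc_at :: "real \<Rightarrow> real \<Rightarrow> (complex \<Rightarrow> complex) \<Rightarrow> (complex \<Rightarrow> real) \<Rightarrow> complex \<Rightarrow> complex \<Rightarrow> bool" where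
  "cmc_at c \<tau> Z h z w \<longleftrightarrow>
     (let C = complex_of_real c; s = \<i> * \<tau>; L = lam c (Z z); Zb = cnj (Z z); p = wz Z z; q = wzb Z z;
          m = wzb (wz Z) z; P = horiz c Z z; R = wz (\<lambda>z. complex_of_real (h z)) z - vert c \<tau> Z z;
          n = wzb (wz (\<lambda>z. complex_of_real (h z))) z
      in m + 2 * C\<^sup>2 * L * Zb * p * q - s * (q * R + cnj R * p) = C * P * cnj P * (1 + w * cnj w) * w * (1 - C\<^sup>2 * Z z * Zb) \<and>
         (n - s / 2 * L * (Z z * cnj m - Zb * m))
          - s * C\<^sup>2 * L\<^sup>2 / 4 * ((Z z * cnj p + Zb * q) * (Z z * cnj q - Zb * p) + (Z z * cnj q + Zb * p) * (Z z * cnj p - Zb * q))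
          = C / 2 * P * cnj P * (1 - w\<^sup>2 * (cnj w)\<^sup>2))"

definition repr_horiz_at :: "real \<Rightarrow> real \<Rightarrow> (complex \<Rightarrow> complex) \<Rightarrow> (complex \<Rightarrow> complex) \<Rightarrow> complex \<Rightarrow> bool" where
  "repr_horiz_at c \<tau> g Z z \<longleftrightarrow>
     (let C = complex_of_real c; s = \<i> * \<tau>; D = 1 - g z * cnj (g z)
      in wz Z z = 2 / (C + s) * ((1 - C * Z z * cnj (g z))\<^sup>2 / D\<^sup>2) * wz g z \<and>
         wzb Z z = - (2 / (C - s)) * ((g z - C * Z z)\<^sup>2 / D\<^sup>2) * cnj (wz g z))"

definition repr_at :: "real \<Rightarrow> real \<Rightarrow> (complex \<Rightarrow> complex) \<Rightarrow> (complex \<Rightarrow> complex) \<Rightarrow> (complex \<Rightarrow> real) \<Rightarrow> complex \<Rightarrow> bool" where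
  "repr_at c \<tau> g Z h z \<longleftrightarrow> repr_horiz_at c \<tau> g Z z \<and>
     (let C = complex_of_real c; s = \<i> * \<tau>; D = 1 - g z * cnj (g z)
      in wz (\<lambda>z. complex_of_real (h z)) z =
           - (2 / (C + s)) * ((cnj (g z) - C * cnj (Z z)) * (1 - C * Z z * cnj (g z)) / ((1 - C\<^sup>2 * Z z * cnj (Z z)) * D\<^sup>2)) * wz g z
           + vert c \<tau> Z z)"

definition gauss_at :: "(complex \<Rightarrow> complex) \<Rightarrow> complex \<Rightarrow> bool" where
  "gauss_at g z \<longleftrightarrow> (1 - g z * cnj (g z)) * wzb (wz g) z + 2 * cnj (g z) * wz g z * wzb g z = 0"

section \<open>From a critical surface to the equation for its Gauss map\<close>

lemma sum_i_nonzero: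
  fixes c \<tau> :: real
  assumes "c \<noteq> 0 \<or> \<tau> \<noteq> 0"
  shows "complex_of_real c + \<i> * complex_of_real \<tau> \<noteq> 0" "complex_of_real c - \<i> * complex_of_real \<tau> \<noteq> 0"
  using assms by (auto simp: complex_eq_iff)

text \<open>Isotropy expresses both derivatives of \<open>\<zeta>\<close> and the vertical part by
  \<open>P\<close> and \<open>w\<close>. After this substitution the second order equations of the
  surface become first order equations for the horizontal and the vertical part.\<close>

lemma cmc_derivatives:
  assumes W: "open W" "z \<in> W" and Z: "smooth_on Z W" and h: "smooth_on (\<lambda>z. complex_of_real (h z)) W"
    and cZ: "\<And>z. z \<in> W \<Longrightarrow> c\<^sup>2 * (norm (Z z))\<^sup>2 < 1"
    and iso: "isotropic_at c \<tau> Z h z w"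
  defines "C \<equiv> complex_of_real c" and "s \<equiv> \<i> * complex_of_real \<tau>" and "P \<equiv> horiz c Z z" and "Zb \<equiv> cnj (Z z)"
    and "R \<equiv> \<lambda>z. wz (\<lambda>z. complex_of_real (h z)) z - vert c \<tau> Z z"
  shows "cmc_at c \<tau> Z h z w \<longleftrightarrow>
      wzb (horiz c Z) z = P * cnj P * (C\<^sup>2 * (Z z + Zb * w\<^sup>2) - s * w * (1 - w * cnj w) + C * w * (1 + w * cnj w)) \<and>
      wzb R z = (C + s) / 2 * P * cnj P * (1 - w\<^sup>2 * (cnj w)\<^sup>2)"
    and "has_wirtinger (horiz c Z) (wz (horiz c Z) z) (wzb (horiz c Z) z) z"
    and "has_wirtinger R (wz R z) (wzb R z) z"
proof -
  define L K p q m n where defs: "L = lam c (Z z)" "K = 1 - C\<^sup>2 * Z z * Zb" "p = wz Z z" "q = wzb Z z"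
    "m = wzb (wz Z) z" "n = wzb (wz (\<lambda>z. complex_of_real (h z))) z"
  have LK: "L * K = 1" using lam_facts(2)[OF cZ[OF W(2)]] by (simp add: defs C_def Zb_def)
  have KL: "K * L = 1" using LK by (simp add: mult.commute)
  have P: "P = L * p" by (simp add: P_def horiz_def defs)
  have cL: "cnj L = L" using lam_facts(4)[OF cZ[OF W(2)]] by (simp add: defs)
  have p: "p = K * P" and pb: "cnj p = K * cnj P"
    unfolding P complex_cnj_mult cL using KL by (simp_all add: mult.assoc[symmetric])
  have qb: "cnj q = - K * (cnj w)\<^sup>2 * P" using iso p unfolding isotropic_at_def defs(3,4) by simp
  have q: "q = - K * w\<^sup>2 * cnj P"
  proof -
    have "cnj (cnj q) = - (w\<^sup>2 * cnj p)" using iso unfolding isotropic_at_def defs(3,4) by simp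
    then show ?thesis using pb by (simp add: mult_ac)
  qed
  have Rz: "R z = - cnj w * P" and Rbz: "cnj (R z) = - w * cnj P" using iso unfolding isotropic_at_def R_def P_def by simp_all
  have "has_wirtinger (horiz c Z) (wz (horiz c Z) z) (C\<^sup>2 * L\<^sup>2 * (Zb * q + Z z * cnj p) * p + L * m) z"
    using has_wirtinger_horizontal[OF W Z cZ] unfolding horiz_def[abs_def] C_def defs Zb_def by simp
  note Pd = this
  show "has_wirtinger (horiz c Z) (wz (horiz c Z) z) (wzb (horiz c Z) z) z"
    using Pd has_wirtinger_unique(2)[OF Pd] by simp
  have "has_wirtinger R (wz (wz (\<lambda>z. complex_of_real (h z))) z - wz (vert c \<tau> Z) z)
      (n - s / 2 * (C\<^sup>2 * L\<^sup>2 * (Zb * q + Z z * cnj p) * (Z z * cnj q - Zb * p)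
      + L * (q * cnj q - cnj p * p + Z z * cnj m - Zb * m))) z"
    unfolding R_def defs Zb_def C_def s_def
    by (intro has_wirtinger_diff has_wirtinger_vert[OF W Z cZ] smooth_on_has_wirtinger[OF smooth_on_wz[OF W(1) h] W(2)])
  note Rd = this
  show "has_wirtinger R (wz R z) (wzb R z) z"
    using has_wirtinger_wz[OF Rd] has_wirtinger_unique(2)[OF Rd] by simp
  have "cmc_at c \<tau> Z h z w \<longleftrightarrow>
      m + 2 * C\<^sup>2 * L * Zb * p * q - s * (q * R z + cnj (R z) * p) = C * P * cnj P * (1 + w * cnj w) * w * K \<and>
      (n - s / 2 * L * (Z z * cnj m - Zb * m))
       - s * C\<^sup>2 * L\<^sup>2 / 4 * ((Z z * cnj p + Zb * q) * (Z z * cnj q - Zb * p) + (Z z * cnj q + Zb * p) * (Z z * cnj p - Zb * q))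
       = C / 2 * P * cnj P * (1 - w\<^sup>2 * (cnj w)\<^sup>2)"
    unfolding cmc_at_def Let_def defs C_def s_def P_def R_def Zb_def ..
  also have "\<dots> \<longleftrightarrow>
    C\<^sup>2 * L\<^sup>2 * (Zb * q + Z z * cnj p) * p + L * m
      = P * cnj P * (C\<^sup>2 * (Z z + Zb * w\<^sup>2) - s * w * (1 - w * cnj w) + C * w * (1 + w * cnj w)) \<and>
    n - s / 2 * (C\<^sup>2 * L\<^sup>2 * (Zb * q + Z z * cnj p) * (Z z * cnj q - Zb * p)
       + L * (q * cnj q - cnj p * p + Z z * cnj m - Zb * m)) = (C + s) / 2 * P * cnj P * (1 - w\<^sup>2 * (cnj w)\<^sup>2)"
    unfolding Rbz pb qb unfolding Rz p q
    by (intro conj_cong horizontal_iff[OF LK] vertical_iff[OF LK defs(2)])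
  finally show "cmc_at c \<tau> Z h z w \<longleftrightarrow>
      wzb (horiz c Z) z = P * cnj P * (C\<^sup>2 * (Z z + Zb * w\<^sup>2) - s * w * (1 - w * cnj w) + C * w * (1 + w * cnj w)) \<and>
      wzb R z = (C + s) / 2 * P * cnj P * (1 - w\<^sup>2 * (cnj w)\<^sup>2)"
    unfolding has_wirtinger_unique(2)[OF Pd] has_wirtinger_unique(2)[OF Rd] .
qed

text \<open>The value that \<open>w\<^sub>z\<close> is forced to take when isotropy and the mean
  curvature equation hold.\<close>

definition stereo_dz :: "real \<Rightarrow> real \<Rightarrow> complex \<Rightarrow> complex \<Rightarrow> complex \<Rightarrow> complex" where
  "stereo_dz c \<tau> Z P w = - P * (complex_of_real c / 2 * (1 + w * cnj w)\<^sup>2 - \<i> * complex_of_real \<tau> / 2 * (1 - w * cnj w)\<^sup>2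
     + (complex_of_real c)\<^sup>2 * w * (cnj Z + Z * (cnj w)\<^sup>2))"

text \<open>The first conclusion keeps the derivative of \<open>w\<close> arbitrary, since the
  converse direction solves it for that derivative; the second evaluates the expression at the value
  for a critical surface.\<close>

lemma gauss_dz:
  assumes cZ: "c\<^sup>2 * (norm (Z z))\<^sup>2 < 1" and Zd: "has_wirtinger Z (wz Z z) (wzb Z z) z"
    and wd: "has_wirtinger w dw dwb z" and w: "norm (w z) < 1" and qb: "cnj (wzb Z z) = - (cnj (w z))\<^sup>2 * wz Z z"
  defines "C \<equiv> complex_of_real c" and "E \<equiv> 1 + complex_of_real c * cnj (Z z) * w z"
  shows "has_wirtinger (\<lambda>z. (w z + C * Z z) / (1 + C * cnj (Z z) * w z))
      (((dw + C * wz Z z) * E - (w z + C * Z z) * (C * (cnj (wzb Z z) * w z + cnj (Z z) * dw))) / E\<^sup>2)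
      (wzb (\<lambda>z. (w z + C * Z z) / (1 + C * cnj (Z z) * w z)) z) z"
    and "((stereo_dz c \<tau> (Z z) (horiz c Z z) (w z) + C * wz Z z) * E
        - (w z + C * Z z) * (C * (cnj (wzb Z z) * w z + cnj (Z z) * stereo_dz c \<tau> (Z z) (horiz c Z z) (w z)))) / E\<^sup>2
      = wz Z z * ((C + \<i> * \<tau>) / 2) * (1 - w z * cnj (w z))\<^sup>2 / E\<^sup>2"
proof -
  have E0: "1 + C * cnj (Z z) * w z \<noteq> 0" using moebius_denominator_nonzero(1)[OF cZ w] by (simp add: C_def)
  have Ed: "E = 1 + C * cnj (Z z) * w z" by (simp add: E_def C_def)
  have "has_wirtinger (\<lambda>z. (w z + C * Z z) / (1 + C * cnj (Z z) * w z))
     (((dw + (C * wz Z z + 0 * Z z)) * (1 + C * cnj (Z z) * w z)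
        - (w z + C * Z z) * (0 + (C * cnj (Z z) * dw + (C * cnj (wzb Z z) + 0 * cnj (Z z)) * w z))) / (1 + C * cnj (Z z) * w z)\<^sup>2)
     (((dwb + (C * wzb Z z + 0 * Z z)) * (1 + C * cnj (Z z) * w z)
        - (w z + C * Z z) * (0 + (C * cnj (Z z) * dwb + (C * cnj (wz Z z) + 0 * cnj (Z z)) * w z))) / (1 + C * cnj (Z z) * w z)\<^sup>2) z"
    by (intro has_wirtinger_divide has_wirtinger_add has_wirtinger_mult has_wirtinger_const has_wirtinger_cnj Zd wd E0)
  note * = this
  show "has_wirtinger (\<lambda>z. (w z + C * Z z) / (1 + C * cnj (Z z) * w z))
      (((dw + C * wz Z z) * E - (w z + C * Z z) * (C * (cnj (wzb Z z) * w z + cnj (Z z) * dw))) / E\<^sup>2)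
      (wzb (\<lambda>z. (w z + C * Z z) / (1 + C * cnj (Z z) * w z)) z) z"
    by (rule has_wirtinger_eq[OF *]) (use has_wirtinger_unique(2)[OF *] in \<open>auto simp: Ed algebra_simps\<close>)
  define K where "K = 1 - C\<^sup>2 * Z z * cnj (Z z)"
  have p: "wz Z z = K * horiz c Z z"
    using lam_facts(2)[OF cZ] unfolding horiz_def K_def C_def by (simp add: mult.assoc[symmetric] mult.commute)
  have q: "cnj (wzb Z z) = - K * (cnj (w z))\<^sup>2 * horiz c Z z" unfolding qb p by simp
  show "((stereo_dz c \<tau> (Z z) (horiz c Z z) (w z) + C * wz Z z) * E
        - (w z + C * Z z) * (C * (cnj (wzb Z z) * w z + cnj (Z z) * stereo_dz c \<tau> (Z z) (horiz c Z z) (w z)))) / E\<^sup>2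
      = wz Z z * ((C + \<i> * \<tau>) / 2) * (1 - w z * cnj (w z))\<^sup>2 / E\<^sup>2"
    unfolding q p stereo_dz_def C_def[symmetric] Ed
    by (rule gauss_derivative[OF K_def E0])
qed

lemma one_minus_norm_nonzero:
  assumes "norm (w :: complex) < 1"
  shows "1 - w * cnj w \<noteq> 0"
proof -
  have "complex_of_real (1 - (norm w)\<^sup>2) \<noteq> 0"
    using assms norm_less_one_iff[of w] by (simp only: of_real_eq_0_iff)
  then show ?thesis unfolding cnj_mult_self by simp
qed

text \<open>Expressed through \<open>w\<close> the formula separates: the first equation becomes the
  value of \<open>g\<^sub>z\<close>, the second the horizontal isotropy condition, and the third the
  vertical one.\<close>

lemma repr_iff:
  assumes cZ: "c\<^sup>2 * (norm (Z z))\<^sup>2 < 1" and w: "norm w < 1" and ct: "c \<noteq> 0 \<or> \<tau> \<noteq> 0"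
    and g: "g z = (w + c * Z z) / (1 + c * cnj (Z z) * w)"
  shows "repr_horiz_at c \<tau> g Z z \<longleftrightarrow>
      wz g z = wz Z z * ((complex_of_real c + \<i> * \<tau>) / 2) * (1 - w * cnj w)\<^sup>2 / (1 + complex_of_real c * cnj (Z z) * w)\<^sup>2 \<and>
      cnj (wzb Z z) = - (cnj w)\<^sup>2 * wz Z z" (is "_ \<longleftrightarrow> ?r1 \<and> ?r2")
    and "repr_at c \<tau> g Z h z \<longleftrightarrow> repr_horiz_at c \<tau> g Z z \<and>
      wz (\<lambda>z. complex_of_real (h z)) z - vert c \<tau> Z z = - cnj w * horiz c Z z"
proof -
  define C s E K D u v where defs: "C = complex_of_real c" "s = \<i> * complex_of_real \<tau>" "E = 1 + C * cnj (Z z) * w"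
    "K = 1 - C\<^sup>2 * Z z * cnj (Z z)" "D = 1 - g z * cnj (g z)" "u = 1 - C * Z z * cnj (g z)" "v = g z - C * Z z"
  note M = moebius_identities[OF cZ w, folded g, folded defs(1), folded defs(3,4,5,6,7)]
  have cs: "C + s \<noteq> 0" "C - s \<noteq> 0" using sum_i_nonzero[OF ct] by (simp_all add: defs)
  define l where "l = 1 - w * cnj w"
  have l: "l \<noteq> 0" using one_minus_norm_nonzero[OF w] by (simp add: l_def)
  have E: "E \<noteq> 0" "cnj E \<noteq> 0" and K: "K \<noteq> 0" using M by auto
  have u: "u = K / cnj E" and D: "D = l * K / (E * cnj E)" and v: "v = K * w / E" using M by (simp_all add: l_def)
  have cK: "cnj K = K" by (simp add: defs mult_ac)
  have cl: "cnj l = l" by (simp add: l_def mult.commute)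
  have cC: "cnj C = C" "cnj s = - s" by (simp_all add: defs)
  \<comment> \<open>The common factors cancel, leaving \<open>u / D = E / l\<close> and
    \<open>v / D = w * cnj E / l\<close>.\<close>
  have uD: "u\<^sup>2 / D\<^sup>2 = E\<^sup>2 / l\<^sup>2" and vD: "v\<^sup>2 / D\<^sup>2 = w\<^sup>2 * (cnj E)\<^sup>2 / l\<^sup>2"
    unfolding u v D using E K l by (simp_all add: field_simps)
  define p q G where pq: "p = wz Z z" "q = wzb Z z" "G = wz g z"
  have r1: "p = 2 / (C + s) * (u\<^sup>2 / D\<^sup>2) * G \<longleftrightarrow> G = p * ((C + s) / 2) * l\<^sup>2 / E\<^sup>2"
  proof -
    have "p = 2 / t * (E\<^sup>2 / l\<^sup>2) * G \<longleftrightarrow> G = p * (t / 2) * l\<^sup>2 / E\<^sup>2" if "t \<noteq> 0" for t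
      using that E l by (auto simp: field_simps)
    then show ?thesis unfolding uD using cs by blast
  qed
  have r2: "q = - (2 / (C - s)) * (v\<^sup>2 / D\<^sup>2) * cnj G \<longleftrightarrow> cnj q = - (cnj w)\<^sup>2 * p"
    if G: "G = p * ((C + s) / 2) * l\<^sup>2 / E\<^sup>2"
  proof -
    have "- (2 / (C - s)) * (v\<^sup>2 / D\<^sup>2) * cnj G = - (w\<^sup>2) * cnj p"
    proof -
      have "- (2 / t) * (w\<^sup>2 * (cnj E)\<^sup>2 / l\<^sup>2) * (cnj p * (t / 2) * l\<^sup>2 / (cnj E)\<^sup>2) = - (w\<^sup>2) * cnj p" if "t \<noteq> 0" for t
        using that E l by (simp add: field_simps)
      moreover have "cnj G = cnj p * ((C - s) / 2) * l\<^sup>2 / (cnj E)\<^sup>2" unfolding G by (simp add: cC cl)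
      ultimately show ?thesis unfolding vD using cs by simp
    qed
    moreover have "q = - (w\<^sup>2) * cnj p \<longleftrightarrow> cnj q = cnj (- (w\<^sup>2) * cnj p)" by (simp only: complex_cnj_cancel_iff)
    ultimately show ?thesis by simp
  qed
  have H: "repr_horiz_at c \<tau> g Z z \<longleftrightarrow> p = 2 / (C + s) * (u\<^sup>2 / D\<^sup>2) * G \<and> q = - (2 / (C - s)) * (v\<^sup>2 / D\<^sup>2) * cnj G"
    by (simp only: repr_horiz_at_def Let_def defs pq)
  show H': "repr_horiz_at c \<tau> g Z z \<longleftrightarrow> wz g z = wz Z z * ((complex_of_real c + \<i> * \<tau>) / 2) * (1 - w * cnj w)\<^sup>2 / (1 + complex_of_real c * cnj (Z z) * w)\<^sup>2 \<and>
      cnj (wzb Z z) = - (cnj w)\<^sup>2 * wz Z z"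
  proof -
    have "repr_horiz_at c \<tau> g Z z \<longleftrightarrow> G = p * ((C + s) / 2) * l\<^sup>2 / E\<^sup>2 \<and> cnj q = - (cnj w)\<^sup>2 * p"
      unfolding H r1 using r2 by blast
    then show ?thesis by (simp only: pq defs l_def)
  qed
  have "- (2 / (C + s)) * ((cnj (g z) - C * cnj (Z z)) * u / (K * D\<^sup>2)) * G = - cnj w * horiz c Z z"
    if "p = 2 / (C + s) * (u\<^sup>2 / D\<^sup>2) * G"
  proof -
    have "cnj (g z) - C * cnj (Z z) = cnj v" by (simp add: defs)
    also have "\<dots> = (cnj w) * u" unfolding v u by (simp add: cK mult.commute)
    finally have "- (2 / (C + s)) * ((cnj (g z) - C * cnj (Z z)) * u / (K * D\<^sup>2)) * G = - cnj w * (p / K)"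
      unfolding that by (simp add: field_simps power2_eq_square)
    also have "p / K = horiz c Z z" unfolding horiz_def lam_def pq defs by simp
    finally show ?thesis .
  qed
  note third = this
  have "repr_at c \<tau> g Z h z \<longleftrightarrow> repr_horiz_at c \<tau> g Z z \<and> wz (\<lambda>z. complex_of_real (h z)) z =
      - (2 / (C + s)) * ((cnj (g z) - C * cnj (Z z)) * u / (K * D\<^sup>2)) * G + vert c \<tau> Z z"
    by (simp only: repr_at_def Let_def defs pq)
  also have "\<dots> \<longleftrightarrow> repr_horiz_at c \<tau> g Z z \<and> wz (\<lambda>z. complex_of_real (h z)) z - vert c \<tau> Z z = - cnj w * horiz c Z z"
  proof (rule conj_cong[OF refl])
    assume "repr_horiz_at c \<tau> g Z z"
    then have "p = 2 / (C + s) * (u\<^sup>2 / D\<^sup>2) * G" using H by blast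
    from third[OF this] show "wz (\<lambda>z. complex_of_real (h z)) z =
        - (2 / (C + s)) * ((cnj (g z) - C * cnj (Z z)) * u / (K * D\<^sup>2)) * G + vert c \<tau> Z z \<longleftrightarrow>
      wz (\<lambda>z. complex_of_real (h z)) z - vert c \<tau> Z z = - cnj w * horiz c Z z"
      by (simp only: diff_eq_eq)
  qed
  finally show "repr_at c \<tau> g Z h z \<longleftrightarrow> repr_horiz_at c \<tau> g Z z \<and>
      wz (\<lambda>z. complex_of_real (h z)) z - vert c \<tau> Z z = - cnj w * horiz c Z z" .
qed

text \<open>\<open>- A\<close> is the derivative of \<open>D\<close>. The terms are arranged so that
  \<open>D * \<gamma> + 2 * G * A\<close>, in which the left side of the equation for
  \<open>g\<close> is contained, appears as one factor.\<close>

lemma quotient_derivative_identity: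
  fixes k u D G \<gamma> uz A :: complex
  assumes "D \<noteq> 0"
  shows "k * (u\<^sup>2 / D\<^sup>2) * \<gamma> + k * ((2 * u * uz * D\<^sup>2 - u\<^sup>2 * (2 * D * - A)) / (D\<^sup>2)\<^sup>2) * G
    = k * (D * \<gamma> + 2 * G * A) / D ^ 3 * u\<^sup>2 + 2 * (k * G / D\<^sup>2) * u * uz"
  using assms by (simp add: field_simps power2_eq_square power3_eq_cube)

text \<open>Each of the two mixed derivatives is obtained by differentiating one equation of the
  formula, before any equation for \<open>g\<close> is known. The first part is used in both
  directions of the theorem.\<close>

lemma repr_second_derivatives:
  assumes W: "open W" "z \<in> W" and g: "smooth_on g W" "\<And>z. z \<in> W \<Longrightarrow> norm (g z) < 1"
    and Z: "smooth_on Z W" and r: "\<And>z. z \<in> W \<Longrightarrow> repr_horiz_at c \<tau> g Z z"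
  defines "C \<equiv> complex_of_real c" and "s \<equiv> \<i> * complex_of_real \<tau>" and "D \<equiv> 1 - g z * cnj (g z)" and "G \<equiv> wz g z"
    and "u \<equiv> 1 - complex_of_real c * Z z * cnj (g z)" and "v \<equiv> g z - complex_of_real c * Z z"
  shows "wzb (wz Z) z = 2 / (C + s) * (D * wzb (wz g) z + 2 * G * (g z * cnj G + wzb g z * cnj (g z))) / D ^ 3 * u\<^sup>2
      + 2 * (2 / (C + s) * G / D\<^sup>2) * u * (- (C * (Z z * cnj G + wzb Z z * cnj (g z))))"
    and "wz (wzb Z) z = - (2 / (C - s) * (D * cnj (wzb (wz g) z) + 2 * cnj G * (g z * cnj (wzb g z) + G * cnj (g z))) / D ^ 3 * v\<^sup>2
      + 2 * (2 / (C - s) * cnj G / D\<^sup>2) * v * (G - C * wz Z z))"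
proof -
  have D0: "D \<noteq> 0" using one_minus_norm_nonzero[OF g(2)[OF W(2)]] by (simp add: D_def)
  have gd: "has_wirtinger g G (wzb g z) z" unfolding G_def by (rule smooth_on_has_wirtinger[OF g(1) W(2)])
  have Zd: "has_wirtinger Z (wz Z z) (wzb Z z) z" by (rule smooth_on_has_wirtinger[OF Z W(2)])
  have Gd: "has_wirtinger (wz g) (wz (wz g) z) (wzb (wz g) z) z"
    by (rule smooth_on_has_wirtinger[OF smooth_on_wz[OF W(1) g(1)] W(2)])
  have D2: "(1 - g z * cnj (g z))\<^sup>2 \<noteq> 0" using D0 by (simp add: D_def)
  define k where "k = 2 / (C + s)" define k' where "k' = 2 / (C - s)"
  have F0: "has_wirtinger (\<lambda>z. k * ((1 - C * Z z * cnj (g z))\<^sup>2 / (1 - g z * cnj (g z))\<^sup>2) * wz g z)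
      (k * (u\<^sup>2 / D\<^sup>2) * wz (wz g) z +
       (k * ((2 * u * (0 - (C * Z z * cnj (wzb g z) + (C * wz Z z + 0 * Z z) * cnj (g z))) * D\<^sup>2
          - u\<^sup>2 * (2 * D * (0 - (g z * cnj (wzb g z) + G * cnj (g z))))) / (D\<^sup>2)\<^sup>2) + 0 * (u\<^sup>2 / D\<^sup>2)) * wz g z)
      (k * (u\<^sup>2 / D\<^sup>2) * wzb (wz g) z +
       (k * ((2 * u * (0 - (C * Z z * cnj G + (C * wzb Z z + 0 * Z z) * cnj (g z))) * D\<^sup>2
          - u\<^sup>2 * (2 * D * (0 - (g z * cnj G + wzb g z * cnj (g z))))) / (D\<^sup>2)\<^sup>2) + 0 * (u\<^sup>2 / D\<^sup>2)) * wz g z) z"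
    unfolding u_def D_def C_def[symmetric]
    by (intro has_wirtinger_mult has_wirtinger_divide has_wirtinger_power2 has_wirtinger_diff has_wirtinger_const
        has_wirtinger_cnj gd Zd Gd D2)
  note F = has_wirtinger_wz[OF F0]
  have "wzb (wz Z) z = wzb (\<lambda>z. k * ((1 - C * Z z * cnj (g z))\<^sup>2 / (1 - g z * cnj (g z))\<^sup>2) * wz g z) z"
    by (rule has_wirtinger_unique(2)[OF has_wirtinger_transform[OF has_wirtinger_works[OF has_wirtinger_differentiable[OF F]] W]])
      (use r in \<open>auto simp: repr_horiz_at_def Let_def k_def C_def s_def\<close>)
  also have "\<dots> = k * (u\<^sup>2 / D\<^sup>2) * wzb (wz g) z + k * ((2 * u * (- (C * (Z z * cnj G + wzb Z z * cnj (g z)))) * D\<^sup>2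
      - u\<^sup>2 * (2 * D * - (g z * cnj G + wzb g z * cnj (g z)))) / (D\<^sup>2)\<^sup>2) * G"
    unfolding has_wirtinger_unique(2)[OF F] by (simp add: algebra_simps G_def)
  also have "\<dots> = k * (D * wzb (wz g) z + 2 * G * (g z * cnj G + wzb g z * cnj (g z))) / D ^ 3 * u\<^sup>2
      + 2 * (k * G / D\<^sup>2) * u * (- (C * (Z z * cnj G + wzb Z z * cnj (g z))))"
    by (rule quotient_derivative_identity[OF D0])
  finally show "wzb (wz Z) z = 2 / (C + s) * (D * wzb (wz g) z + 2 * G * (g z * cnj G + wzb g z * cnj (g z))) / D ^ 3 * u\<^sup>2
      + 2 * (2 / (C + s) * G / D\<^sup>2) * u * (- (C * (Z z * cnj G + wzb Z z * cnj (g z))))"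
    unfolding k_def .
  have F2: "has_wirtinger (\<lambda>z. k' * ((g z - C * Z z)\<^sup>2 / (1 - g z * cnj (g z))\<^sup>2) * cnj (wz g z))
      (k' * (v\<^sup>2 / D\<^sup>2) * cnj (wzb (wz g) z) +
       (k' * ((2 * v * (G - (C * wz Z z + 0 * Z z)) * D\<^sup>2
          - v\<^sup>2 * (2 * D * (0 - (g z * cnj (wzb g z) + G * cnj (g z))))) / (D\<^sup>2)\<^sup>2) + 0 * (v\<^sup>2 / D\<^sup>2)) * cnj (wz g z))
      (k' * (v\<^sup>2 / D\<^sup>2) * cnj (wz (wz g) z) +
       (k' * ((2 * v * (wzb g z - (C * wzb Z z + 0 * Z z)) * D\<^sup>2
          - v\<^sup>2 * (2 * D * (0 - (g z * cnj G + wzb g z * cnj (g z))))) / (D\<^sup>2)\<^sup>2) + 0 * (v\<^sup>2 / D\<^sup>2)) * cnj (wz g z)) z"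
    unfolding v_def D_def C_def[symmetric]
    by (intro has_wirtinger_mult has_wirtinger_divide has_wirtinger_power2 has_wirtinger_diff has_wirtinger_const
        has_wirtinger_cnj gd Zd Gd D2)
  note F2' = has_wirtinger_minus[OF F2]
  have "wz (wzb Z) z = wz (\<lambda>z. - (k' * ((g z - C * Z z)\<^sup>2 / (1 - g z * cnj (g z))\<^sup>2) * cnj (wz g z))) z"
    by (rule has_wirtinger_unique(1)[OF has_wirtinger_transform[OF has_wirtinger_works[OF has_wirtinger_differentiable[OF F2']] W]])
      (use r in \<open>auto simp: repr_horiz_at_def Let_def k'_def C_def s_def\<close>)
  also have "\<dots> = - (k' * (v\<^sup>2 / D\<^sup>2) * cnj (wzb (wz g) z) + k' * ((2 * v * (G - C * wz Z z) * D\<^sup>2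
      - v\<^sup>2 * (2 * D * - (g z * cnj (wzb g z) + G * cnj (g z)))) / (D\<^sup>2)\<^sup>2) * cnj G)"
    unfolding has_wirtinger_unique(1)[OF F2'] by (simp add: algebra_simps G_def)
  also have "\<dots> = - (k' * (D * cnj (wzb (wz g) z) + 2 * cnj G * (g z * cnj (wzb g z) + G * cnj (g z))) / D ^ 3 * v\<^sup>2
      + 2 * (k' * cnj G / D\<^sup>2) * v * (G - C * wz Z z))"
    by (rule arg_cong[where f=uminus]) (rule quotient_derivative_identity[OF D0])
  finally show "wz (wzb Z) z = - (2 / (C - s) * (D * cnj (wzb (wz g) z) + 2 * cnj G * (g z * cnj (wzb g z) + G * cnj (g z))) / D ^ 3 * v\<^sup>2
      + 2 * (2 / (C - s) * cnj G / D\<^sup>2) * v * (G - C * wz Z z))"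
    unfolding k'_def .
qed

lemma smooth_on_horiz:
  assumes "open W" "smooth_on Z W" "\<And>z. z \<in> W \<Longrightarrow> c\<^sup>2 * (norm (Z z))\<^sup>2 < 1"
  shows "smooth_on (horiz c Z) W"
  unfolding horiz_def[abs_def] using assms by (intro smooth_intros smooth_on_lam) auto

lemma smooth_on_vert:
  assumes "open W" "smooth_on Z W" "\<And>z. z \<in> W \<Longrightarrow> c\<^sup>2 * (norm (Z z))\<^sup>2 < 1"
  shows "smooth_on (vert c \<tau> Z) W"
  unfolding vert_def[abs_def] using assms by (intro smooth_intros smooth_on_lam) auto

theorem surface_imp_gauss:
  fixes c \<tau> :: real and Z g w :: "complex \<Rightarrow> complex"
  assumes W: "open W" and Z: "smooth_on Z W" and h: "smooth_on (\<lambda>z. complex_of_real (h z)) W"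
    and cZ: "\<And>z. z \<in> W \<Longrightarrow> c\<^sup>2 * (norm (Z z))\<^sup>2 < 1" and ct: "c \<noteq> 0 \<or> \<tau> \<noteq> 0"
    and iso: "\<And>z. z \<in> W \<Longrightarrow> isotropic_at c \<tau> Z h z (w z)" and cmc: "\<And>z. z \<in> W \<Longrightarrow> cmc_at c \<tau> Z h z (w z)"
    and g: "\<And>z. z \<in> W \<Longrightarrow> g z = (w z + c * Z z) / (1 + c * cnj (Z z) * w z)"
  shows "smooth_on g W" "\<And>z. z \<in> W \<Longrightarrow> norm (g z) < 1 \<and> wz g z \<noteq> 0 \<and> repr_at c \<tau> g Z h z \<and> gauss_at g z"
proof -
  define R where "R = (\<lambda>z. wz (\<lambda>z. complex_of_real (h z)) z - vert c \<tau> Z z)"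
  define C where "C = complex_of_real c"
  have P0: "horiz c Z z \<noteq> 0" if "z \<in> W" for z
    using iso[OF that] lam_facts(3)[OF cZ[OF that]] by (simp add: horiz_def isotropic_at_def)
  have w1: "norm (w z) < 1" and Rw: "R z = - cnj (w z) * horiz c Z z" and qb: "cnj (wzb Z z) = - (cnj (w z))\<^sup>2 * wz Z z"
    and p0: "wz Z z \<noteq> 0" if "z \<in> W" for z
    using iso[OF that] by (auto simp: isotropic_at_def R_def)
  \<comment> \<open>Isotropy recovers \<open>w\<close> from derivatives of the surface, which is
    where the smoothness of \<open>w\<close>, and then of \<open>g\<close>, comes from.\<close>
  have wR: "w z = - cnj (R z / horiz c Z z)" if "z \<in> W" for z
    using Rw[OF that] P0[OF that] by simp
  have "smooth_on (\<lambda>z. - cnj (R z / horiz c Z z)) W" unfolding R_def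
    by (intro smooth_intros smooth_on_horiz smooth_on_vert W Z h cZ P0)
  then have ws: "smooth_on w W" by (rule smooth_on_cong[OF W]) (simp add: wR)
  have E0: "1 + C * cnj (Z z) * w z \<noteq> 0" if "z \<in> W" for z
    using moebius_denominator_nonzero(1)[OF cZ[OF that] w1[OF that]] by (simp add: C_def)
  have "smooth_on (\<lambda>z. (w z + C * Z z) / (1 + C * cnj (Z z) * w z)) W"
    by (intro smooth_intros W Z ws E0)
  then show gs: "smooth_on g W" by (rule smooth_on_cong[OF W]) (simp add: g C_def)
  have wzw: "wz w z = stereo_dz c \<tau> (Z z) (horiz c Z z) (w z)" if z: "z \<in> W" for z
  proof -
    note D = cmc_derivatives[OF W z Z h cZ iso[OF z], folded R_def]
    define P Pz Pzb Rz Rzb where defs: "P = horiz c Z z" "Pz = wz (horiz c Z) z" "Pzb = wzb (horiz c Z) z" "Rz = wz R z" "Rzb = wzb R z"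
    have P: "P \<noteq> 0" using P0[OF z] by (simp add: defs)
    have Pb: "Pzb = P * cnj P * (C\<^sup>2 * (Z z + cnj (Z z) * (w z)\<^sup>2) - \<i> * \<tau> * w z * (1 - w z * cnj (w z)) + C * w z * (1 + w z * cnj (w z)))"
      and Rb: "Rzb = (C + \<i> * \<tau>) / 2 * P * cnj P * (1 - (w z)\<^sup>2 * (cnj (w z))\<^sup>2)"
      using D(1) cmc[OF z] by (simp_all add: defs C_def)
    have "has_wirtinger (\<lambda>z. - cnj (R z / horiz c Z z)) (- cnj ((Rzb * P - R z * Pzb) / P\<^sup>2)) (- cnj ((Rz * P - R z * Pz) / P\<^sup>2)) z"
      unfolding defs by (intro has_wirtinger_minus has_wirtinger_cnj has_wirtinger_divide D(2,3) P0 z)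
    then have "has_wirtinger w (- cnj ((Rzb * P - R z * Pzb) / P\<^sup>2)) (- cnj ((Rz * P - R z * Pz) / P\<^sup>2)) z"
      by (rule has_wirtinger_transform[OF _ W z]) (simp add: wR)
    then have "wz w z = - cnj ((Rzb * P - R z * Pzb) / P\<^sup>2)" by (rule has_wirtinger_unique)
    also have "(Rzb * P - R z * Pzb) / P\<^sup>2 = (Rzb + cnj (w z) * Pzb) / P"
      using P Rw[OF z] by (simp add: defs(1) field_simps power2_eq_square)
    also have "- cnj ((Rzb + cnj (w z) * Pzb) / P) = - (cnj Rzb + w z * cnj Pzb) / cnj P" by (simp add: minus_divide_left)
    also have "cnj Rzb + w z * cnj Pzb = P * cnj P * (C / 2 * (1 + w z * cnj (w z))\<^sup>2 - \<i> * \<tau> / 2 * (1 - w z * cnj (w z))\<^sup>2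
        + C\<^sup>2 * w z * (cnj (Z z) + Z z * (cnj (w z))\<^sup>2))"
      using stereo_derivative[of C "\<i> * \<tau>" P "cnj P" "w z" "cnj (w z)" "cnj (Z z)" "Z z"]
      unfolding Pb Rb by (simp add: C_def mult_ac)
    finally show ?thesis using P by (simp add: stereo_dz_def defs(1) C_def)
  qed
  have gz: "wz g z = wz Z z * ((C + \<i> * \<tau>) / 2) * (1 - w z * cnj (w z))\<^sup>2 / (1 + C * cnj (Z z) * w z)\<^sup>2" if z: "z \<in> W" for z
  proof -
    have Zd: "has_wirtinger Z (wz Z z) (wzb Z z) z" by (rule smooth_on_has_wirtinger[OF Z z])
    have wd: "has_wirtinger w (stereo_dz c \<tau> (Z z) (horiz c Z z) (w z)) (wzb w z) z"
      using smooth_on_has_wirtinger[OF ws z] unfolding wzw[OF z] .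
    note * = gauss_dz[OF cZ[OF z] Zd wd w1[OF z] qb[OF z], folded C_def]
    have "has_wirtinger g (wz Z z * ((C + \<i> * \<tau>) / 2) * (1 - w z * cnj (w z))\<^sup>2 / (1 + C * cnj (Z z) * w z)\<^sup>2)
      (wzb (\<lambda>z. (w z + C * Z z) / (1 + C * cnj (Z z) * w z)) z) z"
      using *(1) unfolding *(2)
      by (rule has_wirtinger_transform[OF _ W z]) (simp add: g C_def)
    then show ?thesis by (rule has_wirtinger_unique)
  qed
  have r: "repr_at c \<tau> g Z h z" and rh: "repr_horiz_at c \<tau> g Z z" if z: "z \<in> W" for z
    using repr_iff(1)[of c Z z "w z" \<tau> g, OF cZ[OF z] w1[OF z] ct g[OF z]]
      repr_iff(2)[of c Z z "w z" \<tau> g h, OF cZ[OF z] w1[OF z] ct g[OF z]] gz[OF z] qb[OF z] Rw[OF z]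
    by (auto simp: C_def R_def)
  have g1: "norm (g z) < 1" if z: "z \<in> W" for z
    using moebius_identities(4)[OF cZ[OF z] w1[OF z]] g[OF z] by simp
  have gz0: "wz g z \<noteq> 0" if z: "z \<in> W" for z
    using gz[OF z] p0[OF z] sum_i_nonzero(1)[OF ct] E0[OF z] one_minus_norm_nonzero[OF w1[OF z]] by (simp add: C_def)
  have "gauss_at g z" if z: "z \<in> W" for z
  proof -
    define s where "s = \<i> * complex_of_real \<tau>"
    define D G u v E where defs: "D = 1 - g z * cnj (g z)" "G = wz g z" "u = 1 - C * Z z * cnj (g z)" "v = g z - C * Z z"
      "E = D * wzb (wz g) z + 2 * cnj (g z) * G * wzb g z"
    have S: "wzb (wz Z) z = 2 / (C + s) * (D * wzb (wz g) z + 2 * G * (g z * cnj G + wzb g z * cnj (g z))) / D ^ 3 * u\<^sup>2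
        + 2 * (2 / (C + s) * G / D\<^sup>2) * u * (- (C * (Z z * cnj G + wzb Z z * cnj (g z))))"
      "wz (wzb Z) z = - (2 / (C - s) * (D * cnj (wzb (wz g) z) + 2 * cnj G * (g z * cnj (wzb g z) + G * cnj (g z))) / D ^ 3 * v\<^sup>2
        + 2 * (2 / (C - s) * cnj G / D\<^sup>2) * v * (G - C * wz Z z))"
      unfolding defs(1-4) C_def s_def by (rule repr_second_derivatives[OF W z gs _ Z]; fact g1 rh)+
    have D0: "D \<noteq> 0" using one_minus_norm_nonzero[OF g1[OF z]] by (simp add: defs)
    have cs: "C + s \<noteq> 0" "C - s \<noteq> 0" using sum_i_nonzero[OF ct] by (simp_all add: C_def s_def)
    have p: "wz Z z = 2 / (C + s) * (u\<^sup>2 / D\<^sup>2) * G" and q: "wzb Z z = - (2 / (C - s)) * (v\<^sup>2 / D\<^sup>2) * cnj G"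
      using rh[OF z] by (simp_all add: repr_horiz_at_def Let_def defs C_def s_def)
    define a ab where ab: "a = 2 / (C + s) * G / D\<^sup>2" "ab = 2 / (C - s) * cnj G / D\<^sup>2"
    have pa: "wz Z z = a * u\<^sup>2" and qa: "wzb Z z = - ab * v\<^sup>2" unfolding p q ab by simp_all
    have cD: "cnj D = D" by (simp add: defs mult.commute)
    have Eb: "cnj E = D * cnj (wzb (wz g) z) + 2 * g z * cnj G * cnj (wzb g z)" by (simp add: defs(5) cD)
    have e1: "D * wzb (wz g) z + 2 * G * (g z * cnj G + wzb g z * cnj (g z)) = E + 2 * g z * G * cnj G"
      by (simp add: defs(5) algebra_simps)
    have e2: "D * cnj (wzb (wz g) z) + 2 * cnj G * (g z * cnj (wzb g z) + G * cnj (g z)) = cnj E + 2 * cnj (g z) * G * cnj G"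
      unfolding Eb by (simp add: algebra_simps)
    have "2 / (C + s) * (E + 2 * g z * G * cnj G) / D ^ 3 * u\<^sup>2 + 2 * a * u * (- (C * (Z z * cnj G + (- ab * v\<^sup>2) * cnj (g z))))
       = - (2 / (C - s) * (cnj E + 2 * cnj (g z) * G * cnj G) / D ^ 3 * v\<^sup>2 + 2 * ab * v * (G - C * (a * u\<^sup>2)))"
      using wzb_wz[OF W Z z] unfolding S e1 e2 ab[symmetric] pa qa .
    then have "2 / (C + s) * (E + 2 * g z * G * cnj G) / D ^ 3 * u\<^sup>2 + 2 / (C - s) * (cnj E + 2 * cnj (g z) * G * cnj G) / D ^ 3 * v\<^sup>2
       = 2 * a * u * C * (- ab * v\<^sup>2 * cnj (g z) + Z z * cnj G) - 2 * ab * v * (G - C * (a * u\<^sup>2))" (is "?l = ?r")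
      by (simp add: algebra_simps)
    then have e3: "(C + s) * (C - s) * D ^ 3 * ?l = (C + s) * (C - s) * D ^ 3 * ?r" by (rule arg_cong)
    have e4: "(C + s) * (C - s) * D ^ 3 * ?l = 2 * (E + 2 * g z * G * cnj G) * (C - s) * u\<^sup>2 + 2 * (cnj E + 2 * cnj (g z) * G * cnj G) * (C + s) * v\<^sup>2"
    proof -
      have "t * t' * d * (2 / t * e / d * u\<^sup>2 + 2 / t' * e' / d * v\<^sup>2) = 2 * e * t' * u\<^sup>2 + 2 * e' * t * v\<^sup>2"
        if "t \<noteq> 0" "t' \<noteq> 0" "d \<noteq> 0" for t t' d e e' :: complex
        using that by (simp add: field_simps)
      moreover have "D ^ 3 \<noteq> 0" using D0 by simp
      ultimately show ?thesis using cs by blast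
    qed
    have eq: "2 * (E + 2 * g z * G * cnj G) * (C - s) * u\<^sup>2 + 2 * (cnj E + 2 * cnj (g z) * G * cnj G) * (C + s) * v\<^sup>2
        = (C + s) * (C - s) * D ^ 3 * ?r" by (rule trans[OF e4[symmetric] e3])
    \<comment> \<open>\<open>E\<close> is the left side of the equation for \<open>g\<close>. Since
      \<open>C - s\<close> and \<open>C + s\<close> are conjugate, comparing moduli gives
      \<open>|E| |u|^2 = |E| |v|^2\<close> up to a nonzero factor, and
      \<open>|v| = |w| |u| < |u|\<close> leaves only \<open>E = 0\<close>.\<close>
    have "E * (C - s) * u\<^sup>2 + cnj E * (C + s) * v\<^sup>2 = 0"
    proof (rule gauss_equation_identity[OF defs(1,3,4) _ _ eq D0])
      show "a * ((C + s) * D\<^sup>2) = 2 * G" "ab * ((C - s) * D\<^sup>2) = 2 * cnj G" using cs D0 by (simp_all add: ab)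
    qed
    then have "E * (C - s) * u\<^sup>2 = - (cnj E * (C + s) * v\<^sup>2)" by (simp add: add_eq_0_iff2)
    then have "norm (E * (C - s) * u\<^sup>2) = norm (cnj E * (C + s) * v\<^sup>2)" by simp
    moreover have "norm (C - s) = norm (C + s)"
    proof -
      have "C - s = cnj (C + s)" by (simp add: C_def s_def)
      then show ?thesis by (simp only: complex_mod_cnj)
    qed
    ultimately have n: "norm E * norm (C + s) * (norm u)\<^sup>2 = norm E * norm (C + s) * (norm v)\<^sup>2"
      by (simp add: norm_mult norm_power)
    have "norm v < norm u"
    proof -
      note M = moebius_identities[OF cZ[OF z] w1[OF z], folded g[OF z], folded C_def]
      have Ed: "1 + C * cnj (Z z) * w z \<noteq> 0" "1 - C\<^sup>2 * Z z * cnj (Z z) \<noteq> 0" using M by auto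
      have "norm u = norm (1 - C\<^sup>2 * Z z * cnj (Z z)) / norm (1 + C * cnj (Z z) * w z)"
        using M(1) unfolding defs(3) by (simp only: norm_divide complex_mod_cnj)
      moreover have "norm v = norm (1 - C\<^sup>2 * Z z * cnj (Z z)) * norm (w z) / norm (1 + C * cnj (Z z) * w z)"
        using M(3) unfolding defs(4) by (simp only: norm_divide norm_mult)
      ultimately show ?thesis using w1[OF z] Ed by (simp add: divide_strict_right_mono)
    qed
    then have "(norm v)\<^sup>2 < (norm u)\<^sup>2" by (intro power_strict_mono) auto
    then have "norm E = 0" using n cs by auto
    then show ?thesis by (simp add: gauss_at_def defs)
  qed
  then show "\<And>z. z \<in> W \<Longrightarrow> norm (g z) < 1 \<and> wz g z \<noteq> 0 \<and> repr_at c \<tau> g Z h z \<and> gauss_at g z"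
    using g1 gz0 r by blast
qed

text \<open>The reverse computation. The derivative of \<open>w\<close> follows from two expressions
  for \<open>g\<^sub>z\<close>, and the equation for \<open>g\<close> enters once, in the mixed
  derivative of \<open>\<zeta>\<close>. Together they determine the conjugate derivatives of the
  horizontal and vertical parts.\<close>

lemma repr_imp_derivatives:
  fixes c \<tau> :: real
  assumes W: "open W" "z \<in> W" and g: "smooth_on g W" "\<And>z. z \<in> W \<Longrightarrow> norm (g z) < 1"
    and Z: "smooth_on Z W" and r: "\<And>z. z \<in> W \<Longrightarrow> repr_horiz_at c \<tau> g Z z"
    and cZ: "\<And>z. z \<in> W \<Longrightarrow> c\<^sup>2 * (norm (Z z))\<^sup>2 < 1" and ct: "c \<noteq> 0 \<or> \<tau> \<noteq> 0"
    and eq: "gauss_at g z"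
  defines "C \<equiv> complex_of_real c" and "s \<equiv> \<i> * complex_of_real \<tau>" and "P \<equiv> horiz c Z z"
    and "w \<equiv> \<lambda>z. (g z - complex_of_real c * Z z) / (1 - complex_of_real c * cnj (Z z) * g z)"
  shows "wzb (horiz c Z) z = P * cnj P * (C\<^sup>2 * (Z z + cnj (Z z) * (w z)\<^sup>2) - s * w z * (1 - w z * cnj (w z)) + C * w z * (1 + w z * cnj (w z)))"
    "has_wirtinger (\<lambda>z. - cnj (w z) * horiz c Z z) (wz (\<lambda>z. - cnj (w z) * horiz c Z z) z)
      ((C + s) / 2 * P * cnj P * (1 - (w z)\<^sup>2 * (cnj (w z))\<^sup>2)) z"
proof -
  have w1: "norm (w z) < 1" and gw: "g z = (w z + c * Z z) / (1 + c * cnj (Z z) * w z)" if "z \<in> W" for z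
    using moebius_inverse[OF cZ[OF that] g(2)[OF that]] by (simp_all add: w_def)
  define E where "E = 1 + C * cnj (Z z) * w z"
  define K where "K = 1 - C\<^sup>2 * Z z * cnj (Z z)"
  note M = moebius_identities[OF cZ[OF W(2)] w1[OF W(2)], folded gw[OF W(2)], folded C_def, folded E_def K_def]
  have cE: "cnj E = 1 + C * Z z * cnj (w z)" by (simp add: E_def C_def)
  have cK: "cnj K = K" by (simp add: K_def C_def mult_ac)
  have KP: "wz Z z = K * P" "cnj (wz Z z) = K * cnj P"
  proof -
    show 1: "wz Z z = K * P"
      using lam_facts(2)[OF cZ[OF W(2)]] unfolding P_def horiz_def K_def C_def by (simp add: mult.assoc[symmetric] mult.commute)
    show "cnj (wz Z z) = K * cnj P" unfolding 1 by (simp add: cK)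
  qed
  have R: "wz g z = wz Z z * ((C + s) / 2) * (1 - w z * cnj (w z))\<^sup>2 / E\<^sup>2" "cnj (wzb Z z) = - (cnj (w z))\<^sup>2 * wz Z z"
    using repr_iff(1)[of c Z z "w z" \<tau> g, OF cZ[OF W(2)] w1[OF W(2)] ct gw[OF W(2)]] r[OF W(2)]
    by (simp_all add: C_def s_def E_def)
  have q: "wzb Z z = - K * (w z)\<^sup>2 * cnj P"
  proof -
    have "wzb Z z = cnj (- (cnj (w z))\<^sup>2 * wz Z z)" using R(2) by (metis complex_cnj_cnj)
    then show ?thesis using KP(2) by simp
  qed
  have E0: "1 - C * cnj (Z z) * g z \<noteq> 0" if "z \<in> W" for z
    using moebius_denominator_nonzero(2)[OF cZ[OF that] g(2)[OF that]] by (simp add: C_def)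
  have ws: "smooth_on w W" unfolding w_def C_def[symmetric] by (intro smooth_intros W Z g E0)
  have Zd: "has_wirtinger Z (wz Z z) (wzb Z z) z" by (rule smooth_on_has_wirtinger[OF Z W(2)])
  have wd: "has_wirtinger w (wz w z) (wzb w z) z" by (rule smooth_on_has_wirtinger[OF ws W(2)])
  define d where "d = stereo_dz c \<tau> (Z z) (horiz c Z z) (w z)"
  have wzw: "wz w z = d"
  proof -
    note G = gauss_dz[OF cZ[OF W(2)] Zd wd w1[OF W(2)] R(2), folded C_def, folded E_def]
    have "has_wirtinger g (((wz w z + C * wz Z z) * E - (w z + C * Z z) * (C * (cnj (wzb Z z) * w z + cnj (Z z) * wz w z))) / E\<^sup>2)
      (wzb (\<lambda>z. (w z + C * Z z) / (1 + C * cnj (Z z) * w z)) z) z"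
      by (rule has_wirtinger_transform[OF G(1) W]) (simp add: gw C_def)
    then have "wz g z = ((wz w z + C * wz Z z) * E - (w z + C * Z z) * (C * (cnj (wzb Z z) * w z + cnj (Z z) * wz w z))) / E\<^sup>2"
      by (rule has_wirtinger_unique)
    moreover have "wz g z = ((d + C * wz Z z) * E - (w z + C * Z z) * (C * (cnj (wzb Z z) * w z + cnj (Z z) * d))) / E\<^sup>2"
      unfolding R(1) d_def G(2) s_def ..
    ultimately have "(wz w z + C * wz Z z) * E - (w z + C * Z z) * (C * (cnj (wzb Z z) * w z + cnj (Z z) * wz w z))
      = (d + C * wz Z z) * E - (w z + C * Z z) * (C * (cnj (wzb Z z) * w z + cnj (Z z) * d))"
      using M(5) by simp
    \<comment> \<open>Both expressions for \<open>g\<^sub>z\<close> depend on the derivative of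
      \<open>w\<close> in the same affine way, with the nonzero slope \<open>K\<close> up to the
      common denominator.\<close>
    then have "(E - (w z + C * Z z) * (C * cnj (Z z))) * (wz w z - d) = 0" by (simp add: algebra_simps)
    moreover have "E - (w z + C * Z z) * (C * cnj (Z z)) = K" by (simp add: E_def K_def power2_eq_square algebra_simps)
    ultimately show ?thesis using M(6) by simp
  qed
  define D G u where defs: "D = 1 - g z * cnj (g z)" "G = wz g z" "u = 1 - C * Z z * cnj (g z)"
  have D0: "D \<noteq> 0" using one_minus_norm_nonzero[OF g(2)[OF W(2)]] by (simp add: defs)
  have u0: "u \<noteq> 0" using M(1,5,6) by (simp add: defs)
  have p: "wz Z z = 2 / (C + s) * (u\<^sup>2 / D\<^sup>2) * G"
    using r[OF W(2)] by (simp add: repr_horiz_at_def Let_def defs C_def s_def)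
  \<comment> \<open>The equation for \<open>g\<close> removes both the second derivative and the
    conjugate derivative of \<open>g\<close>.\<close>
  have e: "D * wzb (wz g) z + 2 * G * (g z * cnj G + wzb g z * cnj (g z)) = 2 * g z * G * cnj G"
    using eq unfolding gauss_at_def defs by (simp add: algebra_simps)
  have "wzb (wz Z) z = 2 / (C + s) * (2 * g z * G * cnj G) / D ^ 3 * u\<^sup>2
      + 2 * (2 / (C + s) * G / D\<^sup>2) * u * (- (C * (Z z * cnj G + wzb Z z * cnj (g z))))"
    using repr_second_derivatives(1)[OF W g Z r, folded C_def s_def, folded defs] unfolding e .
  also have "\<dots> = wz Z z * (2 * g z * cnj G / D - 2 * C * (wzb Z z * cnj (g z) + Z z * cnj G) / u)"
  proof -
    have "2 / t * (2 * a * G * b) / D ^ 3 * u\<^sup>2 + 2 * (2 / t * G / D\<^sup>2) * u * (- e)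
      = 2 / t * (u\<^sup>2 / D\<^sup>2) * G * (2 * a * b / D - 2 * e / u)" if "t \<noteq> 0" for t a b e
      using that D0 u0 by (simp add: field_simps power2_eq_square power3_eq_cube)
    then show ?thesis unfolding p using sum_i_nonzero(1)[OF ct] by (simp add: C_def s_def mult.assoc)
  qed
  also have "\<dots> = K * (P * cnj P * ((C - s) * w z * (1 - w z * cnj (w z)) + 2 * C * (w z)\<^sup>2 * (cnj (w z) + C * cnj (Z z))))"
    unfolding KP(1)
  proof (rule second_derivative_identity[OF K_def E_def cE])
    show "g z = (w z + C * Z z) / E" using gw[OF W(2)] by (simp add: E_def C_def)
    then show "cnj (g z) = (cnj (w z) + C * cnj (Z z)) / cnj E" by (simp add: C_def)
    show "1 - w z * cnj (w z) \<noteq> 0" by (rule one_minus_norm_nonzero[OF w1[OF W(2)]])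
    show "D = (1 - w z * cnj (w z)) * K / (E * cnj E)" "u = K / cnj E" using M(1,2) by (simp_all add: defs)
    show "wzb Z z = - K * (w z)\<^sup>2 * cnj P" by (rule q)
    show "cnj G = K * cnj P * ((C - s) / 2) * (1 - w z * cnj (w z))\<^sup>2 / (cnj E)\<^sup>2"
      unfolding defs R(1) by (simp add: KP(2) C_def s_def mult.commute)
  qed (use M in auto)
  finally have m: "wzb (wz Z) z = K * (P * cnj P * ((C - s) * w z * (1 - w z * cnj (w z)) + 2 * C * (w z)\<^sup>2 * (cnj (w z) + C * cnj (Z z))))" .
  define L where "L = lam c (Z z)"
  have LK: "L * K = 1" using lam_facts(2)[OF cZ[OF W(2)]] by (simp add: L_def K_def C_def)
  have "wzb (horiz c Z) z = C\<^sup>2 * L\<^sup>2 * (cnj (Z z) * wzb Z z + Z z * cnj (wz Z z)) * wz Z z + L * wzb (wz Z) z"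
    using has_wirtinger_unique(2)[OF has_wirtinger_horizontal[OF W Z cZ]] unfolding horiz_def[abs_def] C_def L_def by simp
  also have "\<dots> = P * cnj P * (C\<^sup>2 * (Z z + cnj (Z z) * (w z)\<^sup>2) - s * w z * (1 - w z * cnj (w z)) + C * w z * (1 + w z * cnj (w z)))"
    unfolding m KP(2) unfolding KP(1) q using LK by algebra
  finally show Pzb: "wzb (horiz c Z) z = P * cnj P * (C\<^sup>2 * (Z z + cnj (Z z) * (w z)\<^sup>2) - s * w z * (1 - w z * cnj (w z)) + C * w z * (1 + w z * cnj (w z)))" .
  have Pd: "has_wirtinger (horiz c Z) (wz (horiz c Z) z) (wzb (horiz c Z) z) z"
    by (rule smooth_on_has_wirtinger[OF smooth_on_horiz[OF W(1) Z cZ] W(2)])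
  have "has_wirtinger (\<lambda>z. - cnj (w z) * horiz c Z z) (- cnj (w z) * wz (horiz c Z) z + - cnj (wzb w z) * horiz c Z z)
     (- cnj (w z) * wzb (horiz c Z) z + - cnj (wz w z) * horiz c Z z) z"
    by (intro has_wirtinger_mult has_wirtinger_minus has_wirtinger_cnj wd Pd)
  note this[THEN has_wirtinger_wz]
  moreover have "- cnj (w z) * wzb (horiz c Z) z + - cnj (wz w z) * horiz c Z z = (C + s) / 2 * P * cnj P * (1 - (w z)\<^sup>2 * (cnj (w z))\<^sup>2)"
  proof -
    define T where "T = C / 2 * (1 + w z * cnj (w z))\<^sup>2 + s / 2 * (1 - w z * cnj (w z))\<^sup>2 + C\<^sup>2 * cnj (w z) * (Z z + cnj (Z z) * (w z)\<^sup>2)"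
    define X where "X = wzb (horiz c Z) z"
    have d: "cnj d = - cnj P * T"
      by (simp add: d_def stereo_dz_def P_def C_def s_def T_def mult.commute)
    have "(C + s) / 2 * P * cnj P * (1 - (w z)\<^sup>2 * (cnj (w z))\<^sup>2) + cnj (w z) * X = P * cnj P * T"
      using stereo_derivative[of C "- s" P "cnj P" "cnj (w z)" "w z" "Z z" "cnj (Z z)"]
      unfolding X_def Pzb T_def by (simp add: mult.commute[of "cnj (w z)"] mult.commute[of "(cnj (w z))\<^sup>2"])
    then have e: "(C + s) / 2 * P * cnj P * (1 - (w z)\<^sup>2 * (cnj (w z))\<^sup>2) = P * cnj P * T - cnj (w z) * X"
      by (simp only: eq_diff_eq)
    show ?thesis unfolding wzw P_def[symmetric] d X_def[symmetric] e by (simp add: algebra_simps)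
  qed
  ultimately show "has_wirtinger (\<lambda>z. - cnj (w z) * horiz c Z z) (wz (\<lambda>z. - cnj (w z) * horiz c Z z) z)
      ((C + s) / 2 * P * cnj P * (1 - (w z)\<^sup>2 * (cnj (w z))\<^sup>2)) z" by (rule has_wirtinger_eq[OF _ refl])
qed

lemma smooth_on_Ck: "smooth_on f W \<Longrightarrow> Ck_on k f W"
  by (simp add: smooth_on_def)

lemma smooth_on_wz_conj:
  assumes "open W" "smooth_on S W" "\<And>z. z \<in> W \<Longrightarrow> has_wirtinger f (S z) (cnj (S z)) z"
  shows "smooth_on f W"
  by (rule smooth_on_bootstrap[OF assms(1,3)]) (use assms in \<open>auto intro: smooth_on_Ck smooth_on_cnj\<close>)

text \<open>The right sides are quadratic polynomials in \<open>Z\<close> whose coefficients are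
  smooth functions of \<open>z\<close>, so each order of differentiability of \<open>Z\<close>
  yields the next.\<close>

lemma repr_smooth_on:
  fixes c \<tau> :: real
  assumes W: "open W" and g: "smooth_on g W" "\<And>z. z \<in> W \<Longrightarrow> norm (g z) < 1"
    and Z: "\<And>z. z \<in> W \<Longrightarrow> Z differentiable (at z)" and r: "\<And>z. z \<in> W \<Longrightarrow> repr_horiz_at c \<tau> g Z z"
  shows "smooth_on Z W"
proof -
  define C where "C = complex_of_real c"
  define \<alpha> where "\<alpha> z = 2 / (C + \<i> * \<tau>) / (1 - g z * cnj (g z))\<^sup>2 * wz g z" for z
  define \<beta> where "\<beta> z = - (2 / (C - \<i> * \<tau>)) / (1 - g z * cnj (g z))\<^sup>2 * cnj (wz g z)" for z
  have D0: "(1 - g z * cnj (g z))\<^sup>2 \<noteq> 0" if "z \<in> W" for z using one_minus_norm_nonzero[OF g(2)[OF that]] by simp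
  have ab: "smooth_on \<alpha> W" "smooth_on \<beta> W"
    unfolding \<alpha>_def[abs_def] \<beta>_def[abs_def] by (intro smooth_intros W g D0; simp)+
  show ?thesis
  proof (rule smooth_on_bootstrap[OF W])
    \<comment> \<open>Squares and differences are spelled out as products, sums and negations to
      match the closure rules for \<open>Ck_on\<close>.\<close>
    show "has_wirtinger Z (\<alpha> z * ((1 + - (C * Z z * cnj (g z))) * (1 + - (C * Z z * cnj (g z)))))
        (\<beta> z * ((g z + - (C * Z z)) * (g z + - (C * Z z)))) z" if "z \<in> W" for z
      by (rule has_wirtinger_eq[OF has_wirtinger_works[OF Z[OF that]]])
        (use r[OF that] in \<open>auto simp: repr_horiz_at_def Let_def \<alpha>_def \<beta>_def C_def power2_eq_square\<close>)
    fix k assume k: "Ck_on k Z W"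
    have gk: "Ck_on k g W" "Ck_on k (\<lambda>z. cnj (g z)) W" "Ck_on k \<alpha> W" "Ck_on k \<beta> W"
      using smooth_on_Ck g(1) ab smooth_on_cnj[OF W g(1)] by auto
    show "Ck_on k (\<lambda>z. \<alpha> z * ((1 + - (C * Z z * cnj (g z))) * (1 + - (C * Z z * cnj (g z))))) W \<and>
        Ck_on k (\<lambda>z. \<beta> z * ((g z + - (C * Z z)) * (g z + - (C * Z z)))) W"
      by (intro conjI Ck_on_mult Ck_on_add Ck_on_minus Ck_on_const W k gk)
  qed
qed

theorem gauss_imp_surface:
  fixes c \<tau> :: real
  assumes W: "open W" and g: "smooth_on g W" "\<And>z. z \<in> W \<Longrightarrow> norm (g z) < 1"
    and gz: "\<And>z. z \<in> W \<Longrightarrow> wz g z \<noteq> 0" and eq: "\<And>z. z \<in> W \<Longrightarrow> gauss_at g z"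
    and Zd: "\<And>z. z \<in> W \<Longrightarrow> Z differentiable (at z)"
    and hd: "\<And>z. z \<in> W \<Longrightarrow> (\<lambda>z. complex_of_real (h z)) differentiable (at z)"
    and r: "\<And>z. z \<in> W \<Longrightarrow> repr_at c \<tau> g Z h z"
    and cZ: "\<And>z. z \<in> W \<Longrightarrow> c\<^sup>2 * (norm (Z z))\<^sup>2 < 1" and ct: "c \<noteq> 0 \<or> \<tau> \<noteq> 0"
  defines "w \<equiv> \<lambda>z. (g z - complex_of_real c * Z z) / (1 - complex_of_real c * cnj (Z z) * g z)"
  shows "smooth_on Z W" "smooth_on (\<lambda>z. complex_of_real (h z)) W"
    "\<And>z. z \<in> W \<Longrightarrow> isotropic_at c \<tau> Z h z (w z) \<and> cmc_at c \<tau> Z h z (w z)"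
proof -
  have rh: "repr_horiz_at c \<tau> g Z z" if "z \<in> W" for z using r[OF that] by (simp add: repr_at_def)
  show Z: "smooth_on Z W" by (rule repr_smooth_on[OF W g Zd rh])
  have w1: "norm (w z) < 1" and gw: "g z = (w z + c * Z z) / (1 + c * cnj (Z z) * w z)" if "z \<in> W" for z
    using moebius_inverse[OF cZ[OF that] g(2)[OF that]] by (simp_all add: w_def)
  define H where "H = (\<lambda>z. complex_of_real (h z))"
  have R: "wz g z = wz Z z * ((complex_of_real c + \<i> * \<tau>) / 2) * (1 - w z * cnj (w z))\<^sup>2 / (1 + complex_of_real c * cnj (Z z) * w z)\<^sup>2"
    "cnj (wzb Z z) = - (cnj (w z))\<^sup>2 * wz Z z" "wz H z - vert c \<tau> Z z = - cnj (w z) * horiz c Z z" if "z \<in> W" for z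
    using repr_iff(1)[of c Z z "w z" \<tau> g, OF cZ[OF that] w1[OF that] ct gw[OF that]]
      repr_iff(2)[of c Z z "w z" \<tau> g h, OF cZ[OF that] w1[OF that] ct gw[OF that]] r[OF that] rh[OF that]
    by (simp_all add: H_def)
  have E0: "1 - complex_of_real c * cnj (Z z) * g z \<noteq> 0" if "z \<in> W" for z
    using moebius_denominator_nonzero(2)[OF cZ[OF that] g(2)[OF that]] by simp
  have ws: "smooth_on w W" unfolding w_def by (intro smooth_intros W Z g E0)
  have "smooth_on (\<lambda>z. - cnj (w z) * horiz c Z z + vert c \<tau> Z z) W"
    by (intro smooth_intros smooth_on_horiz smooth_on_vert W Z cZ ws)
  \<comment> \<open>The formula gives only one derivative of the height; the other is its conjugate
    because the height is real. Both are smooth, hence so is the height.\<close>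
  moreover have "has_wirtinger H (- cnj (w z) * horiz c Z z + vert c \<tau> Z z) (cnj (- cnj (w z) * horiz c Z z + vert c \<tau> Z z)) z"
    if "z \<in> W" for z
  proof -
    have Hd: "has_wirtinger H (wz H z) (wzb H z) z" unfolding H_def by (rule has_wirtinger_works[OF hd[OF that]])
    have b: "wzb H z = cnj (wz H z)" by (rule has_wirtinger_real[OF Hd[unfolded H_def], folded H_def])
    have "wz H z = - cnj (w z) * horiz c Z z + vert c \<tau> Z z" using R(3)[OF that] by (simp add: algebra_simps)
    then show ?thesis using Hd b by simp
  qed
  ultimately have H: "smooth_on H W" by (rule smooth_on_wz_conj[OF W])
  then show "smooth_on (\<lambda>z. complex_of_real (h z)) W" by (simp add: H_def)
  show "isotropic_at c \<tau> Z h z (w z) \<and> cmc_at c \<tau> Z h z (w z)" if z: "z \<in> W" for z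
  proof -
    have iso: "isotropic_at c \<tau> Z h z (w z)"
      unfolding isotropic_at_def using R[OF z] gz[OF z] w1[OF z] by (auto simp: H_def)
    note D = cmc_derivatives(1)[OF W z Z H[unfolded H_def] cZ iso]
    have S1: "wzb (horiz c Z) z = horiz c Z z * cnj (horiz c Z z) * ((complex_of_real c)\<^sup>2 * (Z z + cnj (Z z) * (w z)\<^sup>2)
          - \<i> * complex_of_real \<tau> * w z * (1 - w z * cnj (w z)) + complex_of_real c * w z * (1 + w z * cnj (w z)))"
      unfolding w_def by (rule repr_imp_derivatives(1)[OF W z g(1) _ Z]) (use g(2) rh cZ ct eq z in auto)
    have S2: "has_wirtinger (\<lambda>z. - cnj (w z) * horiz c Z z) (wz (\<lambda>z. - cnj (w z) * horiz c Z z) z)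
        ((complex_of_real c + \<i> * complex_of_real \<tau>) / 2 * horiz c Z z * cnj (horiz c Z z) * (1 - (w z)\<^sup>2 * (cnj (w z))\<^sup>2)) z"
      unfolding w_def by (rule repr_imp_derivatives(2)[OF W z g(1) _ Z]) (use g(2) rh cZ ct eq z in auto)
    have "has_wirtinger (\<lambda>z. wz (\<lambda>z. complex_of_real (h z)) z - vert c \<tau> Z z) (wz (\<lambda>z. - cnj (w z) * horiz c Z z) z)
      ((complex_of_real c + \<i> * \<tau>) / 2 * horiz c Z z * cnj (horiz c Z z) * (1 - (w z)\<^sup>2 * (cnj (w z))\<^sup>2)) z"
      by (rule has_wirtinger_transform[OF S2 W z]) (use R(3) in \<open>simp add: H_def\<close>)
    from has_wirtinger_unique(2)[OF this] S1 show ?thesis using D iso by simp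
  qed
qed

lemma has_vector_derivative_ray:
  assumes "has_wirtinger f a b (z0 + of_real t * v)"
  shows "((\<lambda>t. f (z0 + of_real t * v)) has_vector_derivative (a * v + b * cnj v)) (at t within S)"
proof -
  have i: "((\<lambda>t. z0 + of_real t * v) has_derivative (\<lambda>h. of_real h * v)) (at t within S)"
    by (auto intro!: derivative_eq_intros)
  have "((\<lambda>t. f (z0 + of_real t * v)) has_derivative (\<lambda>h. a * (of_real h * v) + b * cnj (of_real h * v))) (at t within S)"
    using has_derivative_compose[OF i assms[unfolded has_wirtinger_def]] .
  then show ?thesis unfolding has_vector_derivative_def
    by (rule has_derivative_eq_rhs) (auto simp: fun_eq_iff scaleR_conv_of_real algebra_simps)
qed

text \<open>The difference of two solutions satisfies a homogeneous linear system.\<close>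

lemma repr_unique:
  fixes c \<tau> :: real
  assumes g: "smooth_on g (ball z0 r)" "\<And>z. z \<in> ball z0 r \<Longrightarrow> norm (g z) < 1"
    and d1: "\<And>z. z \<in> ball z0 r \<Longrightarrow> Z1 differentiable (at z)" "\<And>z. z \<in> ball z0 r \<Longrightarrow> (\<lambda>z. complex_of_real (h1 z)) differentiable (at z)"
    and d2: "\<And>z. z \<in> ball z0 r \<Longrightarrow> Z2 differentiable (at z)" "\<And>z. z \<in> ball z0 r \<Longrightarrow> (\<lambda>z. complex_of_real (h2 z)) differentiable (at z)"
    and r1: "\<And>z. z \<in> ball z0 r \<Longrightarrow> repr_at c \<tau> g Z1 h1 z" and r2: "\<And>z. z \<in> ball z0 r \<Longrightarrow> repr_at c \<tau> g Z2 h2 z"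
    and init: "Z1 z0 = Z2 z0" "h1 z0 = h2 z0" and z: "z \<in> ball z0 r"
  shows "Z1 z = Z2 z \<and> h1 z = h2 z"
proof -
  define C where "C = complex_of_real c"
  define a where "a z = 2 / (C + \<i> * \<tau>) / (1 - g z * cnj (g z))\<^sup>2 * wz g z" for z
  define b where "b z = - (2 / (C - \<i> * \<tau>)) / (1 - g z * cnj (g z))\<^sup>2 * cnj (wz g z)" for z
  have D0: "(1 - g z * cnj (g z))\<^sup>2 \<noteq> 0" if "z \<in> ball z0 r" for z using one_minus_norm_nonzero[OF g(2)[OF that]] by simp
  have "smooth_on a (ball z0 r)" "smooth_on b (ball z0 r)"
    unfolding a_def[abs_def] b_def[abs_def] by (intro smooth_intros open_ball g D0; simp)+
  then have abc: "continuous_on (ball z0 r) a" "continuous_on (ball z0 r) b" "continuous_on (ball z0 r) g"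
    using g(1) smooth_on_continuous_on by blast+
  have Zc: "continuous_on (ball z0 r) Z1" "continuous_on (ball z0 r) Z2"
    using d1 d2 by (auto intro!: continuous_at_imp_continuous_on differentiable_imp_continuous_within)
  \<comment> \<open>The difference of two squares splits off the factor \<open>Z1 - Z2\<close>;
    \<open>A\<close> and \<open>B\<close> are the cofactors, merely continuous functions built from
    both solutions.\<close>
  define A where "A z = - (a z * C * cnj (g z) * ((1 - C * Z1 z * cnj (g z)) + (1 - C * Z2 z * cnj (g z))))" for z
  define B where "B z = - (b z * C * ((g z - C * Z1 z) + (g z - C * Z2 z)))" for z
  have ABc: "continuous_on (ball z0 r) A" "continuous_on (ball z0 r) B"
    unfolding A_def B_def by (intro continuous_intros abc Zc)+
  define f where "f z = Z1 z - Z2 z" for z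
  have fd: "has_wirtinger f (A z * f z) (B z * f z) z" if "z \<in> ball z0 r" for z
  proof -
    have "has_wirtinger f (wz Z1 z - wz Z2 z) (wzb Z1 z - wzb Z2 z) z" unfolding f_def
      by (intro has_wirtinger_diff has_wirtinger_works d1 d2 that)
    moreover have "wz Z1 z - wz Z2 z = A z * f z"
    proof -
      have e: "wz Z1 z = a z * (1 - C * Z1 z * cnj (g z))\<^sup>2" "wz Z2 z = a z * (1 - C * Z2 z * cnj (g z))\<^sup>2"
        using r1[OF that] r2[OF that] by (auto simp: repr_at_def repr_horiz_at_def Let_def a_def C_def)
      show ?thesis unfolding e A_def f_def by (simp add: power2_eq_square algebra_simps)
    qed
    moreover have "wzb Z1 z - wzb Z2 z = B z * f z"
    proof -
      have e: "wzb Z1 z = b z * (g z - C * Z1 z)\<^sup>2" "wzb Z2 z = b z * (g z - C * Z2 z)\<^sup>2"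
        using r1[OF that] r2[OF that] by (auto simp: repr_at_def repr_horiz_at_def Let_def b_def C_def)
      show ?thesis unfolding e B_def f_def by (simp add: power2_eq_square algebra_simps)
    qed
    ultimately show ?thesis by simp
  qed
  have Zeq: "Z1 z = Z2 z" if z: "z \<in> ball z0 r" for z
  proof -
    define v where "v = z - z0"
    have inb: "z0 + of_real t * v \<in> ball z0 r" if "t \<in> {0..1}" for t
    proof -
      have "\<bar>t\<bar> * norm v \<le> 1 * norm v" using that by (intro mult_right_mono) auto
      then show ?thesis using z by (simp add: v_def dist_norm norm_mult norm_minus_commute)
    qed
    define M where "M t = A (z0 + of_real t * v) * v + B (z0 + of_real t * v) * cnj v" for t
    have "continuous_on {0..1} M" unfolding M_def
      by (intro continuous_intros continuous_on_compose2[OF ABc(1)] continuous_on_compose2[OF ABc(2)]) (use inb in auto)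
    then obtain N where N: "N > 0" "\<And>t. t \<in> {0..1} \<Longrightarrow> norm (M t) \<le> N"
      using compact_norm_bound[OF compact_Icc] by blast
    have "f (z0 + of_real 1 * v) = 0"
    proof (rule gronwall_zero[where f="\<lambda>t. f (z0 + of_real t * v)" and f'="\<lambda>t. M t * f (z0 + of_real t * v)" and K=N])
      fix t :: real assume t: "t \<in> {0..1}"
      show "((\<lambda>t. f (z0 + of_real t * v)) has_vector_derivative M t * f (z0 + of_real t * v)) (at t within {0..1})"
        using has_vector_derivative_ray[OF fd[OF inb[OF t]]] by (simp add: M_def algebra_simps)
      show "norm (M t * f (z0 + of_real t * v)) \<le> N * norm (f (z0 + of_real t * v))"
        using N(2)[OF t] by (simp add: norm_mult mult_right_mono)
    qed (use init N in \<open>auto simp: f_def\<close>)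
    then show ?thesis by (simp add: f_def v_def)
  qed
  \<comment> \<open>Once the horizontal parts agree, the third equation gives both heights the same
    derivative, so their difference is constant.\<close>
  define k where "k z = complex_of_real (h1 z) - complex_of_real (h2 z)" for z
  have "has_wirtinger k 0 0 z" if z: "z \<in> ball z0 r" for z
  proof -
    have t: "has_wirtinger Z2 (wz Z1 z) (wzb Z1 z) z"
      by (rule has_wirtinger_transform[OF has_wirtinger_works[OF d1(1)[OF z]] open_ball z Zeq])
    have v: "vert c \<tau> Z1 z = vert c \<tau> Z2 z"
      unfolding vert_def using has_wirtinger_unique[OF t] Zeq[OF z] by simp
    have wz: "wz (\<lambda>z. complex_of_real (h1 z)) z = wz (\<lambda>z. complex_of_real (h2 z)) z"
      using r1[OF z] r2[OF z] v Zeq[OF z] by (simp add: repr_at_def Let_def)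
    note w1 = has_wirtinger_works[OF d1(2)[OF z]] and w2 = has_wirtinger_works[OF d2(2)[OF z]]
    have "has_wirtinger k (wz (\<lambda>z. complex_of_real (h1 z)) z - wz (\<lambda>z. complex_of_real (h2 z)) z)
        (wzb (\<lambda>z. complex_of_real (h1 z)) z - wzb (\<lambda>z. complex_of_real (h2 z)) z) z"
      unfolding k_def by (rule has_wirtinger_diff[OF w1 w2])
    then show ?thesis using wz has_wirtinger_real[OF w1] has_wirtinger_real[OF w2] by simp
  qed
  then have "(k has_derivative (\<lambda>v. 0)) (at z within ball z0 r)" if "z \<in> ball z0 r" for z
    using that by (auto simp: has_wirtinger_def intro: has_derivative_at_withinI)
  from has_derivative_zero_constant[OF convex_ball this]
  obtain K where K: "\<forall>z\<in>ball z0 r. k z = K" by blast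
  have z0: "z0 \<in> ball z0 r" using z by (metis centre_in_ball ball_eq_empty empty_iff not_le)
  have "k z = k z0" using K z z0 by simp
  then have "h1 z = h2 z" using init(2) by (simp add: k_def)
  then show ?thesis using Zeq[OF z] by simp
qed

section \<open>Local existence by projective linearization\<close>

type_synonym mat2 = "(complex \<times> complex) \<times> (complex \<times> complex)"

definition mv :: "mat2 \<Rightarrow> complex \<times> complex \<Rightarrow> complex \<times> complex" where
  "mv m y = (fst (fst m) * fst y + snd (fst m) * snd y, fst (snd m) * fst y + snd (snd m) * snd y)"

lemma bounded_bilinear_mv: "bounded_bilinear mv"
proof
  have "norm (mv m y) \<le> norm m * norm y * 4" for m y
  proof -
    have n: "norm (fst (fst m)) \<le> norm m" "norm (snd (fst m)) \<le> norm m" "norm (fst (snd m)) \<le> norm m" "norm (snd (snd m)) \<le> norm m"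
      using norm_fst_le[of "fst m" "snd m"] norm_snd_le[of "snd m" "fst m"] norm_fst_le[of "fst (fst m)" "snd (fst m)"]
        norm_snd_le[of "snd (fst m)" "fst (fst m)"] norm_fst_le[of "fst (snd m)" "snd (snd m)"] norm_snd_le[of "snd (snd m)" "fst (snd m)"]
      by simp_all
    have y: "norm (fst y) \<le> norm y" "norm (snd y) \<le> norm y"
      using norm_fst_le[of "fst y" "snd y"] norm_snd_le[of "snd y" "fst y"] by simp_all
    have e: "norm (a * b) \<le> norm m * norm y" if "norm a \<le> norm m" "norm b \<le> norm y" for a b :: complex
      using that by (simp add: norm_mult mult_mono)
    have "norm (mv m y) \<le> norm (fst (fst m) * fst y + snd (fst m) * snd y) + norm (fst (snd m) * fst y + snd (snd m) * snd y)"
      unfolding mv_def by (rule norm_Pair_le)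
    also have "\<dots> \<le> (norm m * norm y + norm m * norm y) + (norm m * norm y + norm m * norm y)"
      by (intro add_mono order_trans[OF norm_triangle_ineq] e n y)
    finally show ?thesis by (simp add: mult_ac)
  qed
  then show "\<exists>K. \<forall>m y. norm (mv m y) \<le> norm m * norm y * K" by blast
qed (auto simp: mv_def algebra_simps scaleR_conv_of_real)

lemma smooth_on_Pair:
  assumes "open W" "smooth_on f W" "smooth_on g W"
  shows "smooth_on (\<lambda>x. (f x, g x)) W"
proof -
  have "smooth_on (\<lambda>x. (f x, 0) + (0, g x)) W"
    using assms
    by (intro smooth_on_add smooth_on_linear_comp[where h="\<lambda>x. (x, 0)"] smooth_on_linear_comp[where h="\<lambda>x. (0, x)"])
       (auto intro!: bounded_linear_Pair bounded_linear_ident bounded_linear_zero)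
  then show ?thesis by simp
qed

text \<open>The form \<open>\<alpha> dz + \<beta> d(cnj z)\<close> has the real components
  \<open>\<alpha> + \<beta>\<close> and \<open>\<i> (\<alpha> - \<beta>)\<close> in the coordinates
  \<open>u\<close> and \<open>v\<close>, the shape in which the flat system is stated.\<close>

lemma mixed_derivative_flat:
  fixes \<alpha> \<beta> :: "complex \<Rightarrow> complex"
  assumes "has_wirtinger \<alpha> az azb z" "has_wirtinger \<beta> bz bzb z"
  shows "((\<lambda>z. \<alpha> z + \<beta> z) has_derivative (\<lambda>v. az * v + azb * cnj v + (bz * v + bzb * cnj v))) (at z)"
    "((\<lambda>z. \<i> * (\<alpha> z - \<beta> z)) has_derivative (\<lambda>v. \<i> * (az * v + azb * cnj v - (bz * v + bzb * cnj v)))) (at z)"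
  by (rule has_derivative_add[OF assms[unfolded has_wirtinger_def]],
      rule has_derivative_mult_right[OF has_derivative_diff[OF assms[unfolded has_wirtinger_def]]])

text \<open>A quotient \<open>p / q\<close> of solutions of a linear system satisfies a Riccati
  equation. Since the right sides here are squares \<open>(1 - c \<zeta> cnj g)^2\<close> and
  \<open>(g - c \<zeta>)^2\<close> up to factors, trace free nilpotent matrices realize
  them.\<close>

lemma repr_exists_local:
  fixes c \<tau> :: real
  assumes W: "open W" "z0 \<in> W" and g: "smooth_on g W" "\<And>z. z \<in> W \<Longrightarrow> norm (g z) < 1"
    and eq: "\<And>z. z \<in> W \<Longrightarrow> gauss_at g z" and ct: "c \<noteq> 0 \<or> \<tau> \<noteq> 0"
  shows "\<exists>\<rho>>0. ball z0 \<rho> \<subseteq> W \<and> (\<forall>z1\<in>ball z0 \<rho>. \<forall>\<zeta>. c\<^sup>2 * (norm \<zeta>)\<^sup>2 < 1 \<longrightarrow> (\<exists>Z. Z z1 = \<zeta> \<and>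
    (\<forall>z\<in>ball z0 \<rho>. c\<^sup>2 * (norm (Z z))\<^sup>2 < 1 \<and> Z differentiable (at z) \<and> repr_horiz_at c \<tau> g Z z)))"
proof -
  define C s where Cs: "C = complex_of_real c" "s = \<i> * complex_of_real \<tau>"
  have cs: "C + s \<noteq> 0" "C - s \<noteq> 0" using sum_i_nonzero[OF ct] by (simp_all add: Cs)
  define D where "D z = 1 - g z * cnj (g z)" for z
  have D0: "D z \<noteq> 0" if "z \<in> W" for z using one_minus_norm_nonzero[OF g(2)[OF that]] by (simp add: D_def)
  define a where "a z = 2 / (C + s) * wz g z / (D z)\<^sup>2" for z
  define b where "b z = cnj (a z)" for z
  have cCs: "cnj C = C" "cnj s = - s" by (simp_all add: Cs)
  have cD: "cnj (D z) = D z" for z by (simp add: D_def mult.commute)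
  have b: "b z = 2 / (C - s) * cnj (wz g z) / (D z)\<^sup>2" for z by (simp add: b_def a_def cCs cD)
  have as: "smooth_on a W" unfolding a_def[abs_def] D_def by (intro smooth_intros W g) (use D0 in \<open>auto simp: D_def\<close>)
  have bs: "smooth_on b W" unfolding b_def[abs_def] by (intro smooth_intros W as)
  have gz: "wz g z = (C + s) * (D z)\<^sup>2 * a z / 2" "cnj (wz g z) = (C - s) * (D z)\<^sup>2 * b z / 2" if "z \<in> W" for z
  proof -
    have "x = t * d\<^sup>2 * (2 / t * x / d\<^sup>2) / 2" if "t \<noteq> 0" "d \<noteq> 0" for t d x :: complex
      using that by simp
    then show "wz g z = (C + s) * (D z)\<^sup>2 * a z / 2" "cnj (wz g z) = (C - s) * (D z)\<^sup>2 * b z / 2"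
      unfolding b unfolding a_def using cs D0[OF that] by blast+
  qed
  \<comment> \<open>In terms of the coefficients \<open>a\<close> and \<open>b\<close> the equation
    for \<open>g\<close> is this closed expression for the conjugate derivative of \<open>a\<close>;
    second derivatives of \<open>g\<close> no longer occur in it.\<close>
  have ad: "has_wirtinger a (wz a z) ((C - s) * g z * D z * a z * b z) z"
    and bd: "has_wirtinger b ((C + s) * cnj (g z) * D z * a z * b z) (cnj (wz a z)) z" if z: "z \<in> W" for z
  proof -
    have gd: "has_wirtinger g (wz g z) (wzb g z) z" by (rule smooth_on_has_wirtinger[OF g(1) z])
    have Gd: "has_wirtinger (wz g) (wz (wz g) z) (wzb (wz g) z) z"
      by (rule smooth_on_has_wirtinger[OF smooth_on_wz[OF W(1) g(1)] z])
    have D2: "(1 - g z * cnj (g z))\<^sup>2 \<noteq> 0" using D0[OF z] by (simp add: D_def)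
    have "has_wirtinger a
      (((2 / (C + s) * wz (wz g) z + 0 * wz g z) * (1 - g z * cnj (g z))\<^sup>2 - 2 / (C + s) * wz g z * (2 * (1 - g z * cnj (g z)) * (0 - (g z * cnj (wzb g z) + wz g z * cnj (g z))))) / ((1 - g z * cnj (g z))\<^sup>2)\<^sup>2)
      (((2 / (C + s) * wzb (wz g) z + 0 * wz g z) * (1 - g z * cnj (g z))\<^sup>2 - 2 / (C + s) * wz g z * (2 * (1 - g z * cnj (g z)) * (0 - (g z * cnj (wz g z) + wzb g z * cnj (g z))))) / ((1 - g z * cnj (g z))\<^sup>2)\<^sup>2) z"
      unfolding a_def[abs_def] D_def
      by (intro has_wirtinger_divide has_wirtinger_mult has_wirtinger_const has_wirtinger_power2 has_wirtinger_diff has_wirtinger_cnj gd Gd D2)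
    note h = has_wirtinger_wz[OF this]
    have "((2 / (C + s) * wzb (wz g) z + 0 * wz g z) * (1 - g z * cnj (g z))\<^sup>2 - 2 / (C + s) * wz g z * (2 * (1 - g z * cnj (g z)) * (0 - (g z * cnj (wz g z) + wzb g z * cnj (g z))))) / ((1 - g z * cnj (g z))\<^sup>2)\<^sup>2
      = 2 / (C + s) * (D z * wzb (wz g) z + 2 * cnj (g z) * wz g z * wzb g z + 2 * g z * wz g z * cnj (wz g z)) / D z ^ 3"
    proof -
      have "(k * y * d\<^sup>2 - k * x * (2 * d * (- e))) / (d\<^sup>2)\<^sup>2 = k * (d * y + 2 * x * e) / d ^ 3" if "d \<noteq> 0" for k x y d e :: complex
        using that by (simp add: field_simps power2_eq_square power3_eq_cube)
      from this[OF D0[OF z], of "2 / (C + s)" "wzb (wz g) z" "wz g z" "g z * cnj (wz g z) + wzb g z * cnj (g z)"]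
      show ?thesis unfolding D_def by (simp add: algebra_simps)
    qed
    also have "\<dots> = 2 / (C + s) * (2 * g z * wz g z * cnj (wz g z)) / D z ^ 3"
      using eq[OF z] unfolding gauss_at_def D_def by simp
    also have "\<dots> = (C - s) * g z * D z * a z * b z"
    proof -
      have "2 / t * (2 * y * x * x') / d ^ 3 = t' * y * d * (2 / t * x / d\<^sup>2) * (2 / t' * x' / d\<^sup>2)" if "t \<noteq> 0" "t' \<noteq> 0" "d \<noteq> 0" for t t' d x x' y :: complex
        using that by (simp add: field_simps power2_eq_square power3_eq_cube)
      then show ?thesis unfolding b unfolding a_def using cs D0[OF z] by blast
    qed
    finally show ad: "has_wirtinger a (wz a z) ((C - s) * g z * D z * a z * b z) z" using h by simp
    have e: "cnj ((C - s) * g z * D z * a z * b z) = (C + s) * cnj (g z) * D z * a z * b z"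
      by (simp add: cCs cD b_def mult_ac)
    show "has_wirtinger b ((C + s) * cnj (g z) * D z * a z * b z) (cnj (wz a z)) z"
      by (rule has_wirtinger_eq[OF has_wirtinger_cnj[OF ad, folded b_def] e refl])
  qed
  \<comment> \<open>For a matrix with these entries the quotient has derivative
    \<open>m12 + (m11 - m22) \<zeta> - m21 \<zeta>^2\<close>, which must be
    \<open>a (1 - C \<zeta> cnj g)^2\<close>; likewise the \<open>n\<close> entries must give
    \<open>- b (g - C \<zeta>)^2\<close>. Vanishing trace fixes the rest.\<close>
  define m11 m12 m21 m22 where m: "m11 = (\<lambda>z. - C * cnj (g z) * a z)" "m12 = a"
     "m21 = (\<lambda>z. - C\<^sup>2 * (cnj (g z))\<^sup>2 * a z)" "m22 = (\<lambda>z. C * cnj (g z) * a z)"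
  define n11 n12 n21 n22 where n: "n11 = (\<lambda>z. C * g z * b z)" "n12 = (\<lambda>z. - (g z)\<^sup>2 * b z)"
     "n21 = (\<lambda>z. C\<^sup>2 * b z)" "n22 = (\<lambda>z. - C * g z * b z)"
  define A where "A z = ((m11 z + n11 z, m12 z + n12 z), (m21 z + n21 z, m22 z + n22 z))" for z
  define B where "B z = ((\<i> * (m11 z - n11 z), \<i> * (m12 z - n12 z)), (\<i> * (m21 z - n21 z), \<i> * (m22 z - n22 z)))" for z
  have sm: "smooth_on A W" "smooth_on B W" unfolding A_def[abs_def] B_def[abs_def] m n
    by (intro smooth_on_Pair smooth_intros W g as bs)+
  have flat: "mv (frechet_derivative A (at z) \<i>) y + mv (A z) (mv (B z) y) =
      mv (frechet_derivative B (at z) 1) y + mv (B z) (mv (A z) y)" if z: "z \<in> W" for z y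
  proof -
    have gd: "has_wirtinger g (wz g z) (wzb g z) z" by (rule smooth_on_has_wirtinger[OF g(1) z])
    define x xb p q where xp: "x = wz a z" "xb = cnj (wz a z)" "p = wzb g z" "q = cnj (wzb g z)"
    define G Gb Ab Ba where G: "G = wz g z" "Gb = cnj (wz g z)" "Ab = (C - s) * g z * D z * a z * b z" "Ba = (C + s) * cnj (g z) * D z * a z * b z"
    have gd: "has_wirtinger g G p z" unfolding G xp by (rule smooth_on_has_wirtinger[OF g(1) z])
    have gcd: "has_wirtinger (\<lambda>z. cnj (g z)) q Gb z" using has_wirtinger_cnj[OF gd] unfolding G xp .
    have ad': "has_wirtinger a x Ab z" and bd': "has_wirtinger b Ba xb z" using ad[OF z] bd[OF z] by (simp_all add: xp G)
    have M: "has_wirtinger m11 (- C * cnj (g z) * x + (- C * q + 0 * cnj (g z)) * a z) (- C * cnj (g z) * Ab + (- C * Gb + 0 * cnj (g z)) * a z) z"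
      "has_wirtinger m12 x Ab z"
      "has_wirtinger m21 (- C\<^sup>2 * (cnj (g z))\<^sup>2 * x + (- C\<^sup>2 * (2 * cnj (g z) * q) + 0 * (cnj (g z))\<^sup>2) * a z)
         (- C\<^sup>2 * (cnj (g z))\<^sup>2 * Ab + (- C\<^sup>2 * (2 * cnj (g z) * Gb) + 0 * (cnj (g z))\<^sup>2) * a z) z"
      "has_wirtinger m22 (C * cnj (g z) * x + (C * q + 0 * cnj (g z)) * a z) (C * cnj (g z) * Ab + (C * Gb + 0 * cnj (g z)) * a z) z"
      unfolding m by (intro has_wirtinger_mult has_wirtinger_const has_wirtinger_power2 gcd ad')+
    have N: "has_wirtinger n11 (C * g z * Ba + (C * G + 0 * g z) * b z) (C * g z * xb + (C * p + 0 * g z) * b z) z"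
      "has_wirtinger n12 (- (g z)\<^sup>2 * Ba + - (2 * g z * G) * b z) (- (g z)\<^sup>2 * xb + - (2 * g z * p) * b z) z"
      "has_wirtinger n21 (C\<^sup>2 * Ba + 0 * b z) (C\<^sup>2 * xb + 0 * b z) z"
      "has_wirtinger n22 (- C * g z * Ba + (- C * G + 0 * g z) * b z) (- C * g z * xb + (- C * p + 0 * g z) * b z) z"
      unfolding n by (intro has_wirtinger_mult has_wirtinger_minus has_wirtinger_const has_wirtinger_power2 gd bd')+
    note dA = has_derivative_Pair[OF has_derivative_Pair[OF mixed_derivative_flat(1)[OF M(1) N(1)] mixed_derivative_flat(1)[OF M(2) N(2)]]
       has_derivative_Pair[OF mixed_derivative_flat(1)[OF M(3) N(3)] mixed_derivative_flat(1)[OF M(4) N(4)]], folded A_def]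
    note dB = has_derivative_Pair[OF has_derivative_Pair[OF mixed_derivative_flat(2)[OF M(1) N(1)] mixed_derivative_flat(2)[OF M(2) N(2)]]
       has_derivative_Pair[OF mixed_derivative_flat(2)[OF M(3) N(3)] mixed_derivative_flat(2)[OF M(4) N(4)]], folded B_def]
    note fA = fun_cong[OF frechet_derivative_at[OF dA], of \<i>, symmetric]
      and fB = fun_cong[OF frechet_derivative_at[OF dB], of 1, symmetric]
    define Y1 Y2 where Y: "Y1 = fst y" "Y2 = snd y"
    have Gv: "2 * G = (C + s) * (D z)\<^sup>2 * a z" "2 * Gb = (C - s) * (D z)\<^sup>2 * b z" using gz[OF z] by (simp_all add: G mult.commute[of 2])
    have Dv: "D z = 1 - g z * cnj (g z)" by (simp add: D_def)
    \<comment> \<open>Three entries of \<open>N\<^sub>z\<close> minus the conjugate derivative of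
      \<open>M\<close>, for the matrices \<open>M\<close> and \<open>N\<close> with entries
      \<open>m\<close> and \<open>n\<close>; the fourth is the negative of the first. The right
      sides are the entries of the commutator \<open>M N - N M\<close>.\<close>
    have key: "C * g z * Ba + C * G * b z - (- C * cnj (g z) * Ab - C * Gb * a z) = C\<^sup>2 * a z * b z * (1 - (g z)\<^sup>2 * (cnj (g z))\<^sup>2)"
      "- (g z)\<^sup>2 * Ba - 2 * g z * G * b z - Ab = - 2 * C * g z * a z * b z * D z"
      "C\<^sup>2 * Ba + C\<^sup>2 * (cnj (g z))\<^sup>2 * Ab + 2 * C\<^sup>2 * cnj (g z) * Gb * a z = 2 * C ^ 3 * cnj (g z) * a z * b z * D z"
    proof -
      have "2 * (C * g z * Ba + C * G * b z - (- C * cnj (g z) * Ab - C * Gb * a z)) = 2 * (C\<^sup>2 * a z * b z * (1 - (g z)\<^sup>2 * (cnj (g z))\<^sup>2))"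
        unfolding G(3,4) using Gv Dv by algebra
      then show "C * g z * Ba + C * G * b z - (- C * cnj (g z) * Ab - C * Gb * a z) = C\<^sup>2 * a z * b z * (1 - (g z)\<^sup>2 * (cnj (g z))\<^sup>2)"
        by (rule eq_of_scale) simp
      show "- (g z)\<^sup>2 * Ba - 2 * g z * G * b z - Ab = - 2 * C * g z * a z * b z * D z"
        unfolding G(3,4) using Gv Dv by algebra
      show "C\<^sup>2 * Ba + C\<^sup>2 * (cnj (g z))\<^sup>2 * Ab + 2 * C\<^sup>2 * cnj (g z) * Gb * a z = 2 * C ^ 3 * cnj (g z) * a z * b z * D z"
        unfolding G(3,4) using Gv Dv by algebra
    qed
    have i: "\<i> * \<i> = -1" by simp
    have comm: "mv (frechet_derivative A (at z) \<i>) y - mv (frechet_derivative B (at z) 1) y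
       = mv (B z) (mv (A z) y) - mv (A z) (mv (B z) y)"
    proof (rule prod_eqI)
      define K1 K2 K3 where K: "K1 = C\<^sup>2 * a z * b z * (1 - (g z)\<^sup>2 * (cnj (g z))\<^sup>2)" "K2 = - 2 * C * g z * a z * b z * D z"
        "K3 = 2 * C ^ 3 * cnj (g z) * a z * b z * D z"
      have l1: "fst (mv (frechet_derivative A (at z) \<i>) y - mv (frechet_derivative B (at z) 1) y)
        = 2 * \<i> * (C * g z * Ba + C * G * b z - (- C * cnj (g z) * Ab - C * Gb * a z)) * Y1
          + 2 * \<i> * (- (g z)\<^sup>2 * Ba - 2 * g z * G * b z - Ab) * Y2"
        unfolding fA fB mv_def Y by (simp add: algebra_simps)
      have l2: "snd (mv (frechet_derivative A (at z) \<i>) y - mv (frechet_derivative B (at z) 1) y)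
        = 2 * \<i> * (C\<^sup>2 * Ba + C\<^sup>2 * (cnj (g z))\<^sup>2 * Ab + 2 * C\<^sup>2 * cnj (g z) * Gb * a z) * Y1
          - 2 * \<i> * (C * g z * Ba + C * G * b z - (- C * cnj (g z) * Ab - C * Gb * a z)) * Y2"
        unfolding fA fB mv_def Y by (simp add: algebra_simps)
      have r1: "fst (mv (B z) (mv (A z) y) - mv (A z) (mv (B z) y)) = 2 * \<i> * K1 * Y1 + 2 * \<i> * K2 * Y2"
        unfolding mv_def A_def B_def m n Y K Dv by (simp add: power2_eq_square algebra_simps)
      have r2: "snd (mv (B z) (mv (A z) y) - mv (A z) (mv (B z) y)) = 2 * \<i> * K3 * Y1 - 2 * \<i> * K1 * Y2"
        unfolding mv_def A_def B_def m n Y K Dv by (simp add: power2_eq_square power3_eq_cube algebra_simps)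
      show "fst (mv (frechet_derivative A (at z) \<i>) y - mv (frechet_derivative B (at z) 1) y) = fst (mv (B z) (mv (A z) y) - mv (A z) (mv (B z) y))"
        unfolding l1 r1 key K ..
      show "snd (mv (frechet_derivative A (at z) \<i>) y - mv (frechet_derivative B (at z) 1) y) = snd (mv (B z) (mv (A z) y) - mv (A z) (mv (B z) y))"
        unfolding l2 r2 key K ..
    qed
    then show ?thesis by (simp add: algebra_simps)
  qed
  obtain \<rho> where \<rho>: "\<rho> > 0" "ball z0 \<rho> \<subseteq> W" and sol: "\<And>z1 (y1 :: complex \<times> complex). z1 \<in> ball z0 \<rho> \<Longrightarrow> \<exists>Y :: complex \<Rightarrow> complex \<times> complex. Y z1 = y1 \<and>
     (\<forall>z\<in>ball z0 \<rho>. (Y has_derivative (\<lambda>v. mv (Re v *\<^sub>R A z + Im v *\<^sub>R B z) (Y z))) (at z))"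
    using flat_system_local[OF bounded_bilinear_mv smooth_on_Ck[OF sm(1)] smooth_on_Ck[OF sm(2)] W flat] by blast
  show ?thesis
  proof (intro exI[of _ \<rho>] conjI ballI allI impI \<rho>)
    fix z1 \<zeta> :: complex assume z1: "z1 \<in> ball z0 \<rho>" and \<zeta>: "c\<^sup>2 * (norm \<zeta>)\<^sup>2 < 1"
    obtain Y :: "complex \<Rightarrow> complex \<times> complex" where Y: "Y z1 = (\<zeta>, 1)" "\<And>z. z \<in> ball z0 \<rho> \<Longrightarrow> (Y has_derivative (\<lambda>v. mv (Re v *\<^sub>R A z + Im v *\<^sub>R B z) (Y z))) (at z)"
      using sol[OF z1] by blast
    define p q where pq: "p z = fst (Y z)" "q z = snd (Y z)" for z
    have pd: "has_wirtinger p (m11 z * p z + m12 z * q z) (n11 z * p z + n12 z * q z) z"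
      and qd: "has_wirtinger q (m21 z * p z + m22 z * q z) (n21 z * p z + n22 z * q z) z" if z: "z \<in> ball z0 \<rho>" for z
    proof -
      have e: "(Re v *\<^sub>R (x + y) + Im v *\<^sub>R (\<i> * (x - y))) = x * v + y * cnj v" for v x y :: complex
        by (simp add: complex_eq_iff algebra_simps)
      have "mv (Re v *\<^sub>R A z + Im v *\<^sub>R B z) (Y z) = ((m11 z * p z + m12 z * q z) * v + (n11 z * p z + n12 z * q z) * cnj v,
         (m21 z * p z + m22 z * q z) * v + (n21 z * p z + n22 z * q z) * cnj v)" for v
        unfolding mv_def A_def B_def scaleR_Pair add_Pair fst_conv snd_conv e pq by (simp add: algebra_simps)
      then have "(Y has_derivative (\<lambda>v. ((m11 z * p z + m12 z * q z) * v + (n11 z * p z + n12 z * q z) * cnj v,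
         (m21 z * p z + m22 z * q z) * v + (n21 z * p z + n22 z * q z) * cnj v))) (at z)" using Y(2)[OF z] by simp
      from has_derivative_fst[OF this] has_derivative_snd[OF this]
      show "has_wirtinger p (m11 z * p z + m12 z * q z) (n11 z * p z + n12 z * q z) z"
        "has_wirtinger q (m21 z * p z + m22 z * q z) (n21 z * p z + n22 z * q z) z"
        unfolding has_wirtinger_def pq[abs_def] by simp_all
    qed
    \<comment> \<open>An indefinite hermitian form of the pair. Its two derivatives cancel because
      the matrices are negative adjoints of each other, and it starts from
      \<open>1 - c^2 |\<zeta>|^2 > 0\<close>. Positivity keeps \<open>q\<close> away from 0 and the
      quotient in the disc.\<close>
    define N where "N z = q z * cnj (q z) - C\<^sup>2 * (p z * cnj (p z))" for z
    have "(N has_derivative (\<lambda>v. 0)) (at z within ball z0 \<rho>)" if z: "z \<in> ball z0 \<rho>" for z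
    proof -
      have "has_wirtinger N 0 0 z" unfolding N_def
        by (rule has_wirtinger_eq, (rule has_wirtinger_diff has_wirtinger_mult has_wirtinger_const has_wirtinger_cnj pd[OF z] qd[OF z])+)
           (simp_all add: m n b_def cCs power2_eq_square algebra_simps)
      then show ?thesis by (auto simp: has_wirtinger_def intro: has_derivative_at_withinI)
    qed
    from has_derivative_zero_constant[OF convex_ball this]
    obtain k where k: "\<forall>z\<in>ball z0 \<rho>. N z = k" by blast
    have N: "(norm (q z))\<^sup>2 - c\<^sup>2 * (norm (p z))\<^sup>2 = 1 - c\<^sup>2 * (norm \<zeta>)\<^sup>2" if z: "z \<in> ball z0 \<rho>" for z
    proof -
      have Nr: "N z = complex_of_real ((norm (q z))\<^sup>2 - c\<^sup>2 * (norm (p z))\<^sup>2)" for z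
        by (simp add: N_def cnj_mult_self Cs)
      have "N z = N z1" using k z z1 by simp
      then show ?thesis unfolding Nr of_real_eq_iff by (simp add: pq Y(1))
    qed
    have q0: "q z \<noteq> 0" and cZ: "c\<^sup>2 * (norm (p z / q z))\<^sup>2 < 1" if z: "z \<in> ball z0 \<rho>" for z
    proof -
      have pos: "(norm (q z))\<^sup>2 > c\<^sup>2 * (norm (p z))\<^sup>2" using N[OF z] \<zeta> by linarith
      moreover have "c\<^sup>2 * (norm (p z))\<^sup>2 \<ge> 0" by simp
      ultimately have "(norm (q z))\<^sup>2 > 0" by linarith
      then show "q z \<noteq> 0" by auto
      then show "c\<^sup>2 * (norm (p z / q z))\<^sup>2 < 1" using pos by (simp add: norm_divide power_divide field_simps)
    qed
    have Zd: "has_wirtinger (\<lambda>z. p z / q z) (a z * (1 - C * (p z / q z) * cnj (g z))\<^sup>2) (- b z * (g z - C * (p z / q z))\<^sup>2) z"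
      if z: "z \<in> ball z0 \<rho>" for z
      by (rule has_wirtinger_eq[OF has_wirtinger_divide[OF pd[OF z] qd[OF z] q0[OF z]]])
         (use q0[OF z] in \<open>simp_all add: m n power2_eq_square field_simps\<close>)
    show "\<exists>Z. Z z1 = \<zeta> \<and> (\<forall>z\<in>ball z0 \<rho>. c\<^sup>2 * (norm (Z z))\<^sup>2 < 1 \<and> Z differentiable (at z) \<and> repr_horiz_at c \<tau> g Z z)"
    proof (intro exI[of _ "\<lambda>z. p z / q z"] conjI ballI)
      show "p z1 / q z1 = \<zeta>" by (simp add: pq Y(1))
      fix z assume z: "z \<in> ball z0 \<rho>"
      show "c\<^sup>2 * (norm (p z / q z))\<^sup>2 < 1" by (rule cZ[OF z])
      show "(\<lambda>z. p z / q z) differentiable (at z)" by (rule has_wirtinger_differentiable[OF Zd[OF z]])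
      show "repr_horiz_at c \<tau> g (\<lambda>z. p z / q z) z"
        unfolding repr_horiz_at_def Let_def has_wirtinger_unique[OF Zd[OF z]] D_def[symmetric] Cs[symmetric] b
        by (simp add: a_def)
    qed
  qed
qed

text \<open>With \<open>Z\<close> known, the third equation prescribes the derivative
  \<open>S\<close> of a real function. A primitive exists because the conjugate derivative of
  \<open>S\<close> is real.\<close>

lemma repr_exists:
  fixes c \<tau> :: real
  assumes W: "open W" "z0 \<in> W" and g: "smooth_on g W" "\<And>z. z \<in> W \<Longrightarrow> norm (g z) < 1"
    and eq: "\<And>z. z \<in> W \<Longrightarrow> gauss_at g z" and ct: "c \<noteq> 0 \<or> \<tau> \<noteq> 0"
  shows "\<exists>\<rho>>0. ball z0 \<rho> \<subseteq> W \<and> (\<forall>z1\<in>ball z0 \<rho>. \<forall>\<zeta> y. c\<^sup>2 * (norm \<zeta>)\<^sup>2 < 1 \<longrightarrow> (\<exists>Z h. Z z1 = \<zeta> \<and> h z1 = y \<and>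
    (\<forall>z\<in>ball z0 \<rho>. c\<^sup>2 * (norm (Z z))\<^sup>2 < 1 \<and> Z differentiable (at z) \<and>
      (\<lambda>z. complex_of_real (h z)) differentiable (at z) \<and> repr_at c \<tau> g Z h z)))"
proof -
  obtain \<rho> where \<rho>: "\<rho> > 0" "ball z0 \<rho> \<subseteq> W" and ex: "\<And>z1 \<zeta>. z1 \<in> ball z0 \<rho> \<Longrightarrow> c\<^sup>2 * (norm \<zeta>)\<^sup>2 < 1 \<Longrightarrow> \<exists>Z. Z z1 = \<zeta> \<and>
    (\<forall>z\<in>ball z0 \<rho>. c\<^sup>2 * (norm (Z z))\<^sup>2 < 1 \<and> Z differentiable (at z) \<and> repr_horiz_at c \<tau> g Z z)"
    using repr_exists_local[OF W g eq ct] by meson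
  define U where "U = ball z0 \<rho>"
  have oU: "open U" by (simp add: U_def)
  have gU: "smooth_on g U" using smooth_on_subset[OF g(1)] \<rho>(2) by (simp add: U_def)
  \<comment> \<open>Every disc of radius \<open>2 * r\<close> about a point of
    \<open>ball z0 r\<close> lies in the disc where \<open>Z\<close> is defined and contains
    \<open>ball z0 r\<close>.\<close>
  define r where "r = \<rho> / 4"
  have r: "r > 0" "r \<le> \<rho>" using \<rho> by (simp_all add: r_def)
  show ?thesis
  proof (intro exI[of _ r] conjI ballI allI impI r)
    show "ball z0 r \<subseteq> W" using r \<rho>(2) by auto
    fix z1 \<zeta> :: complex and y :: real assume z1: "z1 \<in> ball z0 r" and \<zeta>: "c\<^sup>2 * (norm \<zeta>)\<^sup>2 < 1"
    have "z1 \<in> ball z0 \<rho>" using z1 r by auto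
    from ex[OF this \<zeta>] obtain Z where Z1: "Z z1 = \<zeta>" and Zc: "\<forall>z\<in>U. c\<^sup>2 * (norm (Z z))\<^sup>2 < 1 \<and> Z differentiable (at z) \<and> repr_horiz_at c \<tau> g Z z"
      unfolding U_def by blast
    have Zs: "smooth_on Z U" by (rule repr_smooth_on[OF oU gU]) (use Zc g(2) \<rho>(2) in \<open>auto simp: U_def\<close>)
    define C s where Cs: "C = complex_of_real c" "s = \<i> * complex_of_real \<tau>"
    define w where "w = (\<lambda>z. (g z - C * Z z) / (1 - C * cnj (Z z) * g z))"
    have g1: "norm (g z) < 1" and cZ: "c\<^sup>2 * (norm (Z z))\<^sup>2 < 1" if "z \<in> U" for z
      using that g(2) \<rho>(2) Zc by (auto simp: U_def)
    have w1: "norm (w z) < 1" and gw: "g z = (w z + c * Z z) / (1 + c * cnj (Z z) * w z)" if "z \<in> U" for z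
      using moebius_inverse[OF cZ[OF that] g1[OF that]] by (simp_all add: w_def Cs)
    have E0: "1 - C * cnj (Z z) * g z \<noteq> 0" if "z \<in> U" for z
      using moebius_denominator_nonzero(2)[OF cZ[OF that] g1[OF that]] by (simp add: Cs)
    have ws: "smooth_on w U" unfolding w_def by (intro smooth_intros oU Zs gU E0)
    define S where "S z = - cnj (w z) * horiz c Z z + vert c \<tau> Z z" for z
    have Ss: "smooth_on S U" unfolding S_def[abs_def]
      by (intro smooth_intros smooth_on_horiz smooth_on_vert oU Zs cZ ws)
    have real: "Im (wzb S z) = 0" if z: "z \<in> U" for z
    proof -
      define P L K p q m where d: "P = horiz c Z z" "L = lam c (Z z)" "K = 1 - C\<^sup>2 * Z z * cnj (Z z)"
        "p = wz Z z" "q = wzb Z z" "m = wzb (wz Z) z"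
      have LK: "L * K = 1" using lam_facts(2)[OF cZ[OF z]] by (simp add: d Cs)
      have cL: "cnj L = L" using lam_facts(4)[OF cZ[OF z]] by (simp add: d)
      have P: "P = L * p" by (simp add: d horiz_def)
      have KL: "K * L = 1" using LK by (simp add: mult.commute)
      have p: "p = K * P" "cnj p = K * cnj P" unfolding P complex_cnj_mult cL using KL by (simp_all add: mult.assoc[symmetric])
      have "cnj q = - (cnj (w z))\<^sup>2 * p"
        using repr_iff(1)[of c Z z "w z" \<tau> g, OF cZ[OF z] w1[OF z] ct gw[OF z]] Zc z by (simp add: d)
      then have q': "q = - (w z)\<^sup>2 * cnj p" by (metis complex_cnj_cnj complex_cnj_minus complex_cnj_mult complex_cnj_power)
      have cK: "cnj K = K" by (simp add: d Cs mult_ac)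
      have q: "q = - K * (w z)\<^sup>2 * cnj P" "cnj q = - K * (cnj (w z))\<^sup>2 * P"
        unfolding q' complex_cnj_mult complex_cnj_minus complex_cnj_power complex_cnj_cnj unfolding p by (simp_all add: mult_ac cK)
      have H: "has_wirtinger (\<lambda>z. - cnj (w z) * horiz c Z z) (wz (\<lambda>z. - cnj (w z) * horiz c Z z) z)
          ((C + s) / 2 * P * cnj P * (1 - (w z)\<^sup>2 * (cnj (w z))\<^sup>2)) z"
        unfolding w_def Cs d by (rule repr_imp_derivatives(2)[OF oU z gU _ Zs]) (use g1 cZ Zc ct eq z \<rho>(2) in \<open>auto simp: U_def\<close>)
      have V: "has_wirtinger (vert c \<tau> Z) (wz (vert c \<tau> Z) z)
          (s / 2 * (C\<^sup>2 * L\<^sup>2 * (cnj (Z z) * q + Z z * cnj p) * (Z z * cnj q - cnj (Z z) * p)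
           + L * (q * cnj q - cnj p * p + Z z * cnj m - cnj (Z z) * m))) z"
        unfolding Cs d by (rule has_wirtinger_vert[OF oU z Zs]) (use cZ in auto)
      have "wzb S z = (C + s) / 2 * P * cnj P * (1 - (w z)\<^sup>2 * (cnj (w z))\<^sup>2)
         + s / 2 * (C\<^sup>2 * L\<^sup>2 * (cnj (Z z) * q + Z z * cnj p) * (Z z * cnj q - cnj (Z z) * p)
           + L * (q * cnj q - cnj p * p + Z z * cnj m - cnj (Z z) * m))"
        unfolding S_def[abs_def] by (rule has_wirtinger_unique(2)[OF has_wirtinger_add[OF H V]])
      also have "\<dots> = (C - s) / 2 * P * cnj P * (1 - (w z)\<^sup>2 * (cnj (w z))\<^sup>2)
         - s / 2 * (C\<^sup>2 * L\<^sup>2 * (Z z * cnj q + cnj (Z z) * p) * (cnj (Z z) * q - Z z * cnj p)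
           + L * (q * cnj q - cnj p * p + cnj (Z z) * m - Z z * cnj m))"
        unfolding p(2) q(2) unfolding p(1) q(1) by (rule vertical_closed[OF LK d(3)])
      also have "\<dots> = cnj ((C + s) / 2 * P * cnj P * (1 - (w z)\<^sup>2 * (cnj (w z))\<^sup>2)
         + s / 2 * (C\<^sup>2 * L\<^sup>2 * (cnj (Z z) * q + Z z * cnj p) * (Z z * cnj q - cnj (Z z) * p)
           + L * (q * cnj q - cnj p * p + Z z * cnj m - cnj (Z z) * m)))"
        by (simp add: cL) (simp add: Cs mult_ac)
      also have "\<dots> = cnj (wzb S z)"
        unfolding S_def[abs_def] has_wirtinger_unique(2)[OF has_wirtinger_add[OF H V]] ..
      finally show ?thesis by (metis Reals_cnj_iff complex_is_Real_iff)
    qed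
    \<comment> \<open>The components of \<open>S dz\<close> plus its conjugate in the real
      coordinates. Closedness of this form is the vanishing of the imaginary part of
      \<open>wzb S\<close>.\<close>
    define a b where ab: "a z = 2 * Re (S z)" "b z = - 2 * Im (S z)" for z
    have sub: "cball z1 (2 * r) \<subseteq> U"
    proof
      fix x assume "x \<in> cball z1 (2 * r)"
      then show "x \<in> U" using z1 \<rho>(1) dist_triangle[of z0 x z1] by (auto simp: U_def r_def)
    qed
    have sub2: "ball z0 r \<subseteq> ball z1 (2 * r)"
    proof
      fix x assume "x \<in> ball z0 r"
      then show "x \<in> ball z1 (2 * r)" using z1 dist_triangle[of z1 x z0] by (auto simp: dist_commute)
    qed
    have "\<exists>h. h z1 = y \<and> (\<forall>z\<in>ball z1 (2 * r). (h has_derivative (\<lambda>v. Re v * a z + Im v * b z)) (at z))"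
    proof (rule closed_form_primitive[OF _ _ oU _ sub])
      show "Ck_on 1 a U" "Ck_on 1 b U" unfolding ab[abs_def]
        by (intro smooth_on_Ck smooth_intros oU Ss)+
      show "frechet_derivative a (at z) \<i> = frechet_derivative b (at z) 1" if z: "z \<in> U" for z
      proof -
        have S': "(S has_derivative (\<lambda>v. wz S z * v + wzb S z * cnj v)) (at z)"
          using smooth_on_has_wirtinger[OF Ss z] by (simp add: has_wirtinger_def)
        have "(a has_derivative (\<lambda>v. 2 * Re (wz S z * v + wzb S z * cnj v))) (at z)"
          "(b has_derivative (\<lambda>v. - 2 * Im (wz S z * v + wzb S z * cnj v))) (at z)"
          unfolding ab[abs_def] by (intro has_derivative_mult_right has_derivative_Re has_derivative_Im S')+
        from fun_cong[OF frechet_derivative_at[OF this(1)], of \<i>, symmetric] fun_cong[OF frechet_derivative_at[OF this(2)], of 1, symmetric]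
        show ?thesis using real[OF z] by simp
      qed
    qed (use r in auto)
    then obtain h where h: "h z1 = y" "\<And>z. z \<in> ball z1 (2 * r) \<Longrightarrow> (h has_derivative (\<lambda>v. Re v * a z + Im v * b z)) (at z)" by blast
    have hd: "has_wirtinger (\<lambda>z. complex_of_real (h z)) (S z) (cnj (S z)) z" if z: "z \<in> ball z0 r" for z
    proof -
      have "((\<lambda>z. complex_of_real (h z)) has_derivative (\<lambda>v. complex_of_real (Re v * a z + Im v * b z))) (at z)"
        using bounded_linear.has_derivative[OF bounded_linear_of_real h(2)] z sub2 by blast
      moreover have "(\<lambda>v. complex_of_real (Re v * a z + Im v * b z)) = (\<lambda>v. S z * v + cnj (S z) * cnj v)"
        by (auto simp: fun_eq_iff ab complex_eq_iff algebra_simps)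
      ultimately show ?thesis by (simp add: has_wirtinger_def)
    qed
    show "\<exists>Z h. Z z1 = \<zeta> \<and> h z1 = y \<and> (\<forall>z\<in>ball z0 r. c\<^sup>2 * (norm (Z z))\<^sup>2 < 1 \<and> Z differentiable (at z) \<and>
      (\<lambda>z. complex_of_real (h z)) differentiable (at z) \<and> repr_at c \<tau> g Z h z)"
    proof (intro exI[of _ Z] exI[of _ h] conjI ballI Z1 h(1))
      fix z assume z: "z \<in> ball z0 r"
      then have zU: "z \<in> U" using r by (auto simp: U_def)
      show "c\<^sup>2 * (norm (Z z))\<^sup>2 < 1" "Z differentiable (at z)" using Zc zU by auto
      show "(\<lambda>z. complex_of_real (h z)) differentiable (at z)" by (rule has_wirtinger_differentiable[OF hd[OF z]])
      show "repr_at c \<tau> g Z h z"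
        using repr_iff(2)[of c Z z "w z" \<tau> g h, OF cZ[OF zU] w1[OF zU] ct gw[OF zU]] Zc zU
          has_wirtinger_unique(1)[OF hd[OF z]] by (simp add: S_def)
    qed
  qed
qed

section \<open>Charts\<close>

abbreviation chart_image :: "'a chart \<Rightarrow> complex set" where
  "chart_image \<phi> \<equiv> snd \<phi> ` fst \<phi>"

lemma complex_chart_onD:
  assumes "complex_chart_on S \<phi>"
  shows "openin (top_of_set S) (fst \<phi>)" "fst \<phi> \<subseteq> S" "open (chart_image \<phi>)"
    "\<And>q. q \<in> fst \<phi> \<Longrightarrow> chart_inv \<phi> (snd \<phi> q) = q"
    "\<And>z. z \<in> chart_image \<phi> \<Longrightarrow> chart_inv \<phi> z \<in> fst \<phi> \<and> snd \<phi> (chart_inv \<phi> z) = z"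
    "continuous_on (fst \<phi>) (snd \<phi>)" "continuous_on (chart_image \<phi>) (chart_inv \<phi>)"
proof -
  have h: "homeomorphism (fst \<phi>) (chart_image \<phi>) (snd \<phi>) (chart_inv \<phi>)"
    and o: "openin (top_of_set S) (fst \<phi>)" "open (chart_image \<phi>)" using assms by (auto simp: complex_chart_on_def)
  show "openin (top_of_set S) (fst \<phi>)" "open (chart_image \<phi>)" by (fact o)+
  show "fst \<phi> \<subseteq> S" using o(1) openin_imp_subset by blast
  show "chart_inv \<phi> (snd \<phi> q) = q" if "q \<in> fst \<phi>" for q using h that unfolding homeomorphism_def by simp
  show "chart_inv \<phi> z \<in> fst \<phi> \<and> snd \<phi> (chart_inv \<phi> z) = z" if "z \<in> chart_image \<phi>" for z
    using h that unfolding homeomorphism_def by blast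
  show "continuous_on (fst \<phi>) (snd \<phi>)" "continuous_on (chart_image \<phi>) (chart_inv \<phi>)"
    using h unfolding homeomorphism_def by blast+
qed

lemma conformal_paramsD: "\<phi> \<in> conformal_params S A \<Longrightarrow> complex_chart_on S \<phi>"
  by (simp add: conformal_params_def)

lemma chart_open_image:
  assumes "complex_chart_on S \<phi>" "openin (top_of_set S) U" "U \<subseteq> fst \<phi>"
  shows "open (snd \<phi> ` U)"
proof -
  note D = complex_chart_onD[OF assms(1)]
  have "openin (top_of_set (chart_image \<phi>)) (chart_image \<phi> \<inter> chart_inv \<phi> -` U)"
    by (rule continuous_openin_preimage[OF D(7) _ assms(2)]) (use D in blast)
  moreover have "chart_image \<phi> \<inter> chart_inv \<phi> -` U = snd \<phi> ` U"
    using D(4,5) assms(3) by (auto simp: subset_iff)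
  ultimately show ?thesis using D(3) openin_open_eq by metis
qed

lemma chart_open_preimage:
  assumes "complex_chart_on S \<phi>" "open V" "V \<subseteq> chart_image \<phi>"
  shows "openin (top_of_set S) (chart_inv \<phi> ` V)"
proof -
  note D = complex_chart_onD[OF assms(1)]
  have "openin (top_of_set (fst \<phi>)) (fst \<phi> \<inter> snd \<phi> -` V)"
    by (rule continuous_openin_preimage_gen[OF D(6) assms(2)])
  moreover have "fst \<phi> \<inter> snd \<phi> -` V = chart_inv \<phi> ` V"
  proof
    show "fst \<phi> \<inter> snd \<phi> -` V \<subseteq> chart_inv \<phi> ` V" 
    proof
      fix q assume "q \<in> fst \<phi> \<inter> snd \<phi> -` V"
      then show "q \<in> chart_inv \<phi> ` V" using D(4) by (intro image_eqI[of q _ "snd \<phi> q"]) auto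
    qed
    show "chart_inv \<phi> ` V \<subseteq> fst \<phi> \<inter> snd \<phi> -` V" using D(5) assms(3) by (auto simp: subset_iff)
  qed
  ultimately show ?thesis using D(1) openin_trans by metis
qed

lemma riemann_surfaceD:
  assumes "riemann_surface S A"
  shows "A \<subseteq> conformal_params S A" "\<And>q. q \<in> S \<Longrightarrow> \<exists>\<phi>\<in>A. q \<in> fst \<phi>" "connected S" "S \<noteq> {}"
  using assms by (auto simp: riemann_surface_def conformal_params_def)

lemma surface_chart:
  assumes "riemann_surface S A" "q \<in> S"
  obtains \<phi> where "\<phi> \<in> conformal_params S A" "q \<in> fst \<phi>"
  using riemann_surfaceD[OF assms(1)] assms(2) by blast

text \<open>Members of the maximal atlas are only known to be compatible with charts in
  \<open>A\<close>, so the transition is factored near \<open>q\<close> through a chart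
  \<open>\<eta>\<close> of \<open>A\<close>.\<close>

lemma transition_holomorphic:
  assumes R: "riemann_surface S A" and \<phi>: "\<phi> \<in> conformal_params S A" and \<psi>: "\<psi> \<in> conformal_params S A"
    and q: "q \<in> fst \<phi>" "q \<in> fst \<psi>"
  obtains t where "((snd \<psi> \<circ> chart_inv \<phi>) has_field_derivative t) (at (snd \<phi> q))"
proof -
  note D\<phi> = complex_chart_onD[OF conformal_paramsD[OF \<phi>]] and D\<psi> = complex_chart_onD[OF conformal_paramsD[OF \<psi>]]
  obtain \<eta> where \<eta>: "\<eta> \<in> A" "q \<in> fst \<eta>" using riemann_surfaceD(2)[OF R] D\<phi>(2) q by blast
  have \<eta>': "complex_chart_on S \<eta>" using R \<eta>(1) by (simp add: riemann_surface_def)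
  note D\<eta> = complex_chart_onD[OF \<eta>']
  let ?V = "fst \<phi> \<inter> fst \<eta>" and ?V' = "fst \<psi> \<inter> fst \<eta>"
  have hol1: "(snd \<eta> \<circ> chart_inv \<phi>) holomorphic_on (snd \<phi> ` ?V)" and hol2: "(snd \<psi> \<circ> chart_inv \<eta>) holomorphic_on (snd \<eta> ` ?V')"
    using \<phi> \<psi> \<eta>(1) unfolding conformal_params_def holomorphically_compatible_def by (auto simp: Int_commute)
  have o1: "open (snd \<phi> ` ?V)" by (rule chart_open_image[OF conformal_paramsD[OF \<phi>]]) (use D\<phi>(1) D\<eta>(1) in auto)
  have o2: "open (snd \<eta> ` ?V')" by (rule chart_open_image[OF \<eta>']) (use D\<psi>(1) D\<eta>(1) in auto)
  have o3: "open (snd \<phi> ` (?V \<inter> fst \<psi>))"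
    by (rule chart_open_image[OF conformal_paramsD[OF \<phi>]]) (use D\<phi>(1) D\<eta>(1) D\<psi>(1) in auto)
  have q1: "snd \<phi> q \<in> snd \<phi> ` ?V" and q2: "(snd \<eta> \<circ> chart_inv \<phi>) (snd \<phi> q) \<in> snd \<eta> ` ?V'"
    using q \<eta>(2) D\<phi>(4) by auto
  obtain t1 where t1: "((snd \<eta> \<circ> chart_inv \<phi>) has_field_derivative t1) (at (snd \<phi> q))"
    using hol1 o1 q1 holomorphic_derivI by blast
  obtain t2 where t2: "((snd \<psi> \<circ> chart_inv \<eta>) has_field_derivative t2) (at ((snd \<eta> \<circ> chart_inv \<phi>) (snd \<phi> q)))"
    using hol2 o2 q2 holomorphic_derivI by blast
  have "((snd \<psi> \<circ> chart_inv \<eta>) \<circ> (snd \<eta> \<circ> chart_inv \<phi>) has_field_derivative t2 * t1) (at (snd \<phi> q))"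
    by (rule DERIV_chain[OF t2 t1])
  then have "((snd \<psi> \<circ> chart_inv \<phi>) has_field_derivative t2 * t1) (at (snd \<phi> q))"
    by (rule has_field_derivative_transform_within_open[OF _ o3]) (use q \<eta>(2) D\<phi>(4) D\<eta>(4) in auto)
  then show ?thesis by (rule that)
qed

lemma chart_germ_cong:
  assumes \<phi>: "complex_chart_on S \<phi>" and q: "q \<in> fst \<phi>" and V: "openin (top_of_set S) V" "q \<in> V"
    and eq: "\<And>r. r \<in> V \<Longrightarrow> f r = h r"
  obtains W where "open W" "snd \<phi> q \<in> W" "W \<subseteq> chart_image \<phi>" "\<And>z. z \<in> W \<Longrightarrow> f (chart_inv \<phi> z) = h (chart_inv \<phi> z)"
proof
  note D = complex_chart_onD[OF \<phi>]
  show "open (snd \<phi> ` (fst \<phi> \<inter> V))" by (rule chart_open_image[OF \<phi>]) (use D(1) V(1) in auto)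
  show "f (chart_inv \<phi> z) = h (chart_inv \<phi> z)" if "z \<in> snd \<phi> ` (fst \<phi> \<inter> V)" for z
    using that D(4) eq by auto
qed (use q V in auto)

text \<open>The factor \<open>t\<close> is the derivative of the transition map and is common to all
  functions. Holomorphy is what keeps the two Wirtinger coefficients from mixing.\<close>

lemma chart_change:
  assumes R: "riemann_surface S A" and \<phi>: "\<phi> \<in> conformal_params S A" and \<psi>: "\<psi> \<in> conformal_params S A"
    and q: "q \<in> fst \<phi>" "q \<in> fst \<psi>"
  shows "\<exists>t. \<forall>f a b. has_wirtinger (\<lambda>z. f (chart_inv \<psi> z)) a b (snd \<psi> q) \<longrightarrow>
    has_wirtinger (\<lambda>z. f (chart_inv \<phi> z)) (a * t) (b * cnj t) (snd \<phi> q)"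
proof -
  note D\<phi> = complex_chart_onD[OF conformal_paramsD[OF \<phi>]] and D\<psi> = complex_chart_onD[OF conformal_paramsD[OF \<psi>]]
  obtain t where t: "((snd \<psi> \<circ> chart_inv \<phi>) has_field_derivative t) (at (snd \<phi> q))"
    using transition_holomorphic[OF R \<phi> \<psi> q] .
  have o: "open (snd \<phi> ` (fst \<phi> \<inter> fst \<psi>))"
    by (rule chart_open_image[OF conformal_paramsD[OF \<phi>]]) (use D\<phi>(1) D\<psi>(1) in auto)
  show ?thesis
  proof (intro exI allI impI)
    fix f a b assume "has_wirtinger (\<lambda>z. f (chart_inv \<psi> z)) a b (snd \<psi> q)"
    then have "has_wirtinger (\<lambda>z. f (chart_inv \<psi> z)) a b ((snd \<psi> \<circ> chart_inv \<phi>) (snd \<phi> q))" using D\<phi>(4)[OF q(1)] by simp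
    from has_wirtinger_comp_holomorphic[OF this t]
    have "has_wirtinger (\<lambda>z. f (chart_inv \<psi> ((snd \<psi> \<circ> chart_inv \<phi>) z))) (a * t) (b * cnj t) (snd \<phi> q)" .
    then show "has_wirtinger (\<lambda>z. f (chart_inv \<phi> z)) (a * t) (b * cnj t) (snd \<phi> q)"
      by (rule has_wirtinger_transform[OF _ o]) (use q D\<phi>(4) D\<psi>(4) in auto)
  qed
qed

section \<open>The representation formula in a chart\<close>

definition Zpart :: "'a chart \<Rightarrow> ('a \<Rightarrow> real ^ 3) \<Rightarrow> complex \<Rightarrow> complex" where
  "Zpart \<phi> X z = zeta (X (chart_inv \<phi> z))"

definition hpart :: "'a chart \<Rightarrow> ('a \<Rightarrow> real ^ 3) \<Rightarrow> complex \<Rightarrow> real" where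
  "hpart \<phi> X z = X (chart_inv \<phi> z) $ 3"

lemma bounded_linear_zeta: "bounded_linear zeta"
proof -
  have "zeta = (\<lambda>p. complex_of_real (p $ 1) + \<i> * complex_of_real (p $ 2))"
    by (auto simp: zeta_def complex_eq_iff)
  moreover have "bounded_linear (\<lambda>p::real^3. complex_of_real (p $ 1) + \<i> * complex_of_real (p $ 2))"
    by (intro bounded_linear_add bounded_linear_compose[OF bounded_linear_of_real]
      bounded_linear_compose[OF bounded_linear_mult_right] bounded_linear_vec_nth)
  ultimately show ?thesis by simp
qed

lemma vec3_decompose: "(p :: real ^ 3) = Re (zeta p) *\<^sub>R axis 1 1 + Im (zeta p) *\<^sub>R axis 2 1 + (p $ 3) *\<^sub>R axis 3 1"
  by (simp add: vec_eq_iff forall_3 axis_def zeta_def)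

lemma differentiable_parts:
  "(X \<circ> chart_inv \<phi>) differentiable (at z) \<longleftrightarrow>
    Zpart \<phi> X differentiable (at z) \<and> (\<lambda>z. complex_of_real (hpart \<phi> X z)) differentiable (at z)" (is "?l \<longleftrightarrow> ?r")
proof
  assume ?l
  then obtain X' where X': "((\<lambda>z. X (chart_inv \<phi> z)) has_derivative X') (at z)" unfolding differentiable_def o_def by blast
  from bounded_linear.has_derivative[OF bounded_linear_zeta this]
    bounded_linear.has_derivative[OF bounded_linear_of_real bounded_linear.has_derivative[OF bounded_linear_vec_nth this]]
  show ?r unfolding differentiable_def Zpart_def[abs_def] hpart_def[abs_def] by blast
next
  assume ?r
  then obtain Z' h' where d: "(Zpart \<phi> X has_derivative Z') (at z)" "((\<lambda>z. complex_of_real (hpart \<phi> X z)) has_derivative h') (at z)"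
    unfolding differentiable_def by blast
  have "((\<lambda>z. Re (Zpart \<phi> X z) *\<^sub>R axis 1 1 + Im (Zpart \<phi> X z) *\<^sub>R axis 2 1 + Re (complex_of_real (hpart \<phi> X z)) *\<^sub>R axis 3 1 :: real ^ 3)
     has_derivative (\<lambda>v. Re (Z' v) *\<^sub>R axis 1 1 + Im (Z' v) *\<^sub>R axis 2 1 + Re (h' v) *\<^sub>R axis 3 1)) (at z)"
    by (intro has_derivative_add has_derivative_scaleR_left has_derivative_Re has_derivative_Im d)
  moreover have "(\<lambda>z. Re (Zpart \<phi> X z) *\<^sub>R axis 1 1 + Im (Zpart \<phi> X z) *\<^sub>R axis 2 1 + Re (complex_of_real (hpart \<phi> X z)) *\<^sub>R axis 3 1 :: real ^ 3) = X \<circ> chart_inv \<phi>"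
    using vec3_decompose by (auto simp: fun_eq_iff Zpart_def hpart_def)
  ultimately show ?l unfolding differentiable_def by auto
qed

lemma smooth_parts:
  assumes "open W"
  shows "smooth_on (X \<circ> chart_inv \<phi>) W \<longleftrightarrow> smooth_on (Zpart \<phi> X) W \<and> smooth_on (\<lambda>z. complex_of_real (hpart \<phi> X z)) W" (is "?l \<longleftrightarrow> ?r")
proof
  assume l: ?l
  then have "smooth_on (\<lambda>z. X (chart_inv \<phi> z)) W" by (simp add: o_def)
  then show ?r unfolding Zpart_def[abs_def] hpart_def[abs_def]
    using assms by (intro conjI smooth_on_of_real smooth_on_nth smooth_on_linear_comp[OF _ bounded_linear_zeta])
next
  assume r: ?r
  have "smooth_on (\<lambda>z. Re (Zpart \<phi> X z) *\<^sub>R axis 1 1 + Im (Zpart \<phi> X z) *\<^sub>R axis 2 1 + Re (complex_of_real (hpart \<phi> X z)) *\<^sub>R axis 3 1 :: real ^ 3) W"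
    using assms r by (intro smooth_on_add smooth_on_scaleR smooth_on_const smooth_on_Re smooth_on_Im) auto
  moreover have "(\<lambda>z. Re (Zpart \<phi> X z) *\<^sub>R axis 1 1 + Im (Zpart \<phi> X z) *\<^sub>R axis 2 1 + Re (complex_of_real (hpart \<phi> X z)) *\<^sub>R axis 3 1 :: real ^ 3) = X \<circ> chart_inv \<phi>"
    using vec3_decompose by (auto simp: fun_eq_iff Zpart_def hpart_def)
  ultimately show ?l by simp
qed

lemma dz_wz: "dz \<phi> f q = wz (\<lambda>z. f (chart_inv \<phi> z)) (snd \<phi> q)"
  and dzbar_wzb: "dzbar \<phi> f q = wzb (\<lambda>z. f (chart_inv \<phi> z)) (snd \<phi> q)"
  by (simp_all add: dz_def dzbar_def wz_def wzb_def du_def dv_def o_def)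

lemma dzbar_dz:
  assumes \<phi>: "complex_chart_on S \<phi>" and q: "q \<in> fst \<phi>" and f: "smooth_on (\<lambda>z. f (chart_inv \<phi> z)) (chart_image \<phi>)"
  shows "dzbar \<phi> (dz \<phi> f) q = wzb (wz (\<lambda>z. f (chart_inv \<phi> z))) (snd \<phi> q)"
proof -
  note D = complex_chart_onD[OF \<phi>]
  have "has_wirtinger (wz (\<lambda>z. f (chart_inv \<phi> z))) (wz (wz (\<lambda>z. f (chart_inv \<phi> z))) (snd \<phi> q)) (wzb (wz (\<lambda>z. f (chart_inv \<phi> z))) (snd \<phi> q)) (snd \<phi> q)"
    using smooth_on_has_wirtinger[OF smooth_on_wz[OF D(3) f]] q by auto
  then have "has_wirtinger (\<lambda>z. dz \<phi> f (chart_inv \<phi> z)) (wz (wz (\<lambda>z. f (chart_inv \<phi> z))) (snd \<phi> q)) (wzb (wz (\<lambda>z. f (chart_inv \<phi> z))) (snd \<phi> q)) (snd \<phi> q)"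
    by (rule has_wirtinger_transform[OF _ D(3)]) (use q D(5) in \<open>auto simp: dz_wz\<close>)
  then show ?thesis unfolding dzbar_wzb by (rule has_wirtinger_unique)
qed

text \<open>Differentiability is included because the derivative operators are total and carry no
  information at points where the map is not differentiable.\<close>

definition formula_at :: "real \<Rightarrow> real \<Rightarrow> ('a \<Rightarrow> complex) \<Rightarrow> ('a \<Rightarrow> real ^ 3) \<Rightarrow> 'a chart \<Rightarrow> 'a \<Rightarrow> bool" where
  "formula_at \<kappa> \<tau> g X \<phi> q \<longleftrightarrow> (X \<circ> chart_inv \<phi>) differentiable (at (snd \<phi> q)) \<and>
     repr_at (crit \<kappa>) \<tau> (\<lambda>z. g (chart_inv \<phi> z)) (Zpart \<phi> X) (hpart \<phi> X) (snd \<phi> q)"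

text \<open>Differentiability allows the derivatives of the conjugates of \<open>g\<close> and
  \<open>\<zeta>\<close>, which occur in the formula, to be replaced by conjugates of
  derivatives.\<close>

lemma representation_solution_iff:
  assumes g: "smooth_map S A g"
  shows "representation_solution S A \<kappa> \<tau> g X \<longleftrightarrow>
    X \<in> S \<rightarrow> E_carrier \<kappa> \<and> (\<forall>\<phi>\<in>conformal_params S A. \<forall>q\<in>fst \<phi>. formula_at \<kappa> \<tau> g X \<phi> q)"
proof -
  have "(let c = complex_of_real (crit \<kappa>); t = complex_of_real \<tau>;
           Z = (\<lambda>r. zeta (X r)); \<zeta> = zeta (X q); \<gamma> = g q;
           D = 1 - complex_of_real ((norm \<gamma>)\<^sup>2);
           L = 1 - c\<^sup>2 * complex_of_real ((norm \<zeta>)\<^sup>2)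
       in dz \<phi> Z q = 2 / (c + \<i> * t) * ((1 - c * \<zeta> * cnj \<gamma>)\<^sup>2 / D\<^sup>2) * dz \<phi> g q \<and>
          dzbar \<phi> Z q =
            - (2 / (c - \<i> * t)) * ((\<gamma> - c * \<zeta>)\<^sup>2 / D\<^sup>2) * dzbar \<phi> (\<lambda>r. cnj (g r)) q \<and>
          dz \<phi> (\<lambda>r. complex_of_real (X r $ 3)) q =
            - (2 / (c + \<i> * t)) * ((cnj \<gamma> - c * cnj \<zeta>) * (1 - c * \<zeta> * cnj \<gamma>) / (L * D\<^sup>2)) * dz \<phi> g q
            + \<i> * t / 2 * ((\<zeta> * dz \<phi> (\<lambda>r. cnj (Z r)) q - cnj \<zeta> * dz \<phi> Z q) / L)) \<longleftrightarrow>
     repr_at (crit \<kappa>) \<tau> (\<lambda>z. g (chart_inv \<phi> z)) (Zpart \<phi> X) (hpart \<phi> X) (snd \<phi> q)"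
    if \<phi>: "\<phi> \<in> conformal_params S A" and q: "q \<in> fst \<phi>" and d: "(X \<circ> chart_inv \<phi>) differentiable (at (snd \<phi> q))" for \<phi> q
  proof -
    note D = complex_chart_onD[OF conformal_paramsD[OF \<phi>]]
    have "smooth_on (\<lambda>z. g (chart_inv \<phi> z)) (chart_image \<phi>)" using g \<phi> by (simp add: smooth_map_def o_def)
    then have gd: "has_wirtinger (\<lambda>z. g (chart_inv \<phi> z)) (wz (\<lambda>z. g (chart_inv \<phi> z)) (snd \<phi> q)) (wzb (\<lambda>z. g (chart_inv \<phi> z)) (snd \<phi> q)) (snd \<phi> q)"
      by (rule smooth_on_has_wirtinger) (use q in auto)
    have Zd: "has_wirtinger (Zpart \<phi> X) (wz (Zpart \<phi> X) (snd \<phi> q)) (wzb (Zpart \<phi> X) (snd \<phi> q)) (snd \<phi> q)"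
      using d differentiable_parts by (intro has_wirtinger_works) blast
    have 1: "dzbar \<phi> (\<lambda>r. cnj (g r)) q = cnj (wz (\<lambda>z. g (chart_inv \<phi> z)) (snd \<phi> q))"
      unfolding dzbar_wzb by (rule has_wirtinger_unique(2)[OF has_wirtinger_cnj[OF gd]])
    have 2: "dz \<phi> (\<lambda>r. cnj (zeta (X r))) q = cnj (wzb (Zpart \<phi> X) (snd \<phi> q))"
      unfolding dz_wz Zpart_def[symmetric] by (rule has_wirtinger_unique(1)[OF has_wirtinger_cnj[OF Zd]])
    have 3: "g q = g (chart_inv \<phi> (snd \<phi> q))" "zeta (X q) = Zpart \<phi> X (snd \<phi> q)" using D(4)[OF q] by (simp_all add: Zpart_def)
    have 4: "dz \<phi> (\<lambda>r. zeta (X r)) q = wz (Zpart \<phi> X) (snd \<phi> q)" "dzbar \<phi> (\<lambda>r. zeta (X r)) q = wzb (Zpart \<phi> X) (snd \<phi> q)"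
      "dz \<phi> g q = wz (\<lambda>z. g (chart_inv \<phi> z)) (snd \<phi> q)"
      "dz \<phi> (\<lambda>r. complex_of_real (X r $ 3)) q = wz (\<lambda>z. complex_of_real (hpart \<phi> X z)) (snd \<phi> q)"
      unfolding dz_wz dzbar_wzb Zpart_def[abs_def] hpart_def by simp_all
    show ?thesis
      unfolding Let_def repr_at_def repr_horiz_at_def 1 2 4 3 vert_def lam_def cnj_mult_self[symmetric]
      by (simp add: mult.assoc)
  qed
  then show ?thesis
    unfolding representation_solution_def representation_formula_def differentiable_map_def formula_at_def by blast
qed

text \<open>Derivatives with respect to \<open>z\<close> scale by \<open>t\<close> and conjugate
  derivatives by \<open>cnj t\<close>, and each equation of the formula is homogeneous under this
  scaling.\<close>

lemma formula_at_chart_change: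
  assumes R: "riemann_surface S A" and \<phi>: "\<phi> \<in> conformal_params S A" and \<psi>: "\<psi> \<in> conformal_params S A"
    and q: "q \<in> fst \<phi>" "q \<in> fst \<psi>" and g: "smooth_map S A g" and f: "formula_at \<kappa> \<tau> g X \<psi> q"
  shows "formula_at \<kappa> \<tau> g X \<phi> q"
proof -
  obtain t where "\<forall>f a b. has_wirtinger (\<lambda>z. f (chart_inv \<psi> z)) a b (snd \<psi> q) \<longrightarrow>
    has_wirtinger (\<lambda>z. f (chart_inv \<phi> z)) (a * t) (b * cnj t) (snd \<phi> q)" using chart_change[OF R \<phi> \<psi> q] ..
  note t = this[rule_format]
  note D\<phi> = complex_chart_onD[OF conformal_paramsD[OF \<phi>]] and D\<psi> = complex_chart_onD[OF conformal_paramsD[OF \<psi>]]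
  have d: "(X \<circ> chart_inv \<psi>) differentiable (at (snd \<psi> q))"
    and r: "repr_at (crit \<kappa>) \<tau> (\<lambda>z. g (chart_inv \<psi> z)) (Zpart \<psi> X) (hpart \<psi> X) (snd \<psi> q)"
    using f by (auto simp: formula_at_def)
  have "smooth_on (\<lambda>z. g (chart_inv \<psi> z)) (chart_image \<psi>)" using g \<psi> by (simp add: smooth_map_def o_def)
  then have gd: "has_wirtinger (\<lambda>z. g (chart_inv \<psi> z)) (wz (\<lambda>z. g (chart_inv \<psi> z)) (snd \<psi> q)) (wzb (\<lambda>z. g (chart_inv \<psi> z)) (snd \<psi> q)) (snd \<psi> q)"
    by (rule smooth_on_has_wirtinger) (use q in auto)
  have Zd: "has_wirtinger (\<lambda>z. zeta (X (chart_inv \<psi> z))) (wz (Zpart \<psi> X) (snd \<psi> q)) (wzb (Zpart \<psi> X) (snd \<psi> q)) (snd \<psi> q)"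
    unfolding Zpart_def[symmetric] using d differentiable_parts by (intro has_wirtinger_works) blast
  have hd: "has_wirtinger (\<lambda>z. complex_of_real (X (chart_inv \<psi> z) $ 3)) (wz (\<lambda>z. complex_of_real (hpart \<psi> X z)) (snd \<psi> q))
     (wzb (\<lambda>z. complex_of_real (hpart \<psi> X z)) (snd \<psi> q)) (snd \<psi> q)"
    unfolding hpart_def[symmetric] using d differentiable_parts by (intro has_wirtinger_works) blast
  note G = t[of g, OF gd] and Z = t[of "\<lambda>r. zeta (X r)", OF Zd, folded Zpart_def] and H = t[of "\<lambda>r. complex_of_real (X r $ 3)", OF hd, folded hpart_def]
  have "(X \<circ> chart_inv \<phi>) differentiable (at (snd \<phi> q))"
    unfolding differentiable_parts using has_wirtinger_differentiable[OF Z] has_wirtinger_differentiable[OF H] by blast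
  moreover have eq: "Zpart \<phi> X (snd \<phi> q) = Zpart \<psi> X (snd \<psi> q)" "chart_inv \<phi> (snd \<phi> q) = q" "chart_inv \<psi> (snd \<psi> q) = q"
    using D\<phi>(4)[OF q(1)] D\<psi>(4)[OF q(2)] by (simp_all add: Zpart_def)
  have "vert (crit \<kappa>) \<tau> (Zpart \<phi> X) (snd \<phi> q) = vert (crit \<kappa>) \<tau> (Zpart \<psi> X) (snd \<psi> q) * t"
    unfolding vert_def has_wirtinger_unique[OF Z] eq by (simp add: algebra_simps)
  note v = this
  have "repr_at (crit \<kappa>) \<tau> (\<lambda>z. g (chart_inv \<phi> z)) (Zpart \<phi> X) (hpart \<phi> X) (snd \<phi> q)"
    unfolding repr_at_def repr_horiz_at_def Let_def v has_wirtinger_unique[OF Z] has_wirtinger_unique[OF G] has_wirtinger_unique[OF H] eq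
    using r unfolding repr_at_def repr_horiz_at_def Let_def eq
    by (simp only: distrib_right mult.assoc complex_cnj_mult)
  ultimately show ?thesis by (simp add: formula_at_def)
qed

lemma formula_at_cong:
  assumes \<phi>: "complex_chart_on S \<phi>" and q: "q \<in> fst \<phi>" and V: "openin (top_of_set S) V" "q \<in> V"
    and eq: "\<And>r. r \<in> V \<Longrightarrow> X r = Y r" and f: "formula_at \<kappa> \<tau> g X \<phi> q"
  shows "formula_at \<kappa> \<tau> g Y \<phi> q"
proof -
  obtain W where W: "open W" "snd \<phi> q \<in> W" "\<And>z. z \<in> W \<Longrightarrow> X (chart_inv \<phi> z) = Y (chart_inv \<phi> z)"
    using chart_germ_cong[where f=X and h=Y, OF \<phi> q V eq] by metis
  have d: "Zpart \<phi> X differentiable (at (snd \<phi> q))" "(\<lambda>z. complex_of_real (hpart \<phi> X z)) differentiable (at (snd \<phi> q))"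
    using f unfolding formula_at_def differentiable_parts by auto
  have Z: "has_wirtinger (Zpart \<phi> Y) (wz (Zpart \<phi> X) (snd \<phi> q)) (wzb (Zpart \<phi> X) (snd \<phi> q)) (snd \<phi> q)"
    by (rule has_wirtinger_transform[OF has_wirtinger_works[OF d(1)] W(1,2)]) (simp add: Zpart_def W)
  have H: "has_wirtinger (\<lambda>z. complex_of_real (hpart \<phi> Y z)) (wz (\<lambda>z. complex_of_real (hpart \<phi> X z)) (snd \<phi> q)) (wzb (\<lambda>z. complex_of_real (hpart \<phi> X z)) (snd \<phi> q)) (snd \<phi> q)"
    by (rule has_wirtinger_transform[OF has_wirtinger_works[OF d(2)] W(1,2)]) (simp add: hpart_def W)
  have ZZ: "Zpart \<phi> Y (snd \<phi> q) = Zpart \<phi> X (snd \<phi> q)" using W(3)[OF W(2)] by (simp add: Zpart_def)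
  have v: "vert (crit \<kappa>) \<tau> (Zpart \<phi> Y) (snd \<phi> q) = vert (crit \<kappa>) \<tau> (Zpart \<phi> X) (snd \<phi> q)"
    unfolding vert_def has_wirtinger_unique[OF Z] ZZ ..
  show ?thesis
    using f has_wirtinger_differentiable[OF Z] has_wirtinger_differentiable[OF H]
    unfolding formula_at_def differentiable_parts repr_at_def repr_horiz_at_def Let_def v has_wirtinger_unique[OF Z] has_wirtinger_unique[OF H] ZZ
    by blast
qed

section \<open>The geometry of an immersion in a chart\<close>

text \<open>Inverse stereographic projection from the south pole, so that
  \<open>w = (N1 + \<i> N2) / (1 + N3)\<close> and the open upper hemisphere corresponds to the unit
  disc.\<close>

definition stereo_normal :: "complex \<Rightarrow> real ^ 3" where
  "stereo_normal w = vector [2 * Re w / (1 + (norm w)\<^sup>2), 2 * Im w / (1 + (norm w)\<^sup>2), (1 - (norm w)\<^sup>2) / (1 + (norm w)\<^sup>2)]"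

lemma stereo_normal_positive: "1 + (norm (w :: complex))\<^sup>2 > 0"
  by (simp add: add_pos_nonneg)

lemma stereo_normal_inverse:
  "stereo_normal w $ 3 \<noteq> -1"
  "Complex (stereo_normal w $ 1) (stereo_normal w $ 2) = complex_of_real (1 + stereo_normal w $ 3) * w"
  "1 + stereo_normal w $ 3 = 2 / (1 + (norm w)\<^sup>2)"
proof -
  note p = stereo_normal_positive[of w]
  show e: "1 + stereo_normal w $ 3 = 2 / (1 + (norm w)\<^sup>2)" using p by (simp add: stereo_normal_def field_simps)
  then show "stereo_normal w $ 3 \<noteq> -1" using p by auto
  show "Complex (stereo_normal w $ 1) (stereo_normal w $ 2) = complex_of_real (1 + stereo_normal w $ 3) * w"
    unfolding e by (simp add: stereo_normal_def complex_eq_iff)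
qed

text \<open>Fixes one chart and one point of the surface, so that metric quantities of the immersion
  can be rewritten through the Wirtinger derivatives of \<open>\<zeta>\<close> and the
  height.\<close>

locale chart_point =
  fixes \<kappa> \<tau> :: real and S :: "'a::topological_space set" and \<phi> :: "'a chart" and X :: "'a \<Rightarrow> real ^ 3" and q :: 'a
  assumes nonpos: "\<kappa> \<le> 0" and chart: "complex_chart_on S \<phi>" and q: "q \<in> fst \<phi>"
    and smooth: "smooth_on (X \<circ> chart_inv \<phi>) (chart_image \<phi>)" and carrier: "X q \<in> E_carrier \<kappa>"
begin

abbreviation "z \<equiv> snd \<phi> q"
abbreviation "Z \<equiv> Zpart \<phi> X"
abbreviation "h \<equiv> hpart \<phi> X"
abbreviation "a \<equiv> vec_dz \<phi> X q"
abbreviation "b \<equiv> vec_dzbar \<phi> X q"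
abbreviation "L \<equiv> complex_of_real (Lam \<kappa> (X q))"
abbreviation "A3 \<equiv> E_coform \<kappa> \<tau> (X q) a"
abbreviation "C \<equiv> complex_of_real (crit \<kappa>)"
abbreviation "coordinate \<equiv> \<lambda>k z. complex_of_real (X (chart_inv \<phi> z) $ k)"

lemma open_image: "open (chart_image \<phi>)" and z_in: "z \<in> chart_image \<phi>" and inv_z: "chart_inv \<phi> z = q"
  using complex_chart_onD[OF chart] q by auto

lemma Z_z: "Z z = zeta (X q)"
  by (simp add: Zpart_def inv_z)

lemma cZ: "(crit \<kappa>)\<^sup>2 * (norm (zeta (X q)))\<^sup>2 < 1"
  using carrier E_carrier_iff[OF nonpos] by blast

lemma lam_Lam: "lam (crit \<kappa>) (zeta (X q)) = L"
  by (simp add: lam_facts(5)[OF cZ] Lam_def)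

lemma has_derivative_X: "((\<lambda>z. X (chart_inv \<phi> z)) has_derivative frechet_derivative (X \<circ> chart_inv \<phi>) (at z)) (at z)"
  using smooth_on_differentiable[OF smooth z_in] frechet_derivative_works by (auto simp: o_def)

lemma derivative_component:
  "frechet_derivative (coordinate k) (at z) v = complex_of_real (frechet_derivative (X \<circ> chart_inv \<phi>) (at z) v $ k)"
  using fun_cong[OF frechet_derivative_at[OF bounded_linear.has_derivative[OF bounded_linear_of_real
    bounded_linear.has_derivative[OF bounded_linear_vec_nth has_derivative_X]]], of v, symmetric] .

lemma a_nth: "a $ k = (complex_of_real (du \<phi> X q $ k) - \<i> * complex_of_real (dv \<phi> X q $ k)) / 2"
  and b_nth: "b $ k = cnj (a $ k)"
  using derivative_component[of k 1] derivative_component[of k \<i>]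
  by (simp_all add: vec_dz_def vec_dzbar_def dz_def dzbar_def du_def dv_def o_def)

lemma du_nth: "du \<phi> X q $ k = 2 * Re (a $ k)" and dv_nth: "dv \<phi> X q $ k = - 2 * Im (a $ k)"
  by (simp_all add: a_nth)

lemma smooth_comp: "smooth_on (coordinate k) (chart_image \<phi>)"
  using smooth open_image by (intro smooth_on_of_real smooth_on_nth) (simp_all add: o_def)

lemma wz_comp: "wz (coordinate k) z = a $ k" and wzb_comp: "wzb (coordinate k) z = b $ k"
  by (simp_all add: vec_dz_def vec_dzbar_def dz_wz dzbar_wzb)

lemma Z_comp: "Z = (\<lambda>x. coordinate 1 x + \<i> * coordinate 2 x)"
  by (auto simp: Zpart_def zeta_def complex_eq_iff)

lemma has_wirtinger_Z:
  "x \<in> chart_image \<phi> \<Longrightarrow> has_wirtinger Z (wz (coordinate 1) x + \<i> * wz (coordinate 2) x) (wzb (coordinate 1) x + \<i> * wzb (coordinate 2) x) x"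
  unfolding Z_comp
  by (rule has_wirtinger_eq[OF has_wirtinger_add[OF _ has_wirtinger_mult[OF has_wirtinger_const]]])
     (auto intro: smooth_on_has_wirtinger smooth_comp)

lemma wz_Z: "wz Z z = a $ 1 + \<i> * a $ 2" and wzb_Z: "wzb Z z = b $ 1 + \<i> * b $ 2"
  using has_wirtinger_unique[OF has_wirtinger_Z[OF z_in]] by (simp_all add: wz_comp wzb_comp)

lemma cnj_wz_Z: "cnj (wz Z z) = b $ 1 - \<i> * b $ 2" and cnj_wzb_Z: "cnj (wzb Z z) = a $ 1 - \<i> * a $ 2"
  by (simp_all add: wz_Z wzb_Z b_nth)

lemma wz_h: "wz (\<lambda>z. complex_of_real (h z)) z = a $ 3"
  using wz_comp[of 3] by (simp add: hpart_def[abs_def])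

lemma horizontal_part: "L * a $ 1 + \<i> * (L * a $ 2) = horiz (crit \<kappa>) Z z"
  "L * a $ 1 - \<i> * (L * a $ 2) = L * cnj (wzb Z z)"
  unfolding horiz_def Z_z lam_Lam wz_Z cnj_wzb_Z by (simp_all add: algebra_simps)

lemma vertical_part: "A3 = wz (\<lambda>z. complex_of_real (h z)) z - vert (crit \<kappa>) \<tau> Z z"
proof -
  have "vert (crit \<kappa>) \<tau> Z z = \<i> * \<tau> / 2 * L * (zeta (X q) * (a $ 1 - \<i> * a $ 2) - cnj (zeta (X q)) * (a $ 1 + \<i> * a $ 2))"
    unfolding vert_def Z_z lam_Lam wz_Z cnj_wzb_Z ..
  also have "zeta (X q) * (a $ 1 - \<i> * a $ 2) - cnj (zeta (X q)) * (a $ 1 + \<i> * a $ 2)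
     = 2 * \<i> * (complex_of_real (X q $ 2) * a $ 1 - complex_of_real (X q $ 1) * a $ 2)"
    by (simp add: zeta_def complex_eq_iff algebra_simps)
  also have "\<i> * \<tau> / 2 * L * (2 * \<i> * (complex_of_real (X q $ 2) * a $ 1 - complex_of_real (X q $ 1) * a $ 2))
     = - (complex_of_real \<tau> * L * (complex_of_real (X q $ 2) * a $ 1 - complex_of_real (X q $ 1) * a $ 2))"
    by (simp add: algebra_simps)
  finally show ?thesis unfolding wz_h E_coform_def by simp
qed

lemma frame_coords_du: "frame_coords \<kappa> \<tau> (X q) (du \<phi> X q) = vector [2 * Re (L * a $ 1), 2 * Re (L * a $ 2), 2 * Re A3]"
  and frame_coords_dv: "frame_coords \<kappa> \<tau> (X q) (dv \<phi> X q) = vector [- 2 * Im (L * a $ 1), - 2 * Im (L * a $ 2), - 2 * Im A3]"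
  by (simp_all add: vec_eq_iff forall_3 frame_coords_E[OF nonpos carrier] du_nth dv_nth)
     (simp_all add: E_coform_def du_nth dv_nth algebra_simps)

lemma E_coform_b: "E_coform \<kappa> \<tau> (X q) b = cnj A3"
  by (simp add: E_coform_def b_nth)

lemma inner_aa: "metric_inner (E_metric \<kappa> \<tau> (X q)) a a = (L * a $ 1)\<^sup>2 + (L * a $ 2)\<^sup>2 + A3\<^sup>2"
  unfolding metric_inner_E by (simp add: power2_eq_square algebra_simps)

lemma inner_ab: "metric_inner (E_metric \<kappa> \<tau> (X q)) a b =
    complex_of_real ((norm (L * a $ 1))\<^sup>2 + (norm (L * a $ 2))\<^sup>2 + (norm A3)\<^sup>2)"
proof -
  have "metric_inner (E_metric \<kappa> \<tau> (X q)) a b = (L * a $ 1) * cnj (L * a $ 1) + (L * a $ 2) * cnj (L * a $ 2) + A3 * cnj A3"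
    unfolding metric_inner_E E_coform_b b_nth by (simp add: power2_eq_square algebra_simps)
  then show ?thesis unfolding cnj_mult_self by simp
qed

lemma conf_factor_eq: "conf_factor \<kappa> \<tau> \<phi> X q = 2 * ((norm (L * a $ 1))\<^sup>2 + (norm (L * a $ 2))\<^sup>2 + (norm A3)\<^sup>2)"
  unfolding conf_factor_def inner_ab Re_complex_of_real ..

lemma inner_ab_conf: "metric_inner (E_metric \<kappa> \<tau> (X q)) a b = complex_of_real (conf_factor \<kappa> \<tau> \<phi> X q / 2)"
  unfolding inner_ab conf_factor_eq by simp

lemma isotropic_iff:
  "isotropic_at (crit \<kappa>) \<tau> Z h z w \<longleftrightarrow> horiz (crit \<kappa>) Z z \<noteq> 0 \<and> norm w < 1 \<and>
     L * a $ 1 - \<i> * (L * a $ 2) = - (cnj w)\<^sup>2 * horiz (crit \<kappa>) Z z \<and> A3 = - cnj w * horiz (crit \<kappa>) Z z"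
proof -
  have L: "L \<noteq> 0" using Lam_relations(1)[OF nonpos carrier] by simp
  have H: "horiz (crit \<kappa>) Z z = L * wz Z z" by (simp add: horiz_def Z_z lam_Lam)
  have "L * cnj (wzb Z z) = - (cnj w)\<^sup>2 * (L * wz Z z) \<longleftrightarrow> cnj (wzb Z z) = - (cnj w)\<^sup>2 * wz Z z"
  proof -
    have "- (cnj w)\<^sup>2 * (L * wz Z z) = L * (- (cnj w)\<^sup>2 * wz Z z)" by (simp add: mult_ac)
    then show ?thesis using L by (simp only: mult_cancel_left) simp
  qed
  then show ?thesis unfolding isotropic_at_def vertical_part[symmetric] horizontal_part(2) H using L by simp
qed

text \<open>Since \<open>X\<^sub>u\<close> and \<open>X\<^sub>v\<close> are twice the real part and
  minus twice the imaginary part of \<open>X\<^sub>z\<close>, the algebra of isotropic vectors in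
  frame components gives conformality, the conformal factor and the normal at once.\<close>

lemma isotropic_geometry:
  assumes "isotropic_at (crit \<kappa>) \<tau> Z h z w"
  shows "metric_inner (E_metric \<kappa> \<tau> (X q)) a a = 0"
    "conf_factor \<kappa> \<tau> \<phi> X q = (norm (horiz (crit \<kappa>) Z z))\<^sup>2 * (1 + (norm w)\<^sup>2)\<^sup>2"
    "conf_factor \<kappa> \<tau> \<phi> X q > 0"
    "cross3 (frame_coords \<kappa> \<tau> (X q) (du \<phi> X q)) (frame_coords \<kappa> \<tau> (X q) (dv \<phi> X q)) = conf_factor \<kappa> \<tau> \<phi> X q *\<^sub>R stereo_normal w"
proof -
  note I = assms[unfolded isotropic_iff]
  note c = cross_isotropic[OF horizontal_part(1), of w A3]
  have *: "L * a $ 1 - \<i> * (L * a $ 2) = - (cnj w)\<^sup>2 * horiz (crit \<kappa>) Z z" "A3 = - cnj w * horiz (crit \<kappa>) Z z" using I by blast+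
  show "metric_inner (E_metric \<kappa> \<tau> (X q)) a a = 0" unfolding inner_aa by (rule c(3)[OF *])
  show e: "conf_factor \<kappa> \<tau> \<phi> X q = (norm (horiz (crit \<kappa>) Z z))\<^sup>2 * (1 + (norm w)\<^sup>2)\<^sup>2"
    unfolding conf_factor_eq by (rule c(2)[OF *])
  note p = stereo_normal_positive[of w]
  have "horiz (crit \<kappa>) Z z \<noteq> 0" using I by blast
  then show "conf_factor \<kappa> \<tau> \<phi> X q > 0" unfolding e using p by (intro mult_pos_pos zero_less_power) auto
  have s: "(1 + (norm w)\<^sup>2) *\<^sub>R stereo_normal w = vector [2 * Re w, 2 * Im w, 1 - (norm w)\<^sup>2]"
    using p by (simp add: vec_eq_iff forall_3 stereo_normal_def)
  show "cross3 (frame_coords \<kappa> \<tau> (X q) (du \<phi> X q)) (frame_coords \<kappa> \<tau> (X q) (dv \<phi> X q)) = conf_factor \<kappa> \<tau> \<phi> X q *\<^sub>R stereo_normal w"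
    unfolding frame_coords_du frame_coords_dv c(1)[OF *] e s[symmetric] by (simp add: power2_eq_square mult_ac)
qed

end

definition frame_vector :: "real \<Rightarrow> real \<Rightarrow> real ^ 3 \<Rightarrow> real ^ 3 \<Rightarrow> real ^ 3" where
  "frame_vector \<kappa> \<tau> p N = (\<Sum>i\<in>UNIV. N $ i *\<^sub>R (E_frame \<kappa> \<tau> p $ i))"

lemma E_cross_frame_vector:
  "E_cross \<kappa> \<tau> p v w = frame_vector \<kappa> \<tau> p (cross3 (frame_coords \<kappa> \<tau> p v) (frame_coords \<kappa> \<tau> p w))"
  by (simp add: E_cross_def frame_vector_def)

lemma frame_vector_scaleR: "frame_vector \<kappa> \<tau> p (k *\<^sub>R N) = k *\<^sub>R frame_vector \<kappa> \<tau> p N"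
  by (simp add: frame_vector_def scaleR_sum_right)

lemma E_coform_add: "E_coform \<kappa> \<tau> p (v + w) = E_coform \<kappa> \<tau> p v + E_coform \<kappa> \<tau> p w"
  by (simp add: E_coform_def algebra_simps)

text \<open>The one-form is a triangular change of coordinates: it contains the third component with
  coefficient 1.\<close>

lemma eq_iff_E_coform: "v = w \<longleftrightarrow> (v $ 1 = w $ 1 \<and> v $ 2 = w $ 2) \<and> E_coform \<kappa> \<tau> p v = E_coform \<kappa> \<tau> p w"
  unfolding vec_eq_iff forall_3 E_coform_def by auto

lemma real_parts_eq_iff:
  assumes "cnj x1 = x1" "cnj x2 = x2" "cnj y1 = y1" "cnj y2 = y2"
  shows "x1 + \<i> * x2 = y1 + \<i> * y2 \<longleftrightarrow> x1 = y1 \<and> x2 = y2"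
  using assms by (auto simp: complex_eq_iff)

context chart_point
begin

lemma second_derivative: "dzbar \<phi> (dz \<phi> (\<lambda>r. complex_of_real (X r $ k))) q = wzb (wz (coordinate k)) z"
  by (rule dzbar_dz[OF chart q smooth_comp])

lemma second_derivative_real: "cnj (wzb (wz (coordinate k)) z) = wzb (wz (coordinate k)) z"
proof -
  note s = smooth_comp[of k]
  have "has_wirtinger (wz (coordinate k)) (wz (wz (coordinate k)) z) (wzb (wz (coordinate k)) z) z"
    by (rule smooth_on_has_wirtinger[OF smooth_on_wz[OF open_image s] z_in])
  from has_wirtinger_cnj[OF this]
  have "has_wirtinger (\<lambda>x. cnj (wz (coordinate k) x)) (cnj (wzb (wz (coordinate k)) z)) (cnj (wz (wz (coordinate k)) z)) z" .
  then have "has_wirtinger (wzb (coordinate k)) (cnj (wzb (wz (coordinate k)) z)) (cnj (wz (wz (coordinate k)) z)) z"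
    by (rule has_wirtinger_transform[OF _ open_image z_in]) (use has_wirtinger_real[OF smooth_on_has_wirtinger[OF s]] in auto)
  from has_wirtinger_unique(1)[OF this] show ?thesis using wzb_wz[OF open_image s z_in] by simp
qed

lemma wzb_wz_Z: "wzb (wz Z) z = wzb (wz (coordinate 1)) z + \<i> * wzb (wz (coordinate 2)) z"
proof -
  have d: "has_wirtinger (wz (coordinate k)) (wz (wz (coordinate k)) z) (wzb (wz (coordinate k)) z) z" for k
    by (rule smooth_on_has_wirtinger[OF smooth_on_wz[OF open_image smooth_comp] z_in])
  have "has_wirtinger (\<lambda>x. wz (coordinate 1) x + \<i> * wz (coordinate 2) x)
     (wz (wz (coordinate 1)) z + (\<i> * wz (wz (coordinate 2)) z + 0 * wz (coordinate 2) z))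
     (wzb (wz (coordinate 1)) z + (\<i> * wzb (wz (coordinate 2)) z + 0 * wz (coordinate 2) z)) z"
    by (intro has_wirtinger_add has_wirtinger_mult has_wirtinger_const d)
  then have "has_wirtinger (wz Z)
     (wz (wz (coordinate 1)) z + (\<i> * wz (wz (coordinate 2)) z + 0 * wz (coordinate 2) z))
     (wzb (wz (coordinate 1)) z + (\<i> * wzb (wz (coordinate 2)) z + 0 * wz (coordinate 2) z)) z"
    by (rule has_wirtinger_transform[OF _ open_image z_in]) (simp add: has_wirtinger_unique[OF has_wirtinger_Z])
  from has_wirtinger_unique(2)[OF this] show ?thesis by simp
qed

lemma E_chris_real: "cnj (E_chris \<kappa> \<tau> (X q) a b $ k) = E_chris \<kappa> \<tau> (X q) a b $ k"
proof -
  have "\<forall>k. cnj (E_chris \<kappa> \<tau> (X q) a b $ k) = E_chris \<kappa> \<tau> (X q) a b $ k"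
    unfolding forall_3 E_chris_def Let_def E_coform_def b_nth by (simp add: algebra_simps)
  then show ?thesis ..
qed

lemma E_coform_second_derivatives:
  "E_coform \<kappa> \<tau> (X q) (\<chi> k. wzb (wz (coordinate k)) z) =
    wzb (wz (\<lambda>z. complex_of_real (h z))) z
      - \<i> * \<tau> / 2 * L * (zeta (X q) * cnj (wzb (wz Z) z) - cnj (zeta (X q)) * wzb (wz Z) z)"
proof -
  define M1 M2 where M: "M1 = wzb (wz (coordinate 1)) z" "M2 = wzb (wz (coordinate 2)) z"
  have e: "zeta (X q) * cnj (M1 + \<i> * M2) - cnj (zeta (X q)) * (M1 + \<i> * M2)
     = 2 * \<i> * (complex_of_real (X q $ 2) * M1 - complex_of_real (X q $ 1) * M2)"
    unfolding complex_cnj_add complex_cnj_mult M second_derivative_real by (simp add: zeta_def complex_eq_iff algebra_simps)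
  show ?thesis unfolding wzb_wz_Z M[symmetric] e E_coform_def
    by (simp add: hpart_def[abs_def] M[symmetric] algebra_simps)
qed

text \<open>The vector equation is split into a horizontal complex equation and a vertical one.
  Merging the two horizontal components into one complex number loses nothing because the covariant
  derivative of \<open>X\<^sub>z\<close> along its conjugate is real.\<close>

lemma mean_curvature_iff:
  assumes iso: "isotropic_at (crit \<kappa>) \<tau> Z h z w"
  shows "cov_dzbar_dz (E_metric \<kappa> \<tau>) \<phi> X q =
      (\<chi> k. complex_of_real (conf_factor \<kappa> \<tau> \<phi> X q * crit \<kappa> / 2 * frame_vector \<kappa> \<tau> (X q) (stereo_normal w) $ k)) \<longleftrightarrow>
    cmc_at (crit \<kappa>) \<tau> Z h z w" (is "?cov = ?r \<longleftrightarrow> _")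
proof -
  define n where "n = frame_vector \<kappa> \<tau> (X q) (stereo_normal w)"
  define N where "N = stereo_normal w"
  have fc: "frame_coords \<kappa> \<tau> (X q) n = N" unfolding n_def N_def frame_vector_def by (rule frame_coords_combination[OF nonpos carrier])
  have n: "Lam \<kappa> (X q) * n $ 1 = N $ 1" "Lam \<kappa> (X q) * n $ 2 = N $ 2" "E_coform \<kappa> \<tau> (X q) n = N $ 3"
    using frame_coords_E[OF nonpos carrier, of \<tau> n] fc by simp_all
  define K where "K = 1 - C\<^sup>2 * zeta (X q) * cnj (zeta (X q))"
  have LK: "L * K = 1" using lam_facts(2)[OF cZ] by (simp add: lam_Lam K_def)
  \<comment> \<open>This factor clears the denominators of the stereographic normal, and the
    conformal factor supplies it twice.\<close>
  define e where "e = 1 + w * cnj w"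
  have er: "e = complex_of_real (1 + (norm w)\<^sup>2)" by (simp add: e_def cnj_mult_self)
  have e0: "e \<noteq> 0" unfolding er of_real_eq_0_iff using stereo_normal_positive[of w] by simp
  have eN: "e * (complex_of_real (N $ 1) + \<i> * complex_of_real (N $ 2)) = 2 * w" "e * complex_of_real (N $ 3) = 1 - w * cnj w"
  proof -
    have "(1 + (norm w)\<^sup>2) * N $ 1 = 2 * Re w" "(1 + (norm w)\<^sup>2) * N $ 2 = 2 * Im w" "(1 + (norm w)\<^sup>2) * N $ 3 = 1 - (norm w)\<^sup>2"
      using stereo_normal_positive[of w] by (simp_all add: N_def stereo_normal_def)
    note t = this
    show "e * (complex_of_real (N $ 1) + \<i> * complex_of_real (N $ 2)) = 2 * w"
      unfolding er using t by (simp add: complex_eq_iff)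
    show "e * complex_of_real (N $ 3) = 1 - w * cnj w"
      unfolding er cnj_mult_self of_real_mult[symmetric] t(3) by simp
  qed
  define P where "P = horiz (crit \<kappa>) Z z"
  have conf: "complex_of_real (conf_factor \<kappa> \<tau> \<phi> X q) = P * cnj P * e\<^sup>2"
    unfolding isotropic_geometry(2)[OF iso] er P_def cnj_mult_self by simp
  have cov: "?cov $ k = wzb (wz (coordinate k)) z + E_chris \<kappa> \<tau> (X q) a b $ k" for k
    unfolding cov_dzbar_dz_E[where \<kappa>=\<kappa> and X=X and q=q, OF nonpos carrier] second_derivative ..
  have real: "cnj (?cov $ k) = ?cov $ k" for k unfolding cov by (simp add: second_derivative_real E_chris_real)
  have rk: "?r $ k = complex_of_real (conf_factor \<kappa> \<tau> \<phi> X q * crit \<kappa> / 2 * n $ k)" for k by (simp add: n_def)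
  have "?cov = ?r \<longleftrightarrow> (?cov $ 1 = ?r $ 1 \<and> ?cov $ 2 = ?r $ 2) \<and> E_coform \<kappa> \<tau> (X q) ?cov = E_coform \<kappa> \<tau> (X q) ?r"
    by (rule eq_iff_E_coform)
  also have "?cov $ 1 = ?r $ 1 \<and> ?cov $ 2 = ?r $ 2 \<longleftrightarrow> ?cov $ 1 + \<i> * ?cov $ 2 = ?r $ 1 + \<i> * ?r $ 2"
    by (rule real_parts_eq_iff[symmetric]) (simp_all only: real rk complex_cnj_complex_of_real)
  also have "?cov $ 1 + \<i> * ?cov $ 2 = wzb (wz Z) z + 2 * C\<^sup>2 * L * cnj (zeta (X q)) * wz Z z * wzb Z z
      - \<i> * \<tau> * (wzb Z z * A3 + cnj A3 * wz Z z)"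
  proof -
    have "?cov $ 1 + \<i> * ?cov $ 2 = wzb (wz Z) z + (E_chris \<kappa> \<tau> (X q) a b $ 1 + \<i> * E_chris \<kappa> \<tau> (X q) a b $ 2)"
      unfolding cov wzb_wz_Z by (simp add: distrib_left)
    then show ?thesis unfolding E_chris_horizontal E_coform_b wz_Z[symmetric] wzb_Z[symmetric] by (simp add: mult_ac)
  qed
  also have "?r $ 1 + \<i> * ?r $ 2 = C * P * cnj P * e * w * K"
  proof -
    have u: "complex_of_real (n $ k) = K * complex_of_real (N $ k)" if "k = 1 \<or> k = 2" for k
    proof -
      have "L * complex_of_real (n $ k) = complex_of_real (N $ k)" using n(1,2) that by (metis of_real_mult)
      then have "K * complex_of_real (N $ k) = (L * K) * complex_of_real (n $ k)" by (simp add: mult_ac)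
      then show ?thesis by (simp add: LK)
    qed
    have "?r $ 1 + \<i> * ?r $ 2 = P * cnj P * e\<^sup>2 * C / 2 * (complex_of_real (n $ 1) + \<i> * complex_of_real (n $ 2))"
      unfolding rk of_real_mult of_real_divide conf by (simp add: n_def[symmetric] algebra_simps)
    also have "\<dots> = P * cnj P * e * C * K / 2 * (e * (complex_of_real (N $ 1) + \<i> * complex_of_real (N $ 2)))"
      using u[of 1] u[of 2] by (simp add: power2_eq_square algebra_simps)
    finally show ?thesis unfolding eN by (simp add: mult_ac)
  qed
  also have "E_coform \<kappa> \<tau> (X q) ?cov = wzb (wz (\<lambda>z. complex_of_real (h z))) z
      - \<i> * \<tau> / 2 * L * (zeta (X q) * cnj (wzb (wz Z) z) - cnj (zeta (X q)) * wzb (wz Z) z)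
      - \<i> * \<tau> * C\<^sup>2 * L\<^sup>2 / 4 * ((zeta (X q) * cnj (wz Z z) + cnj (zeta (X q)) * wzb Z z) * (zeta (X q) * cnj (wzb Z z) - cnj (zeta (X q)) * wz Z z)
         + (zeta (X q) * cnj (wzb Z z) + cnj (zeta (X q)) * wz Z z) * (zeta (X q) * cnj (wz Z z) - cnj (zeta (X q)) * wzb Z z))"
  proof -
    have "?cov = (\<chi> k. wzb (wz (coordinate k)) z) + E_chris \<kappa> \<tau> (X q) a b" by (simp add: vec_eq_iff cov)
    then have "E_coform \<kappa> \<tau> (X q) ?cov = E_coform \<kappa> \<tau> (X q) (\<chi> k. wzb (wz (coordinate k)) z) + E_coform \<kappa> \<tau> (X q) (E_chris \<kappa> \<tau> (X q) a b)"
      by (simp add: E_coform_add)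
    then show ?thesis unfolding E_coform_second_derivatives E_chris_vertical cnj_wz_Z cnj_wzb_Z wz_Z[symmetric] wzb_Z[symmetric]
      by simp
  qed
  also have "E_coform \<kappa> \<tau> (X q) ?r = C / 2 * P * cnj P * (1 - w\<^sup>2 * (cnj w)\<^sup>2)"
  proof -
    have "E_coform \<kappa> \<tau> (X q) ?r = complex_of_real (E_coform \<kappa> \<tau> (X q) ((conf_factor \<kappa> \<tau> \<phi> X q * crit \<kappa> / 2) *\<^sub>R n))"
      by (simp add: E_coform_def n_def)
    also have "E_coform \<kappa> \<tau> (X q) ((conf_factor \<kappa> \<tau> \<phi> X q * crit \<kappa> / 2) *\<^sub>R n) = (conf_factor \<kappa> \<tau> \<phi> X q * crit \<kappa> / 2) * N $ 3"
      unfolding n(3)[symmetric] by (simp add: E_coform_def algebra_simps)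
    also have "complex_of_real \<dots> = P * cnj P * C / 2 * e * (e * complex_of_real (N $ 3))"
      unfolding of_real_mult of_real_divide conf by (simp add: power2_eq_square mult_ac)
    finally show ?thesis unfolding eN by (simp add: e_def power2_eq_square algebra_simps)
  qed
  also have "(wzb (wz Z) z + 2 * C\<^sup>2 * L * cnj (zeta (X q)) * wz Z z * wzb Z z
      - \<i> * \<tau> * (wzb Z z * A3 + cnj A3 * wz Z z) = C * P * cnj P * e * w * K) \<and>
    wzb (wz (\<lambda>z. complex_of_real (h z))) z
      - \<i> * \<tau> / 2 * L * (zeta (X q) * cnj (wzb (wz Z) z) - cnj (zeta (X q)) * wzb (wz Z) z)
      - \<i> * \<tau> * C\<^sup>2 * L\<^sup>2 / 4 * ((zeta (X q) * cnj (wz Z z) + cnj (zeta (X q)) * wzb Z z) * (zeta (X q) * cnj (wzb Z z) - cnj (zeta (X q)) * wz Z z)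
         + (zeta (X q) * cnj (wzb Z z) + cnj (zeta (X q)) * wz Z z) * (zeta (X q) * cnj (wz Z z) - cnj (zeta (X q)) * wzb Z z))
     = C / 2 * P * cnj P * (1 - w\<^sup>2 * (cnj w)\<^sup>2) \<longleftrightarrow> cmc_at (crit \<kappa>) \<tau> Z h z w"
    unfolding cmc_at_def Let_def vertical_part[symmetric] Z_z lam_Lam P_def[symmetric] K_def e_def ..
  finally show ?thesis .
qed

end

lemma chart_pointI:
  assumes "\<kappa> \<le> 0" "\<phi> \<in> conformal_params S A" "q \<in> fst \<phi>" "smooth_map S A X" "X \<in> S \<rightarrow> E_carrier \<kappa>"
  shows "chart_point \<kappa> S \<phi> X q"
  using assms complex_chart_onD(2)[OF conformal_paramsD[OF assms(2)]]
  unfolding chart_point_def by (auto simp: smooth_map_def dest: conformal_paramsD)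

text \<open>The normal is a definite description over all parameters at \<open>q\<close>: one chart
  with nonzero conformal factor gives uniqueness, while existence requires the same vector in every
  chart.\<close>

lemma unit_normal_eqI:
  assumes \<phi>: "\<phi> \<in> conformal_params S A" "q \<in> fst \<phi>" "conf_factor \<kappa> \<tau> \<phi> X q \<noteq> 0"
    and n: "\<And>\<psi>. \<psi> \<in> conformal_params S A \<Longrightarrow> q \<in> fst \<psi> \<Longrightarrow>
      E_cross \<kappa> \<tau> (X q) (du \<psi> X q) (dv \<psi> X q) = conf_factor \<kappa> \<tau> \<psi> X q *\<^sub>R n"
  shows "unit_normal S A \<kappa> \<tau> X q = n"
  unfolding unit_normal_def
proof (rule the_equality)
  show "\<forall>\<phi>\<in>conformal_params S A. q \<in> fst \<phi> \<longrightarrow> E_cross \<kappa> \<tau> (X q) (du \<phi> X q) (dv \<phi> X q) = conf_factor \<kappa> \<tau> \<phi> X q *\<^sub>R n"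
    using n by blast
  fix m assume "\<forall>\<phi>\<in>conformal_params S A. q \<in> fst \<phi> \<longrightarrow> E_cross \<kappa> \<tau> (X q) (du \<phi> X q) (dv \<phi> X q) = conf_factor \<kappa> \<tau> \<phi> X q *\<^sub>R m"
  then have "conf_factor \<kappa> \<tau> \<phi> X q *\<^sub>R m = conf_factor \<kappa> \<tau> \<phi> X q *\<^sub>R n" using \<phi> n by metis
  then show "m = n" using \<phi>(3) by simp
qed

lemma unit_normal_isotropic:
  assumes \<kappa>: "\<kappa> \<le> 0" and R: "riemann_surface S A" and q: "q \<in> S" and X: "smooth_map S A X" "X \<in> S \<rightarrow> E_carrier \<kappa>"
    and iso: "\<And>\<phi>. \<phi> \<in> conformal_params S A \<Longrightarrow> q \<in> fst \<phi> \<Longrightarrow> isotropic_at (crit \<kappa>) \<tau> (Zpart \<phi> X) (hpart \<phi> X) (snd \<phi> q) w"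
  shows "unit_normal S A \<kappa> \<tau> X q = frame_vector \<kappa> \<tau> (X q) (stereo_normal w)"
    "normal_coords S A \<kappa> \<tau> X q = stereo_normal w"
proof -
  obtain \<phi> where \<phi>: "\<phi> \<in> conformal_params S A" "q \<in> fst \<phi>" using surface_chart[OF R q] .
  show u: "unit_normal S A \<kappa> \<tau> X q = frame_vector \<kappa> \<tau> (X q) (stereo_normal w)"
  proof (rule unit_normal_eqI[OF \<phi>])
    show "conf_factor \<kappa> \<tau> \<phi> X q \<noteq> 0"
      using chart_point.isotropic_geometry(3)[OF chart_pointI[OF \<kappa> \<phi> X] iso[OF \<phi>]] by simp
    show "E_cross \<kappa> \<tau> (X q) (du \<psi> X q) (dv \<psi> X q) = conf_factor \<kappa> \<tau> \<psi> X q *\<^sub>R frame_vector \<kappa> \<tau> (X q) (stereo_normal w)"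
      if "\<psi> \<in> conformal_params S A" "q \<in> fst \<psi>" for \<psi>
      unfolding E_cross_frame_vector chart_point.isotropic_geometry(4)[OF chart_pointI[OF \<kappa> that X] iso[OF that]] frame_vector_scaleR ..
  qed
  have "X q \<in> E_carrier \<kappa>" using X(2) q by blast
  from frame_coords_combination[OF \<kappa> this, of \<tau> "stereo_normal w"]
  show "normal_coords S A \<kappa> \<tau> X q = stereo_normal w"
    unfolding normal_coords_def u frame_vector_def .
qed

text \<open>The exceptional cases of the definition are excluded, since \<open>1 + N3\<close> and
  the Moebius denominator are both nonzero; \<open>1 + N3\<close> then cancels from the
  quotient.\<close>

lemma gauss_map_stereo:
  assumes N: "normal_coords S A \<kappa> \<tau> X q = stereo_normal w" and w: "norm w < 1"
    and cZ: "(crit \<kappa>)\<^sup>2 * (norm (zeta (X q)))\<^sup>2 < 1"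
  shows "gauss_map S A \<kappa> \<tau> X q =
    Some ((w + crit \<kappa> * zeta (X q)) / (1 + crit \<kappa> * cnj (zeta (X q)) * w))"
proof -
  define k where "k = complex_of_real (1 + stereo_normal w $ 3)"
  have k0: "k \<noteq> 0" unfolding k_def of_real_eq_0_iff stereo_normal_inverse(3) using stereo_normal_positive[of w] by simp
  have nz: "1 + crit \<kappa> * cnj (zeta (X q)) * w \<noteq> 0" by (rule moebius_denominator_nonzero(1)[OF cZ w])
  have num: "Complex (stereo_normal w $ 1) (stereo_normal w $ 2) + complex_of_real (crit \<kappa>) * zeta (X q) * k
     = k * (w + crit \<kappa> * zeta (X q))"
    unfolding stereo_normal_inverse(2) k_def[symmetric] by (simp add: algebra_simps)
  have den: "cnj (complex_of_real (crit \<kappa>) * zeta (X q)) * Complex (stereo_normal w $ 1) (stereo_normal w $ 2) + 1 + complex_of_real (stereo_normal w $ 3)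
     = k * (1 + crit \<kappa> * cnj (zeta (X q)) * w)"
  proof -
    have "1 + complex_of_real (stereo_normal w $ 3) = k" by (simp add: k_def)
    then show ?thesis unfolding stereo_normal_inverse(2) k_def[symmetric] add.assoc by (simp add: algebra_simps)
  qed
  have "k * (1 + crit \<kappa> * cnj (zeta (X q)) * w) \<noteq> 0" using k0 nz by simp
  then show ?thesis
    unfolding gauss_map_def N Let_def den k_def[symmetric] num using stereo_normal_inverse(1)[of w] k0 by simp
qed

text \<open>Multiplying \<open>X\<^sub>z\<close> by \<open>t\<close> rotates and stretches the pair
  of coordinate velocities within its span, so oriented area scales by \<open>|t|^2\<close>.\<close>

lemma cross3_complex_scale:
  "cross3 (vector [2 * Re (x * t), 2 * Re (y * t), 2 * Re (u * t)]) (vector [- 2 * Im (x * t), - 2 * Im (y * t), - 2 * Im (u * t)])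
    = (norm t)\<^sup>2 *\<^sub>R cross3 (vector [2 * Re x, 2 * Re y, 2 * Re u]) (vector [- 2 * Im x, - 2 * Im y, - 2 * Im u])"
  unfolding cmod_power2 by (simp add: vec_eq_iff forall_3 cross3_def power2_eq_square algebra_simps)

lemma vec_dz_chart_change:
  assumes \<kappa>: "\<kappa> \<le> 0" and R: "riemann_surface S A" and \<phi>: "\<phi> \<in> conformal_params S A" "q \<in> fst \<phi>"
    and \<psi>: "\<psi> \<in> conformal_params S A" "q \<in> fst \<psi>" and X: "smooth_map S A X" "X \<in> S \<rightarrow> E_carrier \<kappa>"
  shows "\<exists>t. \<forall>k. vec_dz \<phi> X q $ k = vec_dz \<psi> X q $ k * t"
proof -
  obtain t where "\<forall>f a b. has_wirtinger (\<lambda>z. f (chart_inv \<psi> z)) a b (snd \<psi> q) \<longrightarrow>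
    has_wirtinger (\<lambda>z. f (chart_inv \<phi> z)) (a * t) (b * cnj t) (snd \<phi> q)"
    using chart_change[OF R \<phi>(1) \<psi>(1) \<phi>(2) \<psi>(2)] ..
  note t = this[rule_format]
  interpret \<psi>: chart_point \<kappa> \<tau> S \<psi> X q by (rule chart_pointI[OF \<kappa> \<psi> X])
  interpret \<phi>: chart_point \<kappa> \<tau> S \<phi> X q by (rule chart_pointI[OF \<kappa> \<phi> X])
  have "vec_dz \<phi> X q $ k = vec_dz \<psi> X q $ k * t" for k
  proof -
    have "has_wirtinger (\<lambda>z. complex_of_real (X (chart_inv \<psi> z) $ k)) (vec_dz \<psi> X q $ k) (vec_dzbar \<psi> X q $ k) (snd \<psi> q)"
      using smooth_on_has_wirtinger[OF \<psi>.smooth_comp \<psi>.z_in] unfolding \<psi>.wz_comp \<psi>.wzb_comp .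
    from t[of "\<lambda>r. complex_of_real (X r $ k)", OF this]
    have "has_wirtinger (\<lambda>z. complex_of_real (X (chart_inv \<phi> z) $ k)) (vec_dz \<psi> X q $ k * t) (vec_dzbar \<psi> X q $ k * cnj t) (snd \<phi> q)" .
    from has_wirtinger_unique(1)[OF this] show ?thesis unfolding \<phi>.wz_comp .
  qed
  then show ?thesis by blast
qed

text \<open>Both quantities scale by \<open>|t|^2\<close>, so their quotient is independent of the
  chart. This makes the unit normal of a conformal immersion well defined.\<close>

lemma conformal_chart_change:
  assumes \<kappa>: "\<kappa> \<le> 0" and R: "riemann_surface S A" and \<phi>: "\<phi> \<in> conformal_params S A" "q \<in> fst \<phi>"
    and \<psi>: "\<psi> \<in> conformal_params S A" "q \<in> fst \<psi>" and X: "smooth_map S A X" "X \<in> S \<rightarrow> E_carrier \<kappa>"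
  shows "\<exists>k. conf_factor \<kappa> \<tau> \<phi> X q = k * conf_factor \<kappa> \<tau> \<psi> X q \<and>
    E_cross \<kappa> \<tau> (X q) (du \<phi> X q) (dv \<phi> X q) = k *\<^sub>R E_cross \<kappa> \<tau> (X q) (du \<psi> X q) (dv \<psi> X q)"
proof -
  obtain t where t: "\<forall>k. vec_dz \<phi> X q $ k = vec_dz \<psi> X q $ k * t" using vec_dz_chart_change[OF assms] ..
  interpret \<psi>: chart_point \<kappa> \<tau> S \<psi> X q by (rule chart_pointI[OF \<kappa> \<psi> X])
  interpret \<phi>: chart_point \<kappa> \<tau> S \<phi> X q by (rule chart_pointI[OF \<kappa> \<phi> X])
  have l: "complex_of_real (Lam \<kappa> (X q)) * vec_dz \<phi> X q $ k = complex_of_real (Lam \<kappa> (X q)) * vec_dz \<psi> X q $ k * t" for k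
    using t by simp
  have A3: "E_coform \<kappa> \<tau> (X q) (vec_dz \<phi> X q) = E_coform \<kappa> \<tau> (X q) (vec_dz \<psi> X q) * t"
    using t by (simp add: E_coform_def algebra_simps)
  have "conf_factor \<kappa> \<tau> \<phi> X q = (norm t)\<^sup>2 * conf_factor \<kappa> \<tau> \<psi> X q"
    unfolding \<phi>.conf_factor_eq \<psi>.conf_factor_eq l A3 norm_mult[of _ t] by (simp add: power_mult_distrib algebra_simps)
  moreover have "E_cross \<kappa> \<tau> (X q) (du \<phi> X q) (dv \<phi> X q) = (norm t)\<^sup>2 *\<^sub>R E_cross \<kappa> \<tau> (X q) (du \<psi> X q) (dv \<psi> X q)"
    unfolding E_cross_frame_vector \<phi>.frame_coords_du \<phi>.frame_coords_dv \<psi>.frame_coords_du \<psi>.frame_coords_dv l A3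
      cross3_complex_scale frame_vector_scaleR ..
  ultimately show ?thesis by blast
qed

text \<open>In the chart, \<open>w\<close> is read off from \<open>X\<^sub>z\<close>; comparing
  cross products then identifies it with the stereographic projection of the chart independent
  normal.\<close>

lemma conformal_isotropic:
  assumes \<kappa>: "\<kappa> \<le> 0" and R: "riemann_surface S A" and ci: "conformal_immersion S A \<kappa> \<tau> X" and q: "q \<in> S"
    and up: "normal_coords S A \<kappa> \<tau> X q $ 3 > 0" and \<phi>: "\<phi> \<in> conformal_params S A" "q \<in> fst \<phi>"
  defines "N \<equiv> normal_coords S A \<kappa> \<tau> X q"
  shows "isotropic_at (crit \<kappa>) \<tau> (Zpart \<phi> X) (hpart \<phi> X) (snd \<phi> q) (Complex (N $ 1) (N $ 2) / complex_of_real (1 + N $ 3))"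
proof -
  have X: "smooth_map S A X" "X \<in> S \<rightarrow> E_carrier \<kappa>" using ci by (auto simp: conformal_immersion_def)
  interpret \<phi>: chart_point \<kappa> \<tau> S \<phi> X q by (rule chart_pointI[OF \<kappa> \<phi> X])
  have conf: "conf_factor \<kappa> \<tau> \<phi> X q > 0" and iso: "metric_inner (E_metric \<kappa> \<tau> (X q)) (vec_dz \<phi> X q) (vec_dz \<phi> X q) = 0"
    using ci \<phi> by (auto simp: conformal_immersion_def)
  define n where "n = (1 / conf_factor \<kappa> \<tau> \<phi> X q) *\<^sub>R E_cross \<kappa> \<tau> (X q) (du \<phi> X q) (dv \<phi> X q)"
  have n: "unit_normal S A \<kappa> \<tau> X q = n"
  proof (rule unit_normal_eqI[OF \<phi>])
    fix \<psi> assume \<psi>: "\<psi> \<in> conformal_params S A" "q \<in> fst \<psi>"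
    obtain k where "conf_factor \<kappa> \<tau> \<psi> X q = k * conf_factor \<kappa> \<tau> \<phi> X q"
      "E_cross \<kappa> \<tau> (X q) (du \<psi> X q) (dv \<psi> X q) = k *\<^sub>R E_cross \<kappa> \<tau> (X q) (du \<phi> X q) (dv \<phi> X q)"
      using conformal_chart_change[OF \<kappa> R \<psi> \<phi> X] by blast
    then show "E_cross \<kappa> \<tau> (X q) (du \<psi> X q) (dv \<psi> X q) = conf_factor \<kappa> \<tau> \<psi> X q *\<^sub>R n"
      using conf by (simp add: n_def)
  qed (use conf in simp)
  have cross: "cross3 (frame_coords \<kappa> \<tau> (X q) (du \<phi> X q)) (frame_coords \<kappa> \<tau> (X q) (dv \<phi> X q)) = conf_factor \<kappa> \<tau> \<phi> X q *\<^sub>R N"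
    unfolding N_def normal_coords_def n n_def frame_coords_scaleR frame_coords_cross[OF \<kappa> \<phi>.carrier] using conf by simp
  have "cross3 (vector [2 * Re (\<phi>.L * \<phi>.a $ 1), 2 * Re (\<phi>.L * \<phi>.a $ 2), 2 * Re \<phi>.A3])
     (vector [- 2 * Im (\<phi>.L * \<phi>.a $ 1), - 2 * Im (\<phi>.L * \<phi>.a $ 2), - 2 * Im \<phi>.A3]) $ 3 > 0"
    unfolding \<phi>.frame_coords_du[symmetric] \<phi>.frame_coords_dv[symmetric] cross using conf up by (simp add: N_def)
  note U = isotropic_upwards[OF iso[unfolded \<phi>.inner_aa] this, unfolded \<phi>.horizontal_part(1)]
  define w where "w = - cnj (\<phi>.A3 / horiz (crit \<kappa>) (Zpart \<phi> X) (snd \<phi> q))"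
  have I: "isotropic_at (crit \<kappa>) \<tau> (Zpart \<phi> X) (hpart \<phi> X) (snd \<phi> q) w"
    unfolding \<phi>.isotropic_iff w_def using U by blast
  from \<phi>.isotropic_geometry(4)[OF I] cross conf have N: "N = stereo_normal w" by simp
  have "complex_of_real (1 + stereo_normal w $ 3) \<noteq> 0"
    unfolding of_real_eq_0_iff stereo_normal_inverse(3) using stereo_normal_positive[of w] by simp
  then have "Complex (N $ 1) (N $ 2) / complex_of_real (1 + N $ 3) = w"
    unfolding N stereo_normal_inverse(2) by simp
  then show ?thesis using I by simp
qed

lemma gauss_at_chart:
  assumes g: "smooth_map S A g" and \<phi>: "\<phi> \<in> conformal_params S A" "q \<in> fst \<phi>"
  shows "gauss_at (\<lambda>z. g (chart_inv \<phi> z)) (snd \<phi> q) \<longleftrightarrow>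
    (1 - complex_of_real ((norm (g q))\<^sup>2)) * dzbar \<phi> (dz \<phi> g) q + 2 * cnj (g q) * dz \<phi> g q * dzbar \<phi> g q = 0"
proof -
  note D = complex_chart_onD[OF conformal_paramsD[OF \<phi>(1)]]
  have "smooth_on (\<lambda>z. g (chart_inv \<phi> z)) (chart_image \<phi>)" using g \<phi>(1) by (simp add: smooth_map_def o_def)
  note dd = dzbar_dz[OF conformal_paramsD[OF \<phi>(1)] \<phi>(2) this]
  show ?thesis unfolding gauss_at_def dd unfolding dz_wz dzbar_wzb D(4)[OF \<phi>(2)] cnj_mult_self ..
qed

lemma crit_nonzero: "\<kappa> \<le> 0 \<Longrightarrow> (\<kappa>, \<tau>) \<noteq> (0, 0) \<Longrightarrow> crit \<kappa> \<noteq> 0 \<or> \<tau> \<noteq> 0"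
  by (auto simp: crit_def)

theorem cmc_surface_gauss_map:
  assumes \<kappa>: "\<kappa> \<le> 0" and \<kappa>\<tau>: "(\<kappa>, \<tau>) \<noteq> (0, 0)" and R: "riemann_surface S A"
    and X: "critical_cmc_immersion S A \<kappa> \<tau> X" and up: "upwards_pointing S A \<kappa> \<tau> X"
  shows "\<exists>g\<in>S \<rightarrow> ball 0 1. (\<forall>q\<in>S. gauss_map S A \<kappa> \<tau> X q = Some (g q)) \<and> smooth_map S A g \<and>
    nowhere_antiholomorphic S A g \<and> gauss_equation S A g \<and> representation_solution S A \<kappa> \<tau> g X"
proof -
  have ci: "conformal_immersion S A \<kappa> \<tau> X" and H: "has_mean_curvature S A \<kappa> \<tau> X (\<lambda>_. crit \<kappa>)"
    using X by (auto simp: critical_cmc_immersion_def)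
  have Xs: "smooth_map S A X" and XE: "X \<in> S \<rightarrow> E_carrier \<kappa>" using ci by (auto simp: conformal_immersion_def)
  define N where "N q = normal_coords S A \<kappa> \<tau> X q" for q
  \<comment> \<open>Defined on the surface from the normal, so the same \<open>w\<close> and
    \<open>g\<close> serve in all charts; \<open>iso\<close> shows that it is the isotropy parameter
    in each of them.\<close>
  define w where "w q = Complex (N q $ 1) (N q $ 2) / complex_of_real (1 + N q $ 3)" for q
  define g where "g q = (w q + crit \<kappa> * zeta (X q)) / (1 + crit \<kappa> * cnj (zeta (X q)) * w q)" for q
  have iso: "isotropic_at (crit \<kappa>) \<tau> (Zpart \<phi> X) (hpart \<phi> X) (snd \<phi> q) (w q)"
    if \<phi>: "\<phi> \<in> conformal_params S A" "q \<in> fst \<phi>" for \<phi> q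
  proof -
    have q: "q \<in> S" using complex_chart_onD(2)[OF conformal_paramsD[OF \<phi>(1)]] \<phi>(2) by blast
    then have "normal_coords S A \<kappa> \<tau> X q $ 3 > 0" using up by (simp add: upwards_pointing_def)
    from conformal_isotropic[OF \<kappa> R ci q this \<phi>] show ?thesis by (simp add: w_def N_def)
  qed
  have cZ: "(crit \<kappa>)\<^sup>2 * (norm (zeta (X q)))\<^sup>2 < 1" if "q \<in> S" for q
    using XE that E_carrier_iff[OF \<kappa>] by blast
  have w1: "norm (w q) < 1" if q: "q \<in> S" for q
  proof -
    obtain \<phi> where "\<phi> \<in> conformal_params S A" "q \<in> fst \<phi>" using surface_chart[OF R q] .
    from iso[OF this] show ?thesis by (simp add: isotropic_at_def)
  qed
  have un: "unit_normal S A \<kappa> \<tau> X q = frame_vector \<kappa> \<tau> (X q) (stereo_normal (w q))"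
    and nc: "normal_coords S A \<kappa> \<tau> X q = stereo_normal (w q)" if q: "q \<in> S" for q
    by (rule unit_normal_isotropic[OF \<kappa> R q Xs XE]; rule iso; assumption)+
  have cmc: "cmc_at (crit \<kappa>) \<tau> (Zpart \<phi> X) (hpart \<phi> X) (snd \<phi> q) (w q)"
    if \<phi>: "\<phi> \<in> conformal_params S A" "q \<in> fst \<phi>" for \<phi> q
  proof -
    have q: "q \<in> S" using complex_chart_onD(2)[OF conformal_paramsD[OF \<phi>(1)]] \<phi>(2) by blast
    interpret \<phi>: chart_point \<kappa> \<tau> S \<phi> X q by (rule chart_pointI[OF \<kappa> \<phi> Xs XE])
    have "cov_dzbar_dz (E_metric \<kappa> \<tau>) \<phi> X q =
      (\<chi> k. complex_of_real (conf_factor \<kappa> \<tau> \<phi> X q * crit \<kappa> / 2 * frame_vector \<kappa> \<tau> (X q) (stereo_normal (w q)) $ k))"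
      using H \<phi> unfolding has_mean_curvature_def un[OF q, symmetric] by blast
    then show ?thesis using \<phi>.mean_curvature_iff[OF iso[OF \<phi>]] by blast
  qed
  have main: "smooth_on (\<lambda>z. g (chart_inv \<phi> z)) (chart_image \<phi>)"
    "\<And>q. q \<in> fst \<phi> \<Longrightarrow> norm (g q) < 1 \<and> dz \<phi> g q \<noteq> 0 \<and>
      repr_at (crit \<kappa>) \<tau> (\<lambda>z. g (chart_inv \<phi> z)) (Zpart \<phi> X) (hpart \<phi> X) (snd \<phi> q) \<and> gauss_at (\<lambda>z. g (chart_inv \<phi> z)) (snd \<phi> q)"
    if \<phi>: "\<phi> \<in> conformal_params S A" for \<phi>
  proof -
    note D = complex_chart_onD[OF conformal_paramsD[OF \<phi>]]
    have sm: "smooth_on (Zpart \<phi> X) (chart_image \<phi>)" "smooth_on (\<lambda>z. complex_of_real (hpart \<phi> X z)) (chart_image \<phi>)"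
    proof -
      have "smooth_on (X \<circ> chart_inv \<phi>) (chart_image \<phi>)" using Xs \<phi> by (simp add: smooth_map_def)
      then show "smooth_on (Zpart \<phi> X) (chart_image \<phi>)" "smooth_on (\<lambda>z. complex_of_real (hpart \<phi> X z)) (chart_image \<phi>)"
        unfolding smooth_parts[OF D(3)] by blast+
    qed
    have c: "(crit \<kappa>)\<^sup>2 * (norm (Zpart \<phi> X z))\<^sup>2 < 1" if "z \<in> chart_image \<phi>" for z
      unfolding Zpart_def by (rule cZ) (use D(2,5) that in blast)
    have i: "isotropic_at (crit \<kappa>) \<tau> (Zpart \<phi> X) (hpart \<phi> X) z (w (chart_inv \<phi> z))"
      and m: "cmc_at (crit \<kappa>) \<tau> (Zpart \<phi> X) (hpart \<phi> X) z (w (chart_inv \<phi> z))" if "z \<in> chart_image \<phi>" for z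
      using iso[OF \<phi>, of "chart_inv \<phi> z"] cmc[OF \<phi>, of "chart_inv \<phi> z"] D(5)[OF that] by auto
    have gz: "g (chart_inv \<phi> z) = (w (chart_inv \<phi> z) + crit \<kappa> * Zpart \<phi> X z) / (1 + crit \<kappa> * cnj (Zpart \<phi> X z) * w (chart_inv \<phi> z))" for z
      by (simp add: g_def Zpart_def)
    note T = surface_imp_gauss[where w="\<lambda>z. w (chart_inv \<phi> z)" and g="\<lambda>z. g (chart_inv \<phi> z)",
      OF D(3) sm _ crit_nonzero[OF \<kappa> \<kappa>\<tau>]]
    show "smooth_on (\<lambda>z. g (chart_inv \<phi> z)) (chart_image \<phi>)" by (rule T(1)) (erule c i m | rule gz)+
    fix q assume q: "q \<in> fst \<phi>"
    then have "snd \<phi> q \<in> chart_image \<phi>" by blast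
    have "norm (g (chart_inv \<phi> (snd \<phi> q))) < 1 \<and> wz (\<lambda>z. g (chart_inv \<phi> z)) (snd \<phi> q) \<noteq> 0 \<and>
      repr_at (crit \<kappa>) \<tau> (\<lambda>z. g (chart_inv \<phi> z)) (Zpart \<phi> X) (hpart \<phi> X) (snd \<phi> q) \<and> gauss_at (\<lambda>z. g (chart_inv \<phi> z)) (snd \<phi> q)"
      by (rule T(2)) (erule c i m | rule gz \<open>snd \<phi> q \<in> chart_image \<phi>\<close>)+
    then show "norm (g q) < 1 \<and> dz \<phi> g q \<noteq> 0 \<and>
      repr_at (crit \<kappa>) \<tau> (\<lambda>z. g (chart_inv \<phi> z)) (Zpart \<phi> X) (hpart \<phi> X) (snd \<phi> q) \<and> gauss_at (\<lambda>z. g (chart_inv \<phi> z)) (snd \<phi> q)"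
      unfolding dz_wz D(4)[OF q] by blast
  qed
  have gs: "smooth_map S A g" using main(1) by (simp add: smooth_map_def o_def)
  show ?thesis
  proof (intro bexI[of _ g] conjI ballI)
    show "gauss_map S A \<kappa> \<tau> X q = Some (g q)" if "q \<in> S" for q
      unfolding g_def by (rule gauss_map_stereo[OF nc[OF that] w1[OF that] cZ[OF that]])
    show "nowhere_antiholomorphic S A g" using main(2) by (simp add: nowhere_antiholomorphic_def)
    show "gauss_equation S A g" unfolding gauss_equation_def
      using main(2) gauss_at_chart[OF gs] by blast
    show "representation_solution S A \<kappa> \<tau> g X"
      unfolding representation_solution_iff[OF gs] formula_at_def
    proof (intro conjI ballI XE)
      fix \<phi> q assume \<phi>: "\<phi> \<in> conformal_params S A" "q \<in> fst \<phi>"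
      show "(X \<circ> chart_inv \<phi>) differentiable at (snd \<phi> q)"
        by (rule smooth_on_differentiable[of _ "chart_image \<phi>"]) (use Xs \<phi> in \<open>auto simp: smooth_map_def\<close>)
      show "repr_at (crit \<kappa>) \<tau> (\<lambda>z. g (chart_inv \<phi> z)) (Zpart \<phi> X) (hpart \<phi> X) (snd \<phi> q)" using main(2)[OF \<phi>] by blast
    qed
    show "g \<in> S \<rightarrow> ball 0 1"
    proof
      fix q assume q: "q \<in> S"
      obtain \<phi> where "\<phi> \<in> conformal_params S A" "q \<in> fst \<phi>" using surface_chart[OF R q] .
      from main(2)[OF this] show "g q \<in> ball 0 1" by simp
    qed
  qed (rule gs)
qed

theorem gauss_map_cmc_surface:
  assumes \<kappa>: "\<kappa> \<le> 0" and \<kappa>\<tau>: "(\<kappa>, \<tau>) \<noteq> (0, 0)" and R: "riemann_surface S A"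
    and g1: "g \<in> S \<rightarrow> ball 0 1" and gs: "smooth_map S A g" and eq: "gauss_equation S A g"
    and na: "nowhere_antiholomorphic S A g" and sol: "representation_solution S A \<kappa> \<tau> g X"
  shows "critical_cmc_immersion S A \<kappa> \<tau> X" "\<And>q. q \<in> S \<Longrightarrow> gauss_map S A \<kappa> \<tau> X q = Some (g q)"
proof -
  have XE: "X \<in> S \<rightarrow> E_carrier \<kappa>" and f: "\<And>\<phi> q. \<phi> \<in> conformal_params S A \<Longrightarrow> q \<in> fst \<phi> \<Longrightarrow> formula_at \<kappa> \<tau> g X \<phi> q"
    using sol unfolding representation_solution_iff[OF gs] by blast+
  have cZ: "(crit \<kappa>)\<^sup>2 * (norm (zeta (X q)))\<^sup>2 < 1" if "q \<in> S" for q
    using XE that E_carrier_iff[OF \<kappa>] by blast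
  have gn: "norm (g q) < 1" if "q \<in> S" for q using g1 that by force
  \<comment> \<open>The inverse hyperbolic translation: the stereographic projection that the normal
    must have for \<open>g\<close> to be the Gauss map.\<close>
  define w where "w q = (g q - complex_of_real (crit \<kappa>) * zeta (X q)) / (1 - complex_of_real (crit \<kappa>) * cnj (zeta (X q)) * g q)" for q
  have main: "smooth_on (Zpart \<phi> X) (chart_image \<phi>)" "smooth_on (\<lambda>z. complex_of_real (hpart \<phi> X z)) (chart_image \<phi>)"
    "\<And>q. q \<in> fst \<phi> \<Longrightarrow> isotropic_at (crit \<kappa>) \<tau> (Zpart \<phi> X) (hpart \<phi> X) (snd \<phi> q) (w q) \<and>
      cmc_at (crit \<kappa>) \<tau> (Zpart \<phi> X) (hpart \<phi> X) (snd \<phi> q) (w q)"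
    if \<phi>: "\<phi> \<in> conformal_params S A" for \<phi>
  proof -
    note D = complex_chart_onD[OF conformal_paramsD[OF \<phi>]]
    let ?g = "\<lambda>z. g (chart_inv \<phi> z)"
    have a1: "smooth_on ?g (chart_image \<phi>)" using gs \<phi> by (simp add: smooth_map_def o_def)
    have in_S: "chart_inv \<phi> z \<in> S" if "z \<in> chart_image \<phi>" for z using D(2,5) that by blast
    have a2: "norm (?g z) < 1" if "z \<in> chart_image \<phi>" for z by (rule gn[OF in_S[OF that]])
    have a3: "wz ?g z \<noteq> 0" and a4: "gauss_at ?g z" and a5: "Zpart \<phi> X differentiable (at z)"
      and a6: "(\<lambda>z. complex_of_real (hpart \<phi> X z)) differentiable (at z)"
      and a7: "repr_at (crit \<kappa>) \<tau> ?g (Zpart \<phi> X) (hpart \<phi> X) z"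
      and a8: "(crit \<kappa>)\<^sup>2 * (norm (Zpart \<phi> X z))\<^sup>2 < 1" if z: "z \<in> chart_image \<phi>" for z
    proof -
      have q: "chart_inv \<phi> z \<in> fst \<phi>" and zq: "snd \<phi> (chart_inv \<phi> z) = z" using D(5)[OF z] by auto
      have "dz \<phi> g (chart_inv \<phi> z) \<noteq> 0" using na \<phi> q by (auto simp: nowhere_antiholomorphic_def)
      then show "wz ?g z \<noteq> 0" unfolding dz_wz zq .
      show "gauss_at ?g z" using gauss_at_chart[OF gs \<phi> q] eq \<phi> q unfolding gauss_equation_def zq by blast
      from f[OF \<phi> q] show "Zpart \<phi> X differentiable (at z)" "(\<lambda>z. complex_of_real (hpart \<phi> X z)) differentiable (at z)"
        "repr_at (crit \<kappa>) \<tau> ?g (Zpart \<phi> X) (hpart \<phi> X) z" unfolding formula_at_def differentiable_parts zq by blast+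
      show "(crit \<kappa>)\<^sup>2 * (norm (Zpart \<phi> X z))\<^sup>2 < 1" unfolding Zpart_def by (rule cZ[OF in_S[OF z]])
    qed
    note T = gauss_imp_surface[where g="?g" and Z="Zpart \<phi> X" and h="hpart \<phi> X", OF D(3) a1 _ _ _ _ _ _ _ crit_nonzero[OF \<kappa> \<kappa>\<tau>]]
    show "smooth_on (Zpart \<phi> X) (chart_image \<phi>)" by (rule T(1)) (erule a2 a3 a4 a5 a6 a7 a8)+
    show "smooth_on (\<lambda>z. complex_of_real (hpart \<phi> X z)) (chart_image \<phi>)" by (rule T(2)) (erule a2 a3 a4 a5 a6 a7 a8)+
    fix q assume q: "q \<in> fst \<phi>"
    then have zq: "snd \<phi> q \<in> chart_image \<phi>" by blast
    have wq: "(?g (snd \<phi> q) - complex_of_real (crit \<kappa>) * Zpart \<phi> X (snd \<phi> q)) / (1 - complex_of_real (crit \<kappa>) * cnj (Zpart \<phi> X (snd \<phi> q)) * ?g (snd \<phi> q)) = w q"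
      unfolding w_def Zpart_def D(4)[OF q] ..
    have "isotropic_at (crit \<kappa>) \<tau> (Zpart \<phi> X) (hpart \<phi> X) (snd \<phi> q) ((?g (snd \<phi> q) - complex_of_real (crit \<kappa>) * Zpart \<phi> X (snd \<phi> q)) / (1 - complex_of_real (crit \<kappa>) * cnj (Zpart \<phi> X (snd \<phi> q)) * ?g (snd \<phi> q))) \<and>
      cmc_at (crit \<kappa>) \<tau> (Zpart \<phi> X) (hpart \<phi> X) (snd \<phi> q) ((?g (snd \<phi> q) - complex_of_real (crit \<kappa>) * Zpart \<phi> X (snd \<phi> q)) / (1 - complex_of_real (crit \<kappa>) * cnj (Zpart \<phi> X (snd \<phi> q)) * ?g (snd \<phi> q)))"
      by (rule T(3)) (erule a2 a3 a4 a5 a6 a7 a8 | rule zq)+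
    then show "isotropic_at (crit \<kappa>) \<tau> (Zpart \<phi> X) (hpart \<phi> X) (snd \<phi> q) (w q) \<and>
      cmc_at (crit \<kappa>) \<tau> (Zpart \<phi> X) (hpart \<phi> X) (snd \<phi> q) (w q)"
      unfolding wq .
  qed
  have Xs: "smooth_map S A X" unfolding smooth_map_def
  proof
    fix \<phi> assume \<phi>: "\<phi> \<in> conformal_params S A"
    show "smooth_on (X \<circ> chart_inv \<phi>) (chart_image \<phi>)"
      unfolding smooth_parts[OF complex_chart_onD(3)[OF conformal_paramsD[OF \<phi>]]] using main(1,2)[OF \<phi>] by blast
  qed
  have iso: "isotropic_at (crit \<kappa>) \<tau> (Zpart \<phi> X) (hpart \<phi> X) (snd \<phi> q) (w q)"
    if "\<phi> \<in> conformal_params S A" "q \<in> fst \<phi>" for \<phi> q using main(3)[OF that] by blast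
  have un: "unit_normal S A \<kappa> \<tau> X q = frame_vector \<kappa> \<tau> (X q) (stereo_normal (w q))"
    and nc: "normal_coords S A \<kappa> \<tau> X q = stereo_normal (w q)" if q: "q \<in> S" for q
    by (rule unit_normal_isotropic[OF \<kappa> R q Xs XE]; rule iso; assumption)+
  show "critical_cmc_immersion S A \<kappa> \<tau> X"
    unfolding critical_cmc_immersion_def conformal_immersion_def has_mean_curvature_def
  proof (intro conjI ballI XE Xs)
    fix \<phi> q assume \<phi>: "\<phi> \<in> conformal_params S A" "q \<in> fst \<phi>"
    interpret \<phi>: chart_point \<kappa> \<tau> S \<phi> X q by (rule chart_pointI[OF \<kappa> \<phi> Xs XE])
    show "metric_inner (E_metric \<kappa> \<tau> (X q)) (vec_dz \<phi> X q) (vec_dz \<phi> X q) = 0" "conf_factor \<kappa> \<tau> \<phi> X q > 0"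
      using \<phi>.isotropic_geometry(1,3)[OF iso[OF \<phi>]] by blast+
    show "metric_inner (E_metric \<kappa> \<tau> (X q)) (vec_dz \<phi> X q) (vec_dzbar \<phi> X q) = complex_of_real (conf_factor \<kappa> \<tau> \<phi> X q / 2)"
      by (rule \<phi>.inner_ab_conf)
    have q: "q \<in> S" using complex_chart_onD(2)[OF conformal_paramsD[OF \<phi>(1)]] \<phi>(2) by blast
    show "cov_dzbar_dz (E_metric \<kappa> \<tau>) \<phi> X q =
        (\<chi> k. complex_of_real (conf_factor \<kappa> \<tau> \<phi> X q * crit \<kappa> / 2 * unit_normal S A \<kappa> \<tau> X q $ k))"
      unfolding un[OF q] \<phi>.mean_curvature_iff[OF iso[OF \<phi>]] using main(3)[OF \<phi>] by blast
  qed
  show "gauss_map S A \<kappa> \<tau> X q = Some (g q)" if q: "q \<in> S" for q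
  proof -
    note M = moebius_inverse[OF cZ[OF q] gn[OF q], folded w_def]
    show ?thesis using gauss_map_stereo[OF nc[OF q] M(1) cZ[OF q]] unfolding M(2) .
  qed
qed

section \<open>Harmonicity\<close>

lemma matrix_inv_mat:
  assumes "(k::real) \<noteq> 0"
  shows "matrix_inv (mat k :: real ^ 'n ^ 'n) = mat (1 / k)"
proof -
  have 1: "(mat a :: real ^ 'n ^ 'n) ** mat b = mat (a * b)" for a b
    by (simp add: matrix_matrix_mult_def mat_def vec_eq_iff if_distrib[of "\<lambda>x. x * _"] cong: if_cong)
  have i: "(mat k :: real ^ 'n ^ 'n) ** mat (1 / k) = mat 1" "(mat (1 / k) :: real ^ 'n ^ 'n) ** mat k = mat 1"
    using assms by (simp_all add: 1)
  then have "\<exists>B. (mat k :: real ^ 'n ^ 'n) ** B = mat 1 \<and> B ** mat k = mat 1" by blast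
  then have "matrix_inv (mat k :: real ^ 'n ^ 'n) ** mat k = mat 1"
    unfolding matrix_inv_def by (rule someI2_ex) blast
  then have "(matrix_inv (mat k :: real ^ 'n ^ 'n) ** mat k) ** mat (1 / k) = mat (1 / k)" by simp
  then show ?thesis unfolding matrix_mul_assoc[symmetric] i by simp
qed

lemma partial_hyperbolic:
  fixes p :: "real ^ 2"
  assumes "norm p < 1"
  shows "partial l (\<lambda>y. hyperbolic_disc_metric y $ i $ j) p = (if i = j then 16 * p $ l / (1 - (norm p)\<^sup>2) ^ 3 else 0)"
proof (cases "i = j")
  case True
  have D: "1 - p \<bullet> p \<noteq> 0" using assms by (simp add: power2_norm_eq_inner[symmetric] power_less_one_iff abs_square_less_1[symmetric])
      (metis abs_norm_cancel abs_square_less_1 less_irrefl)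
  have u: "((\<lambda>y. 1 - y \<bullet> y) has_derivative (\<lambda>v. - (2 * (p \<bullet> v)))) (at p)"
    by (auto intro!: derivative_eq_intros simp: inner_commute)
  have "((\<lambda>u. 4 / u\<^sup>2) has_real_derivative - 8 / d ^ 3) (at d)" if "d \<noteq> 0" for d :: real
    using that by (auto intro!: derivative_eq_intros simp: field_simps power2_eq_square power3_eq_cube)
  from this[OF D, unfolded has_field_derivative_def]
  have "((\<lambda>u. 4 / u\<^sup>2) has_derivative (\<lambda>v. - 8 / (1 - p \<bullet> p) ^ 3 * v)) (at (1 - p \<bullet> p))" .
  from has_derivative_compose[OF u this]
  have "((\<lambda>y. 4 / (1 - y \<bullet> y)\<^sup>2) has_derivative (\<lambda>v. 16 * (p \<bullet> v) / (1 - p \<bullet> p) ^ 3)) (at p)"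
    by simp
  from fun_cong[OF frechet_derivative_at[OF this], of "axis l 1", symmetric]
  show ?thesis using True unfolding partial_def hyperbolic_disc_metric_def
    by (simp add: mat_def power2_norm_eq_inner inner_axis)
next
  case False
  then show ?thesis by (simp add: partial_def hyperbolic_disc_metric_def mat_def)
qed

text \<open>The metric is \<open>exp (2 f)\<close> times the flat one with
  \<open>f = ln (2 / (1 - |p|^2))\<close>. The symbols of such a metric are combinations of the
  partial derivatives of \<open>f\<close>, here \<open>2 p\<^sub>i / (1 - |p|^2)\<close>.\<close>

lemma christoffel_hyperbolic:
  fixes p :: "real ^ 2"
  assumes "norm p < 1"
  shows "christoffel hyperbolic_disc_metric p k i j =
    2 / (1 - (norm p)\<^sup>2) * ((if j = k then p $ i else 0) + (if i = k then p $ j else 0) - (if i = j then p $ k else 0))"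
proof -
  define D where "D = 1 - (norm p)\<^sup>2"
  have D: "D \<noteq> 0" using assms unfolding D_def by (metis abs_norm_cancel abs_square_less_1 eq_iff_diff_eq_0 less_irrefl)
  have "matrix_inv (hyperbolic_disc_metric p) = mat (D\<^sup>2 / 4)"
    unfolding hyperbolic_disc_metric_def D_def[symmetric] using D by (subst matrix_inv_mat) auto
  then have "christoffel hyperbolic_disc_metric p k i j =
     D\<^sup>2 / 4 * ((if j = k then 16 * p $ i / D ^ 3 else 0) + (if i = k then 16 * p $ j / D ^ 3 else 0) - (if i = j then 16 * p $ k / D ^ 3 else 0)) / 2"
    unfolding christoffel_def partial_hyperbolic[OF assms] D_def[symmetric]
    by (simp add: mat_def if_distrib[of "\<lambda>x. x * _"] cong: if_cong)
  also have "\<dots> = 2 / D * ((if j = k then p $ i else 0) + (if i = k then p $ j else 0) - (if i = j then p $ k else 0))"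
    using D by (simp add: power2_eq_square power3_eq_cube field_simps)
  finally show ?thesis unfolding D_def .
qed

lemma zeta_embedding: "zeta (vector [Re x, Im x, 0]) = x"
  by (simp add: zeta_def complex_eq_iff)

lemma gauss_equation_imp_harmonic:
  assumes R: "riemann_surface S A" and g: "smooth_map S A g" and g1: "g \<in> S \<rightarrow> ball 0 1" and eq: "gauss_equation S A g"
  shows "harmonic_map S A hyperbolic_disc_metric (\<lambda>q. complex_vec (g q))"
proof -
  \<comment> \<open>Placing \<open>g\<close> in a horizontal plane of flat space makes the facts of
    \<open>chart_point\<close> about derivatives of components available for
    \<open>g\<close>.\<close>
  define Y where "Y q = (vector [Re (g q), Im (g q), 0] :: real ^ 3)" for q
  have Ys: "smooth_map S A Y" unfolding smooth_map_def
  proof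
    fix \<phi> assume \<phi>: "\<phi> \<in> conformal_params S A"
    have o: "open (chart_image \<phi>)" using complex_chart_onD(3)[OF conformal_paramsD[OF \<phi>]] .
    have "Zpart \<phi> Y = g \<circ> chart_inv \<phi>" "hpart \<phi> Y = (\<lambda>z. 0)"
      by (auto simp: fun_eq_iff Zpart_def hpart_def Y_def zeta_embedding)
    then show "smooth_on (Y \<circ> chart_inv \<phi>) (chart_image \<phi>)"
      unfolding smooth_parts[OF o] using g \<phi> o by (auto simp: smooth_map_def intro: smooth_on_const)
  qed
  have YE: "Y \<in> S \<rightarrow> E_carrier 0" by (simp add: E_carrier_def)
  show ?thesis unfolding harmonic_map_def
  proof (intro conjI ballI)
    have bl: "bounded_linear complex_vec"
    proof -
      have "complex_vec = (\<lambda>w. Re w *\<^sub>R axis 1 1 + Im w *\<^sub>R axis 2 1)"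
        by (auto simp: fun_eq_iff complex_vec_def vec_eq_iff forall_2 axis_def)
      moreover have "bounded_linear (\<lambda>w. Re w *\<^sub>R (axis 1 1 :: real ^ 2) + Im w *\<^sub>R axis 2 1)"
        by (intro bounded_linear_add bounded_linear_compose[OF bounded_linear_scaleR_left] bounded_linear_Re bounded_linear_Im)
      ultimately show ?thesis by simp
    qed
    show "smooth_map S A (\<lambda>q. complex_vec (g q))" unfolding smooth_map_def o_def
    proof
      fix \<phi> assume \<phi>: "\<phi> \<in> conformal_params S A"
      show "smooth_on (\<lambda>z. complex_vec (g (chart_inv \<phi> z))) (chart_image \<phi>)"
        by (rule smooth_on_linear_comp[OF complex_chart_onD(3)[OF conformal_paramsD[OF \<phi>]] bl])
           (use g \<phi> in \<open>simp add: smooth_map_def o_def\<close>)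
    qed
    fix \<phi> q assume \<phi>: "\<phi> \<in> conformal_params S A" "q \<in> fst \<phi>"
    have q: "q \<in> S" using complex_chart_onD(2)[OF conformal_paramsD[OF \<phi>(1)]] \<phi>(2) by blast
    interpret \<phi>: chart_point 0 0 S \<phi> Y q by (rule chart_pointI[OF _ \<phi> Ys YE]) simp
    have Zg: "Zpart \<phi> Y = (\<lambda>z. g (chart_inv \<phi> z))" by (auto simp: fun_eq_iff Zpart_def Y_def zeta_embedding)
    let ?p = "complex_vec (g q)" and ?f = "\<lambda>q. complex_vec (g q)"
    have np: "norm ?p = norm (g q)" by (simp add: complex_vec_def norm_vec_def L2_set_def sum_2 cmod_def)
    have g1q: "norm (g q) < 1" using g1 q by force
    have comp: "(\<lambda>r. complex_of_real (?f r $ 1)) = (\<lambda>r. complex_of_real (Y r $ 1))" "(\<lambda>r. complex_of_real (?f r $ 2)) = (\<lambda>r. complex_of_real (Y r $ 2))"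
      by (auto simp: complex_vec_def Y_def)
    define a1 a2 where a: "a1 = vec_dz \<phi> Y q $ 1" "a2 = vec_dz \<phi> Y q $ 2"
    define M1 M2 where M: "M1 = wzb (wz (\<phi>.coordinate 1)) (snd \<phi> q)" "M2 = wzb (wz (\<phi>.coordinate 2)) (snd \<phi> q)"
    have A: "vec_dz \<phi> ?f q $ 1 = a1" "vec_dz \<phi> ?f q $ 2 = a2" unfolding vec_dz_def by (simp_all add: comp a vec_dz_def)
    have B: "vec_dzbar \<phi> ?f q $ 1 = cnj a1" "vec_dzbar \<phi> ?f q $ 2 = cnj a2"
      unfolding a \<phi>.b_nth[symmetric] by (simp_all add: comp vec_dzbar_def)
    define D where "D = complex_of_real (1 - (norm (g q))\<^sup>2)"
    have D0: "D \<noteq> 0" unfolding D_def of_real_eq_0_iff using g1q norm_less_one_iff[of "g q"] by simp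
    define x y where xy: "x = complex_of_real (Re (g q))" "y = complex_of_real (Im (g q))"
    let ?V = "cov_dzbar_dz hyperbolic_disc_metric \<phi> ?f q"
    have V: "?V $ 1 = M1 + 2 / D * (x * (a1 * cnj a1 - a2 * cnj a2) + y * (a1 * cnj a2 + a2 * cnj a1))"
      "?V $ 2 = M2 + 2 / D * (x * (a1 * cnj a2 + a2 * cnj a1) - y * (a1 * cnj a1 - a2 * cnj a2))"
      unfolding cov_dzbar_dz_def christoffel_hyperbolic[OF g1q[folded np]] np M
      by (simp_all add: sum_2 A B comp \<phi>.second_derivative)
         (simp_all add: complex_vec_def xy D_def[unfolded of_real_diff of_real_1 of_real_power, symmetric] algebra_simps add_divide_distrib diff_divide_distrib)
    have real: "cnj (?V $ 1) = ?V $ 1" "cnj (?V $ 2) = ?V $ 2"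
      unfolding V using \<phi>.second_derivative_real[of 1] \<phi>.second_derivative_real[of 2]
      by (simp_all add: M xy D_def mult.commute)
    have g': "dz \<phi> g q = a1 + \<i> * a2" "dzbar \<phi> g q = cnj a1 + \<i> * cnj a2" "dzbar \<phi> (dz \<phi> g) q = M1 + \<i> * M2"
    proof -
      show "dz \<phi> g q = a1 + \<i> * a2" unfolding dz_wz Zg[symmetric] \<phi>.wz_Z a ..
      show "dzbar \<phi> g q = cnj a1 + \<i> * cnj a2" unfolding dzbar_wzb Zg[symmetric] \<phi>.wzb_Z a \<phi>.b_nth ..
      have "smooth_on (\<lambda>z. g (chart_inv \<phi> z)) (chart_image \<phi>)" using g \<phi>(1) by (simp add: smooth_map_def o_def)
      from dzbar_dz[OF conformal_paramsD[OF \<phi>(1)] \<phi>(2) this]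
      show "dzbar \<phi> (dz \<phi> g) q = M1 + \<i> * M2" unfolding Zg[symmetric] \<phi>.wzb_wz_Z M .
    qed
    have e: "D * (M1 + \<i> * M2) + 2 * cnj (g q) * (a1 + \<i> * a2) * (cnj a1 + \<i> * cnj a2) = 0"
      using eq \<phi> unfolding gauss_equation_def g'[symmetric] D_def by simp
    have gxy: "cnj (g q) = x - \<i> * y" by (simp add: xy complex_eq_iff)
    have i2: "\<i> * \<i> = -1" by simp
    \<comment> \<open>The two real components combine into the left side of the equation for
      \<open>g\<close>; since each is real, both vanish.\<close>
    have "D * (?V $ 1 + \<i> * ?V $ 2) = D * (M1 + \<i> * M2) + 2 * (x - \<i> * y) * (a1 + \<i> * a2) * (cnj a1 + \<i> * cnj a2)"
    proof -
      have l: "D * (m1 + 2 / D * u + \<i> * (m2 + 2 / D * v)) = D * (m1 + \<i> * m2) + 2 * (u + \<i> * v)" for m1 m2 u v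
        using D0 by (simp add: field_simps)
      show ?thesis unfolding V l by (simp add: algebra_simps)
    qed
    then have "D * (?V $ 1 + \<i> * ?V $ 2) = 0" unfolding gxy[symmetric] e .
    then have "?V $ 1 + \<i> * ?V $ 2 = 0 + \<i> * 0" using D0 by simp
    then have "?V $ 1 = 0" "?V $ 2 = 0" using real_parts_eq_iff[OF real, of 0 0] by simp_all
    then show "?V = 0" by (simp add: vec_eq_iff forall_2)
  qed
qed

section \<open>Solutions of the representation formula\<close>

lemma vec3_eqI: "zeta p = zeta p' \<Longrightarrow> p $ 3 = p' $ 3 \<Longrightarrow> p = p'"
  using vec3_decompose[of p] vec3_decompose[of p'] by metis

text \<open>Uniqueness in the plane is proved along rays, so the neighbourhood is first shrunk to a
  coordinate disc contained in \<open>V\<close>.\<close>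

lemma formula_at_unique:
  assumes g: "smooth_map S A g" and g1: "g \<in> S \<rightarrow> ball 0 1" and \<phi>: "\<phi> \<in> conformal_params S A"
    and V: "openin (top_of_set S) V" "V \<subseteq> fst \<phi>" "q \<in> V" and XY: "X q = Y q"
    and f: "\<And>r. r \<in> V \<Longrightarrow> formula_at \<kappa> \<tau> g X \<phi> r" "\<And>r. r \<in> V \<Longrightarrow> formula_at \<kappa> \<tau> g Y \<phi> r"
  shows "\<exists>W. openin (top_of_set S) W \<and> q \<in> W \<and> W \<subseteq> V \<and> (\<forall>x\<in>W. X x = Y x)"
proof -
  note D = complex_chart_onD[OF conformal_paramsD[OF \<phi>]]
  have q: "q \<in> fst \<phi>" using V by blast
  have "open (snd \<phi> ` V)" by (rule chart_open_image[OF conformal_paramsD[OF \<phi>] V(1,2)])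
  then obtain r where r: "r > 0" "ball (snd \<phi> q) r \<subseteq> snd \<phi> ` V" using V(3) open_contains_ball by (metis image_eqI)
  let ?B = "ball (snd \<phi> q) r"
  have BI: "?B \<subseteq> chart_image \<phi>" using r(2) V(2) by blast
  have inV: "chart_inv \<phi> z \<in> V" "snd \<phi> (chart_inv \<phi> z) = z" if zB: "z \<in> ?B" for z
  proof -
    obtain x where "x \<in> V" "z = snd \<phi> x" using r(2) zB by blast
    then show "chart_inv \<phi> z \<in> V" using D(4)[of x] V(2) by auto
    show "snd \<phi> (chart_inv \<phi> z) = z" using D(5) BI zB by blast
  qed
  have P: "Zpart \<phi> X differentiable (at z)" "(\<lambda>z. complex_of_real (hpart \<phi> X z)) differentiable (at z)"
    "Zpart \<phi> Y differentiable (at z)" "(\<lambda>z. complex_of_real (hpart \<phi> Y z)) differentiable (at z)"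
    "repr_at (crit \<kappa>) \<tau> (\<lambda>z. g (chart_inv \<phi> z)) (Zpart \<phi> X) (hpart \<phi> X) z"
    "repr_at (crit \<kappa>) \<tau> (\<lambda>z. g (chart_inv \<phi> z)) (Zpart \<phi> Y) (hpart \<phi> Y) z" if "z \<in> ?B" for z
    using f[OF inV(1)[OF that]] unfolding formula_at_def differentiable_parts inV(2)[OF that] by blast+
  have gB: "smooth_on (\<lambda>z. g (chart_inv \<phi> z)) ?B"
    by (rule smooth_on_subset[OF _ BI]) (use g \<phi> in \<open>simp add: smooth_map_def o_def\<close>)
  have gn: "norm (g (chart_inv \<phi> z)) < 1" if "z \<in> ?B" for z
    using g1 inV(1)[OF that] V(2) D(2) by force
  have init: "Zpart \<phi> X (snd \<phi> q) = Zpart \<phi> Y (snd \<phi> q)" "hpart \<phi> X (snd \<phi> q) = hpart \<phi> Y (snd \<phi> q)"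
    using XY by (simp_all add: Zpart_def hpart_def D(4)[OF q])
  have "X (chart_inv \<phi> z) = Y (chart_inv \<phi> z)" if z: "z \<in> ?B" for z
  proof -
    have "Zpart \<phi> X z = Zpart \<phi> Y z \<and> hpart \<phi> X z = hpart \<phi> Y z"
      by (rule repr_unique[where g="\<lambda>z. g (chart_inv \<phi> z)" and c="crit \<kappa>" and \<tau>=\<tau> and ?z0.0="snd \<phi> q" and r=r and
          ?Z1.0="Zpart \<phi> X" and ?Z2.0="Zpart \<phi> Y" and ?h1.0="hpart \<phi> X" and ?h2.0="hpart \<phi> Y", OF gB _ _ _ _ _ _ _ init z])
         (erule gn P)+
    then show ?thesis by (intro vec3_eqI) (simp_all add: Zpart_def hpart_def)
  qed
  then show ?thesis
  proof (intro exI[of _ "chart_inv \<phi> ` ?B"] conjI)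
    show "openin (top_of_set S) (chart_inv \<phi> ` ?B)" by (rule chart_open_preimage[OF conformal_paramsD[OF \<phi>] open_ball BI])
    show "q \<in> chart_inv \<phi> ` ?B" using D(4)[OF q] r(1) by (metis centre_in_ball image_eqI)
    show "chart_inv \<phi> ` ?B \<subseteq> V" using inV(1) by blast
  qed blast
qed

lemma differentiable_in_charts_continuous:
  assumes U: "U \<subseteq> S"
    and d: "\<And>q. q \<in> U \<Longrightarrow> \<exists>\<phi>\<in>conformal_params S A. q \<in> fst \<phi> \<and> (X \<circ> chart_inv \<phi>) differentiable (at (snd \<phi> q))"
  shows "continuous_on U X"
  unfolding continuous_on_eq_continuous_within
proof
  fix q assume q: "q \<in> U"
  obtain \<phi> where \<phi>: "\<phi> \<in> conformal_params S A" "q \<in> fst \<phi>" "(X \<circ> chart_inv \<phi>) differentiable (at (snd \<phi> q))"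
    using d[OF q] by blast
  note D = complex_chart_onD[OF conformal_paramsD[OF \<phi>(1)]]
  obtain T where T: "open T" "fst \<phi> = S \<inter> T" using D(1) openin_open by blast
  have "continuous_on (U \<inter> T) (snd \<phi>)" by (rule continuous_on_subset[OF D(6)]) (use T U in blast)
  then have c: "continuous (at q within (U \<inter> T)) (snd \<phi>)" using q \<phi>(2) T by (simp add: continuous_on_eq_continuous_within)
  have "isCont (X \<circ> chart_inv \<phi>) (snd \<phi> q)" by (rule differentiable_imp_continuous_within[OF \<phi>(3)])
  from isCont_tendsto_compose[OF this c[unfolded continuous_within]]
  have "((X \<circ> chart_inv \<phi> \<circ> snd \<phi>) \<longlongrightarrow> X q) (at q within (U \<inter> T))"
    using D(4)[OF \<phi>(2)] by (simp add: o_def)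
  moreover have "eventually (\<lambda>r. (X \<circ> chart_inv \<phi> \<circ> snd \<phi>) r = X r) (at q within (U \<inter> T))"
    unfolding eventually_at_filter by (rule always_eventually) (use D(4) T U in auto)
  ultimately have "(X \<longlongrightarrow> X q) (at q within (U \<inter> T))" using tendsto_cong by blast
  moreover have "at q within (U \<inter> T) = at q within U"
    by (rule at_within_nhd[of _ T]) (use q \<phi>(2) T in auto)
  ultimately show "continuous (at q within U) X" by (simp add: continuous_within)
qed

text \<open>The coincidence set is closed by continuity and open by local uniqueness, and
  \<open>S\<close> is connected.\<close>

lemma representation_unique:
  assumes R: "riemann_surface S A" and g: "smooth_map S A g" and g1: "g \<in> S \<rightarrow> ball 0 1"
    and X: "representation_solution S A \<kappa> \<tau> g X" and Y: "representation_solution S A \<kappa> \<tau> g Y"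
    and z0: "z0 \<in> S" "Y z0 = X z0" and q: "q \<in> S"
  shows "Y q = X q"
proof -
  have fX: "\<And>\<phi> q. \<phi> \<in> conformal_params S A \<Longrightarrow> q \<in> fst \<phi> \<Longrightarrow> formula_at \<kappa> \<tau> g X \<phi> q"
    and fY: "\<And>\<phi> q. \<phi> \<in> conformal_params S A \<Longrightarrow> q \<in> fst \<phi> \<Longrightarrow> formula_at \<kappa> \<tau> g Y \<phi> q"
    using X Y unfolding representation_solution_iff[OF g] by blast+
  have "\<exists>\<phi>\<in>conformal_params S A. r \<in> fst \<phi> \<and> (X \<circ> chart_inv \<phi>) differentiable (at (snd \<phi> r)) \<and> (Y \<circ> chart_inv \<phi>) differentiable (at (snd \<phi> r))"
    if r: "r \<in> S" for r
  proof -
    obtain \<phi> where \<phi>: "\<phi> \<in> conformal_params S A" "r \<in> fst \<phi>" using surface_chart[OF R r] .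
    with fX[OF \<phi>] fY[OF \<phi>] show ?thesis unfolding formula_at_def by blast
  qed
  then have "continuous_on S X" "continuous_on S Y"
    by (intro differentiable_in_charts_continuous[OF subset_refl]; blast)+
  then have "continuous_on S (\<lambda>r. Y r - X r)" by (intro continuous_on_diff)
  then have "closedin (top_of_set S) {r \<in> S. Y r - X r = 0}" by (rule continuous_closedin_preimage_constant)
  then have cl: "closedin (top_of_set S) {r \<in> S. Y r = X r}" by simp
  have op: "openin (top_of_set S) {r \<in> S. Y r = X r}"
  proof (subst openin_subopen, intro ballI)
    fix r assume r: "r \<in> {r \<in> S. Y r = X r}"
    obtain \<phi> where \<phi>: "\<phi> \<in> conformal_params S A" "r \<in> fst \<phi>" using surface_chart[OF R, of r] r by blast
    note D = complex_chart_onD[OF conformal_paramsD[OF \<phi>(1)]]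
    have "\<exists>W. openin (top_of_set S) W \<and> r \<in> W \<and> W \<subseteq> fst \<phi> \<and> (\<forall>x\<in>W. Y x = X x)"
      by (rule formula_at_unique[OF g g1 \<phi>(1) D(1) subset_refl \<phi>(2), of _ _ \<kappa> \<tau>]) (use r fX fY \<phi> in auto)
    then show "\<exists>T. openin (top_of_set S) T \<and> r \<in> T \<and> T \<subseteq> {r \<in> S. Y r = X r}" using D(2) by blast
  qed
  have "{r \<in> S. Y r = X r} = {} \<or> {r \<in> S. Y r = X r} = S"
    using op cl riemann_surfaceD(3)[OF R] connected_clopen by blast
  then show ?thesis using z0 q by blast
qed

text \<open>Supplies the neighbourhoods required for continuation: one coordinate disc for all
  starting points and values. The formula is verified in the chart that defines the disc and carried
  to all others by the change of chart.\<close>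

lemma local_representation:
  assumes \<kappa>: "\<kappa> \<le> 0" and \<kappa>\<tau>: "(\<kappa>, \<tau>) \<noteq> (0, 0)" and R: "riemann_surface S A" and g: "smooth_map S A g"
    and g1: "g \<in> S \<rightarrow> ball 0 1" and eq: "gauss_equation S A g" and q: "q \<in> S"
  shows "\<exists>U. q \<in> U \<and> openin (top_of_set S) U \<and> path_connected U \<and> (\<forall>r\<in>U. \<forall>y\<in>E_carrier \<kappa>. \<exists>f.
    f \<in> U \<rightarrow> E_carrier \<kappa> \<and> (\<forall>s\<in>U. \<forall>\<psi>\<in>conformal_params S A. s \<in> fst \<psi> \<longrightarrow> formula_at \<kappa> \<tau> g f \<psi> s) \<and> f r = y)"
proof -
  obtain \<phi> where \<phi>: "\<phi> \<in> conformal_params S A" "q \<in> fst \<phi>" using surface_chart[OF R q] .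
  note D = complex_chart_onD[OF conformal_paramsD[OF \<phi>(1)]]
  let ?g = "\<lambda>z. g (chart_inv \<phi> z)"
  have gs: "smooth_on ?g (chart_image \<phi>)" using g \<phi>(1) by (simp add: smooth_map_def o_def)
  have gn: "norm (?g z) < 1" if "z \<in> chart_image \<phi>" for z using g1 D(2,5) that by force
  have ga: "gauss_at ?g z" if "z \<in> chart_image \<phi>" for z
  proof -
    have i: "chart_inv \<phi> z \<in> fst \<phi>" and e: "snd \<phi> (chart_inv \<phi> z) = z" using D(5)[OF that] by auto
    show ?thesis using gauss_at_chart[OF g \<phi>(1) i] eq \<phi>(1) i unfolding gauss_equation_def e by blast
  qed
  have zI: "snd \<phi> q \<in> chart_image \<phi>" using \<phi>(2) by blast
  have "\<exists>\<rho>>0. ball (snd \<phi> q) \<rho> \<subseteq> chart_image \<phi> \<and> (\<forall>z1\<in>ball (snd \<phi> q) \<rho>. \<forall>\<zeta> y. (crit \<kappa>)\<^sup>2 * (norm \<zeta>)\<^sup>2 < 1 \<longrightarrow> (\<exists>Z h. Z z1 = \<zeta> \<and> h z1 = y \<and>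
    (\<forall>z\<in>ball (snd \<phi> q) \<rho>. (crit \<kappa>)\<^sup>2 * (norm (Z z))\<^sup>2 < 1 \<and> Z differentiable (at z) \<and>
      (\<lambda>z. complex_of_real (h z)) differentiable (at z) \<and> repr_at (crit \<kappa>) \<tau> ?g Z h z)))"
    by (rule repr_exists[OF D(3) zI gs _ _ crit_nonzero[OF \<kappa> \<kappa>\<tau>]]) (erule gn ga)+
  then obtain \<rho> where \<rho>: "\<rho> > 0" "ball (snd \<phi> q) \<rho> \<subseteq> chart_image \<phi>"
    and sol: "\<And>z1 \<zeta> y. z1 \<in> ball (snd \<phi> q) \<rho> \<Longrightarrow> (crit \<kappa>)\<^sup>2 * (norm (\<zeta> :: complex))\<^sup>2 < 1 \<Longrightarrow> \<exists>Z h. Z z1 = \<zeta> \<and> h z1 = y \<and>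
    (\<forall>z\<in>ball (snd \<phi> q) \<rho>. (crit \<kappa>)\<^sup>2 * (norm (Z z))\<^sup>2 < 1 \<and> Z differentiable (at z) \<and>
      (\<lambda>z. complex_of_real (h z)) differentiable (at z) \<and> repr_at (crit \<kappa>) \<tau> ?g Z h z)" by blast
  define B where "B = ball (snd \<phi> q) \<rho>"
  have oB: "open B" by (simp add: B_def)
  have BI: "B \<subseteq> chart_image \<phi>" using \<rho>(2) by (simp add: B_def)
  define U where "U = chart_inv \<phi> ` B"
  have U: "s \<in> fst \<phi>" "snd \<phi> s \<in> B" if "s \<in> U" for s using that D(5) BI by (auto simp: U_def)
  show ?thesis
  proof (intro exI[of _ U] conjI ballI)
    show "q \<in> U" unfolding U_def B_def using D(4)[OF \<phi>(2)] \<rho>(1) by (metis centre_in_ball image_eqI)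
    show "openin (top_of_set S) U" unfolding U_def by (rule chart_open_preimage[OF conformal_paramsD[OF \<phi>(1)] oB BI])
    show "path_connected U" unfolding U_def
      by (rule path_connected_continuous_image[OF continuous_on_subset[OF D(7) BI]])
         (simp add: B_def convex_imp_path_connected)
    fix r y assume r: "r \<in> U" and y: "y \<in> E_carrier \<kappa>"
    obtain Z h where Z: "Z (snd \<phi> r) = zeta y" "h (snd \<phi> r) = y $ 3" and ZB: "\<forall>z\<in>B. (crit \<kappa>)\<^sup>2 * (norm (Z z))\<^sup>2 < 1 \<and> Z differentiable (at z) \<and>
      (\<lambda>z. complex_of_real (h z)) differentiable (at z) \<and> repr_at (crit \<kappa>) \<tau> ?g Z h z"
      using sol[of "snd \<phi> r" "zeta y" "y $ 3"] U(2)[OF r] y unfolding E_carrier_iff[OF \<kappa>] B_def[symmetric] by blast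
    define f where "f s = (vector [Re (Z (snd \<phi> s)), Im (Z (snd \<phi> s)), h (snd \<phi> s)] :: real ^ 3)" for s
    have zf: "zeta (f s) = Z (snd \<phi> s)" "f s $ 3 = h (snd \<phi> s)" for s by (simp_all add: f_def zeta_def complex_eq_iff)
    have formula: "formula_at \<kappa> \<tau> g f \<phi> s" if s: "s \<in> U" for s
    proof -
      let ?z = "snd \<phi> s"
      note zB = U(2)[OF s]
      have d: "has_wirtinger (Zpart \<phi> f) (wz Z ?z) (wzb Z ?z) ?z"
        by (rule has_wirtinger_transform[OF has_wirtinger_works oB zB]) (use ZB zB D(5) BI in \<open>auto simp: Zpart_def zf\<close>)
      have d': "has_wirtinger (\<lambda>z. complex_of_real (hpart \<phi> f z)) (wz (\<lambda>z. complex_of_real (h z)) ?z) (wzb (\<lambda>z. complex_of_real (h z)) ?z) ?z"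
        by (rule has_wirtinger_transform[OF has_wirtinger_works oB zB]) (use ZB zB D(5) BI in \<open>auto simp: hpart_def zf\<close>)
      have ZZ: "Zpart \<phi> f ?z = Z ?z" by (simp add: Zpart_def zf D(4)[OF U(1)[OF s]])
      have v: "vert (crit \<kappa>) \<tau> (Zpart \<phi> f) ?z = vert (crit \<kappa>) \<tau> Z ?z"
        unfolding vert_def has_wirtinger_unique[OF d] ZZ ..
      have "repr_at (crit \<kappa>) \<tau> ?g Z h ?z" using ZB zB by blast
      then show ?thesis unfolding formula_at_def differentiable_parts repr_at_def repr_horiz_at_def Let_def v
          has_wirtinger_unique[OF d] has_wirtinger_unique[OF d'] ZZ
        using has_wirtinger_differentiable[OF d] has_wirtinger_differentiable[OF d'] by blast
    qed
    show "\<exists>f. f \<in> U \<rightarrow> E_carrier \<kappa> \<and> (\<forall>s\<in>U. \<forall>\<psi>\<in>conformal_params S A. s \<in> fst \<psi> \<longrightarrow> formula_at \<kappa> \<tau> g f \<psi> s) \<and> f r = y"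
    proof (intro exI[of _ f] conjI ballI impI)
      show "f \<in> U \<rightarrow> E_carrier \<kappa>" using ZB U(2) by (auto simp: E_carrier_iff[OF \<kappa>] zf)
      show "f r = y" by (rule vec3_eqI) (simp_all add: zf Z)
      show "formula_at \<kappa> \<tau> g f \<psi> s" if "s \<in> U" "\<psi> \<in> conformal_params S A" "s \<in> fst \<psi>" for s \<psi>
        by (rule formula_at_chart_change[OF R that(2) \<phi>(1) that(3) U(1)[OF that(1)] g formula[OF that(1)]])
    qed
  qed
qed

theorem representation_exists:
  assumes \<kappa>: "\<kappa> \<le> 0" and \<kappa>\<tau>: "(\<kappa>, \<tau>) \<noteq> (0, 0)" and R: "riemann_surface S A" and sc: "simply_connected S"
    and g: "smooth_map S A g" and g1: "g \<in> S \<rightarrow> ball 0 1" and eq: "gauss_equation S A g"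
    and z0: "z0 \<in> S" "p \<in> E_carrier \<kappa>"
  shows "\<exists>X. representation_solution S A \<kappa> \<tau> g X \<and> X z0 = p"
proof -
  \<comment> \<open>The sheets are the solutions over open subsets, required to satisfy the formula
    in every conformal parameter, so that a map that locally equals sheets solves it
    globally.\<close>
  define M where "M = {(U, f). openin (top_of_set S) U \<and> f \<in> U \<rightarrow> E_carrier \<kappa> \<and>
    (\<forall>s\<in>U. \<forall>\<psi>\<in>conformal_params S A. s \<in> fst \<psi> \<longrightarrow> formula_at \<kappa> \<tau> g f \<psi> s)}"
  have MD: "openin (top_of_set S) U" "f \<in> U \<rightarrow> E_carrier \<kappa>" "U \<subseteq> S"
    "\<And>s \<psi>. s \<in> U \<Longrightarrow> \<psi> \<in> conformal_params S A \<Longrightarrow> s \<in> fst \<psi> \<Longrightarrow> formula_at \<kappa> \<tau> g f \<psi> s" if "(U, f) \<in> M" for U f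
    using that openin_imp_subset unfolding M_def by blast+
  interpret flat_sections S M "E_carrier \<kappa>"
  proof
    fix U f assume Uf: "(U, f) \<in> M"
    show "openin (top_of_set S) U" by (rule MD(1)[OF Uf])
    show "continuous_on U f"
    proof (rule differentiable_in_charts_continuous[OF MD(3)[OF Uf]])
      fix q assume q: "q \<in> U"
      obtain \<phi> where \<phi>: "\<phi> \<in> conformal_params S A" "q \<in> fst \<phi>" using surface_chart[OF R, of q] MD(3)[OF Uf] q by blast
      then show "\<exists>\<phi>\<in>conformal_params S A. q \<in> fst \<phi> \<and> (f \<circ> chart_inv \<phi>) differentiable at (snd \<phi> q)"
        using MD(4)[OF Uf q \<phi>] by (auto simp: formula_at_def)
    qed
    show "f r \<in> E_carrier \<kappa>" if "r \<in> U" for r using MD(2)[OF Uf] that by blast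
    fix V h r assume Vh: "(V, h) \<in> M" and r: "r \<in> U" "r \<in> V" "f r = h r"
    obtain \<phi> where \<phi>: "\<phi> \<in> conformal_params S A" "r \<in> fst \<phi>" using surface_chart[OF R, of r] MD(3)[OF Uf] r by blast
    have o: "openin (top_of_set S) (U \<inter> V \<inter> fst \<phi>)"
      using MD(1)[OF Uf] MD(1)[OF Vh] complex_chart_onD(1)[OF conformal_paramsD[OF \<phi>(1)]] by (intro openin_Int)
    have "\<exists>W. openin (top_of_set S) W \<and> r \<in> W \<and> W \<subseteq> U \<inter> V \<inter> fst \<phi> \<and> (\<forall>x\<in>W. f x = h x)"
      by (rule formula_at_unique[where \<kappa>=\<kappa> and \<tau>=\<tau>, OF g g1 \<phi>(1) o]) (use r \<phi> MD(4)[OF Uf] MD(4)[OF Vh] in auto)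
    then show "\<exists>W. openin (top_of_set S) W \<and> r \<in> W \<and> W \<subseteq> U \<inter> V \<and> (\<forall>x\<in>W. f x = h x)" by blast
  next
    fix q assume "q \<in> S"
    from local_representation[OF \<kappa> \<kappa>\<tau> R g g1 eq this] obtain U where U: "q \<in> U" "openin (top_of_set S) U" "path_connected U"
      "\<forall>r\<in>U. \<forall>y\<in>E_carrier \<kappa>. \<exists>f. f \<in> U \<rightarrow> E_carrier \<kappa> \<and> (\<forall>s\<in>U. \<forall>\<psi>\<in>conformal_params S A. s \<in> fst \<psi> \<longrightarrow> formula_at \<kappa> \<tau> g f \<psi> s) \<and> f r = y"
      by blast
    then have "\<forall>r\<in>U. \<forall>y\<in>E_carrier \<kappa>. \<exists>f. (U, f) \<in> M \<and> f r = y" unfolding M_def by blast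
    then show "\<exists>U. q \<in> U \<and> openin (top_of_set S) U \<and> path_connected U \<and> (\<forall>r\<in>U. \<forall>y\<in>E_carrier \<kappa>. \<exists>f. (U, f) \<in> M \<and> f r = y)"
      using U(1-3) by blast
  qed
  obtain X where X: "X z0 = p" "\<forall>q\<in>S. \<exists>U f. (U, f) \<in> M \<and> q \<in> U \<and> (\<forall>r\<in>U. X r = f r)"
    using global_section[OF sc z0] by blast
  have "representation_solution S A \<kappa> \<tau> g X" unfolding representation_solution_iff[OF g]
  proof (intro conjI ballI)
    show "X \<in> S \<rightarrow> E_carrier \<kappa>"
    proof
      fix q assume "q \<in> S"
      then obtain U f where "(U, f) \<in> M" "q \<in> U" "\<forall>r\<in>U. X r = f r" using X(2) by blast
      then show "X q \<in> E_carrier \<kappa>" using MD(2) by (metis PiE)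
    qed
    fix \<phi> q assume \<phi>: "\<phi> \<in> conformal_params S A" "q \<in> fst \<phi>"
    then have "q \<in> S" using complex_chart_onD(2)[OF conformal_paramsD[OF \<phi>(1)]] by blast
    then obtain U f where U: "(U, f) \<in> M" "q \<in> U" "\<forall>r\<in>U. X r = f r" using X(2) by blast
    show "formula_at \<kappa> \<tau> g X \<phi> q"
      by (rule formula_at_cong[OF conformal_paramsD[OF \<phi>(1)] \<phi>(2) MD(1)[OF U(1)] U(2) _ MD(4)[OF U(1,2) \<phi>]]) (use U(3) in simp)
  qed
  then show ?thesis using X(1) by blast
qed

text \<open>Recovering the immersion from \<open>g\<close> is expressed as uniqueness of solutions
  with one prescribed value; the map given by the formula is expressed by existence together with
  the same uniqueness.\<close>

theorem theorem5p1:
  fixes \<kappa> \<tau> :: real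
    and S :: "'a::t2_space set"
    and A :: "'a chart set"
  assumes "\<kappa> \<le> 0" and "(\<kappa>, \<tau>) \<noteq> (0, 0)"
    and "riemann_surface S A"
  shows
    "(\<forall>X. critical_cmc_immersion S A \<kappa> \<tau> X \<and> nowhere_vertical S A \<kappa> \<tau> X \<and>
          upwards_pointing S A \<kappa> \<tau> X \<longrightarrow>
        (\<exists>g \<in> S \<rightarrow> ball 0 1.
           (\<forall>q\<in>S. gauss_map S A \<kappa> \<tau> X q = Some (g q)) \<and>
           smooth_map S A g \<and>
           nowhere_antiholomorphic S A g \<and>
           gauss_equation S A g \<and>
           harmonic_map S A hyperbolic_disc_metric (\<lambda>q. complex_vec (g q)) \<and>
           representation_solution S A \<kappa> \<tau> g X \<and>
           (\<forall>Y z\<^sub>0. representation_solution S A \<kappa> \<tau> g Y \<and> z\<^sub>0 \<in> S \<and> Y z\<^sub>0 = X z\<^sub>0 \<longrightarrow>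
                    (\<forall>q\<in>S. Y q = X q)))) \<and>
     (simply_connected S \<longrightarrow>
       (\<forall>g \<in> S \<rightarrow> ball 0 1.
          smooth_map S A g \<and> gauss_equation S A g \<and> nowhere_antiholomorphic S A g \<longrightarrow>
          (\<forall>z\<^sub>0\<in>S. \<forall>p\<in>E_carrier \<kappa>.
             (\<exists>X. representation_solution S A \<kappa> \<tau> g X \<and> X z\<^sub>0 = p \<and>
                (\<forall>Y. representation_solution S A \<kappa> \<tau> g Y \<and> Y z\<^sub>0 = p \<longrightarrow> (\<forall>q\<in>S. Y q = X q))) \<and>
             (\<forall>X. representation_solution S A \<kappa> \<tau> g X \<and> X z\<^sub>0 = p \<longrightarrow>
                critical_cmc_immersion S A \<kappa> \<tau> X \<and>
                (\<forall>q\<in>S. gauss_map S A \<kappa> \<tau> X q = Some (g q))))))"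
proof (intro conjI impI allI ballI)
  fix X assume X: "critical_cmc_immersion S A \<kappa> \<tau> X \<and> nowhere_vertical S A \<kappa> \<tau> X \<and> upwards_pointing S A \<kappa> \<tau> X"
  obtain g where g: "g \<in> S \<rightarrow> ball 0 1" "\<forall>q\<in>S. gauss_map S A \<kappa> \<tau> X q = Some (g q)" "smooth_map S A g"
    "nowhere_antiholomorphic S A g" "gauss_equation S A g" "representation_solution S A \<kappa> \<tau> g X"
    using cmc_surface_gauss_map[OF assms] X by blast
  show "\<exists>g \<in> S \<rightarrow> ball 0 1.
           (\<forall>q\<in>S. gauss_map S A \<kappa> \<tau> X q = Some (g q)) \<and>
           smooth_map S A g \<and>
           nowhere_antiholomorphic S A g \<and>
           gauss_equation S A g \<and>
           harmonic_map S A hyperbolic_disc_metric (\<lambda>q. complex_vec (g q)) \<and>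
           representation_solution S A \<kappa> \<tau> g X \<and>
           (\<forall>Y z\<^sub>0. representation_solution S A \<kappa> \<tau> g Y \<and> z\<^sub>0 \<in> S \<and> Y z\<^sub>0 = X z\<^sub>0 \<longrightarrow> (\<forall>q\<in>S. Y q = X q))"
    using g gauss_equation_imp_harmonic[OF assms(3) g(3,1,5)] representation_unique[OF assms(3) g(3,1,6)] by blast
next
  fix g z\<^sub>0 p
  assume sc: "simply_connected S" and g1: "g \<in> S \<rightarrow> ball 0 1"
    and g: "smooth_map S A g \<and> gauss_equation S A g \<and> nowhere_antiholomorphic S A g"
    and p: "z\<^sub>0 \<in> S" "p \<in> E_carrier \<kappa>"
  have gs: "smooth_map S A g" and eq: "gauss_equation S A g" and na: "nowhere_antiholomorphic S A g" using g by blast+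
  obtain X where X: "representation_solution S A \<kappa> \<tau> g X" "X z\<^sub>0 = p"
    using representation_exists[OF assms sc gs g1 eq p] by blast
  then show "\<exists>X. representation_solution S A \<kappa> \<tau> g X \<and> X z\<^sub>0 = p \<and>
      (\<forall>Y. representation_solution S A \<kappa> \<tau> g Y \<and> Y z\<^sub>0 = p \<longrightarrow> (\<forall>q\<in>S. Y q = X q))"
    using representation_unique[OF assms(3) gs g1 X(1) _ p(1)] by blast
  fix X assume sol: "representation_solution S A \<kappa> \<tau> g X \<and> X z\<^sub>0 = p"
  then have "representation_solution S A \<kappa> \<tau> g X" ..
  note T = gauss_map_cmc_surface[OF assms g1 gs eq na this]
  show "critical_cmc_immersion S A \<kappa> \<tau> X" by (rule T(1))
  show "gauss_map S A \<kappa> \<tau> X q = Some (g q)" if "q \<in> S" for q by (rule T(2)[OF that])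
qed

end
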